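(* Let $\gamma\in(0,1)$. Suppose that the measure preserving semiflow $(X,m,\Psi)$ is pointwise dual ergodic with $\gamma$-regularly varying return sequence and has a section which is both a Darling-Kac (D-K) section and a generalized local limit (GLL) section. Then for every $t>0$, with $a(n)=a_n(\Psi_1)$, $a_t(n):=a_n(\Psi_t)$ and $u_t(n)\sim\frac{\gamma a_t(n)}{n}$, $$\frac1{a(N)}\sum_{n=1}^N\left|\widehat{\Psi_t}^{\,n}\left(1_C\,g\left(\tfrac{S_n^{(\Psi_t)}(f)}{a_t(n)}\right)\right)-m(C)\,\mathbb E\big(g(m(f)W_\gamma)\big)\,u_t(n)\right|\xrightarrow[N\to\infty]{}0\quad\text{a.e.}$$ for all $C\in\mathcal F_+$, $g\in C_B(\mathbb R_+)$ and $f\in L^1_+$.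
   Context: General notation. For a $\sigma$-finite Polish measure space $(X,m)$: $\mathcal F_+:=\{A\in\mathcal B(X):0<m(A)<\infty\}$; $L^1_+$ is the set of non-negative functions in $L^1(m)$; $m(f):=\int_Xf\,dm$; $C_B(\mathbb R_+)$ is the space of bounded continuous functions on $\mathbb R_+=[0,\infty)$. For a measure preserving transformation (MPT) $T$ of $(X,m)$: $S_n^{(T)}(f):=\sum_{k=0}^{n-1}f\circ T^k$, and the transfer operator $\widehat T$ on $L^1(m)$ is defined by $\int\widehat Tf\cdot g\,dm=\int f\cdot g\circ T\,dm$ ($g\in L^\infty(m)$). $T$ is pointwise dual ergodic if there is a sequence $a_n(T)$ (the return sequence) with $\frac1{a_n(T)}\sum_{k=0}^{n-1}\widehat T^kf\to m(f)$ a.e. for all $f\in L^1(m)$; a set $\Omega$ with $0<m(\Omega)<\infty$ is then a Darling-Kac set for $T$ if for $f=1_\Omega$ this convergence is uniform on $\Omega$. For a $\gamma$-regularly varying function $b$, $b^{-1}$ denotes its (asymptotic) inverse. Random variables. $Y_\gamma$ is the Mittag-Leffler random variable of order $\gamma$ normalized so that $\mathbb E(Y_\gamma)=1$; $Z_\gamma:=Y_\gamma^{-1/\gamma}$ is the positive $\gamma$-stable random variable with $\mathbb E(e^{-sZ_\gamma})=\exp[-s^\gamma/\Gamma(1+\gamma)]$, with probability density $f_{Z_\gamma}$; $W_\gamma$ is the $\mathbb R_+$-valued random variable with $\mathbb E(g(W_\gamma))=\mathbb E(Y_\gamma g(Y_\gamma))$. Semiflows and sections. A measure preserving semiflow $(X,m,\Psi)$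 is a continuous semigroup homomorphism $\Psi:\mathbb R_+\to\mathrm{MPT}(X,m)$ (weak operator topology). Given a probability preserving transformation $(\Omega,\mu,\tau)$ and measurable $\mathfrak r:\Omega\to\mathbb R_+$, with $\mathfrak r_n:=\sum_{k=0}^{n-1}\mathfrak r\circ\tau^k$, the suspended semiflow $(\Omega,\mu,\tau)^{\mathfrak r}=(X,m,\Psi)$ is: $X=\{(x,s)\in\Omega\times\mathbb R_+:0\le s<\mathfrak r(x)\}$, $m=\mu\times\mathrm{Leb}|_X$, $\Psi_t(x,y)=(\tau^n(x),y+t-\mathfrak r_n(x))$ where $n$ is such that $y+t\in[\mathfrak r_n(x),\mathfrak r_{n+1}(x))$. Then $(\Omega,\mu,\tau,\mathfrak r)$ is called a section of $(X,m,\Psi)$; it is standard if $\mathfrak r$ is a.s. bounded below by a positive constant, and then $\min\mathfrak r>0$ denotes its (essential) lower bound. $\Psi$ is pointwise dual ergodic if each $\Psi_t$ ($t>0$) is; then $a_n(\Psi_t)\sim a(nt)/t$ with $a(n):=a_n(\Psi_1)$, the return sequence of $\Psi$. A standard section is a Darling-Kac (D-K) section if $\Omega\times[0,t]$ is a Darling-Kac set for $\Psi_t$ for all $0<t<\min\mathfrak r$. Fibered systems. $(\Omega,\mu,\tau,\alpha)$ is a fibered system if $(\Omega,\mu,\tau)$ is a probability preserving transformation and $\alpha\subset\mathcal B(\Omega)$ is a countable generating partition such that $\tau:a\to\tau a$ is invertible and nonsingular for each $a\in\alpha$; $\alpha_n:=\bigvee_{k=0}^{n-1}\tau^{-k}\alpha$,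 $\mathcal C_\alpha:=\bigcup_{n\ge1}\alpha_n$; $\widehat\tau$ is the transfer operator of $\tau$ with respect to $\mu$. Local limits. The process $(\Omega,\mu,\tau,\mathfrak r)$ ($\tau$ ergodic) is asymptotically $\gamma$-stable, with normalizing function $b$, if $b$ is $\gamma$-regularly varying, $\mu([\mathfrak r>t])\sim\frac1{\Gamma(1+\gamma)\Gamma(1-\gamma)}\cdot\frac1{b(t)}$ as $t\to\infty$, and $\mathfrak r_n/b^{-1}(n)\to Z_\gamma$ in distribution. For such a process, $(\Omega,\mu,\tau,\alpha,\mathfrak r)$ satisfies a (continuous) generalized LLT (GLLT) if it satisfies one of the following, the convergence of functions on $\Omega$ being $\mu$-a.e.: - aperiodic LLT: for all $A\in\mathcal C_\alpha$ and bounded intervals $I\subset\mathbb R$, $b^{-1}(n)\,\widehat\tau^n(1_{A\cap[\mathfrak r_n\in k_n+I]})\to f_{Z_\gamma}(x)\,|I|\,\mu(A)$ as $n\to\infty$, $k_n\in\mathbb R$, $k_n/b^{-1}(n)\to x$, uniformly in $x\in[c,d]$ whenever $0<c<d<\infty$; - periodic LLT: there are $p>0$ and $\xi\in(0,p)$ such that the closed subgroup of $\mathbb R$ generated by $\xi$ and $p$ is $\mathbb R$, and for all $A\in\mathcal C_\alpha$ and bounded intervals $I\subset\mathbb R$, with $I_J:=I\cap[Jp,(J+1)p)$, $b^{-1}(n)\,\widehat\tau^n(1_{A\cap[\mathfrak r_n\in k_n+I]})-p\,f_{Z_\gamma}(x)\,\mu(A)\sum_{J\in\mathbb Z}1_{p\mathbb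 Z+I_J}(n\xi-k_n)\to0$ as $n\to\infty$, $k_n\in\mathbb R$, $k_n/b^{-1}(n)\to x$, uniformly in $x\in[c,d]$ whenever $0<c<d<\infty$. A generalized local limit (GLL) section for $(X,m,\Psi)$ is $(\Omega,\mu,\tau,\alpha,\mathfrak r)$ where $(X,m,\Psi)=(\Omega,\mu,\tau)^{\mathfrak r}$, $(\Omega,\mu,\tau,\alpha)$ is a fibered system and $(\Omega,\mu,\tau,\alpha,\mathfrak r)$ satisfies a GLLT. *)

theory Defs
  imports "HOL-Probability.Probability" "HOL-Library.Landau_Symbols"
begin

instance prod :: (polish_space, polish_space) polish_space ..

section \<open>Measure preserving transformations and transfer operators\<close>

text \<open>
  The carrier may be any Borel subset of the ambient Polish type: such a subset is Polish in a
  finer topology with the same Borel sets, and the phase space of a suspended semiflow is in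
  general Borel, but not a \<open>G\<delta>\<close>.
\<close>

definition polish_measure_space :: "'a::polish_space measure \<Rightarrow> bool" where
  "polish_measure_space M \<longleftrightarrow>
     sigma_finite_measure M \<and> space M \<in> sets borel \<and>
     sets M = sets (restrict_space borel (space M))"

definition mpt :: "'a measure \<Rightarrow> ('a \<Rightarrow> 'a) \<Rightarrow> bool" where
  "mpt M T \<longleftrightarrow> T \<in> measurable M M \<and> distr M M T = M"

definition prob_preserving :: "'a::polish_space measure \<Rightarrow> ('a \<Rightarrow> 'a) \<Rightarrow> bool" where
  "prob_preserving M T \<longleftrightarrow> polish_measure_space M \<and> prob_space M \<and> mpt M T"

definition ergodic_map :: "'a measure \<Rightarrow> ('a \<Rightarrow> 'a) \<Rightarrow> bool" where
  "ergodic_map M T \<longleftrightarrow>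
     (\<forall>A\<in>sets M. T -` A \<inter> space M = A \<longrightarrow>
        emeasure M A = 0 \<or> emeasure M (space M - A) = 0)"

definition birkhoff_sum :: "('a \<Rightarrow> 'a) \<Rightarrow> nat \<Rightarrow> ('a \<Rightarrow> real) \<Rightarrow> 'a \<Rightarrow> real" where
  "birkhoff_sum T n f x = (\<Sum>k<n. f ((T ^^ k) x))"

definition finite_pos_sets :: "'a measure \<Rightarrow> 'a set set" where
  "finite_pos_sets M = {A \<in> sets M. 0 < emeasure M A \<and> emeasure M A < \<infinity>}"

text \<open>
  For integrable \<open>f\<close> this picks a version of the image of \<open>f\<close>, which is determined only up to
  a null set. All uses below are insensitive to the choice of versions.
\<close>

definition transfer_op :: "'a measure \<Rightarrow> ('a \<Rightarrow> 'a) \<Rightarrow> ('a \<Rightarrow> real) \<Rightarrow> 'a \<Rightarrow> real" where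
  "transfer_op M T f =
     (SOME h. integrable M h \<and>
        (\<forall>g\<in>borel_measurable M. (\<exists>B. AE x in M. \<bar>g x\<bar> \<le> B) \<longrightarrow>
           (\<integral>x. h x * g x \<partial>M) = (\<integral>x. f x * g (T x) \<partial>M)))"

text \<open>
  A transformation is pointwise dual ergodic iff it has a return sequence; the latter is unique
  up to asymptotic equivalence.
\<close>

definition return_sequence :: "'a measure \<Rightarrow> ('a \<Rightarrow> 'a) \<Rightarrow> (nat \<Rightarrow> real) \<Rightarrow> bool" where
  "return_sequence M T a \<longleftrightarrow>
     (\<forall>n\<ge>1. 0 < a n) \<and>
     (\<forall>f. integrable M f \<longrightarrow>
        (AE x in M. (\<lambda>n. (1 / a n) * (\<Sum>k<n. (transfer_op M T ^^ k) f x))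
           \<longlonglongrightarrow> (\<integral>y. f y \<partial>M)))"

text \<open>Uniform convergence on \<open>A\<close> is understood modulo null sets.\<close>

definition darling_kac_set :: "'a measure \<Rightarrow> ('a \<Rightarrow> 'a) \<Rightarrow> 'a set \<Rightarrow> bool" where
  "darling_kac_set M T A \<longleftrightarrow>
     A \<in> finite_pos_sets M \<and>
     (\<exists>a. return_sequence M T a \<and>
        (\<forall>e>0. \<forall>\<^sub>F n in sequentially. AE x in M. x \<in> A \<longrightarrow>
           \<bar>(1 / a n) * (\<Sum>k<n. (transfer_op M T ^^ k) (indicator A) x) - measure M A\<bar> < e))"


section \<open>Regular variation\<close>

text \<open>
  A sequence \<open>a\<close> is called regularly varying iff the function
  \<open>\<lambda>x. a (nat \<lfloor>x\<rfloor>)\<close> is.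
\<close>

definition regularly_varying :: "real \<Rightarrow> (real \<Rightarrow> real) \<Rightarrow> bool" where
  "regularly_varying \<gamma> b \<longleftrightarrow>
     (\<exists>x0. (\<forall>x\<ge>x0. 0 < b x) \<and> set_borel_measurable borel {x0..} b) \<and>
     (\<forall>c>0. ((\<lambda>x. b (c * x) / b x) \<longlongrightarrow> c powr \<gamma>) at_top)"

definition asymptotic_inverse :: "(real \<Rightarrow> real) \<Rightarrow> (real \<Rightarrow> real) \<Rightarrow> bool" where
  "asymptotic_inverse b binv \<longleftrightarrow>
     filterlim binv at_top at_top \<and>
     (\<lambda>x. b (binv x)) \<sim>[at_top] (\<lambda>x. x) \<and> (\<lambda>x. binv (b x)) \<sim>[at_top] (\<lambda>x. x)"


section \<open>The limit laws\<close>

definition mittag_leffler_fun :: "real \<Rightarrow> real \<Rightarrow> real" where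
  "mittag_leffler_fun \<gamma> z = (\<Sum>n. z ^ n / Gamma (1 + \<gamma> * real n))"

text \<open>
  \<open>Y\<close> is the law of the Mittag-Leffler random variable of order \<open>\<gamma>\<close>; the factor
  \<open>Gamma (1 + \<gamma>)\<close> normalizes its expectation to be 1.
\<close>

definition mittag_leffler_law :: "real \<Rightarrow> real measure \<Rightarrow> bool" where
  "mittag_leffler_law \<gamma> Y \<longleftrightarrow>
     real_distribution Y \<and> (AE y in Y. 0 < y) \<and>
     (\<forall>z. integrable Y (\<lambda>y. exp (z * y)) \<and>
          (\<integral>y. exp (z * y) \<partial>Y) = mittag_leffler_fun \<gamma> (Gamma (1 + \<gamma>) * z))"

definition stable_law :: "real \<Rightarrow> real measure \<Rightarrow> real measure" where
  "stable_law \<gamma> Y = distr Y borel (\<lambda>y. y powr (- 1 / \<gamma>))"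

text \<open>
  Local limits involve the values of the density at individual points of \<open>(0, \<infinity>)\<close>, so the
  continuous version is meant.
\<close>

definition stable_density :: "real \<Rightarrow> real measure \<Rightarrow> (real \<Rightarrow> real) \<Rightarrow> bool" where
  "stable_density \<gamma> Y fZ \<longleftrightarrow>
     (\<forall>x. 0 \<le> fZ x) \<and> continuous_on {0<..} fZ \<and>
     distributed Y lborel (\<lambda>y. y powr (- 1 / \<gamma>)) (\<lambda>x. ennreal (fZ x))"

text \<open>The law of \<open>W\<close>, where \<open>E (g W) = E (Y * g Y)\<close>.\<close>

definition size_biased_law :: "real measure \<Rightarrow> real measure" where
  "size_biased_law Y = density Y (\<lambda>y. ennreal y)"


section \<open>Semiflows and sections\<close>

definition square_integrable :: "'a measure \<Rightarrow> ('a \<Rightarrow> real) \<Rightarrow> bool" where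
  "square_integrable M f \<longleftrightarrow> f \<in> borel_measurable M \<and> integrable M (\<lambda>x. (f x)\<^sup>2)"

text \<open>
  Measure preserving transformations are identified if they agree almost everywhere; the last
  conjunct is continuity with respect to the weak operator topology for the operators
  \<open>f \<mapsto> f \<circ> \<Psi> t\<close> on \<open>L\<^sup>2\<close>.
\<close>

definition mp_semiflow :: "'a::polish_space measure \<Rightarrow> (real \<Rightarrow> 'a \<Rightarrow> 'a) \<Rightarrow> bool" where
  "mp_semiflow M \<Psi> \<longleftrightarrow>
     polish_measure_space M \<and>
     (\<forall>t\<ge>0. mpt M (\<Psi> t)) \<and>
     (AE x in M. \<Psi> 0 x = x) \<and>
     (\<forall>s\<ge>0. \<forall>t\<ge>0. AE x in M. \<Psi> (s + t) x = \<Psi> s (\<Psi> t x)) \<and>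
     (\<forall>f g. square_integrable M f \<longrightarrow> square_integrable M g \<longrightarrow>
        continuous_on {0..} (\<lambda>t. \<integral>x. f (\<Psi> t x) * g x \<partial>M))"

definition suspension_measure :: "'w measure \<Rightarrow> ('w \<Rightarrow> real) \<Rightarrow> ('w \<times> real) measure" where
  "suspension_measure \<mu> r =
     restrict_space (\<mu> \<Otimes>\<^sub>M lborel) {(x, s). x \<in> space \<mu> \<and> 0 \<le> s \<and> s < r x}"

definition suspension_flow ::
  "('w \<Rightarrow> 'w) \<Rightarrow> ('w \<Rightarrow> real) \<Rightarrow> real \<Rightarrow> 'w \<times> real \<Rightarrow> 'w \<times> real" where
  "suspension_flow \<tau> r t = (\<lambda>(x, y).
     let n = (THE n. birkhoff_sum \<tau> n r x \<le> y + t \<and> y + t < birkhoff_sum \<tau> (Suc n) r x)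
     in ((\<tau> ^^ n) x, y + t - birkhoff_sum \<tau> n r x))"

definition is_section ::
  "('w::polish_space \<times> real) measure \<Rightarrow> (real \<Rightarrow> 'w \<times> real \<Rightarrow> 'w \<times> real) \<Rightarrow>
   'w measure \<Rightarrow> ('w \<Rightarrow> 'w) \<Rightarrow> ('w \<Rightarrow> real) \<Rightarrow> bool" where
  "is_section m \<Psi> \<mu> \<tau> r \<longleftrightarrow>
     prob_preserving \<mu> \<tau> \<and> r \<in> borel_measurable \<mu> \<and> (\<forall>x\<in>space \<mu>. 0 \<le> r x) \<and>
     m = suspension_measure \<mu> r \<and>
     (\<forall>t\<ge>0. AE z in m. \<Psi> t z = suspension_flow \<tau> r t z)"

definition standard_section ::
  "('w::polish_space \<times> real) measure \<Rightarrow> (real \<Rightarrow> 'w \<times> real \<Rightarrow> 'w \<times> real) \<Rightarrow>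
   'w measure \<Rightarrow> ('w \<Rightarrow> 'w) \<Rightarrow> ('w \<Rightarrow> real) \<Rightarrow> bool" where
  "standard_section m \<Psi> \<mu> \<tau> r \<longleftrightarrow>
     is_section m \<Psi> \<mu> \<tau> r \<and> (\<exists>c>0. AE x in \<mu>. c \<le> r x)"

definition ess_lower_bound :: "'w measure \<Rightarrow> ('w \<Rightarrow> real) \<Rightarrow> real" where
  "ess_lower_bound \<mu> r = Sup {c. AE x in \<mu>. c \<le> r x}"

text \<open>
  For \<open>t\<close> below the essential lower bound of \<open>r\<close>, the set \<open>space \<mu> \<times> {0..t}\<close> is contained in
  the phase space only up to a null set, hence the intersection.
\<close>

definition darling_kac_section ::
  "('w::polish_space \<times> real) measure \<Rightarrow> (real \<Rightarrow> 'w \<times> real \<Rightarrow> 'w \<times> real) \<Rightarrow>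
   'w measure \<Rightarrow> ('w \<Rightarrow> 'w) \<Rightarrow> ('w \<Rightarrow> real) \<Rightarrow> bool" where
  "darling_kac_section m \<Psi> \<mu> \<tau> r \<longleftrightarrow>
     standard_section m \<Psi> \<mu> \<tau> r \<and>
     (\<forall>t. 0 < t \<and> t < ess_lower_bound \<mu> r \<longrightarrow>
        darling_kac_set m (\<Psi> t) ((space \<mu> \<times> {0..t}) \<inter> space m))"


section \<open>Fibered systems\<close>

definition refined_partition ::
  "'w measure \<Rightarrow> ('w \<Rightarrow> 'w) \<Rightarrow> 'w set set \<Rightarrow> nat \<Rightarrow> 'w set set" where
  "refined_partition \<mu> \<tau> \<alpha> n =
     {{x \<in> space \<mu>. \<forall>k<n. (\<tau> ^^ k) x \<in> c k} | c. \<forall>k<n. c k \<in> \<alpha>} - {{}}"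

definition cylinders :: "'w measure \<Rightarrow> ('w \<Rightarrow> 'w) \<Rightarrow> 'w set set \<Rightarrow> 'w set set" where
  "cylinders \<mu> \<tau> \<alpha> = (\<Union>n\<in>{1..}. refined_partition \<mu> \<tau> \<alpha> n)"

text \<open>The partition generates the \<open>\<sigma>\<close>-algebra modulo null sets.\<close>

definition fibered_system ::
  "'w::polish_space measure \<Rightarrow> ('w \<Rightarrow> 'w) \<Rightarrow> 'w set set \<Rightarrow> bool" where
  "fibered_system \<mu> \<tau> \<alpha> \<longleftrightarrow>
     prob_preserving \<mu> \<tau> \<and>
     countable \<alpha> \<and> \<alpha> \<subseteq> sets \<mu> \<and> partition_on (space \<mu>) \<alpha> \<and>
     (\<forall>B\<in>sets \<mu>. \<exists>B'\<in>sigma_sets (space \<mu>) (cylinders \<mu> \<tau> \<alpha>).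
        emeasure \<mu> ((B - B') \<union> (B' - B)) = 0) \<and>
     (\<forall>A\<in>\<alpha>. inj_on \<tau> A \<and>
        (\<forall>B\<in>sets \<mu>. B \<subseteq> A \<longrightarrow>
           \<tau> ` B \<in> sets \<mu> \<and> (emeasure \<mu> (\<tau> ` B) = 0 \<longleftrightarrow> emeasure \<mu> B = 0)))"


section \<open>Stable limits and local limits\<close>

definition asymptotically_stable ::
  "real \<Rightarrow> real measure \<Rightarrow> 'w::polish_space measure \<Rightarrow> ('w \<Rightarrow> 'w) \<Rightarrow> ('w \<Rightarrow> real) \<Rightarrow>
   (real \<Rightarrow> real) \<Rightarrow> (real \<Rightarrow> real) \<Rightarrow> bool" where
  "asymptotically_stable \<gamma> Y \<mu> \<tau> r b binv \<longleftrightarrow>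
     ergodic_map \<mu> \<tau> \<and>
     regularly_varying \<gamma> b \<and> asymptotic_inverse b binv \<and>
     (\<lambda>t. measure \<mu> {x \<in> space \<mu>. r x > t})
       \<sim>[at_top] (\<lambda>t. 1 / (Gamma (1 + \<gamma>) * Gamma (1 - \<gamma>)) * (1 / b t)) \<and>
     weak_conv_m (\<lambda>n. distr \<mu> borel (\<lambda>x. birkhoff_sum \<tau> n r x / binv (real n)))
       (stable_law \<gamma> Y)"

definition local_prob ::
  "'w measure \<Rightarrow> ('w \<Rightarrow> 'w) \<Rightarrow> ('w \<Rightarrow> real) \<Rightarrow> 'w set \<Rightarrow> real set \<Rightarrow> nat \<Rightarrow> real \<Rightarrow> 'w \<Rightarrow> real" where
  "local_prob \<mu> \<tau> r A I n k =
     (transfer_op \<mu> \<tau> ^^ n)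
       (indicator (A \<inter> {x \<in> space \<mu>. birkhoff_sum \<tau> n r x \<in> (\<lambda>s. k + s) ` I}))"

text \<open>
  In both local limit theorems the sequences \<open>k\<^sub>n\<close> are indexed by their limits \<open>x \<in> [c, d]\<close>,
  and the convergence of \<open>k\<^sub>n / binv n\<close> to \<open>x\<close>, as well as the asserted one, is uniform in \<open>x\<close>.
  For each \<open>n\<close> and \<open>k\<close> the function \<^term>\<open>local_prob \<mu> \<tau> r A I n k\<close> is only defined up to a null
  set, so an almost everywhere statement can only involve countably many \<open>k\<close> simultaneously;
  hence \<open>x\<close> ranges over an arbitrary countable \<open>D \<subseteq> [c, d]\<close>. As \<open>D\<close> and the \<open>k\<^sub>n\<close> are
  arbitrary, this amounts to a supremum over all \<open>k \<in> [c binv n, d binv n]\<close> from any prescribed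
  countable set.
\<close>

definition aperiodic_llt ::
  "'w measure \<Rightarrow> ('w \<Rightarrow> 'w) \<Rightarrow> 'w set set \<Rightarrow> ('w \<Rightarrow> real) \<Rightarrow> (real \<Rightarrow> real) \<Rightarrow> (real \<Rightarrow> real) \<Rightarrow> bool"
  where
  "aperiodic_llt \<mu> \<tau> \<alpha> r binv fZ \<longleftrightarrow>
     (\<forall>A\<in>cylinders \<mu> \<tau> \<alpha>. \<forall>I. is_interval I \<and> bounded I \<longrightarrow>
      (\<forall>c d. 0 < c \<and> c < d \<longrightarrow>
       (\<forall>D k. countable D \<and> D \<subseteq> {c..d} \<and>
          uniform_limit D (\<lambda>n x. k n x / binv (real n)) (\<lambda>x. x) sequentially \<longrightarrow>
          (AE w in \<mu>. uniform_limit D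
             (\<lambda>n x. binv (real n) * local_prob \<mu> \<tau> r A I n (k n x) w)
             (\<lambda>x. fZ x * measure lborel I * measure \<mu> A) sequentially))))"

definition periodic_llt ::
  "'w measure \<Rightarrow> ('w \<Rightarrow> 'w) \<Rightarrow> 'w set set \<Rightarrow> ('w \<Rightarrow> real) \<Rightarrow> (real \<Rightarrow> real) \<Rightarrow> (real \<Rightarrow> real) \<Rightarrow> bool"
  where
  "periodic_llt \<mu> \<tau> \<alpha> r binv fZ \<longleftrightarrow>
     (\<exists>p \<xi>. 0 < p \<and> 0 < \<xi> \<and> \<xi> < p \<and>
      closure {of_int i * \<xi> + of_int j * p | i j :: int. True} = (UNIV :: real set) \<and>
      (\<forall>A\<in>cylinders \<mu> \<tau> \<alpha>. \<forall>I. is_interval I \<and> bounded I \<longrightarrow>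
       (\<forall>c d. 0 < c \<and> c < d \<longrightarrow>
        (\<forall>D k. countable D \<and> D \<subseteq> {c..d} \<and>
           uniform_limit D (\<lambda>n x. k n x / binv (real n)) (\<lambda>x. x) sequentially \<longrightarrow>
           (AE w in \<mu>. uniform_limit D
              (\<lambda>n x. binv (real n) * local_prob \<mu> \<tau> r A I n (k n x) w
                 - p * fZ x * measure \<mu> A *
                   (\<Sum>\<^sub>\<infinity>J::int. indicator
                      {p * of_int i + s | (i::int) s. s \<in> I \<inter> {of_int J * p..<(of_int J + 1) * p}}
                      (real n * \<xi> - k n x)))
              (\<lambda>x. 0) sequentially)))))"

definition gll_section ::
  "real \<Rightarrow> real measure \<Rightarrow>
   ('w::polish_space \<times> real) measure \<Rightarrow> (real \<Rightarrow> 'w \<times> real \<Rightarrow> 'w \<times> real) \<Rightarrow>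
   'w measure \<Rightarrow> ('w \<Rightarrow> 'w) \<Rightarrow> 'w set set \<Rightarrow> ('w \<Rightarrow> real) \<Rightarrow> bool" where
  "gll_section \<gamma> Y m \<Psi> \<mu> \<tau> \<alpha> r \<longleftrightarrow>
     is_section m \<Psi> \<mu> \<tau> r \<and> fibered_system \<mu> \<tau> \<alpha> \<and>
     (\<exists>b binv fZ. stable_density \<gamma> Y fZ \<and> asymptotically_stable \<gamma> Y \<mu> \<tau> r b binv \<and>
        (aperiodic_llt \<mu> \<tau> \<alpha> r binv fZ \<or> periodic_llt \<mu> \<tau> \<alpha> r binv fZ))"

end

theory Submission
  imports Defs "HOL-Analysis.Kronecker_Approximation_Theorem"
begin

text \<open>
  Let \<open>N\<^sub>T\<close> be the number of visits to the section up to time \<open>T\<close>. The event that a point of a cylinder set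
  makes \<open>k\<close> visits and ends up at a given place in the strip over the section is an event about
  the \<open>k\<close>-th return time, so the local limit theorem describes its image under the transfer operator.
  Summation over \<open>k\<close> (a Riemann sum in \<open>T / b\<inverse>(k)\<close>) and Fatou's lemma yield only lower bounds, pointwise along the
  flow, for the images of \<open>1\<^sub>C g(N\<^sub>T / b(T))\<close>, namely \<open>E(g(W)) u\<close>. They are used for \<open>g\<close> and for
  \<open>1 - g\<close>: by pointwise dual ergodicity the averages of the sum converge to what the two bounds add up to, so
  in the average the bounds are equalities. The Darling-Kac property identifies the return sequence \<open>a\<close>
  with \<open>b\<close>, through the expected number of visits, whose uniform integrability follows from
  a second moment estimate. For a general \<open>C\<close> one uses that the density \<open>1\<^sub>C\<close> is transported to the strip by the flow
  and approximated by cylinders; for general \<open>f\<close>, the ratio ergodic theorem compares \<open>S\<^sub>n(f)\<close> to \<open>N\<^sub>T\<close>.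
\<close>

section \<open>Transfer operators\<close>

text \<open>Only lower bounds are available because the local limits are uniform only while
  \<open>T / binv k\<close> stays in a compact subset of (0, \<infinity>): very few and very many
  visits are not controlled, so the sum over \<open>k\<close> admits no dominated convergence. In
  the variable \<open>l = k / b T\<close> this sum becomes an integral against \<open>l\<close>
  times the density of \<open>Y\<close>, which is the origin of the size biased law. A second
  obstacle is that transfer images are determined modulo null sets, while heights and times form
  continua; heights are placed on countable grids and times on multiples of a step \<open>s\<close>.
  The step lies below the lower bound of the roof, so that it contains at most one visit, and below
  the period of a periodic local limit; the given time is \<open>t = q * s\<close>. Finally, a shift
  of the starting time, or the replacement of \<open>f\<close> by the visit count, perturbs the
  normalized count by an error relative to its size. Test functions are therefore first taken
  uniformly continuous for relative errors; bounded continuous ones follow by truncation, the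
  tightness being the same limit applied to the complement of the cutoff.\<close>

locale mp_system = sigma_finite_measure M for M :: "'a measure" +
  fixes T :: "'a \<Rightarrow> 'a"
  assumes mpt: "mpt M T"
begin

lemma T_measurable [measurable]: "T \<in> measurable M M"
  using mpt unfolding mpt_def by simp

lemma T_space: "x \<in> space M \<Longrightarrow> T x \<in> space M"
  using T_measurable by (simp add: measurable_def Pi_iff)

lemma iter_measurable [measurable]: "(T ^^ n) \<in> measurable M M"
proof (induction n)
  case 0 show ?case by simp
next
  case (Suc n)
  then show ?case by (simp only: funpow.simps) (intro measurable_comp[of _ _ M] T_measurable)
qed

lemma iter_space: "x \<in> space M \<Longrightarrow> (T ^^ n) x \<in> space M"
  using measurable_space[OF iter_measurable] .

lemma distr_iter: "distr M M (T ^^ n) = M"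
proof (induction n)
  case 0 then show ?case by (simp add: id_def distr_id)
next
  case (Suc n)
  have "distr M M (T ^^ Suc n) = distr (distr M M (T ^^ n)) M T"
    by (subst distr_distr) (auto simp: o_def)
  also have "\<dots> = M" using Suc mpt by (simp add: mpt_def)
  finally show ?case .
qed

lemma AE_iter: assumes "AE x in M. P x" shows "AE x in M. P ((T ^^ n) x)"
proof -
  have "AE x in distr M M (T ^^ n). P x" using assms by (simp only: distr_iter)
  then show ?thesis by (rule AE_distrD[OF iter_measurable])
qed

lemma AE_T: "AE x in M. P x \<Longrightarrow> AE x in M. P (T x)"
  using AE_iter[of P 1] by simp

lemma integrable_iter:
  fixes f :: "'a \<Rightarrow> real"
  assumes "integrable M f"
  shows "integrable M (\<lambda>x. f ((T ^^ n) x))"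
  using integrable_distr[OF iter_measurable, where f = f] assms by (simp add: distr_iter)

lemma integral_iter:
  fixes f :: "'a \<Rightarrow> real"
  assumes "f \<in> borel_measurable M"
  shows "(\<integral>x. f ((T ^^ n) x) \<partial>M) = (\<integral>x. f x \<partial>M)"
  using integral_distr[OF iter_measurable, of f] assms by (simp add: distr_iter)

section \<open>Existence of the transfer operator by Radon-Nikodym\<close>

lemma ac_iter: "absolutely_continuous M (distr (density M f) M T)" if [measurable]: "f \<in> borel_measurable M"
proof -
  have "N \<in> null_sets (distr (density M f) M T)" if N: "N \<in> null_sets M" for N
  proof -
    have [measurable]: "N \<in> sets M" using N by auto
    have "emeasure M (T -` N \<inter> space M) = emeasure (distr M M T) N"
      by (subst emeasure_distr) auto
    also have "\<dots> = 0" using mpt N by (auto simp: mpt_def)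
    finally have "AE x in M. x \<notin> T -` N \<inter> space M"
      by (intro AE_not_in null_setsI) (auto intro: measurable_sets)
    then have "emeasure (density M f) (T -` N \<inter> space M) = 0"
      by (subst emeasure_density) (auto intro!: nn_integral_zero' elim!: eventually_mono)
    then show ?thesis by (auto simp: null_sets_def emeasure_distr)
  qed
  then show ?thesis by (auto simp: absolutely_continuous_def)
qed

text \<open>The image of the measure with density \<open>f\<close> is absolutely continuous because
  preimages of null sets are null, and its Radon-Nikodym density is the required \<open>h\<close>.
  Both integrals are integrals of \<open>g\<close> against this image measure, so they agree for
  every measurable \<open>g\<close>, with the common default 0 when \<open>g\<close> is not
  integrable.\<close>

lemma transfer_exists_pos:
  fixes f :: "'a \<Rightarrow> real"
  assumes f: "integrable M f" and pos: "AE x in M. 0 \<le> f x"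
  shows "\<exists>h. integrable M h \<and> (\<forall>g\<in>borel_measurable M. (\<integral>x. h x * g x \<partial>M) = (\<integral>x. f x * g (T x) \<partial>M))"
proof -
  have [measurable]: "f \<in> borel_measurable M" using f by auto
  define N where "N = distr (density M (\<lambda>x. ennreal (f x))) M T"
  have sN: "sets N = sets M" by (simp add: N_def)
  have ac: "absolutely_continuous M N" unfolding N_def by (rule ac_iter) simp
  obtain h where h[measurable]: "h \<in> borel_measurable M" and hN: "density M h = N"
    using Radon_Nikodym[OF ac sN] by auto
  have tot: "emeasure N (space N) = (\<integral>\<^sup>+x. ennreal (f x) \<partial>M)"
  proof -
    have "T -` space M \<inter> space M = space M" using T_space by auto
    then show ?thesis
      unfolding N_def by (simp add: emeasure_distr emeasure_density cong: nn_integral_cong)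
  qed
  have fin: "(\<integral>\<^sup>+x. ennreal (f x) \<partial>M) < \<infinity>"
    using f by (subst nn_integral_eq_integral[OF f pos]) auto
  have hfin: "(\<integral>\<^sup>+x. h x \<partial>M) < \<infinity>"
  proof -
    have "(\<integral>\<^sup>+x. h x \<partial>M) = emeasure (density M h) (space M)"
      by (simp add: emeasure_density cong: nn_integral_cong)
    also have "\<dots> = emeasure N (space N)" by (simp add: hN sets_eq_imp_space_eq[OF sN])
    finally show ?thesis using tot fin by simp
  qed
  have hAE: "AE x in M. h x \<noteq> \<infinity>" using nn_integral_noteq_infinite[OF h] hfin by auto
  define k where "k x = enn2real (h x)" for x
  have [measurable]: "k \<in> borel_measurable M" unfolding k_def by simp
  have kh: "AE x in M. ennreal (k x) = h x" using hAE by (auto simp: k_def less_top)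
  have kint: "integrable M k"
  proof (rule integrableI_nonneg)
    show "AE x in M. 0 \<le> k x" by (simp add: k_def)
    have "(\<integral>\<^sup>+x. ennreal (k x) \<partial>M) = (\<integral>\<^sup>+x. h x \<partial>M)" by (rule nn_integral_cong_AE[OF kh])
    then show "(\<integral>\<^sup>+x. ennreal (k x) \<partial>M) < \<infinity>" using hfin by simp
  qed simp
  have dk: "density M (\<lambda>x. ennreal (k x)) = N"
    unfolding hN[symmetric] by (rule density_cong) (use kh in auto)
  have "(\<integral>x. k x * g x \<partial>M) = (\<integral>x. f x * g (T x) \<partial>M)" if [measurable]: "g \<in> borel_measurable M" for g
  proof -
    have "(\<integral>x. k x * g x \<partial>M) = (\<integral>x. g x \<partial>N)"
      unfolding dk[symmetric] by (subst integral_density) (auto simp: k_def)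
    also have "\<dots> = (\<integral>x. g (T x) \<partial>density M (\<lambda>x. ennreal (f x)))"
      unfolding N_def by (subst integral_distr) auto
    also have "\<dots> = (\<integral>x. f x * g (T x) \<partial>M)"
      by (subst integral_density) (use pos in auto)
    finally show ?thesis .
  qed
  then show ?thesis using kint by auto
qed

lemma integrable_bounded_mult:
  fixes f g :: "'a \<Rightarrow> real"
  assumes "integrable M f" "g \<in> borel_measurable M" "AE x in M. \<bar>g x\<bar> \<le> B"
  shows "integrable M (\<lambda>x. f x * g x)"
proof (rule Bochner_Integration.integrable_bound[of _ "\<lambda>x. B * \<bar>f x\<bar>"])
  show "AE x in M. norm (f x * g x) \<le> norm (B * \<bar>f x\<bar>)"
    using assms(3)
  proof (rule eventually_mono)
    fix x assume "\<bar>g x\<bar> \<le> B"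
    then have "\<bar>f x\<bar> * \<bar>g x\<bar> \<le> \<bar>f x\<bar> * \<bar>B\<bar>" by (intro mult_left_mono) auto
    then show "norm (f x * g x) \<le> norm (B * \<bar>f x\<bar>)" by (simp add: abs_mult mult.commute)
  qed
qed (use assms in auto)

text \<open>Positive and negative parts are treated separately; boundedness of \<open>g\<close>
  makes the four products integrable, so that the two identities may be subtracted.\<close>

lemma transfer_exists:
  fixes f :: "'a \<Rightarrow> real"
  assumes f: "integrable M f"
  shows "\<exists>h. integrable M h \<and> (\<forall>g\<in>borel_measurable M. (\<exists>B. AE x in M. \<bar>g x\<bar> \<le> B) \<longrightarrow>
           (\<integral>x. h x * g x \<partial>M) = (\<integral>x. f x * g (T x) \<partial>M))"
proof -
  obtain h1 where h1: "integrable M h1" "\<And>g. g \<in> borel_measurable M \<Longrightarrow>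
      (\<integral>x. h1 x * g x \<partial>M) = (\<integral>x. max 0 (f x) * g (T x) \<partial>M)"
    using transfer_exists_pos[of "\<lambda>x. max 0 (f x)"] f by auto
  obtain h2 where h2: "integrable M h2" "\<And>g. g \<in> borel_measurable M \<Longrightarrow>
      (\<integral>x. h2 x * g x \<partial>M) = (\<integral>x. max 0 (- f x) * g (T x) \<partial>M)"
    using transfer_exists_pos[of "\<lambda>x. max 0 (- f x)"] f by auto
  have "(\<integral>x. (h1 x - h2 x) * g x \<partial>M) = (\<integral>x. f x * g (T x) \<partial>M)"
    if g: "g \<in> borel_measurable M" "AE x in M. \<bar>g x\<bar> \<le> B" for g B
  proof -
    note gT = measurable_compose[OF T_measurable g(1)] AE_T[OF g(2)]
    have "(\<integral>x. (h1 x - h2 x) * g x \<partial>M) = (\<integral>x. h1 x * g x \<partial>M) - (\<integral>x. h2 x * g x \<partial>M)"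
      unfolding left_diff_distrib
      by (rule Bochner_Integration.integral_diff) (use h1 h2 g in \<open>auto intro!: integrable_bounded_mult\<close>)
    also have "\<dots> = (\<integral>x. max 0 (f x) * g (T x) \<partial>M) - (\<integral>x. max 0 (- f x) * g (T x) \<partial>M)"
      using h1 h2 g by simp
    also have "\<dots> = (\<integral>x. max 0 (f x) * g (T x) - max 0 (- f x) * g (T x) \<partial>M)"
      by (rule Bochner_Integration.integral_diff[symmetric]) (use f gT in \<open>auto intro!: integrable_bounded_mult\<close>)
    also have "\<dots> = (\<integral>x. f x * g (T x) \<partial>M)"
      by (rule Bochner_Integration.integral_cong) (auto simp: max_def)
    finally show ?thesis .
  qed
  moreover have "integrable M (\<lambda>x. h1 x - h2 x)" using h1 h2 by auto
  ultimately show ?thesis by (intro exI[of _ "\<lambda>x. h1 x - h2 x"]) auto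
qed

lemma transfer_op_props:
  assumes "integrable M f"
  shows "integrable M (transfer_op M T f)"
    and "g \<in> borel_measurable M \<Longrightarrow> AE x in M. \<bar>g x\<bar> \<le> B \<Longrightarrow>
      (\<integral>x. transfer_op M T f x * g x \<partial>M) = (\<integral>x. f x * g (T x) \<partial>M)"
  using someI_ex[OF transfer_exists[OF assms]] unfolding transfer_op_def by blast+

section \<open>Calculus of the iterates modulo null sets\<close>

abbreviation Th :: "nat \<Rightarrow> ('a \<Rightarrow> real) \<Rightarrow> 'a \<Rightarrow> real" where
  "Th n \<equiv> transfer_op M T ^^ n"

lemma Th_integrable [simp, intro]: "integrable M f \<Longrightarrow> integrable M (Th n f)"
  by (induction n) (auto intro: transfer_op_props)

lemma Th_dual:
  assumes "integrable M f" and "g \<in> borel_measurable M" and "AE x in M. \<bar>g x\<bar> \<le> B"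
  shows "(\<integral>x. Th n f x * g x \<partial>M) = (\<integral>x. f x * g ((T ^^ n) x) \<partial>M)"
  using assms
proof (induction n arbitrary: g)
  case 0 then show ?case by simp
next
  case (Suc n)
  have "(\<integral>x. Th (Suc n) f x * g x \<partial>M) = (\<integral>x. Th n f x * g (T x) \<partial>M)"
    using transfer_op_props(2)[OF Th_integrable[OF Suc.prems(1)] Suc.prems(2,3)] by simp
  also have "\<dots> = (\<integral>x. f x * g (T ((T ^^ n) x)) \<partial>M)"
    using Suc.prems AE_T[OF Suc.prems(3)] by (intro Suc.IH) auto
  finally show ?case by simp
qed

lemma Th_dual_set:
  assumes "integrable M f" and "A \<in> sets M"
  shows "(\<integral>x. Th n f x * indicator A x \<partial>M) = (\<integral>x. f x * indicator A ((T ^^ n) x) \<partial>M)"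
  by (rule Th_dual[where B = 1]) (use assms in \<open>auto simp: indicator_def\<close>)

lemma integral_Th: "integrable M f \<Longrightarrow> (\<integral>x. Th n f x \<partial>M) = (\<integral>x. f x \<partial>M)"
  using Th_dual[of f "\<lambda>_. 1" 1 n] by simp

text \<open>Tested on the set where \<open>h < f\<close>: there \<open>f - h\<close> is positive
  while its integral is at most 0, so the set is null.\<close>

lemma AE_le_if_set_integrals_le:
  fixes f h :: "'a \<Rightarrow> real"
  assumes "integrable M f" "integrable M h"
    and le: "\<And>A. A \<in> sets M \<Longrightarrow> (\<integral>x. f x * indicator A x \<partial>M) \<le> (\<integral>x. h x * indicator A x \<partial>M)"
  shows "AE x in M. f x \<le> h x"
proof -
  have [measurable]: "f \<in> borel_measurable M" "h \<in> borel_measurable M" using assms by auto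
  define A where "A = {x \<in> space M. h x < f x}"
  have [measurable]: "A \<in> sets M" unfolding A_def by simp
  have i1: "integrable M (\<lambda>x. f x * indicator A x)" "integrable M (\<lambda>x. h x * indicator A x)"
    using assms by (auto intro!: integrable_real_mult_indicator)
  have "(\<integral>x. (f x * indicator A x - h x * indicator A x) \<partial>M) \<le> 0"
    using le[of A] i1 by simp
  moreover have nn: "AE x in M. 0 \<le> f x * indicator A x - h x * indicator A x"
    by (auto simp: A_def indicator_def)
  ultimately have "(\<integral>x. (f x * indicator A x - h x * indicator A x) \<partial>M) = 0"
    by (intro antisym integral_nonneg_AE) auto
  then have "AE x in M. f x * indicator A x - h x * indicator A x = 0"
    using integral_nonneg_eq_0_iff_AE[OF _ nn] i1 by auto
  then show ?thesis by (rule AE_mp) (auto simp: A_def indicator_def intro!: AE_I2)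
qed

lemma Th_ge:
  assumes "integrable M f" "integrable M h"
    and "\<And>A. A \<in> sets M \<Longrightarrow> (\<integral>x. h x * indicator A x \<partial>M) \<le> (\<integral>x. f x * indicator A ((T ^^ n) x) \<partial>M)"
  shows "AE x in M. h x \<le> Th n f x"
  by (rule AE_le_if_set_integrals_le) (use assms in \<open>auto simp: Th_dual_set\<close>)

text \<open>Since \<open>transfer_op\<close> picks an arbitrary version, identities between transfer
  images are reached through this characterization by integrals over sets, and hold almost
  everywhere only.\<close>

lemma Th_unique:
  assumes "integrable M f" "integrable M h"
    and "\<And>A. A \<in> sets M \<Longrightarrow> (\<integral>x. h x * indicator A x \<partial>M) = (\<integral>x. f x * indicator A ((T ^^ n) x) \<partial>M)"
  shows "AE x in M. Th n f x = h x"
proof -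
  have "AE x in M. h x \<le> Th n f x" by (rule Th_ge) (use assms in auto)
  moreover have "AE x in M. Th n f x \<le> h x"
    by (rule AE_le_if_set_integrals_le) (use assms in \<open>auto simp: Th_dual_set\<close>)
  ultimately show ?thesis by eventually_elim simp
qed

lemma Th_mono:
  assumes f: "integrable M f" and h: "integrable M h" and le: "AE x in M. f x \<le> h x"
  shows "AE x in M. Th n f x \<le> Th n h x"
proof (rule Th_ge[OF h Th_integrable[OF f]])
  fix A assume [measurable]: "A \<in> sets M"
  have b: "AE x in M. \<bar>indicator A ((T ^^ n) x) :: real\<bar> \<le> 1" by (auto simp: indicator_def)
  show "(\<integral>x. Th n f x * indicator A x \<partial>M) \<le> (\<integral>x. h x * indicator A ((T ^^ n) x) \<partial>M)"
    unfolding Th_dual_set[OF f \<open>A \<in> sets M\<close>]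
    by (rule integral_mono_AE)
      (use f h b le in \<open>auto intro!: integrable_bounded_mult[where B = 1] elim!: eventually_mono mult_right_mono\<close>)
qed

lemma Th_cong_AE:
  assumes f: "integrable M f" and h: "integrable M h" and eq: "AE x in M. f x = h x"
  shows "AE x in M. Th n f x = Th n h x"
proof -
  have "AE x in M. Th n f x \<le> Th n h x" "AE x in M. Th n h x \<le> Th n f x"
    by (rule Th_mono[OF f h], use eq in force, rule Th_mono[OF h f], use eq in force)
  then show ?thesis by eventually_elim simp
qed

lemma Th_lincomb:
  assumes f: "integrable M f" and h: "integrable M h"
  shows "AE x in M. Th n (\<lambda>x. c * f x + d * h x) x = c * Th n f x + d * Th n h x"
proof (rule Th_unique)
  fix A assume A[measurable]: "A \<in> sets M"
  have b: "AE x in M. \<bar>indicator A ((T ^^ n) x) :: real\<bar> \<le> 1" by (auto simp: indicator_def)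
  have i: "integrable M (\<lambda>x. f x * indicator A ((T ^^ n) x))" "integrable M (\<lambda>x. h x * indicator A ((T ^^ n) x))"
    using f h b by (auto intro!: integrable_bounded_mult[where B = 1])
  have j: "integrable M (\<lambda>x. Th n f x * indicator A x)" "integrable M (\<lambda>x. Th n h x * indicator A x)"
    using f h by (auto intro!: integrable_real_mult_indicator)
  show "(\<integral>x. (c * Th n f x + d * Th n h x) * indicator A x \<partial>M)
      = (\<integral>x. (c * f x + d * h x) * indicator A ((T ^^ n) x) \<partial>M)"
    using i j Th_dual_set[OF f A, of n] Th_dual_set[OF h A, of n]
    by (simp add: distrib_right mult.assoc)
qed (use f h in auto)

lemma Th_add:
  "integrable M f \<Longrightarrow> integrable M h \<Longrightarrow> AE x in M. Th n (\<lambda>x. f x + h x) x = Th n f x + Th n h x"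
  using Th_lincomb[of f h n 1 1] by simp

lemma Th_diff:
  "integrable M f \<Longrightarrow> integrable M h \<Longrightarrow> AE x in M. Th n (\<lambda>x. f x - h x) x = Th n f x - Th n h x"
  using Th_lincomb[of f h n 1 "-1"] by simp

lemma Th_cmult:
  "integrable M f \<Longrightarrow> AE x in M. Th n (\<lambda>x. c * f x) x = c * Th n f x"
  using Th_lincomb[of f f n c 0] by simp

lemma Th_zero: "AE x in M. Th n (\<lambda>x. 0) x = 0"
  using Th_cmult[of "\<lambda>_. 0" n 0] by simp

lemma Th_nonneg: "integrable M f \<Longrightarrow> AE x in M. 0 \<le> f x \<Longrightarrow> AE x in M. 0 \<le> Th n f x"
  using Th_mono[of "\<lambda>_. 0" f n] Th_zero[of n] by (auto elim: eventually_elim2)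

lemma Th_abs_le:
  assumes f: "integrable M f" and h: "integrable M h" and le: "AE x in M. \<bar>f x\<bar> \<le> h x"
  shows "AE x in M. \<bar>Th n f x\<bar> \<le> Th n h x"
proof -
  have "AE x in M. Th n f x \<le> Th n h x" using le by (intro Th_mono f h) (auto elim!: eventually_mono)
  moreover have "AE x in M. Th n (\<lambda>x. -1 * f x) x \<le> Th n h x"
    using le f by (intro Th_mono h) (auto elim!: eventually_mono)
  ultimately show ?thesis using Th_cmult[OF f, of n "-1"] by eventually_elim auto
qed

lemma Th_sum:
  assumes "finite I" "\<And>i. i \<in> I \<Longrightarrow> integrable M (f i)"
  shows "AE x in M. Th n (\<lambda>x. \<Sum>i\<in>I. f i x) x = (\<Sum>i\<in>I. Th n (f i) x)"
  using assms
proof (induction I rule: finite_induct)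
  case empty then show ?case using Th_zero by simp
next
  case (insert i I)
  have "AE x in M. Th n (\<lambda>x. f i x + (\<Sum>i\<in>I. f i x)) x = Th n (f i) x + Th n (\<lambda>x. \<Sum>i\<in>I. f i x) x"
    using insert by (intro Th_add) auto
  moreover have "AE x in M. Th n (\<lambda>x. \<Sum>i\<in>I. f i x) x = (\<Sum>i\<in>I. Th n (f i) x)"
    using insert by auto
  ultimately show ?case
    by (rule eventually_elim2) (use insert.hyps in simp)
qed

text \<open>A factor that depends only on the position after \<open>j\<close> steps comes out of the
  transfer operator. Below it moves the weights \<open>g (D n)\<close> past one step and shows that
  an image is supported in the strip over the section.\<close>

lemma Th_mult_iter:
  assumes f: "integrable M f" and k: "k \<in> borel_measurable M" "\<And>x. \<bar>k x\<bar> \<le> B"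
  shows "AE x in M. Th j (\<lambda>x. f x * k ((T ^^ j) x)) x = Th j f x * k x"
proof (rule Th_unique)
  note [measurable] = k(1)
  show "integrable M (\<lambda>x. f x * k ((T ^^ j) x))" "integrable M (\<lambda>x. Th j f x * k x)"
    using k f by (auto intro!: integrable_bounded_mult[where B = B])
  fix A assume A[measurable]: "A \<in> sets M"
  have bd: "\<bar>k x * indicator A x\<bar> \<le> B" for x
    using k(2)[of x] by (auto simp: indicator_def split: if_splits)
  show "(\<integral>x. Th j f x * k x * indicator A x \<partial>M) = (\<integral>x. f x * k ((T ^^ j) x) * indicator A ((T ^^ j) x) \<partial>M)"
    using Th_dual[OF f, of "\<lambda>x. k x * indicator A x" B j] bd by (simp add: mult.assoc)
qed

end

section \<open>The ratio ergodic theorem\<close>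

context mp_system
begin

section \<open>Birkhoff sums and the maximal inequality\<close>

lemma birkhoff_sum_Suc: "birkhoff_sum T (Suc n) f x = f x + birkhoff_sum T n f (T x)"
  unfolding birkhoff_sum_def by (subst sum.lessThan_Suc_shift) (simp add: funpow_swap1)

lemma birkhoff_sum_measurable [measurable]:
  "f \<in> borel_measurable M \<Longrightarrow> birkhoff_sum T n f \<in> borel_measurable M"
  unfolding birkhoff_sum_def by simp

lemma birkhoff_sum_diff: "birkhoff_sum T n (\<lambda>x. f x - c * h x) x = birkhoff_sum T n f x - c * birkhoff_sum T n h x"
  unfolding birkhoff_sum_def by (simp add: sum_subtractf sum_distrib_left)

text \<open>The maximum of 0 and the first \<open>n\<close> Birkhoff sums. Unrolled from the first
  step of the orbit, \<open>maxsum f (Suc n) x\<close> equals \<open>f x + maxsum f n (T x)\<close>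
  wherever it is positive, which is what the maximal inequality uses.\<close>

primrec maxsum :: "('a \<Rightarrow> real) \<Rightarrow> nat \<Rightarrow> 'a \<Rightarrow> real" where
  "maxsum f 0 = (\<lambda>x. 0)"
| "maxsum f (Suc n) = (\<lambda>x. max 0 (f x + maxsum f n (T x)))"

lemma maxsum_nonneg: "0 \<le> maxsum f n x" by (cases n) auto

lemma maxsum_mono: "maxsum f n x \<le> maxsum f (Suc n) x"
proof (induction n arbitrary: x)
  case (Suc n)
  from Suc[of "T x"] show ?case by auto
qed simp

lemma maxsum_mono': "n \<le> k \<Longrightarrow> maxsum f n x \<le> maxsum f k x"
  by (rule lift_Suc_mono_le[of "\<lambda>n. maxsum f n x"]) (rule maxsum_mono)

lemma birkhoff_sum_le_maxsum: "birkhoff_sum T n f x \<le> maxsum f n x"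
proof (induction n arbitrary: x)
  case 0 show ?case by (simp add: birkhoff_sum_def)
next
  case (Suc n)
  from Suc[of "T x"] show ?case by (simp add: birkhoff_sum_Suc)
qed

lemma maxsum_integrable: "integrable M f \<Longrightarrow> integrable M (maxsum f n)"
proof (induction n)
  case (Suc n)
  then show ?case using integrable_iter[of "maxsum f n" 1] by auto
qed simp

text \<open>Garsia's proof: where the maximal sum is positive, \<open>f\<close> is at least its decrease along the orbit.\<close>

lemma maximal_ergodic:
  assumes f: "integrable M f"
  shows "0 \<le> (\<integral>x. f x * indicator {x \<in> space M. 0 < maxsum f (Suc n) x} x \<partial>M)"
proof -
  let ?m = "maxsum f (Suc n)"
  have m: "integrable M ?m" by (rule maxsum_integrable[OF f])
  have mT: "integrable M (\<lambda>x. ?m (T x))" using integrable_iter[OF m, of 1] by simp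
  have [measurable]: "?m \<in> borel_measurable M" using m by (rule borel_measurable_integrable)
  have "0 = (\<integral>x. ?m x - ?m (T x) \<partial>M)"
    using m mT integral_iter[of ?m 1] by (simp del: maxsum.simps)
  also have "\<dots> \<le> (\<integral>x. f x * indicator {x \<in> space M. 0 < ?m x} x \<partial>M)"
  proof (rule integral_mono)
    show "integrable M (\<lambda>x. ?m x - ?m (T x))" using m mT by (simp del: maxsum.simps)
    show "integrable M (\<lambda>x. f x * indicator {x \<in> space M. 0 < ?m x} x)"
      by (rule integrable_real_mult_indicator[OF _ f]) measurable
    fix x assume x: "x \<in> space M"
    show "?m x - ?m (T x) \<le> f x * indicator {x \<in> space M. 0 < ?m x} x"
      using maxsum_mono[of f n "T x"] maxsum_nonneg[of f "Suc n" "T x"] x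
      by (auto simp: indicator_def max_def split: if_splits)
  qed
  finally show ?thesis .
qed

text \<open>The sets in the maximal inequality increase to almost the whole space when almost every
  orbit has a positive sum, and dominated convergence applies.\<close>

lemma integral_nonneg_if_sums_pos:
  assumes f: "integrable M f" and pos: "AE x in M. \<exists>k. 0 < birkhoff_sum T k f x"
  shows "0 \<le> (\<integral>x. f x \<partial>M)"
proof -
  have [measurable]: "f \<in> borel_measurable M" using f by auto
  have [measurable]: "maxsum f (Suc n) \<in> borel_measurable M" for n
    using maxsum_integrable[OF f] by (rule borel_measurable_integrable)
  let ?E = "\<lambda>n. {x \<in> space M. 0 < maxsum f (Suc n) x}"
  have "(\<lambda>n. \<integral>x. f x * indicator (?E n) x \<partial>M) \<longlonglongrightarrow> (\<integral>x. f x \<partial>M)"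
  proof (rule integral_dominated_convergence[where w = "\<lambda>x. \<bar>f x\<bar>"])
    show "AE x in M. (\<lambda>n. f x * indicator (?E n) x) \<longlonglongrightarrow> f x"
    proof (rule AE_mp[OF pos], rule AE_I2, rule impI)
      fix x assume x: "x \<in> space M" and "\<exists>k. 0 < birkhoff_sum T k f x"
      then obtain k where k: "0 < birkhoff_sum T k f x" by auto
      have "0 < maxsum f (Suc n) x" if "n \<ge> k" for n
        using k birkhoff_sum_le_maxsum[of k f x] maxsum_mono'[of k "Suc n" f x] that by linarith
      then have "\<forall>\<^sub>F n in sequentially. f x * indicator (?E n) x = f x"
        using x unfolding eventually_sequentially by (intro exI[of _ k]) (auto simp del: maxsum.simps)
      then show "(\<lambda>n. f x * indicator (?E n) x) \<longlonglongrightarrow> f x" by (rule tendsto_eventually)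
    qed
  qed (use f in \<open>auto simp: indicator_def simp del: maxsum.simps\<close>)
  then show ?thesis
    by (rule LIMSEQ_le_const) (use maximal_ergodic[OF f] in auto)
qed

text \<open>The set of points with unbounded sums is invariant, as moving the starting point by one
  step changes the sums by the single value \<open>f x\<close>. It cannot have full measure, since
  then the integral of \<open>f\<close> would be nonnegative; ergodicity makes it null.\<close>

lemma sums_bounded_above:
  assumes erg: "ergodic_map M T" and f: "integrable M f" and neg: "(\<integral>x. f x \<partial>M) < 0"
  shows "AE x in M. \<exists>C. \<forall>n. birkhoff_sum T n f x \<le> C"
proof -
  have [measurable]: "f \<in> borel_measurable M" using f by auto
  define Q where "Q = {x \<in> space M. \<forall>K::nat. \<exists>n. birkhoff_sum T n f x > real K}"
  have [measurable]: "Q \<in> sets M" unfolding Q_def by measurable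
  have "T x \<in> Q \<longleftrightarrow> x \<in> Q" if x: "x \<in> space M" for x
  proof
    assume "T x \<in> Q"
    have "\<exists>n. birkhoff_sum T n f x > real K" for K
    proof -
      obtain L :: nat where L: "real L \<ge> real K - f x" using real_arch_simple by blast
      obtain n where "birkhoff_sum T n f (T x) > real L" using \<open>T x \<in> Q\<close> by (auto simp: Q_def)
      then show ?thesis using L by (intro exI[of _ "Suc n"]) (simp add: birkhoff_sum_Suc)
    qed
    then show "x \<in> Q" using x by (auto simp: Q_def)
  next
    assume "x \<in> Q"
    have "\<exists>n. birkhoff_sum T n f (T x) > real K" for K
    proof -
      obtain L :: nat where L: "real L \<ge> real K + f x" using real_arch_simple by blast
      obtain n where n: "birkhoff_sum T n f x > real L" using \<open>x \<in> Q\<close> by (auto simp: Q_def)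
      have "n \<noteq> 0"
      proof
        assume "n = 0" then show False using n by (auto simp: birkhoff_sum_def)
      qed
      then obtain n' where "n = Suc n'" by (cases n) auto
      then show ?thesis using n L by (intro exI[of _ n']) (simp add: birkhoff_sum_Suc)
    qed
    then show "T x \<in> Q" using T_space[OF x] by (auto simp: Q_def)
  qed
  then have "T -` Q \<inter> space M = Q" by (auto simp: Q_def)
  then have "emeasure M Q = 0 \<or> emeasure M (space M - Q) = 0"
    using erg by (auto simp: ergodic_map_def)
  moreover have "emeasure M (space M - Q) \<noteq> 0"
  proof
    assume "emeasure M (space M - Q) = 0"
    then have "AE x in M. x \<notin> space M - Q" by (intro AE_not_in null_setsI) auto
    then have "AE x in M. \<exists>k. 0 < birkhoff_sum T k f x"
      by (rule AE_mp) (auto simp: Q_def intro!: AE_I2 dest!: spec[of _ "0::nat"])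
    then show False using integral_nonneg_if_sums_pos[OF f] neg by auto
  qed
  ultimately have "AE x in M. x \<notin> Q" by (intro AE_not_in null_setsI) auto
  then show ?thesis
    by (rule AE_mp) (auto simp: Q_def not_less intro!: AE_I2)
qed

text \<open>The function \<open>f - (?q + e) * p\<close> has negative integral, so its sums are
  bounded above; divided by the diverging sums of \<open>p\<close>, the bound disappears. Countably
  many values \<open>e = 1 / Suc i\<close> share one null set.\<close>

lemma ratio_limsup:
  assumes erg: "ergodic_map M T" and f: "integrable M f" and p: "integrable M p"
    and pos: "0 < (\<integral>x. p x \<partial>M)"
    and inf: "AE x in M. filterlim (\<lambda>n. birkhoff_sum T n p x) at_top sequentially"
  shows "AE x in M. \<forall>e>0. \<forall>\<^sub>F n in sequentially.
    birkhoff_sum T n f x / birkhoff_sum T n p x < (\<integral>x. f x \<partial>M) / (\<integral>x. p x \<partial>M) + e"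
proof -
  let ?q = "(\<integral>x. f x \<partial>M) / (\<integral>x. p x \<partial>M)"
  have "AE x in M. \<exists>C. \<forall>n. birkhoff_sum T n (\<lambda>x. f x - (?q + 1 / real (Suc i)) * p x) x \<le> C" for i
  proof (rule sums_bounded_above[OF erg])
    show "(\<integral>x. f x - (?q + 1 / real (Suc i)) * p x \<partial>M) < 0"
      using f p pos by (simp add: distrib_right)
  qed (use f p in auto)
  then have "AE x in M. \<forall>i. \<exists>C. \<forall>n. birkhoff_sum T n (\<lambda>x. f x - (?q + 1 / real (Suc i)) * p x) x \<le> C"
    by (simp add: AE_all_countable)
  then show ?thesis using inf
  proof (rule eventually_elim2, intro allI impI)
    fix x and e :: real
    assume all: "\<forall>i. \<exists>C. \<forall>n. birkhoff_sum T n (\<lambda>x. f x - (?q + 1 / real (Suc i)) * p x) x \<le> C"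
      and lim: "filterlim (\<lambda>n. birkhoff_sum T n p x) at_top sequentially" and e: "e > 0"
    obtain i :: nat where i: "1 / real (Suc i) < e / 2"
      using nat_approx_posE[of "e/2"] e by auto
    obtain C where C: "birkhoff_sum T n f x \<le> (?q + 1 / real (Suc i)) * birkhoff_sum T n p x + C" for n
      using all[rule_format, of i] unfolding birkhoff_sum_diff by (auto simp: diff_le_eq add.commute)
    have "\<forall>\<^sub>F n in sequentially. birkhoff_sum T n p x > max 0 (2 * C / e)"
      using lim by (rule filterlim_at_top_dense[THEN iffD1, rule_format])
    then show "\<forall>\<^sub>F n in sequentially. birkhoff_sum T n f x / birkhoff_sum T n p x < ?q + e"
    proof (rule eventually_mono)
      fix n assume a: "birkhoff_sum T n p x > max 0 (2 * C / e)"
      let ?p = "birkhoff_sum T n p x"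
      have "C < e / 2 * ?p" using a e by (simp add: field_simps)
      moreover have "(1 / real (Suc i)) * ?p < e / 2 * ?p" using a i by (intro mult_strict_right_mono) auto
      ultimately have "birkhoff_sum T n f x < (?q + e) * ?p"
        using C[of n] by (simp only: distrib_right)
      then show "birkhoff_sum T n f x / ?p < ?q + e" using a by (simp add: pos_divide_less_eq)
    qed
  qed
qed

text \<open>Divergence of the sums of \<open>p\<close> stands in for conservativity; it will be
  verified for the number of visits. The lower estimate is the upper one for
  \<open>- f\<close>.\<close>

theorem ratio_ergodic:
  assumes erg: "ergodic_map M T" and f: "integrable M f" and p: "integrable M p"
    and pos: "0 < (\<integral>x. p x \<partial>M)"
    and inf: "AE x in M. filterlim (\<lambda>n. birkhoff_sum T n p x) at_top sequentially"
  shows "AE x in M. (\<lambda>n. birkhoff_sum T n f x / birkhoff_sum T n p x)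
    \<longlonglongrightarrow> (\<integral>x. f x \<partial>M) / (\<integral>x. p x \<partial>M)"
proof -
  have "integrable M (\<lambda>x. - f x)" using f by simp
  from ratio_limsup[OF erg this p pos inf] ratio_limsup[OF erg f p pos inf]
  show ?thesis
  proof (rule eventually_elim2)
    fix x
    have neg: "birkhoff_sum T n (\<lambda>x. - f x) x = - birkhoff_sum T n f x" for n
      by (simp add: birkhoff_sum_def sum_negf)
    assume A: "\<forall>e>0. \<forall>\<^sub>F n in sequentially. birkhoff_sum T n (\<lambda>x. - f x) x / birkhoff_sum T n p x
        < (\<integral>x. - f x \<partial>M) / (\<integral>x. p x \<partial>M) + e"
      and B: "\<forall>e>0. \<forall>\<^sub>F n in sequentially. birkhoff_sum T n f x / birkhoff_sum T n p x
        < (\<integral>x. f x \<partial>M) / (\<integral>x. p x \<partial>M) + e"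
    show "(\<lambda>n. birkhoff_sum T n f x / birkhoff_sum T n p x) \<longlonglongrightarrow> (\<integral>x. f x \<partial>M) / (\<integral>x. p x \<partial>M)"
    proof (rule tendstoI)
      fix e :: real assume "e > 0"
      from A[rule_format, OF this] B[rule_format, OF this]
      show "\<forall>\<^sub>F n in sequentially. dist (birkhoff_sum T n f x / birkhoff_sum T n p x)
          ((\<integral>x. f x \<partial>M) / (\<integral>x. p x \<partial>M)) < e"
        by eventually_elim (auto simp: neg dist_real_def abs_less_iff)
    qed
  qed
qed

text \<open>For an invariant \<open>A\<close> and \<open>B \<subseteq> A\<close> of finite measure,
  all transfer images of the indicator of \<open>B\<close> vanish off \<open>A\<close>, yet their
  averages converge to the measure of \<open>B\<close> almost everywhere. If the complement of
  \<open>A\<close> is not null, every such \<open>B\<close> is null, and \<open>A\<close> is a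
  countable union of them.\<close>

lemma ergodic_if_return_sequence:
  assumes rs: "return_sequence M T a"
  shows "ergodic_map M T"
  unfolding ergodic_map_def
proof (intro ballI impI)
  fix A assume A[measurable]: "A \<in> sets M" and inv: "T -` A \<inter> space M = A"
  have TA: "T x \<in> A \<longleftrightarrow> x \<in> A" if "x \<in> space M" for x using inv that by auto
  have itA: "(T ^^ n) x \<in> A \<longleftrightarrow> x \<in> A" if x: "x \<in> space M" for n x
    using TA iter_space[OF x] by (induction n) auto
  show "emeasure M A = 0 \<or> emeasure M (space M - A) = 0"
  proof (rule disjCI)
    assume ne: "emeasure M (space M - A) \<noteq> 0"
    have "emeasure M B = 0" if B[measurable]: "B \<in> sets M" "B \<subseteq> A" "emeasure M B < \<infinity>" for B
    proof -
      have ib: "integrable M (indicator B :: 'a \<Rightarrow> real)" using B by simp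
      have "AE x in M. Th n (indicator B) x = indicator A x * Th n (indicator B) x" for n
      proof (rule Th_unique[OF ib])
        show "integrable M (\<lambda>x. indicator A x * Th n (indicator B) x)"
          using Th_integrable[OF ib, of n] by (rule integrable_mult_indicator[OF A, of "Th n (indicator B)", simplified])
        fix E assume E[measurable]: "E \<in> sets M"
        have "(\<integral>x. indicator A x * Th n (indicator B) x * indicator E x \<partial>M)
            = (\<integral>x. Th n (indicator B) x * indicator (A \<inter> E) x \<partial>M)"
          by (rule Bochner_Integration.integral_cong) (auto simp: indicator_def)
        also have "\<dots> = (\<integral>x. indicator B x * indicator (A \<inter> E) ((T ^^ n) x) \<partial>M)"
          by (rule Th_dual_set[OF ib]) simp
        also have "\<dots> = (\<integral>x. indicator B x * indicator E ((T ^^ n) x) \<partial>M)"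
          by (rule Bochner_Integration.integral_cong) (use itA B(2) in \<open>auto simp: indicator_def\<close>)
        finally show "(\<integral>x. indicator A x * Th n (indicator B) x * indicator E x \<partial>M)
            = (\<integral>x. indicator B x * indicator E ((T ^^ n) x) \<partial>M)" .
      qed
      then have "AE x in M. \<forall>n. Th n (indicator B) x = indicator A x * Th n (indicator B) x"
        unfolding AE_all_countable by blast
      moreover have "AE x in M. (\<lambda>n. (1 / a n) * (\<Sum>k<n. Th k (indicator B) x)) \<longlonglongrightarrow> measure M B"
      proof -
        have "(\<integral>x. indicator B x \<partial>M) = measure M B" by simp
        moreover have "AE x in M. (\<lambda>n. (1 / a n) * (\<Sum>k<n. Th k (indicator B) x)) \<longlonglongrightarrow> (\<integral>x. indicator B x \<partial>M)"
          using rs ib unfolding return_sequence_def by blast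
        ultimately show ?thesis by (simp only:)
      qed
      ultimately have "AE x in M. x \<in> space M - A \<longrightarrow> measure M B = 0"
      proof (rule eventually_elim2, intro impI)
        fix x assume z: "\<forall>n. Th n (indicator B) x = indicator A x * Th n (indicator B) x"
          and l: "(\<lambda>n. (1 / a n) * (\<Sum>k<n. Th k (indicator B) x)) \<longlonglongrightarrow> measure M B"
          and x: "x \<in> space M - A"
        have "Th n (indicator B) x = 0" for n using z[rule_format, of n] x by simp
        then have "(\<lambda>n. 0::real) \<longlonglongrightarrow> measure M B" using l by simp
        then show "measure M B = 0" using LIMSEQ_unique tendsto_const by blast
      qed
      moreover have "\<not> (AE x in M. x \<notin> space M - A)"
      proof
        assume "AE x in M. x \<notin> space M - A"
        then have "emeasure M (space M - A) = 0" by (subst (asm) AE_iff_measurable[OF _ refl]) (auto intro: arg_cong2[where f = emeasure] simp: Int_def Diff_eq)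
        then show False using ne by simp
      qed
      ultimately have "measure M B = 0"
        by (cases "measure M B = 0") (auto elim: eventually_mono)
      then show ?thesis using B by (simp add: emeasure_eq_ennreal_measure)
    qed note small = this
    obtain W :: "nat \<Rightarrow> 'a set" where W: "range W \<subseteq> sets M" "(\<Union>i. W i) = space M" "\<And>i. emeasure M (W i) \<noteq> \<infinity>"
      using sigma_finite by blast
    have "emeasure M (A \<inter> W i) = 0" for i
    proof (rule small)
      have "emeasure M (A \<inter> W i) \<le> emeasure M (W i)" using W by (intro emeasure_mono) auto
      then show "emeasure M (A \<inter> W i) < \<infinity>" using W(3)[of i] by (auto simp: less_top order_le_less_trans)
    qed (use W in auto)
    then have "(\<Union>i. A \<inter> W i) \<in> null_sets M" using W by (intro null_sets_UN) (auto intro!: null_setsI)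
    moreover have "(\<Union>i. A \<inter> W i) = A" using W(2) sets.sets_into_space[OF A] by auto
    ultimately show "emeasure M A = 0" by auto
  qed
qed

end

section \<open>Cesaro averages\<close>

definition avg :: "(nat \<Rightarrow> real) \<Rightarrow> (nat \<Rightarrow> real) \<Rightarrow> nat \<Rightarrow> real" where
  "avg a x N = (1 / a N) * (\<Sum>n=1..N. x n)"

lemma avg_add: "avg a (\<lambda>n. x n + y n) N = avg a x N + avg a y N"
  by (simp add: avg_def sum.distrib distrib_left)

lemma avg_diff: "avg a (\<lambda>n. x n - y n) N = avg a x N - avg a y N"
  by (simp add: avg_def sum_subtractf right_diff_distrib)

lemma avg_cmult: "avg a (\<lambda>n. c * x n) N = c * avg a x N"
  by (simp add: avg_def sum_distrib_left mult_ac)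

lemma avg_nonneg: "0 < a N \<Longrightarrow> (\<And>n. 1 \<le> n \<Longrightarrow> 0 \<le> x n) \<Longrightarrow> 0 \<le> avg a x N"
  unfolding avg_def by (intro mult_nonneg_nonneg sum_nonneg) auto

text \<open>Finitely many exceptional indices contribute a constant to the sums, which is negligible
  against \<open>a N\<close>.\<close>

lemma avg_limsup:
  assumes a: "filterlim a at_top sequentially"
    and le: "\<forall>\<^sub>F n in sequentially. x n \<le> y n" and y: "avg a y \<longlonglongrightarrow> l" and e: "e > 0"
  shows "\<forall>\<^sub>F N in sequentially. avg a x N < l + e"
proof -
  obtain n0 where n0: "\<And>n. n \<ge> n0 \<Longrightarrow> x n \<le> y n" using le by (auto simp: eventually_sequentially)
  define K where "K = (\<Sum>n\<in>{1..n0}. \<bar>x n - y n\<bar>)"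
  have "((\<lambda>N. (1 / a N) * K) \<longlongrightarrow> 0 * K) sequentially"
    by (intro tendsto_mult tendsto_const) (use tendsto_inverse_0_at_top[OF a] in \<open>simp add: divide_inverse\<close>)
  then have l: "((\<lambda>N. avg a y N + (1 / a N) * K) \<longlongrightarrow> l) sequentially"
    using tendsto_add[OF y] by fastforce
  have "\<forall>\<^sub>F N in sequentially. avg a y N + (1 / a N) * K < l + e"
    using order_tendstoD(2)[OF l, of "l + e"] e by simp
  moreover have "\<forall>\<^sub>F N in sequentially. 0 < a N"
    using a by (rule filterlim_at_top_dense[THEN iffD1, rule_format])
  ultimately show ?thesis
  proof eventually_elim
    fix N assume lt: "avg a y N + (1 / a N) * K < l + e" and pos: "0 < a N"
    have "(\<Sum>n=1..N. x n) - (\<Sum>n=1..N. y n) = (\<Sum>n\<in>{1..N}. x n - y n)" by (simp add: sum_subtractf)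
    also have "\<dots> \<le> (\<Sum>n\<in>{1..N}. if n \<in> {1..n0} then \<bar>x n - y n\<bar> else 0)"
      using n0 by (intro sum_mono) (auto simp: not_le)
    also have "\<dots> = (\<Sum>n\<in>{1..N} \<inter> {1..n0}. \<bar>x n - y n\<bar>)" by (rule sum.inter_restrict[symmetric]) simp
    also have "\<dots> \<le> K" unfolding K_def by (intro sum_mono2) auto
    finally have "(1 / a N) * (\<Sum>n=1..N. x n) \<le> (1 / a N) * ((\<Sum>n=1..N. y n) + K)"
      using pos by (intro mult_left_mono) auto
    then have "avg a x N \<le> avg a y N + (1 / a N) * K" by (simp add: avg_def distrib_left)
    with lt show "avg a x N < l + e" by linarith
  qed
qed

text \<open>The averaged limits below are obtained in this form: for each \<epsilon> a majorant
  whose average converges to at most \<epsilon>. The majorant may depend on \<epsilon> and has to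
  dominate only eventually.\<close>

lemma avg_null:
  assumes a: "filterlim a at_top sequentially" and nn: "\<And>n. 0 \<le> x n"
    and dom: "\<And>e. e > 0 \<Longrightarrow> \<exists>y l. (\<forall>\<^sub>F n in sequentially. x n \<le> y n) \<and> avg a y \<longlonglongrightarrow> l \<and> l \<le> e"
  shows "avg a x \<longlonglongrightarrow> 0"
proof (rule tendstoI)
  fix e :: real assume e: "e > 0"
  obtain y l where yl: "\<forall>\<^sub>F n in sequentially. x n \<le> y n" "avg a y \<longlonglongrightarrow> l" "l \<le> e/2"
    using dom[of "e/2"] e by auto
  have "\<forall>\<^sub>F N in sequentially. avg a x N < l + e/2" using avg_limsup[OF a yl(1,2)] e by simp
  moreover have "\<forall>\<^sub>F N in sequentially. 0 < a N"
    using a by (rule filterlim_at_top_dense[THEN iffD1, rule_format])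
  ultimately show "\<forall>\<^sub>F N in sequentially. dist (avg a x N) 0 < e"
  proof eventually_elim
    fix N assume "avg a x N < l + e/2" "0 < a N"
    moreover have "0 \<le> avg a x N" using \<open>0 < a N\<close> nn by (intro avg_nonneg) auto
    ultimately show "dist (avg a x N) 0 < e" using yl(3) by (simp add: dist_real_def)
  qed
qed

lemma avg_null_shift:
  assumes a: "filterlim a at_top sequentially" and nn: "\<And>n. 0 \<le> x n"
    and nul: "avg a (\<lambda>n. x (Suc n)) \<longlonglongrightarrow> 0"
  shows "avg a x \<longlonglongrightarrow> 0"
proof (rule tendsto_sandwich[of "\<lambda>_. 0" "avg a x" sequentially "\<lambda>N. avg a (\<lambda>n. x (Suc n)) N + (1 / a N) * x 1"])
  have pos: "\<forall>\<^sub>F N in sequentially. 0 < a N"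
    using a by (rule filterlim_at_top_dense[THEN iffD1, rule_format])
  then show "\<forall>\<^sub>F N in sequentially. 0 \<le> avg a x N"
    by (rule eventually_mono) (auto intro!: avg_nonneg nn)
  show "\<forall>\<^sub>F N in sequentially. avg a x N \<le> avg a (\<lambda>n. x (Suc n)) N + (1 / a N) * x 1"
    using pos
  proof eventually_elim
    fix N assume pos: "0 < a N"
    have "(\<Sum>n=1..N. x n) \<le> (\<Sum>n=1..Suc N. x n)" using nn[of "Suc N"] by simp
    also have "\<dots> = x 1 + (\<Sum>n=1..N. x (Suc n))"
      using sum.atLeast_Suc_atMost[of 1 "Suc N" x] sum.shift_bounds_cl_Suc_ivl[of x 1 N] by simp
    finally show "avg a x N \<le> avg a (\<lambda>n. x (Suc n)) N + (1 / a N) * x 1"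
      using pos by (simp add: avg_def divide_right_mono flip: add_divide_distrib)
  qed
  have "((\<lambda>N. (1 / a N) * x 1) \<longlongrightarrow> 0 * x 1) sequentially"
    by (intro tendsto_mult tendsto_const) (use tendsto_inverse_0_at_top[OF a] in \<open>simp add: divide_inverse\<close>)
  then show "(\<lambda>N. avg a (\<lambda>n. x (Suc n)) N + (1 / a N) * x 1) \<longlonglongrightarrow> 0"
    using tendsto_add[OF nul] by fastforce
qed simp

text \<open>The sum over \<open>1..N\<close> is the sum over \<open>k < N\<close> for the initial
  function \<open>Th 1 F\<close>, which has the same integral.\<close>

lemma (in mp_system) avg_Th:
  assumes rs: "return_sequence M T a" and F: "integrable M F"
  shows "AE z in M. avg a (\<lambda>n. Th n F z) \<longlonglongrightarrow> (\<integral>x. F x \<partial>M)"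
proof -
  have "AE z in M. (\<lambda>n. (1 / a n) * (\<Sum>k<n. Th k (Th 1 F) z)) \<longlonglongrightarrow> (\<integral>x. Th 1 F x \<partial>M)"
    using rs Th_integrable[OF F, of 1] unfolding return_sequence_def by blast
  moreover have "(\<Sum>k<n. Th k (Th 1 F) z) = (\<Sum>k=1..n. Th k F z)" for n z
  proof -
    have "(\<Sum>k=1..n. Th k F z) = (\<Sum>k<n. Th (Suc k) F z)"
      by (rule sum.reindex_bij_witness[of _ Suc "\<lambda>k. k - 1"]) auto
    then show ?thesis by (simp add: funpow_swap1)
  qed
  ultimately show ?thesis using integral_Th[OF F, of 1] by (simp add: avg_def[abs_def])
qed

text \<open>
  \<open>D n\<close> stands for the normalized occupation numbers, and \<open>good g e F\<close> says that the assertion holds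
  for the initial density \<open>F\<close>, with \<open>e\<close> in the place of the expectation of \<open>g(W)\<close>.
\<close>

locale cesaro_system = mp_system M R for M :: "'a measure" and R :: "'a \<Rightarrow> 'a" +
  fixes a :: "nat \<Rightarrow> real" and u :: "nat \<Rightarrow> real" and D :: "nat \<Rightarrow> 'a \<Rightarrow> real"
  assumes rs: "return_sequence M R a"
    and a_inf: "filterlim a at_top sequentially"
    and u_pos: "\<And>n. n \<ge> 1 \<Longrightarrow> 0 < u n"
    and u_avg: "avg a u \<longlonglongrightarrow> 1"
    and u_shift: "(\<lambda>n. u (Suc n) / u n) \<longlonglongrightarrow> 1"
    and D_meas [measurable]: "\<And>n. D n \<in> borel_measurable M"
    and D_nonneg: "\<And>n x. 0 \<le> D n x"
    and D_shift: "\<And>d. d > 0 \<Longrightarrow> \<forall>\<^sub>F n in sequentially. AE x in M. \<bar>D (Suc n) x - D n (R x)\<bar> \<le> d * (1 + D n (R x))"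
begin

definition good :: "(real \<Rightarrow> real) \<Rightarrow> real \<Rightarrow> ('a \<Rightarrow> real) \<Rightarrow> bool" where
  "good g e F \<longleftrightarrow> integrable M F \<and>
     (AE z in M. avg a (\<lambda>n. \<bar>Th n (\<lambda>x. F x * g (D n x)) z - (\<integral>x. F x \<partial>M) * e * u n\<bar>) \<longlonglongrightarrow> 0)"

section \<open>Closure properties of the good densities\<close>

context
  fixes g :: "real \<Rightarrow> real" and e :: real
  assumes g_meas [measurable]: "g \<in> borel_measurable borel"
    and g_bd: "\<And>x. 0 \<le> g x" "\<And>x. g x \<le> 1" and e_nonneg: "0 \<le> e"
begin

lemma g_abs: "\<bar>g x\<bar> \<le> 1" using g_bd[of x] by simp

lemma Fg_integrable: "integrable M F \<Longrightarrow> integrable M (\<lambda>x. F x * g (D n x))"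
  by (rule integrable_bounded_mult[where B = 1]) (auto simp: g_abs)

lemma good_lincomb:
  assumes "good g e F" "good g e H"
  shows "good g e (\<lambda>x. c * F x + d * H x)"
proof -
  have F: "integrable M F" and H: "integrable M H" using assms by (auto simp: good_def)
  have F1: "AE z in M. avg a (\<lambda>n. \<bar>Th n (\<lambda>x. F x * g (D n x)) z - (\<integral>x. F x \<partial>M) * e * u n\<bar>) \<longlonglongrightarrow> 0"
    and H1: "AE z in M. avg a (\<lambda>n. \<bar>Th n (\<lambda>x. H x * g (D n x)) z - (\<integral>x. H x \<partial>M) * e * u n\<bar>) \<longlonglongrightarrow> 0"
    using assms by (auto simp: good_def)
  have "AE z in M. \<forall>n. Th n (\<lambda>x. c * (F x * g (D n x)) + d * (H x * g (D n x))) z =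
      c * Th n (\<lambda>x. F x * g (D n x)) z + d * Th n (\<lambda>x. H x * g (D n x)) z"
    unfolding AE_all_countable using Fg_integrable F H by (intro allI Th_lincomb)
  with F1 H1 have "AE z in M. avg a (\<lambda>n. \<bar>Th n (\<lambda>x. (c * F x + d * H x) * g (D n x)) z
      - (\<integral>x. c * F x + d * H x \<partial>M) * e * u n\<bar>) \<longlonglongrightarrow> 0"
  proof eventually_elim
    fix z
    let ?f = "\<lambda>n. \<bar>Th n (\<lambda>x. F x * g (D n x)) z - (\<integral>x. F x \<partial>M) * e * u n\<bar>"
    let ?h = "\<lambda>n. \<bar>Th n (\<lambda>x. H x * g (D n x)) z - (\<integral>x. H x \<partial>M) * e * u n\<bar>"
    assume l1: "avg a ?f \<longlonglongrightarrow> 0" and l2: "avg a ?h \<longlonglongrightarrow> 0"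
      and eq: "\<forall>n. Th n (\<lambda>x. c * (F x * g (D n x)) + d * (H x * g (D n x))) z =
        c * Th n (\<lambda>x. F x * g (D n x)) z + d * Th n (\<lambda>x. H x * g (D n x)) z"
    show "avg a (\<lambda>n. \<bar>Th n (\<lambda>x. (c * F x + d * H x) * g (D n x)) z
      - (\<integral>x. c * F x + d * H x \<partial>M) * e * u n\<bar>) \<longlonglongrightarrow> 0"
    proof (rule avg_null[OF a_inf])
      fix \<epsilon> :: real assume "\<epsilon> > 0"
      have "\<bar>Th n (\<lambda>x. (c * F x + d * H x) * g (D n x)) z - (\<integral>x. c * F x + d * H x \<partial>M) * e * u n\<bar>
          \<le> \<bar>c\<bar> * ?f n + \<bar>d\<bar> * ?h n" for n
      proof -
        have "Th n (\<lambda>x. (c * F x + d * H x) * g (D n x)) z - (\<integral>x. c * F x + d * H x \<partial>M) * e * u n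
          = c * (Th n (\<lambda>x. F x * g (D n x)) z - (\<integral>x. F x \<partial>M) * e * u n)
            + d * (Th n (\<lambda>x. H x * g (D n x)) z - (\<integral>x. H x \<partial>M) * e * u n)"
          using eq[rule_format, of n] F H by (simp add: distrib_right mult.assoc right_diff_distrib)
        then show ?thesis by (simp only: abs_mult[symmetric] abs_triangle_ineq)
      qed
      moreover have "avg a (\<lambda>n. \<bar>c\<bar> * ?f n + \<bar>d\<bar> * ?h n) \<longlonglongrightarrow> \<bar>c\<bar> * 0 + \<bar>d\<bar> * 0"
        unfolding avg_add avg_cmult by (intro tendsto_intros l1 l2)
      ultimately show "\<exists>y l. (\<forall>\<^sub>F n in sequentially. \<bar>Th n (\<lambda>x. (c * F x + d * H x) * g (D n x)) z
          - (\<integral>x. c * F x + d * H x \<partial>M) * e * u n\<bar> \<le> y n) \<and> avg a y \<longlonglongrightarrow> l \<and> l \<le> \<epsilon>"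
        using \<open>\<epsilon> > 0\<close> by (intro exI conjI always_eventually allI) auto
    qed simp
  qed
  then show ?thesis using F H by (auto simp: good_def)
qed

text \<open>Because \<open>g\<close> is bounded by 1, replacing \<open>F\<close> by \<open>H\<close>
  changes the transfer images by at most \<open>Th n\<close> of \<open>\<bar>F - H\<bar>\<close>,
  whose averages converge to the L1 distance. A sequence of approximants keeps the exceptional sets
  countable in number.\<close>

lemma good_limit:
  assumes F: "integrable M F"
    and approx: "\<And>d. d > 0 \<Longrightarrow> \<exists>H. good g e H \<and> (\<integral>x. \<bar>F x - H x\<bar> \<partial>M) \<le> d"
  shows "good g e F"
proof -
  have "\<forall>i. \<exists>H. good g e H \<and> (\<integral>x. \<bar>F x - H x\<bar> \<partial>M) \<le> 1 / real (Suc i)"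
    by (intro allI approx) simp
  then obtain H where H: "\<And>i. good g e (H i)" and d: "\<And>i. (\<integral>x. \<bar>F x - H i x\<bar> \<partial>M) \<le> 1 / real (Suc i)"
    by metis
  have Hi: "integrable M (H i)" for i using H by (auto simp: good_def)
  have "AE z in M. \<forall>i. avg a (\<lambda>n. \<bar>Th n (\<lambda>x. H i x * g (D n x)) z - (\<integral>x. H i x \<partial>M) * e * u n\<bar>) \<longlonglongrightarrow> 0"
    unfolding AE_all_countable using H by (auto simp: good_def)
  moreover have "AE z in M. \<forall>i. avg a (\<lambda>n. Th n (\<lambda>x. \<bar>F x - H i x\<bar>) z) \<longlonglongrightarrow> (\<integral>x. \<bar>F x - H i x\<bar> \<partial>M)"
    unfolding AE_all_countable by (intro allI avg_Th[OF rs]) (use F Hi in auto)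
  moreover have "AE z in M. \<forall>i n. \<bar>Th n (\<lambda>x. F x * g (D n x) - H i x * g (D n x)) z\<bar> \<le> Th n (\<lambda>x. \<bar>F x - H i x\<bar>) z"
    unfolding AE_all_countable
  proof (intro allI Th_abs_le AE_I2)
    fix i n x
    have "\<bar>F x * g (D n x) - H i x * g (D n x)\<bar> = \<bar>F x - H i x\<bar> * \<bar>g (D n x)\<bar>"
      by (simp add: left_diff_distrib abs_mult[symmetric])
    also have "\<dots> \<le> \<bar>F x - H i x\<bar> * 1" by (intro mult_left_mono g_abs) auto
    finally show "\<bar>F x * g (D n x) - H i x * g (D n x)\<bar> \<le> \<bar>F x - H i x\<bar>" by simp
  qed (use F Hi in \<open>auto intro!: Fg_integrable\<close>)
  moreover have "AE z in M. \<forall>i n. Th n (\<lambda>x. F x * g (D n x) - H i x * g (D n x)) z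
      = Th n (\<lambda>x. F x * g (D n x)) z - Th n (\<lambda>x. H i x * g (D n x)) z"
    unfolding AE_all_countable by (intro allI Th_diff Fg_integrable F Hi)
  ultimately have "AE z in M. avg a (\<lambda>n. \<bar>Th n (\<lambda>x. F x * g (D n x)) z - (\<integral>x. F x \<partial>M) * e * u n\<bar>) \<longlonglongrightarrow> 0"
  proof eventually_elim
    fix z
    assume l1: "\<forall>i. avg a (\<lambda>n. \<bar>Th n (\<lambda>x. H i x * g (D n x)) z - (\<integral>x. H i x \<partial>M) * e * u n\<bar>) \<longlonglongrightarrow> 0"
      and l2: "\<forall>i. avg a (\<lambda>n. Th n (\<lambda>x. \<bar>F x - H i x\<bar>) z) \<longlonglongrightarrow> (\<integral>x. \<bar>F x - H i x\<bar> \<partial>M)"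
      and le: "\<forall>i n. \<bar>Th n (\<lambda>x. F x * g (D n x) - H i x * g (D n x)) z\<bar> \<le> Th n (\<lambda>x. \<bar>F x - H i x\<bar>) z"
      and eq: "\<forall>i n. Th n (\<lambda>x. F x * g (D n x) - H i x * g (D n x)) z
      = Th n (\<lambda>x. F x * g (D n x)) z - Th n (\<lambda>x. H i x * g (D n x)) z"
    show "avg a (\<lambda>n. \<bar>Th n (\<lambda>x. F x * g (D n x)) z - (\<integral>x. F x \<partial>M) * e * u n\<bar>) \<longlonglongrightarrow> 0"
    proof (rule avg_null[OF a_inf])
      fix \<epsilon> :: real assume "\<epsilon> > 0"
      \<comment> \<open>The total error is \<open>?d\<close> from the densities plus
        \<open>?d * e\<close> from the integrals, hence the factor \<open>1 + e\<close>.\<close>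
      then have "\<epsilon> / (1 + e) > 0" using e_nonneg by simp
      then obtain i :: nat where i: "1 / real (Suc i) < \<epsilon> / (1 + e)" by (rule nat_approx_posE)
      let ?d = "\<integral>x. \<bar>F x - H i x\<bar> \<partial>M"
      let ?y = "\<lambda>n. \<bar>Th n (\<lambda>x. H i x * g (D n x)) z - (\<integral>x. H i x \<partial>M) * e * u n\<bar>
        + Th n (\<lambda>x. \<bar>F x - H i x\<bar>) z + (?d * e) * u n"
      have int: "\<bar>(\<integral>x. H i x \<partial>M) - (\<integral>x. F x \<partial>M)\<bar> \<le> ?d"
        using integral_abs_bound[of M "\<lambda>x. F x - H i x"] F Hi[of i] by simp
      have "\<bar>Th n (\<lambda>x. F x * g (D n x)) z - (\<integral>x. F x \<partial>M) * e * u n\<bar> \<le> ?y n" if "n \<ge> 1" for n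
      proof -
        have "\<bar>((\<integral>x. H i x \<partial>M) - (\<integral>x. F x \<partial>M)) * (e * u n)\<bar> \<le> ?d * (e * u n)"
          unfolding abs_mult using int e_nonneg u_pos[OF that] by (intro mult_mono) auto
        then have "\<bar>(\<integral>x. H i x \<partial>M) * e * u n - (\<integral>x. F x \<partial>M) * e * u n\<bar> \<le> ?d * e * u n"
          by (simp add: left_diff_distrib mult.assoc)
        with le[rule_format, of n i] eq[rule_format, of n i] show ?thesis by linarith
      qed
      then have "\<forall>\<^sub>F n in sequentially. \<bar>Th n (\<lambda>x. F x * g (D n x)) z - (\<integral>x. F x \<partial>M) * e * u n\<bar> \<le> ?y n"
        unfolding eventually_sequentially by blast
      moreover have "avg a ?y \<longlonglongrightarrow> 0 + ?d + (?d * e) * 1"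
        unfolding avg_add avg_cmult by (intro tendsto_intros l1[rule_format] l2[rule_format] u_avg)
      moreover have "0 + ?d + (?d * e) * 1 \<le> \<epsilon>"
      proof -
        have "?d * (1 + e) \<le> \<epsilon> / (1 + e) * (1 + e)"
          using d[of i] i e_nonneg by (intro mult_right_mono) auto
        also have "\<dots> = \<epsilon>" using e_nonneg by simp
        finally show ?thesis by (simp add: distrib_left)
      qed
      ultimately show "\<exists>y l. (\<forall>\<^sub>F n in sequentially. \<bar>Th n (\<lambda>x. F x * g (D n x)) z - (\<integral>x. F x \<partial>M) * e * u n\<bar> \<le> y n)
        \<and> avg a y \<longlonglongrightarrow> l \<and> l \<le> \<epsilon>"
        by - (rule exI, rule exI, rule conjI, assumption, rule conjI, assumption+)
    qed simp
  qed
  then show ?thesis using F by (simp add: good_def)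
qed

lemma good_cong_AE:
  assumes H: "good g e H" and F: "integrable M F" and eq: "AE x in M. F x = H x"
  shows "good g e F"
proof (rule good_limit[OF F], intro exI conjI)
  have "(\<integral>x. \<bar>F x - H x\<bar> \<partial>M) = (\<integral>x. 0 \<partial>M)"
    by (rule integral_cong_AE) (use H F eq in \<open>auto simp: good_def\<close>)
  then show "(\<integral>x. \<bar>F x - H x\<bar> \<partial>M) \<le> d" if "d > 0" for d :: real using that by simp
qed (rule H)

text \<open>By duality, the weight \<open>g (D n (R x))\<close> at time \<open>Suc n\<close> for
  \<open>F\<close> becomes the weight \<open>g (D n x)\<close> at time \<open>n\<close> for
  \<open>Th 1 F\<close>. Replacing \<open>D (Suc n) x\<close> by \<open>D n (R x)\<close> costs an
  error relative to \<open>1 + D n (R x)\<close>, and \<open>osc\<close> asks exactly that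
  \<open>g\<close> be insensitive to such errors. The shift from \<open>u n\<close> to
  \<open>u (Suc n)\<close> is harmless because their ratio tends to 1.\<close>

lemma good_transfer:
  assumes osc: "\<And>\<epsilon>. \<epsilon> > 0 \<Longrightarrow> \<exists>d>0. \<forall>x y. 0 \<le> x \<longrightarrow> 0 \<le> y \<longrightarrow> \<bar>x - y\<bar> \<le> d * (1 + y) \<longrightarrow> \<bar>g x - g y\<bar> \<le> \<epsilon>"
    and F: "integrable M F" and H: "good g e (Th 1 F)"
  shows "good g e F"
proof -
  define G where "G n x = F x * g (D n (R x))" for n x
  have Gi: "integrable M (G n)" for n
    unfolding G_def by (rule integrable_bounded_mult[where B = 1]) (use F in \<open>auto simp: g_abs\<close>)
  let ?c = "(\<integral>x. F x \<partial>M) * e"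
  have "AE z in M. avg a (\<lambda>n. \<bar>Th n (\<lambda>x. Th 1 F x * g (D n x)) z - ?c * u n\<bar>) \<longlonglongrightarrow> 0"
    using H integral_Th[OF F, of 1] by (simp add: good_def)
  moreover have "AE z in M. avg a (\<lambda>n. Th n (Th 1 (\<lambda>x. \<bar>F x\<bar>)) z) \<longlonglongrightarrow> (\<integral>x. Th 1 (\<lambda>x. \<bar>F x\<bar>) x \<partial>M)"
    using F by (intro avg_Th[OF rs] Th_integrable) auto
  moreover have "AE z in M. \<forall>n. Th n (\<lambda>x. Th 1 F x * g (D n x)) z = Th (Suc n) (G n) z"
    unfolding AE_all_countable
  proof
    fix n
    have "AE x in M. Th 1 (G n) x = Th 1 F x * g (D n x)"
      using Th_mult_iter[OF F, of "\<lambda>x. g (D n x)" 1 1] g_abs by (simp add: G_def[abs_def])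
    then have "AE x in M. Th n (Th 1 (G n)) x = Th n (\<lambda>x. Th 1 F x * g (D n x)) x"
      using Gi F by (intro Th_cong_AE Fg_integrable Th_integrable) auto
    then show "AE z in M. Th n (\<lambda>x. Th 1 F x * g (D n x)) z = Th (Suc n) (G n) z"
      by (auto simp: funpow_swap1)
  qed
  moreover have "AE z in M. \<forall>n. Th (Suc n) (\<lambda>x. F x * g (D (Suc n) x) - G n x) z
      = Th (Suc n) (\<lambda>x. F x * g (D (Suc n) x)) z - Th (Suc n) (G n) z"
    unfolding AE_all_countable by (intro allI Th_diff Fg_integrable F Gi)
  moreover have "AE z in M. \<forall>i. \<forall>\<^sub>F n in sequentially.
      \<bar>Th (Suc n) (\<lambda>x. F x * g (D (Suc n) x) - G n x) z\<bar> \<le> 1 / real (Suc i) * Th n (Th 1 (\<lambda>x. \<bar>F x\<bar>)) z"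
    unfolding AE_all_countable
  proof
    fix i
    obtain d where d: "d > 0" "\<And>x y. 0 \<le> x \<Longrightarrow> 0 \<le> y \<Longrightarrow> \<bar>x - y\<bar> \<le> d * (1 + y) \<Longrightarrow> \<bar>g x - g y\<bar> \<le> 1 / real (Suc i)"
      using osc[of "1 / real (Suc i)"] by auto
    obtain n0 where n0: "\<And>n. n \<ge> n0 \<Longrightarrow> AE x in M. \<bar>D (Suc n) x - D n (R x)\<bar> \<le> d * (1 + D n (R x))"
      using D_shift[OF d(1)] by (auto simp: eventually_sequentially)
    have "AE z in M. \<forall>n. n \<ge> n0 \<longrightarrow> \<bar>Th (Suc n) (\<lambda>x. F x * g (D (Suc n) x) - G n x) z\<bar> \<le> 1 / real (Suc i) * Th n (Th 1 (\<lambda>x. \<bar>F x\<bar>)) z"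
      unfolding AE_all_countable
    proof
      fix n
      show "AE z in M. n \<ge> n0 \<longrightarrow> \<bar>Th (Suc n) (\<lambda>x. F x * g (D (Suc n) x) - G n x) z\<bar> \<le> 1 / real (Suc i) * Th n (Th 1 (\<lambda>x. \<bar>F x\<bar>)) z"
      proof (cases "n \<ge> n0")
        case True
        have "AE z in M. \<bar>Th (Suc n) (\<lambda>x. F x * g (D (Suc n) x) - G n x) z\<bar> \<le> Th (Suc n) (\<lambda>x. 1 / real (Suc i) * \<bar>F x\<bar>) z"
        proof (rule Th_abs_le)
          show "AE x in M. \<bar>F x * g (D (Suc n) x) - G n x\<bar> \<le> 1 / real (Suc i) * \<bar>F x\<bar>"
            using n0[OF True]
          proof eventually_elim
            fix x assume "\<bar>D (Suc n) x - D n (R x)\<bar> \<le> d * (1 + D n (R x))"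
            then have "\<bar>g (D (Suc n) x) - g (D n (R x))\<bar> \<le> 1 / real (Suc i)" by (intro d(2) D_nonneg)
            then have "\<bar>F x\<bar> * \<bar>g (D (Suc n) x) - g (D n (R x))\<bar> \<le> \<bar>F x\<bar> * (1 / real (Suc i))" by (intro mult_left_mono) auto
            then show "\<bar>F x * g (D (Suc n) x) - G n x\<bar> \<le> 1 / real (Suc i) * \<bar>F x\<bar>"
              by (simp only: G_def abs_mult[symmetric] right_diff_distrib mult.commute)
          qed
        qed (use F Gi in \<open>auto intro!: Fg_integrable\<close>)
        moreover have "AE z in M. Th (Suc n) (\<lambda>x. 1 / real (Suc i) * \<bar>F x\<bar>) z = 1 / real (Suc i) * Th (Suc n) (\<lambda>x. \<bar>F x\<bar>) z"
          using F by (intro Th_cmult) auto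
        ultimately show ?thesis by eventually_elim (simp add: funpow_swap1)
      qed simp
    qed
    then show "AE z in M. \<forall>\<^sub>F n in sequentially.
      \<bar>Th (Suc n) (\<lambda>x. F x * g (D (Suc n) x) - G n x) z\<bar> \<le> 1 / real (Suc i) * Th n (Th 1 (\<lambda>x. \<bar>F x\<bar>)) z"
      by eventually_elim (auto simp: eventually_sequentially)
  qed
  ultimately have "AE z in M. avg a (\<lambda>n. \<bar>Th n (\<lambda>x. F x * g (D n x)) z - ?c * u n\<bar>) \<longlonglongrightarrow> 0"
  proof eventually_elim
    fix z
    let ?x = "\<lambda>n. \<bar>Th n (\<lambda>x. F x * g (D n x)) z - ?c * u n\<bar>"
    let ?y = "\<lambda>n. \<bar>Th n (\<lambda>x. Th 1 F x * g (D n x)) z - ?c * u n\<bar>"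
    let ?F = "\<integral>x. Th 1 (\<lambda>x. \<bar>F x\<bar>) x \<partial>M"
    assume l1: "avg a ?y \<longlonglongrightarrow> 0"
      and l2: "avg a (\<lambda>n. Th n (Th 1 (\<lambda>x. \<bar>F x\<bar>)) z) \<longlonglongrightarrow> ?F"
      and eq1: "\<forall>n. Th n (\<lambda>x. Th 1 F x * g (D n x)) z = Th (Suc n) (G n) z"
      and eq2: "\<forall>n. Th (Suc n) (\<lambda>x. F x * g (D (Suc n) x) - G n x) z
      = Th (Suc n) (\<lambda>x. F x * g (D (Suc n) x)) z - Th (Suc n) (G n) z"
      and le: "\<forall>i. \<forall>\<^sub>F n in sequentially.
      \<bar>Th (Suc n) (\<lambda>x. F x * g (D (Suc n) x) - G n x) z\<bar> \<le> 1 / real (Suc i) * Th n (Th 1 (\<lambda>x. \<bar>F x\<bar>)) z"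
    have "avg a (\<lambda>n. ?x (Suc n)) \<longlonglongrightarrow> 0"
    proof (rule avg_null[OF a_inf])
      fix \<epsilon> :: real assume eps: "\<epsilon> > 0"
      \<comment> \<open>The factor of \<open>1 / Suc i\<close> in the total error: \<open>?F\<close>
        from the change of weights and \<open>\<bar>?c\<bar>\<close> from the change of
        \<open>u\<close>.\<close>
      define K where "K = ?F + \<bar>?c\<bar>"
      have F0: "?F \<ge> 0" using F by (subst integral_Th) auto
      have "\<epsilon> / (K + 1) > 0" using eps F0 by (simp add: K_def add_nonneg_pos)
      then obtain i :: nat where i: "1 / real (Suc i) < \<epsilon> / (K + 1)" by (rule nat_approx_posE)
      let ?i = "1 / real (Suc i)"
      have "\<forall>\<^sub>F n in sequentially. \<bar>u (Suc n) / u n - 1\<bar> < ?i"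
        using tendstoD[OF u_shift, of ?i] by (simp add: dist_real_def)
      with le[rule_format, of i] eventually_ge_at_top[of 1]
      have "\<forall>\<^sub>F n in sequentially. ?x (Suc n) \<le> ?y n + ?i * Th n (Th 1 (\<lambda>x. \<bar>F x\<bar>)) z + (\<bar>?c\<bar> * ?i) * u n"
      proof eventually_elim
        fix n assume 1: "\<bar>Th (Suc n) (\<lambda>x. F x * g (D (Suc n) x) - G n x) z\<bar> \<le> ?i * Th n (Th 1 (\<lambda>x. \<bar>F x\<bar>)) z"
          and n: "1 \<le> n" and 2: "\<bar>u (Suc n) / u n - 1\<bar> < ?i"
        have un: "0 < u n" using u_pos n by auto
        have "u (Suc n) / u n - 1 = (u (Suc n) - u n) / u n" using un by (simp add: field_simps)
        then have "\<bar>u (Suc n) - u n\<bar> < ?i * u n" using 2 un by (simp add: abs_divide pos_divide_less_eq)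
        then have "\<bar>?c\<bar> * \<bar>u (Suc n) - u n\<bar> \<le> \<bar>?c\<bar> * (?i * u n)" by (intro mult_left_mono) auto
        then have "\<bar>?c * u (Suc n) - ?c * u n\<bar> \<le> \<bar>?c\<bar> * ?i * u n"
          by (simp only: abs_mult[symmetric] right_diff_distrib mult.assoc)
        then show "?x (Suc n) \<le> ?y n + ?i * Th n (Th 1 (\<lambda>x. \<bar>F x\<bar>)) z + (\<bar>?c\<bar> * ?i) * u n"
          using 1 eq1[rule_format, of n] eq2[rule_format, of n] by linarith
      qed
      moreover have "avg a (\<lambda>n. ?y n + ?i * Th n (Th 1 (\<lambda>x. \<bar>F x\<bar>)) z + (\<bar>?c\<bar> * ?i) * u n) \<longlonglongrightarrow> 0 + ?i * ?F + (\<bar>?c\<bar> * ?i) * 1"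
        unfolding avg_add avg_cmult by (intro tendsto_intros l1 l2 u_avg)
      moreover have "0 + ?i * ?F + (\<bar>?c\<bar> * ?i) * 1 \<le> \<epsilon>"
      proof -
        have "?i * K \<le> \<epsilon> / (K + 1) * (K + 1)"
          using i F0 eps by (intro mult_mono) (auto simp: K_def)
        also have "\<dots> = \<epsilon>" using F0 by (auto simp: K_def)
        finally show ?thesis by (simp add: K_def distrib_left mult.commute)
      qed
      ultimately show "\<exists>y l. (\<forall>\<^sub>F n in sequentially. ?x (Suc n) \<le> y n) \<and> avg a y \<longlonglongrightarrow> l \<and> l \<le> \<epsilon>"
        by - (rule exI, rule exI, rule conjI, assumption, rule conjI, assumption+)
    qed simp
    then show "avg a ?x \<longlonglongrightarrow> 0" by (rule avg_null_shift[OF a_inf abs_ge_zero])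
  qed
  then show ?thesis using F by (simp add: good_def)
qed

lemma good_transfer_iter:
  assumes osc: "\<And>\<epsilon>. \<epsilon> > 0 \<Longrightarrow> \<exists>d>0. \<forall>x y. 0 \<le> x \<longrightarrow> 0 \<le> y \<longrightarrow> \<bar>x - y\<bar> \<le> d * (1 + y) \<longrightarrow> \<bar>g x - g y\<bar> \<le> \<epsilon>"
    and F: "integrable M F" and H: "good g e (Th j F)"
  shows "good g e F"
  using H
proof (induction j)
  case (Suc j)
  then have "good g e (Th 1 (Th j F))" by simp
  then show ?case by (intro Suc.IH good_transfer[OF osc Th_integrable[OF F]])
qed simp

text \<open>
  Lower bounds for \<open>g\<close> and for \<open>1 - g\<close> leave no room, because the averages for the
  constant function \<open>1\<close> converge.
\<close>

lemma good_if_lower_bounds: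
  assumes F: "integrable M F"
    and lb: "AE z in M. \<forall>\<epsilon>>0. \<forall>\<^sub>F n in sequentially.
      ((\<integral>x. F x \<partial>M) * e - \<epsilon>) * u n \<le> Th n (\<lambda>x. F x * g (D n x)) z"
    and lb': "AE z in M. \<forall>\<epsilon>>0. \<forall>\<^sub>F n in sequentially.
      ((\<integral>x. F x \<partial>M) * (1 - e) - \<epsilon>) * u n \<le> Th n (\<lambda>x. F x * (1 - g (D n x))) z"
  shows "good g e F"
proof -
  have Fi: "integrable M (\<lambda>x. F x * (1 - g (D n x)))" for n
    using F Fg_integrable[OF F, of n] by (simp add: right_diff_distrib)
  have "AE z in M. \<forall>n. Th n (\<lambda>x. F x * g (D n x) + F x * (1 - g (D n x))) z
      = Th n (\<lambda>x. F x * g (D n x)) z + Th n (\<lambda>x. F x * (1 - g (D n x))) z"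
    unfolding AE_all_countable by (intro allI Th_add Fg_integrable F Fi)
  with lb lb' avg_Th[OF rs F]
  have "AE z in M. avg a (\<lambda>n. \<bar>Th n (\<lambda>x. F x * g (D n x)) z - (\<integral>x. F x \<partial>M) * e * u n\<bar>) \<longlonglongrightarrow> 0"
  proof eventually_elim
    fix z
    let ?m = "\<integral>x. F x \<partial>M"
    let ?v = "\<lambda>n. Th n (\<lambda>x. F x * g (D n x)) z" and ?w = "\<lambda>n. Th n (\<lambda>x. F x * (1 - g (D n x))) z"
    assume 1: "\<forall>\<epsilon>>0. \<forall>\<^sub>F n in sequentially. (?m * e - \<epsilon>) * u n \<le> ?v n"
      and 2: "\<forall>\<epsilon>>0. \<forall>\<^sub>F n in sequentially. (?m * (1 - e) - \<epsilon>) * u n \<le> ?w n"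
      and l: "avg a (\<lambda>n. Th n F z) \<longlonglongrightarrow> ?m"
      and eq: "\<forall>n. Th n (\<lambda>x. F x * g (D n x) + F x * (1 - g (D n x))) z = ?v n + ?w n"
    have eq': "Th n F z = ?v n + ?w n" for n
      using eq[rule_format, of n] by (simp add: right_diff_distrib)
    show "avg a (\<lambda>n. \<bar>?v n - ?m * e * u n\<bar>) \<longlonglongrightarrow> 0"
    proof (rule avg_null[OF a_inf])
      fix \<epsilon> :: real assume "\<epsilon> > 0"
      \<comment> \<open>One third bounds the upper deviation of \<open>?v n\<close> through the
        lower bound for \<open>?w n\<close>. The lower deviation uses all three: one directly, two
        because \<open>Th n F z - ?m * u n\<close> may itself be as small as minus two thirds of
        \<open>\<epsilon> * u n\<close>.\<close>
      then have e3: "\<epsilon> / 3 > 0" by simp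
      from 1[rule_format, OF e3] 2[rule_format, OF e3] eventually_ge_at_top[of 1]
      have "\<forall>\<^sub>F n in sequentially. \<bar>?v n - ?m * e * u n\<bar> \<le> Th n F z - ?m * u n + \<epsilon> * u n"
      proof eventually_elim
        fix n assume "(?m * e - \<epsilon> / 3) * u n \<le> ?v n" "(?m * (1 - e) - \<epsilon> / 3) * u n \<le> ?w n" "1 \<le> n"
        moreover have "0 < \<epsilon> * u n" using u_pos[OF \<open>1 \<le> n\<close>] \<open>\<epsilon> > 0\<close> by simp
        ultimately show "\<bar>?v n - ?m * e * u n\<bar> \<le> Th n F z - ?m * u n + \<epsilon> * u n"
          unfolding eq' by (simp add: left_diff_distrib right_diff_distrib)
      qed
      moreover have "avg a (\<lambda>n. Th n F z - ?m * u n + \<epsilon> * u n) \<longlonglongrightarrow> ?m - ?m * 1 + \<epsilon> * 1"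
        unfolding avg_add avg_diff avg_cmult by (intro tendsto_intros l u_avg)
      ultimately show "\<exists>y l. (\<forall>\<^sub>F n in sequentially. \<bar>?v n - ?m * e * u n\<bar> \<le> y n) \<and> avg a y \<longlonglongrightarrow> l \<and> l \<le> \<epsilon>"
        by - (rule exI, rule exI, rule conjI, assumption, rule conjI, assumption, simp)
    qed simp
  qed
  then show ?thesis using F by (simp add: good_def)
qed

end

end

section \<open>Regular variation\<close>

text \<open>
  \<open>b\<close> is the reciprocal of the tail of the roof function, up to a constant; this choice makes it monotone.
\<close>

locale monotone_rv =
  fixes \<gamma> :: real and b :: "real \<Rightarrow> real" and binv :: "real \<Rightarrow> real"
  assumes gamma: "0 < \<gamma>"
    and b_pos: "\<And>x. 0 < b x" and b_mono: "mono b" and b_inf: "filterlim b at_top at_top"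
    and b_rv: "\<And>c. 0 < c \<Longrightarrow> ((\<lambda>x. b (c * x) / b x) \<longlongrightarrow> c powr \<gamma>) at_top"
    and b_binv: "((\<lambda>x. b (binv x) / x) \<longlongrightarrow> 1) at_top"
    and binv_inf: "filterlim binv at_top at_top"
begin

section \<open>Ratios of \<open>b\<close> and of its asymptotic inverse\<close>

lemma powr_close:
  assumes "0 < c" "0 < \<epsilon>"
  obtains d where "0 < d" "d < c" "(c + d) powr \<gamma> < c powr \<gamma> + \<epsilon>" "c powr \<gamma> - \<epsilon> < (c - d) powr \<gamma>"
proof -
  have "((\<lambda>x. x powr \<gamma>) \<longlongrightarrow> c powr \<gamma>) (at c)"
    using assms by (intro tendsto_intros) auto
  from tendstoD[OF this assms(2)]
  obtain s where s: "s > 0" "\<And>x. x \<noteq> c \<Longrightarrow> dist x c < s \<Longrightarrow> dist (x powr \<gamma>) (c powr \<gamma>) < \<epsilon>"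
    unfolding eventually_at by auto
  define d where "d = min (s/2) (c/2)"
  show ?thesis
  proof (rule that[of d])
    show "0 < d" "d < c" using s assms by (auto simp: d_def)
    have "dist (c + d) c < s" "dist (c - d) c < s" using s assms by (auto simp: d_def dist_real_def)
    then have "dist ((c + d) powr \<gamma>) (c powr \<gamma>) < \<epsilon>" "dist ((c - d) powr \<gamma>) (c powr \<gamma>) < \<epsilon>"
      using s \<open>0 < d\<close> by auto
    then show "(c + d) powr \<gamma> < c powr \<gamma> + \<epsilon>" "c powr \<gamma> - \<epsilon> < (c - d) powr \<gamma>"
      by (auto simp: dist_real_def abs_less_iff)
  qed
qed

text \<open>Monotonicity replaces the uniform convergence theorem: \<open>y n\<close> eventually
  lies between \<open>(c - d) * x n\<close> and \<open>(c + d) * x n\<close>, where the ratios have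
  fixed limits.\<close>

lemma b_ratio:
  assumes x: "filterlim x at_top F" and yx: "((\<lambda>n. y n / x n) \<longlongrightarrow> c) F" and c: "0 < c"
  shows "((\<lambda>n. b (y n) / b (x n)) \<longlongrightarrow> c powr \<gamma>) F"
proof (rule tendstoI)
  fix \<epsilon> :: real assume "\<epsilon> > 0"
  then obtain d where d: "0 < d" "d < c" "(c + d) powr \<gamma> < c powr \<gamma> + \<epsilon>" "c powr \<gamma> - \<epsilon> < (c - d) powr \<gamma>"
    using powr_close[OF c] by metis
  have "((\<lambda>n. b ((c + d) * x n) / b (x n)) \<longlongrightarrow> (c + d) powr \<gamma>) F"
    "((\<lambda>n. b ((c - d) * x n) / b (x n)) \<longlongrightarrow> (c - d) powr \<gamma>) F"
    using filterlim_compose[OF b_rv x] c d by auto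
  then have "\<forall>\<^sub>F n in F. b ((c + d) * x n) / b (x n) < c powr \<gamma> + \<epsilon>"
    "\<forall>\<^sub>F n in F. c powr \<gamma> - \<epsilon> < b ((c - d) * x n) / b (x n)"
    using d by (auto dest: order_tendstoD)
  moreover have "\<forall>\<^sub>F n in F. y n / x n < c + d" "\<forall>\<^sub>F n in F. c - d < y n / x n"
    by (rule order_tendstoD(2)[OF yx], use d in simp) (rule order_tendstoD(1)[OF yx], use d in simp)
  moreover have "\<forall>\<^sub>F n in F. 0 < x n"
    using x by (rule filterlim_at_top_dense[THEN iffD1, rule_format])
  ultimately show "\<forall>\<^sub>F n in F. dist (b (y n) / b (x n)) (c powr \<gamma>) < \<epsilon>"
  proof eventually_elim
    fix n
    assume 1: "b ((c + d) * x n) / b (x n) < c powr \<gamma> + \<epsilon>" "c powr \<gamma> - \<epsilon> < b ((c - d) * x n) / b (x n)"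
      and "y n / x n < c + d" "c - d < y n / x n" "0 < x n"
    then have "y n \<le> (c + d) * x n" "(c - d) * x n \<le> y n" by (auto simp: field_simps)
    then have "b (y n) / b (x n) \<le> b ((c + d) * x n) / b (x n)" "b ((c - d) * x n) / b (x n) \<le> b (y n) / b (x n)"
      using b_mono b_pos[of "x n"] by (auto intro!: divide_right_mono simp: mono_def)
    then show "dist (b (y n) / b (x n)) (c powr \<gamma>) < \<epsilon>" using 1 by (auto simp: dist_real_def abs_less_iff)
  qed
qed

text \<open>As \<open>binv\<close> need not be monotone, the comparison is made after applying
  \<open>b\<close>. If \<open>binv (k n) / x n\<close> exceeded some \<open>c' > c\<close>, then
  \<open>b (binv (k n))\<close> would be at least \<open>b (c' * x n)\<close>, about
  \<open>c' powr \<gamma> * b (x n)\<close>, whereas it is asymptotic to \<open>l * b (x n)\<close>;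
  similarly from below.\<close>

lemma binv_ratio:
  assumes x: "filterlim x at_top F" and k: "((\<lambda>n. k n / b (x n)) \<longlongrightarrow> l) F" and l: "0 < l"
  shows "((\<lambda>n. binv (k n) / x n) \<longlongrightarrow> l powr (1 / \<gamma>)) F"
proof -
  have bx: "filterlim (\<lambda>n. b (x n)) at_top F" by (rule filterlim_compose[OF b_inf x])
  have kinf: "filterlim k at_top F"
  proof -
    have "filterlim (\<lambda>n. (k n / b (x n)) * b (x n)) at_top F"
      by (rule filterlim_tendsto_pos_mult_at_top[OF k l bx])
    then show ?thesis using b_pos by (simp add: order_less_imp_not_eq2)
  qed
  have "((\<lambda>n. b (binv (k n)) / k n * (k n / b (x n))) \<longlongrightarrow> 1 * l) F"
    by (intro tendsto_mult k filterlim_compose[OF b_binv kinf])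
  moreover have "\<forall>\<^sub>F n in F. k n \<noteq> 0"
    using filterlim_at_top_dense[THEN iffD1, rule_format, OF kinf, of 0] by (rule eventually_mono) auto
  ultimately have lim: "((\<lambda>n. b (binv (k n)) / b (x n)) \<longlongrightarrow> l) F"
    by (subst (asm) filterlim_cong[OF refl refl, where g = "\<lambda>n. b (binv (k n)) / b (x n)"]) (auto elim: eventually_mono)
  define c where "c = l powr (1 / \<gamma>)"
  have c: "0 < c" "c powr \<gamma> = l" using l gamma by (auto simp: c_def powr_powr)
  have pos: "\<forall>\<^sub>F n in F. 0 < x n" using x by (rule filterlim_at_top_dense[THEN iffD1, rule_format])
  have scale: "((\<lambda>n. b (c' * x n) / b (x n)) \<longlongrightarrow> c' powr \<gamma>) F" if "c' > 0" for c'
    using filterlim_compose[OF b_rv[OF that] x] .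
  have up: "\<forall>\<^sub>F n in F. binv (k n) / x n < c'" if "c < c'" for c'
  proof -
    have "c powr \<gamma> < c' powr \<gamma>" using c that gamma by (intro powr_less_mono2) auto
    \<comment> \<open>A strict gap is needed to invert the monotone \<open>b\<close>: the order of
      two arguments follows only from a strict inequality of their values.\<close>
    then obtain q where q: "l < q" "q < c' powr \<gamma>" using c(2) dense by metis
    have "\<forall>\<^sub>F n in F. q < b (c' * x n) / b (x n)" "\<forall>\<^sub>F n in F. b (binv (k n)) / b (x n) < q"
      using order_tendstoD[OF scale[of c']] order_tendstoD[OF lim] c that q by auto
    then show ?thesis using pos
    proof eventually_elim
      fix n assume "q < b (c' * x n) / b (x n)" "b (binv (k n)) / b (x n) < q" "0 < x n"
      then have "b (binv (k n)) < b (c' * x n)" using b_pos[of "x n"] by (simp add: field_simps)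
      then have "binv (k n) < c' * x n" using b_mono by (meson linorder_not_le mono_def)
      then show "binv (k n) / x n < c'" using \<open>0 < x n\<close> by (simp add: field_simps)
    qed
  qed
  have low: "\<forall>\<^sub>F n in F. c' < binv (k n) / x n" if "c' < c" "0 < c'" for c'
  proof -
    have "c' powr \<gamma> < c powr \<gamma>" using c that gamma by (intro powr_less_mono2) auto
    then obtain q where q: "q < l" "c' powr \<gamma> < q" using c(2) dense by metis
    have "\<forall>\<^sub>F n in F. b (c' * x n) / b (x n) < q" "\<forall>\<^sub>F n in F. q < b (binv (k n)) / b (x n)"
      using order_tendstoD[OF scale[of c']] order_tendstoD[OF lim] c that q by auto
    then show ?thesis using pos
    proof eventually_elim
      fix n assume "b (c' * x n) / b (x n) < q" "q < b (binv (k n)) / b (x n)" "0 < x n"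
      then have "b (c' * x n) < b (binv (k n))" using b_pos[of "x n"] by (simp add: field_simps)
      then have "c' * x n < binv (k n)" using b_mono by (meson linorder_not_le mono_def)
      then show "c' < binv (k n) / x n" using \<open>0 < x n\<close> by (simp add: field_simps)
    qed
  qed
  have "((\<lambda>n. binv (k n) / x n) \<longlongrightarrow> c) F"
  proof (rule order_tendstoI)
    fix c' assume "c < c'" then show "\<forall>\<^sub>F n in F. binv (k n) / x n < c'" by (rule up)
  next
    fix c' assume "c' < c"
    then have "max c' (c/2) < c" "0 < max c' (c/2)" using c by auto
    then have "\<forall>\<^sub>F n in F. max c' (c/2) < binv (k n) / x n" by (rule low)
    then show "\<forall>\<^sub>F n in F. c' < binv (k n) / x n" by (rule eventually_mono) auto
  qed
  then show ?thesis by (simp add: c_def)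
qed

end


section \<open>Fatou's lemma for sums over occupation numbers\<close>

text \<open>The integrand is the step function with value \<open>w k\<close> on an interval of
  length \<open>1 / c\<close>; this turns sums over \<open>k\<close> into integrals over the
  rescaled variable \<open>l = k / c\<close>.\<close>

lemma nn_integral_step:
  fixes w :: "nat \<Rightarrow> ennreal"
  assumes "0 < c"
  shows "(\<integral>\<^sup>+l. indicator {0..} l * w (nat \<lfloor>l * c\<rfloor>) \<partial>lborel) = ennreal (1 / c) * (\<Sum>k. w k)"
proof -
  have *: "indicator {0..} l * w (nat \<lfloor>l * c\<rfloor>) = (\<Sum>k. w k * indicator {real k / c..<real (Suc k) / c} l)" for l
  proof (cases "l \<ge> 0")
    case True
    let ?k = "nat \<lfloor>l * c\<rfloor>"
    have "l * c \<ge> 0" using True assms by simp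
    then have kk: "real ?k \<le> l * c" "l * c < real (Suc ?k)" by linarith+
    have iff: "l \<in> {real k / c..<real (Suc k) / c} \<longleftrightarrow> k = ?k" for k
    proof -
      have "l \<in> {real k / c..<real (Suc k) / c} \<longleftrightarrow> real k \<le> l * c \<and> l * c < real (Suc k)"
        using assms by (simp add: field_simps)
      also have "\<dots> \<longleftrightarrow> \<lfloor>l * c\<rfloor> = int k" by (simp add: floor_eq_iff add.commute)
      also have "\<dots> \<longleftrightarrow> k = ?k" using \<open>l * c \<ge> 0\<close> by auto
      finally show ?thesis .
    qed
    have "(\<Sum>k. w k * indicator {real k / c..<real (Suc k) / c} l) = (\<Sum>k\<in>{?k}. w k * indicator {real k / c..<real (Suc k) / c} l)"
      by (rule suminf_finite) (use iff in \<open>auto simp: indicator_def\<close>)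
    also have "\<dots> = w ?k" using iff[of ?k] by (simp add: indicator_def)
    finally show ?thesis using True by simp
  next
    case False
    then have "l < real k / c" for k using divide_nonneg_pos[OF of_nat_0_le_iff assms, of k] by linarith
    then have "w k * indicator {real k / c..<real (Suc k) / c} l = 0" for k
      by (simp add: indicator_def not_le)
    then have "(\<Sum>k. w k * indicator {real k / c..<real (Suc k) / c} l) = 0" by (simp only: suminf_zero)
    then show ?thesis using False by simp
  qed
  have "(\<integral>\<^sup>+l. indicator {0..} l * w (nat \<lfloor>l * c\<rfloor>) \<partial>lborel)
      = (\<Sum>k. \<integral>\<^sup>+l. w k * indicator {real k / c..<real (Suc k) / c} l \<partial>lborel)"
    unfolding * by (rule nn_integral_suminf) simp
  also have "\<dots> = (\<Sum>k. ennreal (1 / c) * w k)"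
  proof (intro suminf_cong)
    fix k
    have "real (Suc k) / c - real k / c = 1 / c" using assms by (simp add: field_simps)
    moreover have "real k / c \<le> real (Suc k) / c" using assms by (simp add: field_simps)
    ultimately show "(\<integral>\<^sup>+l. w k * indicator {real k / c..<real (Suc k) / c} l \<partial>lborel) = ennreal (1 / c) * w k"
      by (simp add: nn_integral_cmult_indicator mult.commute)
  qed
  finally show ?thesis by simp
qed

lemma suminf_blocks:
  fixes w :: "nat \<Rightarrow> ennreal"
  assumes "0 < L"
  shows "(\<Sum>j. \<Sum>i<L. w (L * j + i)) = (\<Sum>k. w k)"
proof -
  have "(\<lambda>j. \<Sum>i\<in>{j * L..<j * L + L}. w i) sums (\<Sum>k. w k)"
    by (rule sums_group[OF _ assms]) auto
  moreover have "(\<Sum>i\<in>{j * L..<j * L + L}. w i) = (\<Sum>i<L. w (L * j + i))" for j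
    by (rule sum.reindex_bij_witness[of _ "\<lambda>i. L * j + i" "\<lambda>i. i - L * j"]) (auto simp: mult.commute)
  ultimately show ?thesis by (simp add: sums_iff)
qed

text \<open>
  The averages over blocks of length \<open>L\<close> take care of the periodic case, where the single terms oscillate.
\<close>

lemma sum_fatou:
  fixes q :: "nat \<Rightarrow> nat \<Rightarrow> real" and B :: "nat \<Rightarrow> real" and \<phi> :: "real \<Rightarrow> real"
  assumes L: "0 < L" and B: "\<And>n. n \<ge> 1 \<Longrightarrow> 0 < B n" and q: "\<And>n k. 0 \<le> q n k"
    and \<phi>: "\<phi> \<in> borel_measurable borel"
    and lim: "\<And>l \<epsilon>. 0 < l \<Longrightarrow> 0 < \<epsilon> \<Longrightarrow> \<forall>\<^sub>F n in sequentially.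
       \<phi> l - \<epsilon> \<le> B n / L * (\<Sum>i<L. q n (L * nat \<lfloor>l * (B n / L)\<rfloor> + i))"
    and c: "c < (\<integral>\<^sup>+l. indicator {0<..} l * ennreal (\<phi> l) \<partial>lborel)"
  shows "\<forall>\<^sub>F n in sequentially. c < (\<Sum>k. ennreal (q n k))"
proof -
  note [measurable] = \<phi>
  \<comment> \<open>A step function of \<open>l\<close> whose integral will be the complete sum over
    \<open>k\<close>; Fatou's lemma is applied in the variable \<open>l\<close>.\<close>
  define Q where "Q n l = ennreal (B n / L * (\<Sum>i<L. q n (L * nat \<lfloor>l * (B n / L)\<rfloor> + i)))" for n l
  have [measurable]: "Q n \<in> borel_measurable borel" for n unfolding Q_def by measurable
  have int: "(\<integral>\<^sup>+l. indicator {0..} l * Q n l \<partial>lborel) = (\<Sum>k. ennreal (q n k))" if "n \<ge> 1" for n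
  proof -
    have p: "0 < B n / L" using B[OF that] L by simp
    have "(\<integral>\<^sup>+l. indicator {0..} l * Q n l \<partial>lborel)
        = (\<integral>\<^sup>+l. indicator {0..} l * (\<lambda>j. ennreal (B n / L) * (\<Sum>i<L. ennreal (q n (L * j + i)))) (nat \<lfloor>l * (B n / L)\<rfloor>) \<partial>lborel)"
    proof (intro nn_integral_cong arg_cong2[where f = "(*)"] refl)
      fix l
      show "Q n l = (\<lambda>j. ennreal (B n / L) * (\<Sum>i<L. ennreal (q n (L * j + i)))) (nat \<lfloor>l * (B n / L)\<rfloor>)"
        unfolding Q_def using p q by (subst ennreal_mult) (auto simp: sum_nonneg sum_ennreal less_imp_le)
    qed
    also have "\<dots> = ennreal (1 / (B n / L)) * (ennreal (B n / L) * (\<Sum>j. \<Sum>i<L. ennreal (q n (L * j + i))))"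
      by (subst nn_integral_step[OF p]) simp
    also have "\<dots> = (\<Sum>k. ennreal (q n k))"
      proof -
      have "1 / (B n / L) * (B n / L) = 1" using p by (metis divide_self_if less_irrefl mult.commute times_divide_eq_right mult_1_right)
      then have "ennreal (1 / (B n / L)) * ennreal (B n / L) = 1" using p L B[OF that] by (subst ennreal_mult[symmetric]) auto
      then show ?thesis
        unfolding suminf_blocks[OF L, of "\<lambda>k. ennreal (q n k)"] by (subst mult.assoc[symmetric]) simp
    qed
    finally show ?thesis .
  qed
  have "c < (\<integral>\<^sup>+l. liminf (\<lambda>n. indicator {0..} l * Q n l) \<partial>lborel)"
  proof (rule less_le_trans[OF c], rule nn_integral_mono)
    fix l :: real
    show "indicator {0<..} l * ennreal (\<phi> l) \<le> liminf (\<lambda>n. indicator {0..} l * Q n l)"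
    proof (cases "0 < l")
      case True
      have "ennreal (\<phi> l) \<le> liminf (\<lambda>n. Q n l)"
      proof (rule ennreal_le_epsilon)
        fix e :: real assume "0 < e"
        have "ennreal (\<phi> l - e) \<le> liminf (\<lambda>n. Q n l)"
        proof (rule Liminf_bounded)
          show "\<forall>\<^sub>F n in sequentially. ennreal (\<phi> l - e) \<le> Q n l"
            using lim[OF True \<open>0 < e\<close>] by (rule eventually_mono) (simp add: Q_def ennreal_leI)
        qed
        moreover have "ennreal (\<phi> l) \<le> ennreal (\<phi> l - e) + ennreal e"
          using \<open>0 < e\<close> by (cases "\<phi> l - e \<ge> 0") (auto simp: ennreal_plus[symmetric] ennreal_leI not_le ennreal_neg simp del: ennreal_plus)
        ultimately show "ennreal (\<phi> l) \<le> liminf (\<lambda>n. Q n l) + ennreal e"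
          by (meson add_right_mono order_trans)
      qed
      then show ?thesis using True by simp
    qed simp
  qed
  also have "\<dots> \<le> liminf (\<lambda>n. \<integral>\<^sup>+l. indicator {0..} l * Q n l \<partial>lborel)"
    by (rule nn_integral_liminf) simp
  finally have "\<forall>\<^sub>F n in sequentially. c < (\<integral>\<^sup>+l. indicator {0..} l * Q n l \<partial>lborel)"
    by (simp add: less_LiminfD)
  then show ?thesis
    using eventually_ge_at_top[of 1] by eventually_elim (simp add: int)
qed

text \<open>The lower half of Karamata's theorem, read as a Riemann sum for the integral of
  \<open>\<gamma> * l powr (\<gamma> - 1)\<close> over the unit interval, which is 1. The matching
  upper bound will come from pointwise dual ergodicity.\<close>

lemma (in monotone_rv) karamata_lower:
  assumes s: "0 < s" and e: "\<epsilon> > 0"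
  shows "\<forall>\<^sub>F N in sequentially. (1 - \<epsilon>) * (b (real N * s) / s) \<le> (\<Sum>n=1..N. \<gamma> * b (real n * s) / (real n * s))"
proof -
  \<comment> \<open>The term with index \<open>k\<close> stands for \<open>n = Suc k\<close>,
    divided by the expected size of the sum.\<close>
  define q where "q N k = (if k < N then (\<gamma> * b (real (Suc k) * s) / (real (Suc k) * s)) / (b (real N * s) / s) else 0)" for N k
  have q0: "0 \<le> q N k" for N k using b_pos gamma s by (simp add: q_def less_imp_le)
  have sum: "(\<Sum>k. ennreal (q N k)) = ennreal ((\<Sum>n=1..N. \<gamma> * b (real n * s) / (real n * s)) / (b (real N * s) / s))" for N
  proof -
    have "(\<Sum>k. ennreal (q N k)) = (\<Sum>k<N. ennreal (q N k))"
      by (rule suminf_finite) (auto simp: q_def)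
    also have "\<dots> = ennreal (\<Sum>k<N. q N k)" using q0 by (simp add: sum_ennreal)
    also have "(\<Sum>k<N. q N k) = (\<Sum>k<N. \<gamma> * b (real (Suc k) * s) / (real (Suc k) * s)) / (b (real N * s) / s)"
      unfolding sum_divide_distrib by (rule sum.cong) (auto simp: q_def)
    also have "(\<Sum>k<N. \<gamma> * b (real (Suc k) * s) / (real (Suc k) * s)) = (\<Sum>n=1..N. \<gamma> * b (real n * s) / (real n * s))"
      by (rule sum.reindex_bij_witness[of _ "\<lambda>k. k - 1" Suc]) auto
    finally show ?thesis .
  qed
  define \<phi> where "\<phi> l = (if l < 1 then \<gamma> * l powr (\<gamma> - 1) else 0)" for l
  have [measurable]: "\<phi> \<in> borel_measurable borel" unfolding \<phi>_def by measurable
  have int: "(\<integral>\<^sup>+l. indicator {0<..} l * ennreal (\<phi> l) \<partial>lborel) = ennreal 1"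
  proof -
    have hi: "((\<lambda>l. \<gamma> * l powr (\<gamma> - 1)) has_integral (1 powr \<gamma> - 0 powr \<gamma>)) {0..1}"
    proof (rule fundamental_theorem_of_calculus_interior)
      show "continuous_on {0..1} (\<lambda>l. l powr \<gamma>)"
        using gamma by (intro continuous_on_powr' continuous_intros) auto
      fix x :: real assume "x \<in> {0<..<1}"
      then have "((\<lambda>l. l powr \<gamma>) has_real_derivative \<gamma> * x powr (\<gamma> - 1)) (at x)"
        by (auto intro!: derivative_eq_intros)
      then show "((\<lambda>l. l powr \<gamma>) has_vector_derivative \<gamma> * x powr (\<gamma> - 1)) (at x)"
        by (simp add: has_real_derivative_iff_has_vector_derivative)
    qed simp
    have "(\<integral>\<^sup>+l. indicator {0<..} l * ennreal (\<phi> l) \<partial>lborel)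
        = (\<integral>\<^sup>+l. ennreal (\<gamma> * l powr (\<gamma> - 1)) * indicator {0..1} l \<partial>lborel)"
    proof (rule nn_integral_cong_AE)
      show "AE l in lborel. indicator {0<..} l * ennreal (\<phi> l) = ennreal (\<gamma> * l powr (\<gamma> - 1)) * indicator {0..1} l"
        using AE_lborel_singleton[of "1::real"] AE_lborel_singleton[of "0::real"]
        by eventually_elim (auto simp: \<phi>_def indicator_def)
    qed
    also have "\<dots> = ennreal (1 powr \<gamma> - 0 powr \<gamma>)"
      using gamma by (intro nn_integral_has_integral_lebesgue'[OF _ hi]) auto
    finally show ?thesis using gamma by simp
  qed
  have "\<forall>\<^sub>F N in sequentially. ennreal (1 - \<epsilon>) < (\<Sum>k. ennreal (q N k))"
  proof (rule sum_fatou[where L = 1 and B = real and \<phi> = \<phi>])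
    fix l \<epsilon>' :: real assume l: "0 < l" and e': "0 < \<epsilon>'"
    show "\<forall>\<^sub>F N in sequentially. \<phi> l - \<epsilon>' \<le> real N / real 1 * (\<Sum>i<1. q N (1 * nat \<lfloor>l * (real N / real 1)\<rfloor> + i))"
    proof (cases "l < 1")
      case False
      have "0 \<le> real N / real 1 * (\<Sum>i<1. q N (1 * nat \<lfloor>l * (real N / real 1)\<rfloor> + i))" for N
        by (intro mult_nonneg_nonneg sum_nonneg q0) auto
      moreover have "\<phi> l - \<epsilon>' \<le> 0" using False e' by (simp add: \<phi>_def)
      ultimately show ?thesis using order_trans by (intro always_eventually allI) blast
    next
      case True
      define k where "k N = nat \<lfloor>l * real N\<rfloor>" for N
      have kb: "l * real N - 1 < real (k N)" "real (k N) \<le> l * real N" for N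
      proof -
        have "0 \<le> l * real N" using l by simp
        then show "l * real N - 1 < real (k N)" "real (k N) \<le> l * real N" unfolding k_def by linarith+
      qed
      have k1: "(\<lambda>N. real (Suc (k N)) / real N) \<longlonglongrightarrow> l"
      proof (rule tendsto_sandwich[of "\<lambda>N. l" _ _ "\<lambda>N. l + 1 / real N"])
        show "\<forall>\<^sub>F N in sequentially. l \<le> real (Suc (k N)) / real N"
          using eventually_gt_at_top[of 0] proof eventually_elim
          fix N :: nat assume "0 < N" then show "l \<le> real (Suc (k N)) / real N"
            using kb(1)[of N] by (simp add: pos_le_divide_eq)
        qed
        show "\<forall>\<^sub>F N in sequentially. real (Suc (k N)) / real N \<le> l + 1 / real N"
          using eventually_gt_at_top[of 0] proof eventually_elim
          fix N :: nat assume N: "0 < N"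
          then have "real (Suc (k N)) \<le> (l + 1 / real N) * real N" using kb(2)[of N] by (simp add: distrib_right)
          then show "real (Suc (k N)) / real N \<le> l + 1 / real N" using N by (simp add: pos_divide_le_eq)
        qed
        show "(\<lambda>N. l + 1 / real N) \<longlonglongrightarrow> l" using tendsto_add[OF tendsto_const lim_1_over_n] by simp
      qed simp
      have Ns: "filterlim (\<lambda>N. real N * s) at_top sequentially"
        using filterlim_tendsto_pos_mult_at_top[OF tendsto_const s filterlim_real_sequentially] by (simp add: mult.commute)
      have bl: "(\<lambda>N. b (real (Suc (k N)) * s) / b (real N * s)) \<longlonglongrightarrow> l powr \<gamma>"
        by (rule b_ratio[OF Ns _ l]) (use k1 s in simp)
      have "(\<lambda>N. \<gamma> * inverse (real (Suc (k N)) / real N) * (b (real (Suc (k N)) * s) / b (real N * s))) \<longlonglongrightarrow> \<gamma> * inverse l * l powr \<gamma>"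
        by (intro tendsto_intros k1 bl) (use l in auto)
      moreover have "\<gamma> * inverse l * l powr \<gamma> = \<phi> l" using True l by (simp add: \<phi>_def powr_diff divide_inverse)
      ultimately have "\<forall>\<^sub>F N in sequentially. \<phi> l - \<epsilon>' < \<gamma> * inverse (real (Suc (k N)) / real N) * (b (real (Suc (k N)) * s) / b (real N * s))"
        using order_tendstoD(1)[of _ "\<phi> l" sequentially "\<phi> l - \<epsilon>'"] e' by simp
      then show ?thesis using eventually_gt_at_top[of 0]
      proof eventually_elim
        fix N :: nat assume le: "\<phi> l - \<epsilon>' < \<gamma> * inverse (real (Suc (k N)) / real N) * (b (real (Suc (k N)) * s) / b (real N * s))" and N: "0 < N"
        have "l * real N < real N" using True N by simp
        then have "k N < N" using kb(2)[of N] by linarith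
        then have "real N * q N (k N) = \<gamma> * inverse (real (Suc (k N)) / real N) * (b (real (Suc (k N)) * s) / b (real N * s))"
          using N s b_pos[of "real N * s"] by (simp add: q_def field_simps del: of_nat_Suc)
        then show "\<phi> l - \<epsilon>' \<le> real N / real 1 * (\<Sum>i<1. q N (1 * nat \<lfloor>l * (real N / real 1)\<rfloor> + i))"
          using le by (simp add: k_def)
      qed
    qed
  next
    show "ennreal (1 - \<epsilon>) < (\<integral>\<^sup>+l. indicator {0<..} l * ennreal (\<phi> l) \<partial>lborel)"
      unfolding int using e by (intro ennreal_lessI) auto
  qed (use q0 in auto)
  then show ?thesis
  proof eventually_elim
    fix N assume "ennreal (1 - \<epsilon>) < (\<Sum>k. ennreal (q N k))"
    then have "1 - \<epsilon> \<le> (\<Sum>n=1..N. \<gamma> * b (real n * s) / (real n * s)) / (b (real N * s) / s)"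
      unfolding sum by (rule contrapos_pp) (simp add: not_le not_less ennreal_leI)
    moreover have "0 < b (real N * s) / s" using b_pos s by simp
    ultimately show "(1 - \<epsilon>) * (b (real N * s) / s) \<le> (\<Sum>n=1..N. \<gamma> * b (real n * s) / (real n * s))"
      by (simp only: pos_le_divide_eq)
  qed
qed

section \<open>Local limits along the flow\<close>

lemma card_int_interval:
  fixes A B :: real
  shows "B - A - 1 \<le> real (card {l::int. A \<le> of_int l \<and> of_int l \<le> B})"
proof -
  have "{l::int. A \<le> of_int l \<and> of_int l \<le> B} = {\<lceil>A\<rceil>..\<lfloor>B\<rfloor>}"
    by (auto simp: ceiling_le_iff le_floor_iff)
  then show ?thesis by simp linarith
qed

text \<open>
  If \<open>h / k\<close> is within \<open>1 / k\<^sup>2\<close> of the rotation number, then \<open>k\<close> consecutive points of any orbit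
  are within \<open>2 / k\<close> of the \<open>k\<close> equispaced points.
\<close>

lemma rotation_blocks:
  fixes p \<xi> \<alpha> \<beta> :: real
  assumes p: "0 < p" and irr: "\<xi> / p \<notin> \<rat>" and ab: "0 \<le> \<alpha>" "\<alpha> < \<beta>" "\<beta> \<le> p" and e: "0 < \<epsilon>"
  shows "\<exists>L\<ge>1. \<forall>x. \<beta> - \<alpha> - \<epsilon> \<le> 1 / real L *
    (\<Sum>i<L. p * indicator {y. \<exists>z::int. y - p * of_int z \<in> {\<alpha>..<\<beta>}} (x + real i * \<xi>))"
proof -
  \<comment> \<open>An irrational number has approximations \<open>h / k\<close> of quality
    \<open>1 / k^2\<close> with arbitrarily large \<open>k\<close>; the bound
    \<open>4 * p / \<epsilon>\<close> makes the four points lost in the count below, each of weight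
    \<open>p / k\<close>, amount to at most \<epsilon>.\<close>
  have "infinite (approx_set (\<xi> / p))" using irr rational_iff_finite_approx_set by blast
  from infinite_approx_set[OF this, of "\<lceil>4 * p / \<epsilon>\<rceil>"]
  obtain h k where hk: "(h, k) \<in> approx_set (\<xi> / p)" "k > \<lceil>4 * p / \<epsilon>\<rceil>" by auto
  have k0: "k > 0" and cop: "coprime h k" and near: "\<bar>\<xi> / p - of_int h / of_int k\<bar> < 1 / (of_int k)\<^sup>2"
    using hk by (auto simp: approx_set_def)
  have k\<epsilon>: "4 * p / \<epsilon> < of_int k" using hk(2) by (simp add: ceiling_less_iff)
  define L where "L = nat k"
  have L: "L \<ge> 1" "real L = of_int k" using k0 by (auto simp: L_def)
  let ?P = "{y. \<exists>z::int. y - p * of_int z \<in> {\<alpha>..<\<beta>}}"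
  have "\<beta> - \<alpha> - \<epsilon> \<le> 1 / real L * (\<Sum>i<L. p * indicator ?P (x + real i * \<xi>))" for x
  proof -
    \<comment> \<open>With \<open>x / p\<close> rounded down to a multiple of \<open>1 / k\<close>,
      the orbit point of index \<open>i\<close> is near \<open>(c + i * h) / k\<close> in units of
      \<open>p\<close>, and since \<open>h\<close> and \<open>k\<close> are coprime,
      \<open>f\<close> permutes the residues modulo \<open>k\<close>.\<close>
    define c where "c = \<lfloor>of_int k * x / p\<rfloor>"
    define f where "f i = (c + i * h) mod k" for i :: int
    have inj: "inj_on f {0..<k}"
    proof (rule inj_onI)
      fix i j assume ij: "i \<in> {0..<k}" "j \<in> {0..<k}" "f i = f j"
      then have "k dvd (c + i * h) - (c + j * h)" by (simp only: f_def mod_eq_dvd_iff)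
      then have "k dvd (i - j) * h" by (simp add: left_diff_distrib)
      then have "k dvd i - j" using cop by (simp add: coprime_dvd_mult_left_iff coprime_commute)
      then show "i = j" using ij zdvd_imp_le[of k "\<bar>i - j\<bar>"] by (cases "i = j") auto
    qed
    have "f ` {0..<k} \<subseteq> {0..<k}" using k0 by (auto simp: f_def)
    then have surj: "f ` {0..<k} = {0..<k}" using inj by (intro endo_inj_surj) auto
    \<comment> \<open>The rounding of \<open>x\<close> and the approximation of
      \<open>\<xi> / p\<close> move a point upwards by less than \<open>2 / k\<close> and downwards
      by at most \<open>1 / k\<close>; the margins 2 and 1 absorb this.\<close>
    define S where "S = {l::int. of_int k * (\<alpha> / p) + 1 \<le> real_of_int l \<and> real_of_int l \<le> of_int k * (\<beta> / p) - 2}"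
    have S: "S \<subseteq> {0..<k}"
    proof
      fix l assume l: "l \<in> S"
      have "0 \<le> of_int k * (\<alpha> / p)" using ab p k0 by simp
      moreover have "of_int k * (\<beta> / p) \<le> of_int k * 1" using ab p k0 by (intro mult_left_mono) auto
      ultimately have "0 < real_of_int l" "real_of_int l < of_int k" using l by (auto simp: S_def)
      then show "l \<in> {0..<k}" by auto
    qed
    have "card S = card {i \<in> {0..<k}. f i \<in> S}"
    proof -
      have "f ` {i \<in> {0..<k}. f i \<in> S} = S"
      proof (intro equalityI subsetI)
        fix l assume "l \<in> S"
        then have "l \<in> f ` {0..<k}" using surj S by blast
        then show "l \<in> f ` {i \<in> {0..<k}. f i \<in> S}" using \<open>l \<in> S\<close> by blast
      qed auto
      moreover have "inj_on f {i \<in> {0..<k}. f i \<in> S}" using inj by (rule inj_on_subset) auto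
      ultimately show ?thesis using card_image by metis
    qed
    also have "\<dots> \<le> card {i. i < L \<and> x + real i * \<xi> \<in> ?P}"
    proof (rule card_inj_on_le[where f = nat])
      show "nat ` {i \<in> {0..<k}. f i \<in> S} \<subseteq> {i. i < L \<and> x + real i * \<xi> \<in> ?P}"
      proof safe
        fix i assume i: "i \<in> {0..<k}" and fi: "f i \<in> S"
        then show "nat i < L" by (auto simp: L_def)
        define l where "l = f i"
        define z where "z = (c + i * h) div k"
        have dec: "c + i * h = k * z + l" by (simp add: z_def l_def f_def)
        have "\<bar>of_int i * (\<xi> / p - of_int h / of_int k)\<bar> \<le> of_int k * (1 / (of_int k)\<^sup>2)"
          unfolding abs_mult using i near by (intro mult_mono) auto
        also have "\<dots> = 1 / of_int k" using k0 by (simp add: power2_eq_square)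
        finally have d1: "\<bar>of_int i * (\<xi> / p) - of_int i * of_int h / of_int k\<bar> \<le> 1 / of_int k"
          by (simp add: right_diff_distrib)
        have "of_int c \<le> of_int k * x / p" "of_int k * x / p < of_int c + 1" unfolding c_def by linarith+
        then have d2: "of_int c / of_int k \<le> x / p" "x / p < of_int c / of_int k + 1 / of_int k"
          using k0 by (auto simp: field_simps)
        have split: "real_of_int c / of_int k + of_int i * of_int h / of_int k = of_int z + of_int l / of_int k"
        proof -
          have "real_of_int (c + i * h) / of_int k = real_of_int (k * z + l) / of_int k" by (simp only: dec)
          then show ?thesis using k0 by (simp add: add_divide_distrib)
        qed
        have "of_int k * (\<alpha> / p) + 1 \<le> of_int l" "of_int l \<le> of_int k * (\<beta> / p) - 2"
          using fi by (auto simp: l_def S_def)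
        then have "(of_int k * (\<alpha> / p) + 1) / of_int k \<le> of_int l / of_int k"
          "of_int l / of_int k \<le> (of_int k * (\<beta> / p) - 2) / of_int k"
          using k0 by (auto intro!: divide_right_mono)
        then have d3: "\<alpha> / p + 1 / of_int k \<le> of_int l / of_int k" "of_int l / of_int k \<le> \<beta> / p - 2 / of_int k"
          using k0 by (auto simp: add_divide_distrib diff_divide_distrib)
        have "x / p + of_int i * (\<xi> / p) - of_int z \<in> {\<alpha> / p..<\<beta> / p}"
          using d1 d2 d3 split by auto
        moreover have "x / p + of_int i * (\<xi> / p) - of_int z = (x + of_int i * \<xi> - p * of_int z) / p"
          using p by (simp add: add_divide_distrib diff_divide_distrib)
        ultimately have "x + of_int i * \<xi> - p * of_int z \<in> {\<alpha>..<\<beta>}"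
          using p by (auto simp: divide_le_cancel divide_less_cancel)
        then show "\<exists>z. x + real (nat i) * \<xi> - p * real_of_int z \<in> {\<alpha>..<\<beta>}"
          using i by auto
      qed
    qed (auto simp: inj_on_def)
    finally have "real (card S) \<le> real (card {i. i < L \<and> x + real i * \<xi> \<in> ?P})" by simp
    \<comment> \<open>One more point is lost in counting the integers of an interval, which makes
      four in all.\<close>
    moreover have "of_int k * (\<beta> / p) - 2 - (of_int k * (\<alpha> / p) + 1) - 1 \<le> real (card S)"
      unfolding S_def by (rule card_int_interval)
    moreover have "(\<Sum>i<L. indicator ?P (x + real i * \<xi>)) = real (card {i. i < L \<and> x + real i * \<xi> \<in> ?P})"
      by (simp add: indicator_def sum.If_cases Int_def lessThan_def)
    ultimately have "of_int k * ((\<beta> - \<alpha>) / p) - 4 \<le> (\<Sum>i<L. indicator ?P (x + real i * \<xi>))"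
      by (simp add: diff_divide_distrib right_diff_distrib)
    then have *: "p / of_int k * (of_int k * ((\<beta> - \<alpha>) / p) - 4) \<le> p / of_int k * (\<Sum>i<L. indicator ?P (x + real i * \<xi>))"
      using p k0 by (intro mult_left_mono) auto
    have "4 * p / of_int k \<le> \<epsilon>" using k\<epsilon> k0 e by (simp add: field_simps)
    then have "\<beta> - \<alpha> - \<epsilon> \<le> \<beta> - \<alpha> - 4 * p / of_int k" by simp
    also have "\<dots> = p / of_int k * (of_int k * ((\<beta> - \<alpha>) / p) - 4)" using p k0 by (simp add: field_simps)
    also note *
    also have "p / of_int k * (\<Sum>i<L. indicator ?P (x + real i * \<xi>)) = 1 / real L * (\<Sum>i<L. p * indicator ?P (x + real i * \<xi>))"
      unfolding sum_distrib_left[symmetric] L(2) by simp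
    finally show ?thesis .
  qed
  then show ?thesis using L by blast
qed

text \<open>If \<open>\<xi> / p = a / b\<close>, the group consists of multiples of
  \<open>d = p / b\<close> and stays at distance at least \<open>d / 2\<close> from the point
  \<open>d / 2\<close>.\<close>

lemma irrational_if_dense:
  assumes p: "0 < p" and dense: "closure {of_int i * \<xi> + of_int j * p | i j :: int. True} = (UNIV :: real set)"
  shows "\<xi> / p \<notin> \<rat>"
proof
  assume "\<xi> / p \<in> \<rat>"
  then obtain a b :: int where ab: "b > 0" "\<xi> / p = of_int a / of_int b" by (auto elim: Rats_cases')
  let ?G = "{of_int i * \<xi> + of_int j * p | i j :: int. True}"
  define d where "d = p / of_int b"
  have d: "d > 0" using ab p by (simp add: d_def)
  have sub: "\<exists>z::int. y = of_int z * d" if "y \<in> ?G" for y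
  proof -
    from that obtain i j :: int where y: "y = of_int i * \<xi> + of_int j * p" by blast
    have "\<xi> = of_int a * d" "p = of_int b * d" using ab p by (auto simp: d_def field_simps)
    then have "y = of_int (i * a + j * b) * d" unfolding y by (simp add: algebra_simps)
    then show ?thesis by blast
  qed
  have "d / 2 \<in> closure ?G" using dense by simp
  then obtain y where y: "y \<in> ?G" "dist y (d / 2) < d / 2"
    using d unfolding closure_approachable by (meson half_gt_zero)
  obtain z :: int where "y = of_int z * d" using sub y by blast
  then have "\<bar>(of_int z - 1 / 2) * d\<bar> < d / 2" using y by (simp add: dist_real_def left_diff_distrib)
  then have "\<bar>of_int z - 1 / 2 :: real\<bar> < 1 / 2" using d by (simp add: abs_mult)
  then have "0 < real_of_int z" "real_of_int z < 1" unfolding abs_less_iff by linarith+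
  then have "0 < z" "z < 1" by (simp_all only: of_int_0_less_iff of_int_less_1_iff)
  then show False by simp
qed

text \<open>
  A common form of both local limit theorems, for intervals shorter than the period. The weights
  \<open>\<eta>\<close> are constant in the aperiodic case.
\<close>

definition local_limits ::
  "'w measure \<Rightarrow> ('w \<Rightarrow> 'w) \<Rightarrow> ('w \<Rightarrow> real) \<Rightarrow> (real \<Rightarrow> real) \<Rightarrow> (real \<Rightarrow> real) \<Rightarrow> 'w set \<Rightarrow> real \<Rightarrow> real \<Rightarrow> bool"
  where
  "local_limits \<mu> \<tau> r binv fZ A \<alpha> \<beta> \<longleftrightarrow>
     (\<exists>\<eta> C. (\<forall>j k. 0 \<le> \<eta> j k \<and> \<eta> j k \<le> C) \<and>
        (\<forall>\<epsilon>>0. \<exists>L\<ge>1. \<forall>j k. \<beta> - \<alpha> - \<epsilon> \<le> 1 / real L * (\<Sum>i<L. \<eta> (j + i) k)) \<and>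
        (\<forall>c d D k. 0 < c \<and> c < d \<and> countable D \<and> D \<subseteq> {c..d} \<and>
            uniform_limit D (\<lambda>n x. k n x / binv (real n)) (\<lambda>x. x) sequentially \<longrightarrow>
           (AE w in \<mu>. uniform_limit D
             (\<lambda>n x. binv (real n) * local_prob \<mu> \<tau> r A {\<alpha>..<\<beta>} n (k n x) w - fZ x * measure \<mu> A * \<eta> n (k n x))
             (\<lambda>x. 0) sequentially)))"

text \<open>In the periodic case \<open>s0\<close> is the period: an interval inside
  \<open>[0, p)\<close> meets only the piece with \<open>J = 0\<close>, so the sum over
  \<open>J\<close> collapses to one indicator, and the weights are \<open>p\<close> times the
  indicator of the translates of the interval by multiples of \<open>p\<close>, evaluated along a
  rotation. In the aperiodic case the weights are the length of the interval and any
  \<open>s0\<close> serves.\<close>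

lemma local_limits_if_glt:
  assumes "aperiodic_llt \<mu> \<tau> \<aa> r binv fZ \<or> periodic_llt \<mu> \<tau> \<aa> r binv fZ"
  shows "\<exists>s0>0. \<forall>A\<in>cylinders \<mu> \<tau> \<aa>. \<forall>\<alpha> \<beta>. 0 \<le> \<alpha> \<and> \<alpha> < \<beta> \<and> \<beta> \<le> s0 \<longrightarrow> local_limits \<mu> \<tau> r binv fZ A \<alpha> \<beta>"
  using assms
proof
  assume ap: "aperiodic_llt \<mu> \<tau> \<aa> r binv fZ"
  have "local_limits \<mu> \<tau> r binv fZ A \<alpha> \<beta>" if A: "A \<in> cylinders \<mu> \<tau> \<aa>" and ab: "\<alpha> < \<beta>" for A \<alpha> \<beta>
    unfolding local_limits_def
  proof (intro exI[of _ "\<lambda>_ _. \<beta> - \<alpha>"] exI[of _ "\<beta> - \<alpha>"] conjI allI impI)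
    fix \<epsilon> :: real assume "\<epsilon> > 0"
    then show "\<exists>L\<ge>1. \<forall>(j::nat) (k::real). \<beta> - \<alpha> - \<epsilon> \<le> 1 / real L * (\<Sum>i<L. \<beta> - \<alpha>)" by (intro exI[of _ 1]) auto
  next
    fix c d :: real and D and k :: "nat \<Rightarrow> real \<Rightarrow> real"
    assume H: "0 < c \<and> c < d \<and> countable D \<and> D \<subseteq> {c..d} \<and>
            uniform_limit D (\<lambda>n x. k n x / binv (real n)) (\<lambda>x. x) sequentially"
    have I: "is_interval {\<alpha>..<\<beta>} \<and> bounded {\<alpha>..<\<beta>}" by (simp add: is_interval_def)
    have "AE w in \<mu>. uniform_limit D
             (\<lambda>n x. binv (real n) * local_prob \<mu> \<tau> r A {\<alpha>..<\<beta>} n (k n x) w)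
             (\<lambda>x. fZ x * measure lborel {\<alpha>..<\<beta>} * measure \<mu> A) sequentially"
      using ap A I H unfolding aperiodic_llt_def by blast
    then show "AE w in \<mu>. uniform_limit D
             (\<lambda>n x. binv (real n) * local_prob \<mu> \<tau> r A {\<alpha>..<\<beta>} n (k n x) w - fZ x * measure \<mu> A * (\<beta> - \<alpha>))
             (\<lambda>x. 0) sequentially"
      by (rule eventually_mono) (use ab in \<open>simp add: uniform_limit_iff dist_real_def mult_ac\<close>)
  qed (use ab in auto)
  then show ?thesis by (intro exI[of _ 1]) auto
next
  assume "periodic_llt \<mu> \<tau> \<aa> r binv fZ"
  then obtain p \<xi> where p: "0 < p" and dense: "closure {of_int i * \<xi> + of_int j * p | i j :: int. True} = (UNIV :: real set)"
    and lim: "\<And>A I c d D k. A \<in> cylinders \<mu> \<tau> \<aa> \<Longrightarrow> is_interval I \<and> bounded I \<Longrightarrow> 0 < c \<and> c < d \<Longrightarrow>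
       countable D \<and> D \<subseteq> {c..d} \<and> uniform_limit D (\<lambda>n x. k n x / binv (real n)) (\<lambda>x. x) sequentially \<Longrightarrow>
       AE w in \<mu>. uniform_limit D
              (\<lambda>n x. binv (real n) * local_prob \<mu> \<tau> r A I n (k n x) w
                 - p * fZ x * measure \<mu> A *
                   (\<Sum>\<^sub>\<infinity>J::int. indicator
                      {p * of_int i + s | (i::int) s. s \<in> I \<inter> {of_int J * p..<(of_int J + 1) * p}}
                      (real n * \<xi> - k n x)))
              (\<lambda>x. 0) sequentially"
    unfolding periodic_llt_def by - (elim exE conjE, rule that, assumption, assumption, blast)
  have irr: "\<xi> / p \<notin> \<rat>" by (rule irrational_if_dense[OF p dense])
  have "local_limits \<mu> \<tau> r binv fZ A \<alpha> \<beta>" if A: "A \<in> cylinders \<mu> \<tau> \<aa>" and ab: "0 \<le> \<alpha>" "\<alpha> < \<beta>" "\<beta> \<le> p" for A \<alpha> \<beta>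
  proof -
    let ?P = "{y. \<exists>z::int. y - p * of_int z \<in> {\<alpha>..<\<beta>}}"
    have sumP: "(\<Sum>\<^sub>\<infinity>J::int. indicator {p * of_int i + s | (i::int) s. s \<in> {\<alpha>..<\<beta>} \<inter> {of_int J * p..<(of_int J + 1) * p}} y)
        = (indicator ?P y :: real)" for y :: real
    proof -
      let ?S = "\<lambda>J::int. {p * of_int i + s | (i::int) s. s \<in> {\<alpha>..<\<beta>} \<inter> {of_int J * p..<(of_int J + 1) * p}}"
      have empty: "?S J = {}" if "J \<noteq> 0" for J
      proof -
        have "{\<alpha>..<\<beta>} \<inter> {of_int J * p..<(of_int J + 1) * p} = {}"
        proof (cases "J > 0")
          case True
          then have "1 * p \<le> of_int J * p" using p by (intro mult_right_mono) auto
          then have "\<beta> \<le> of_int J * p" using ab by linarith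
          then show ?thesis by auto
        next
          case False
          then have "of_int J + 1 \<le> (0::real)" using that by linarith
          then have "(of_int J + 1) * p \<le> 0" using p by (simp add: mult_nonpos_nonneg)
          then have "(of_int J + 1) * p \<le> \<alpha>" using ab by linarith
          then show ?thesis by auto
        qed
        then show ?thesis by blast
      qed
      have S0: "?S 0 = ?P"
      proof (intro set_eqI iffI)
        fix y assume "y \<in> ?P"
        then obtain z :: int where z: "y - p * of_int z \<in> {\<alpha>..<\<beta>}" by blast
        then have "y - p * of_int z \<in> {\<alpha>..<\<beta>} \<inter> {of_int 0 * p..<(of_int 0 + 1) * p}" using ab by auto
        moreover have "y = p * of_int z + (y - p * of_int z)" by simp
        ultimately show "y \<in> ?S 0" by blast
      next
        fix y assume "y \<in> ?S 0"
        then obtain i :: int and s where "y = p * of_int i + s" "s \<in> {\<alpha>..<\<beta>}" by blast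
        then show "y \<in> ?P" by (auto intro!: exI[of _ i])
      qed
      have "(\<Sum>\<^sub>\<infinity>J::int. indicator (?S J) y :: real) = (\<Sum>\<^sub>\<infinity>J\<in>{0}. indicator (?S J) y)"
        by (rule infsum_cong_neutral) (use empty in auto)
      also have "\<dots> = indicator (?S 0) y" by simp
      finally show ?thesis unfolding S0 .
    qed
    define \<eta> where "\<eta> j k = p * indicator ?P (real j * \<xi> - k)" for j :: nat and k :: real
    have "AE w in \<mu>. uniform_limit D
           (\<lambda>n x. binv (real n) * local_prob \<mu> \<tau> r A {\<alpha>..<\<beta>} n (k n x) w - fZ x * measure \<mu> A * \<eta> n (k n x))
           (\<lambda>x. 0) sequentially"
      if H: "0 < c \<and> c < d \<and> countable D \<and> D \<subseteq> {c..d} \<and>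
        uniform_limit D (\<lambda>n x. k n x / binv (real n)) (\<lambda>x. x) sequentially" for c d D k
    proof -
      have I: "is_interval {\<alpha>..<\<beta>} \<and> bounded {\<alpha>..<\<beta>}" by (simp add: is_interval_def)
      show ?thesis
        using lim[OF A I, of c d D k] H unfolding sumP by (simp add: \<eta>_def mult_ac)
    qed
    moreover have "\<exists>L\<ge>1. \<forall>j k. \<beta> - \<alpha> - \<epsilon> \<le> 1 / real L * (\<Sum>i<L. \<eta> (j + i) k)" if \<epsilon>: "\<epsilon> > 0" for \<epsilon>
    proof -
      obtain L where L: "L \<ge> 1" "\<And>x. \<beta> - \<alpha> - \<epsilon> \<le> 1 / real L * (\<Sum>i<L. p * indicator ?P (x + real i * \<xi>))"
        using rotation_blocks[OF p irr ab \<epsilon>] by blast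
      have "\<eta> (j + i) k = p * indicator ?P ((real j * \<xi> - k) + real i * \<xi>)" for i j k
        by (simp add: \<eta>_def algebra_simps)
      then show ?thesis using L by (intro exI[of _ L]) simp
    qed
    moreover have "0 \<le> \<eta> j k \<and> \<eta> j k \<le> p" for j k using p by (simp add: \<eta>_def indicator_def)
    ultimately show ?thesis unfolding local_limits_def by blast
  qed
  then show ?thesis using p by auto
qed

section \<open>The limit laws\<close>

lemma Gamma_lower_bound: "\<exists>\<kappa>>0. \<forall>x\<ge>1. \<kappa> \<le> Gamma (x::real)"
proof -
  have "continuous_on {1..2} (Gamma :: real \<Rightarrow> real)"
    by (intro continuous_on_Gamma continuous_on_id) (auto dest: nonpos_Ints_nonpos)
  then obtain c :: real where c: "c \<in> {1..2}" "\<And>x. x \<in> {1..2} \<Longrightarrow> Gamma c \<le> Gamma x"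
    using continuous_attains_inf[of "{1..2::real}" Gamma] by auto
  \<comment> \<open>The minimum over [1, 2] propagates to the right because
    \<open>Gamma x = (x - 1) * Gamma (x - 1)\<close> with a factor of at least 1.\<close>
  have "Gamma c \<le> Gamma x" if "1 \<le> x" "x \<le> real n + 2" for x n
    using that
  proof (induction n arbitrary: x)
    case 0 then show ?case using c by auto
  next
    case (Suc n)
    show ?case
    proof (cases "x \<le> 2")
      case False
      then have "Gamma c \<le> Gamma (x - 1)" using Suc by (intro Suc.IH) auto
      also have "\<dots> \<le> (x - 1) * Gamma (x - 1)" using False less_imp_le[OF Gamma_real_pos, of "x - 1"] by (simp add: mult_le_cancel_right1 not_less)
      also have "\<dots> = Gamma (x - 1 + 1)" using False by (intro Gamma_plus1[symmetric]) (auto dest: nonpos_Ints_nonpos)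
      finally show ?thesis by simp
    qed (use c Suc in auto)
  qed
  then have "\<forall>x\<ge>1. Gamma c \<le> Gamma x" using real_arch_simple by (metis add_increasing2 order_trans zero_le_numeral)
  moreover have "Gamma c > 0" using c by (intro Gamma_real_pos) auto
  ultimately show ?thesis by auto
qed

text \<open>The coefficient of \<open>z\<close> is
  \<open>Gamma (1 + \<gamma>) / Gamma (1 + \<gamma>) = 1\<close>. Termwise differentiation is
  justified by the lower bound for Gamma, which dominates the series at
  \<open>1 / (2 * Gamma (1 + \<gamma>))\<close> by a geometric one.\<close>

lemma mittag_leffler_fun_deriv:
  assumes "0 < \<gamma>"
  shows "((\<lambda>z. mittag_leffler_fun \<gamma> (Gamma (1 + \<gamma>) * z)) has_real_derivative 1) (at 0)"
proof -
  define G where "G = Gamma (1 + \<gamma>)"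
  have G: "G > 0" using assms by (simp add: G_def Gamma_real_pos)
  define c where "c n = G ^ n / Gamma (1 + \<gamma> * real n)" for n :: nat
  obtain \<kappa> where \<kappa>: "\<kappa> > 0" "\<And>x. x \<ge> 1 \<Longrightarrow> \<kappa> \<le> Gamma (x::real)" using Gamma_lower_bound by auto
  have "summable (\<lambda>n. c n * (1 / (2 * G)) ^ n)"
  proof (rule summable_comparison_test')
    show "summable (\<lambda>n. (1 / \<kappa>) * (1 / 2) ^ n :: real)" by (intro summable_mult summable_geometric) simp
    fix n :: nat
    have ge: "\<kappa> \<le> Gamma (1 + \<gamma> * real n)" using assms by (intro \<kappa>) simp
    have "norm (c n * (1 / (2 * G)) ^ n) = (1 / 2) ^ n / Gamma (1 + \<gamma> * real n)"
      using G ge \<kappa>(1) by (simp add: c_def power_divide power_mult_distrib abs_mult)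
    also have "\<dots> \<le> (1 / 2) ^ n / \<kappa>" using ge \<kappa>(1) by (intro divide_left_mono mult_pos_pos) auto
    finally show "norm (c n * (1 / (2 * G)) ^ n) \<le> (1 / \<kappa>) * (1 / 2) ^ n" by simp
  qed
  from termdiffs_strong[OF this, of 0] G
  have "((\<lambda>z. \<Sum>n. c n * z ^ n) has_real_derivative (\<Sum>n. diffs c n * 0 ^ n)) (at 0)" by simp
  moreover have "(\<Sum>n. diffs c n * 0 ^ n) = 1"
    using powser_zero[of "diffs c"] G by (simp add: diffs_def c_def G_def)
  moreover have "(\<lambda>z. \<Sum>n. c n * z ^ n) = (\<lambda>z. mittag_leffler_fun \<gamma> (Gamma (1 + \<gamma>) * z))"
    by (simp add: mittag_leffler_fun_def c_def G_def power_mult_distrib fun_eq_iff)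
  ultimately show ?thesis by simp
qed

text \<open>The mean is the derivative at 0 of the moment generating function. Differentiation under
  the integral uses difference quotients with \<open>h n = 1 / Suc n\<close>, dominated by
  \<open>exp (2 * y)\<close>, which is integrable as all exponential moments exist.\<close>

lemma mittag_leffler_law_mean:
  assumes g: "0 < \<gamma>" and Y: "mittag_leffler_law \<gamma> Y"
  shows "integrable Y (\<lambda>y. y)" and "(\<integral>y. y \<partial>Y) = 1"
proof -
  interpret real_distribution Y using Y by (simp add: mittag_leffler_law_def)
  have pos: "AE y in Y. 0 < y" and int: "integrable Y (\<lambda>y. exp (z * y))"
    and eq: "(\<integral>y. exp (z * y) \<partial>Y) = mittag_leffler_fun \<gamma> (Gamma (1 + \<gamma>) * z)" for z
    using Y by (auto simp: mittag_leffler_law_def)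
  have [measurable]: "(\<lambda>y. y) \<in> borel_measurable Y" by simp
  define h where "h n = 1 / real (Suc n)" for n
  have h0: "h \<longlonglongrightarrow> 0" unfolding h_def by (rule LIMSEQ_Suc[OF lim_1_over_n])
  have hp: "h n > 0" "h n \<le> 1" for n by (auto simp: h_def)
  then have hne: "h n \<noteq> 0" for n by (metis less_irrefl)
  have hat: "filterlim h (at 0) sequentially"
    unfolding filterlim_at using h0 hne by simp
  let ?d = "\<lambda>n y. (exp (h n * y) - 1) / h n"
  have dlim: "(\<lambda>n. ?d n y) \<longlonglongrightarrow> y" for y
  proof -
    have "((\<lambda>z. exp (z * y)) has_real_derivative y) (at 0)" by (auto intro!: derivative_eq_intros)
    then have "((\<lambda>k. (exp (k * y) - 1) / k) \<longlongrightarrow> y) (at 0)" by (simp add: DERIV_def)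
    from filterlim_compose[OF this hat] show ?thesis .
  qed
  have dom: "AE y in Y. norm (?d n y) \<le> exp (2 * y)" for n
    using pos
  proof eventually_elim
    fix y :: real assume y: "0 < y"
    have "1 - h n * y \<le> exp (- (h n * y))" using exp_ge_add_one_self[of "- (h n * y)"] by simp
    then have "(1 - h n * y) * exp (h n * y) \<le> exp (- (h n * y)) * exp (h n * y)" by (intro mult_right_mono) auto
    then have "exp (h n * y) - 1 \<le> h n * y * exp (h n * y)" by (simp add: exp_minus algebra_simps)
    then have "?d n y \<le> y * exp (h n * y)" using hp by (simp add: pos_divide_le_eq mult_ac)
    also have "\<dots> \<le> exp y * exp y"
    proof (intro mult_mono)
      show "y \<le> exp y" using exp_ge_add_one_self[of y] by linarith
      show "exp (h n * y) \<le> exp y" using y hp[of n] by simp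
    qed (use y in auto)
    also have "\<dots> = exp (2 * y)" by (simp add: exp_add[symmetric])
    finally show "norm (?d n y) \<le> exp (2 * y)" using hp[of n] y by simp
  qed
  have meas: "?d n \<in> borel_measurable Y" for n by measurable
  show "integrable Y (\<lambda>y. y)"
    by (rule integrable_dominated_convergence[where s = ?d and w = "\<lambda>y. exp (2 * y)"]) (use int dom dlim meas in auto)
  have "(\<lambda>n. \<integral>y. ?d n y \<partial>Y) \<longlonglongrightarrow> (\<integral>y. y \<partial>Y)"
    by (rule integral_dominated_convergence[where w = "\<lambda>y. exp (2 * y)"]) (use int dom dlim meas in auto)
  moreover have "(\<lambda>n. \<integral>y. ?d n y \<partial>Y) \<longlonglongrightarrow> 1"
  proof -
    let ?m = "\<lambda>z. mittag_leffler_fun \<gamma> (Gamma (1 + \<gamma>) * z)"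
    have "?m 0 = 1" using eq[of 0] prob_space by simp
    then have "((\<lambda>k. (?m k - 1) / k) \<longlongrightarrow> 1) (at 0)"
      using mittag_leffler_fun_deriv[OF g] by (simp add: DERIV_def)
    from filterlim_compose[OF this hat] have "(\<lambda>n. (?m (h n) - 1) / h n) \<longlonglongrightarrow> 1" .
    moreover have "(\<integral>y. ?d n y \<partial>Y) = (?m (h n) - 1) / h n" for n
      using int[of "h n"] eq[of "h n"] prob_space by simp
    ultimately show ?thesis by (simp only:)
  qed
  ultimately show "(\<integral>y. y \<partial>Y) = 1" by (rule LIMSEQ_unique)
qed

text \<open>Substitution \<open>x = l powr (- 1 / \<gamma>)\<close> in the density of
  \<open>Z = Y powr (- 1 / \<gamma>)\<close>. The factor in front of \<open>fZ\<close> is the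
  Jacobian times \<open>l\<close>, and this extra \<open>l\<close> is the source of the size biased
  law. The left side is the limit profile of the local limits in the rescaled number of
  visits.\<close>

lemma stable_density_change_of_variables:
  assumes g: "0 < \<gamma>" and Y: "mittag_leffler_law \<gamma> Y" and f: "stable_density \<gamma> Y fZ"
    and k: "k \<in> borel_measurable borel" "\<And>x. 0 \<le> k x" "\<And>x. k x \<le> (1::real)"
  shows "(\<integral>\<^sup>+l. indicator {0<..} l * ennreal (1 / \<gamma> * l powr (- 1 / \<gamma>) * fZ (l powr (- 1 / \<gamma>)) * k l) \<partial>lborel)
    = ennreal (\<integral>y. y * k y \<partial>Y)"
proof -
  interpret real_distribution Y using Y by (simp add: mittag_leffler_law_def)
  note [measurable] = k(1)
  have pos: "AE y in Y. 0 < y" using Y by (simp add: mittag_leffler_law_def)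
  have fZ: "\<And>x. 0 \<le> fZ x" and dist: "distributed Y lborel (\<lambda>y. y powr (- 1 / \<gamma>)) (\<lambda>x. ennreal (fZ x))"
    using f by (auto simp: stable_density_def)
  have [measurable]: "fZ \<in> borel_measurable borel"
    using distributed_real_measurable[OF _ dist] fZ by (simp add: measurable_lborel1)
  \<comment> \<open>The function with \<open>\<psi> Z = Y * k Y\<close>, as
    \<open>Y = Z powr (- \<gamma>)\<close>.\<close>
  define \<psi> where "\<psi> x = indicator {0<..} x * (x powr (- \<gamma>) * k (x powr (- \<gamma>)))" for x :: real
  have [measurable]: "\<psi> \<in> borel_measurable borel" unfolding \<psi>_def by measurable
  have \<psi>0: "0 \<le> \<psi> x" for x using k by (simp add: \<psi>_def)
  define I where "I = (\<integral>y. y * k y \<partial>Y)"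
  have iY: "integrable Y (\<lambda>y. y * k y)"
  proof (rule Bochner_Integration.integrable_bound[OF mittag_leffler_law_mean(1)[OF g Y]])
    show "AE y in Y. norm (y * k y) \<le> norm y"
      using k by (auto simp: abs_mult mult_le_cancel_left1 intro!: AE_I2 mult_left_le)
  qed simp
  have eqY: "AE y in Y. \<psi> (y powr (- 1 / \<gamma>)) = y * k y"
    using pos
  proof eventually_elim
    fix y :: real assume "0 < y"
    then show "\<psi> (y powr (- 1 / \<gamma>)) = y * k y" using g by (simp add: \<psi>_def powr_powr)
  qed
  have iY': "integrable Y (\<lambda>y. \<psi> (y powr (- 1 / \<gamma>)))"
    by (subst integrable_cong_AE[OF _ _ eqY]) (use iY in auto)
  have "integrable lborel (\<lambda>x. fZ x * \<psi> x)"
    using distributed_integrable[OF dist, of \<psi>] fZ iY' by simp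
  moreover have "(\<integral>x. fZ x * \<psi> x \<partial>lborel) = I"
    using distributed_integral[OF dist, of \<psi>] fZ integral_cong_AE[OF _ _ eqY] by (simp add: I_def)
  moreover define \<theta> where "\<theta> x = fZ x * (x powr (- \<gamma>) * k (x powr (- \<gamma>)))" for x
  moreover have "(\<lambda>x. fZ x * \<psi> x) = (\<lambda>x. indicator {0<..} x *\<^sub>R \<theta> x)"
    by (auto simp: \<psi>_def \<theta>_def fun_eq_iff)
  ultimately have \<theta>: "set_integrable lborel {0<..} \<theta>" "(LINT x:{0<..}|lborel. \<theta> x) = I"
    by (auto simp: set_integrable_def set_lebesgue_integral_def)
  have abs: "\<theta> absolutely_integrable_on {0<..}"
    using \<theta>(1) unfolding set_integrable_def by (rule integrable_completion[THEN iffD2, rotated]) (simp add: \<theta>_def)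
  have int: "integral {0<..} \<theta> = I" using set_borel_integral_eq_integral(2)[OF \<theta>(1)] \<theta>(2) by simp
  define w where "w l = l powr (- 1 / \<gamma>)" for l :: real
  define w' where "w' l = (- 1 / \<gamma>) * l powr (- 1 / \<gamma> - 1)" for l :: real
  have img: "w ` {0<..} = {0<..}"
  proof (intro equalityI subsetI)
    fix x :: real assume "x \<in> {0<..}"
    then have "x = w (x powr (- \<gamma>))" "x powr (- \<gamma>) \<in> {0<..}" using g by (auto simp: w_def powr_powr)
    then show "x \<in> w ` {0<..}" by blast
  qed (auto simp: w_def)
  have "(\<lambda>l. \<bar>w' l\<bar> * \<theta> (w l)) absolutely_integrable_on {0<..} \<and> integral {0<..} (\<lambda>l. \<bar>w' l\<bar> * \<theta> (w l)) = I"
  proof (subst has_absolute_integral_change_of_variables_1'[where S = "{0<..}" and g = w and g' = w' and f = \<theta>])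
    show "inj_on w {0<..}"
    proof (rule inj_onI)
      fix x y :: real assume "x \<in> {0<..}" "y \<in> {0<..}" "w x = w y"
      then have "(w x) powr (- \<gamma>) = (w y) powr (- \<gamma>)" by simp
      then show "x = y" using \<open>x \<in> _\<close> \<open>y \<in> _\<close> g by (simp add: w_def powr_powr)
    qed
    fix x :: real assume "x \<in> {0<..}"
    then have "(w has_real_derivative w' x) (at x)"
      unfolding w_def w'_def by (auto intro!: derivative_eq_intros)
    then show "(w has_field_derivative w' x) (at x within {0<..})" by (rule has_field_derivative_at_within)
  qed (use abs int in \<open>auto simp: img\<close>)
  then have hi: "((\<lambda>l. \<bar>w' l\<bar> * \<theta> (w l)) has_integral I) {0<..}"
    using absolutely_integrable_on_def integrable_integral by metis
  have eq: "1 / \<gamma> * l powr (- 1 / \<gamma>) * fZ (l powr (- 1 / \<gamma>)) * k l = \<bar>w' l\<bar> * \<theta> (w l)" if "l > 0" for l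
  proof -
    have "w l powr (- \<gamma>) = l" using that g by (simp add: w_def powr_powr)
    moreover have "\<bar>w' l\<bar> * l = 1 / \<gamma> * l powr (- 1 / \<gamma>)"
      using that g by (simp add: w'_def powr_diff abs_mult)
    moreover have "\<bar>w' l\<bar> * \<theta> (w l) = (\<bar>w' l\<bar> * (w l powr (- \<gamma>))) * fZ (w l) * k (w l powr (- \<gamma>))"
      by (simp add: \<theta>_def)
    ultimately show ?thesis by (simp add: w_def)
  qed
  have "(\<integral>\<^sup>+l. indicator {0<..} l * ennreal (1 / \<gamma> * l powr (- 1 / \<gamma>) * fZ (l powr (- 1 / \<gamma>)) * k l) \<partial>lborel)
      = (\<integral>\<^sup>+l. ennreal (\<bar>w' l\<bar> * \<theta> (w l)) * indicator {0<..} l \<partial>lborel)"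
  proof (rule nn_integral_cong)
    fix l :: real
    show "indicator {0<..} l * ennreal (1 / \<gamma> * l powr (- 1 / \<gamma>) * fZ (l powr (- 1 / \<gamma>)) * k l)
        = ennreal (\<bar>w' l\<bar> * \<theta> (w l)) * indicator {0<..} l"
    proof (cases "0 < l")
      case True
      show ?thesis unfolding eq[OF True] by (rule mult.commute)
    qed simp
  qed
  also have "\<dots> = ennreal I"
    by (rule nn_integral_has_integral_lebesgue'[OF _ hi]) (use fZ k in \<open>auto simp: \<theta>_def\<close>)
  finally show ?thesis by (simp add: I_def)
qed

text \<open>\<open>Y\<close> charges only positive numbers, so neither the density
  \<open>ennreal y\<close> nor the restriction to \<open>{0..}\<close> cuts anything off.\<close>

lemma size_biased_expectation:
  assumes g: "0 < \<gamma>" and Y: "mittag_leffler_law \<gamma> Y" and k: "k \<in> borel_measurable borel"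
  shows "(LINT w:{0..}|size_biased_law Y. k w) = (\<integral>y. y * k y \<partial>Y)"
proof -
  interpret real_distribution Y using Y by (simp add: mittag_leffler_law_def)
  note [measurable] = k
  have pos: "AE y in Y. 0 < y" using Y by (simp add: mittag_leffler_law_def)
  have "(LINT w:{0..}|size_biased_law Y. k w) = (\<integral>y. y *\<^sub>R (indicator {0..} y *\<^sub>R k y) \<partial>Y)"
    unfolding size_biased_law_def set_lebesgue_integral_def
    by (rule integral_density) (use pos in auto)
  also have "\<dots> = (\<integral>y. y * k y \<partial>Y)"
    by (rule integral_cong_AE) (use pos in auto)
  finally show ?thesis .
qed

section \<open>Local limits at the times \<open>n * s\<close>\<close>

context monotone_rv
begin

context
  fixes \<mu> :: "'w measure" and \<tau> :: "'w \<Rightarrow> 'w" and r :: "'w \<Rightarrow> real" and fZ :: "real \<Rightarrow> real" and s :: real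
    and A :: "'w set" and \<alpha> \<beta> y0 :: real
  assumes mps: "mp_system \<mu> \<tau>" and fin: "finite_measure \<mu>"
    and r_meas: "r \<in> borel_measurable \<mu>" and A_sets: "A \<in> sets \<mu>"
    and fZ_cont: "continuous_on {0<..} fZ" and fZ_nonneg: "\<And>x. 0 \<le> fZ x" and s: "0 < s"
begin

lemma ns_inf: "filterlim (\<lambda>n. real n * s) at_top sequentially"
  using filterlim_tendsto_pos_mult_at_top[OF tendsto_const s filterlim_real_sequentially] by (simp add: mult.commute)

lemma local_prob_nonneg: "AE w in \<mu>. 0 \<le> local_prob \<mu> \<tau> r A {\<alpha>..<\<beta>} n k w"
proof -
  interpret mp_system \<mu> \<tau> by (rule mps)
  interpret finite_measure \<mu> by (rule fin)
  note [measurable] = r_meas A_sets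
  have "A \<inter> {x \<in> space \<mu>. birkhoff_sum \<tau> n r x \<in> {k + \<alpha>..<k + \<beta>}} \<in> sets \<mu>"
    by measurable
  then show ?thesis unfolding local_prob_def image_add_atLeastLessThan
    by (intro Th_nonneg integrable_real_indicator) (auto simp: emeasure_eq_measure add.commute)
qed

text \<open>The local limit theorem gives a null set for each countable family of places, but here
  one null set must serve all \<open>l\<close> and all sequences \<open>k\<close>. The places of
  interest \<open>n * s - y0\<close> are countable, so they are encoded as \<open>kk j x\<close>
  with rational \<open>x\<close>; a given sequence is then recovered by a suitable choice of
  rationals \<open>x n\<close> near \<open>n * s / binv (k n)\<close>.\<close>

lemma local_limits_sequence:
  assumes lim: "\<forall>c d D k. 0 < c \<and> c < d \<and> countable D \<and> D \<subseteq> {c..d} \<and>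
            uniform_limit D (\<lambda>n x. k n x / binv (real n)) (\<lambda>x. x) sequentially \<longrightarrow>
           (AE w in \<mu>. uniform_limit D
             (\<lambda>n x. binv (real n) * local_prob \<mu> \<tau> r A {\<alpha>..<\<beta>} n (k n x) w - fZ x * measure \<mu> A * \<eta> n (k n x))
             (\<lambda>x. 0) sequentially)"
    and eta: "\<And>j k. 0 \<le> \<eta> j k" "\<And>j k. \<eta> j k \<le> C"
  shows "AE w in \<mu>. \<forall>l k. 0 < l \<longrightarrow> ((\<lambda>n. real (k n) / b (real n * s)) \<longlonglongrightarrow> l) \<longrightarrow>
    ((\<lambda>n. real n * s * local_prob \<mu> \<tau> r A {\<alpha>..<\<beta>} (k n) (real n * s - y0) w
      - l powr (- 1 / \<gamma>) * fZ (l powr (- 1 / \<gamma>)) * measure \<mu> A * \<eta> (k n) (real n * s - y0)) \<longlonglongrightarrow> 0)"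
proof -
  \<comment> \<open>For fixed \<open>j\<close> the value depends only on the cell of
    \<open>x * binv j\<close> in the grid of mesh \<open>s\<close>, and
    \<open>kk j x / binv j\<close> tends to \<open>x\<close> uniformly.\<close>
  define kk where "kk j x = s * of_int \<lfloor>x * binv (real j) / s\<rfloor> - y0" for j x
  \<comment> \<open>Rational points of compact intervals that exhaust (0, \<infinity>).\<close>
  define D where "D i = \<rat> \<inter> {1 / real (i + 2)..real (i + 2)}" for i :: nat
  have binv_real: "filterlim (\<lambda>j. binv (real j)) at_top sequentially"
    by (rule filterlim_compose[OF binv_inf filterlim_real_sequentially])
  have unif: "uniform_limit (D i) (\<lambda>j x. kk j x / binv (real j)) (\<lambda>x. x) sequentially" for i
  proof (rule uniform_limitI)
    fix e :: real assume e: "e > 0"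
    have "\<forall>\<^sub>F j in sequentially. binv (real j) > max 0 ((s + \<bar>y0\<bar>) / e)"
      using binv_real by (rule filterlim_at_top_dense[THEN iffD1, rule_format])
    then show "\<forall>\<^sub>F j in sequentially. \<forall>x\<in>D i. dist (kk j x / binv (real j)) x < e"
    proof (rule eventually_mono, intro ballI)
      fix j x assume j: "binv (real j) > max 0 ((s + \<bar>y0\<bar>) / e)"
      let ?B = "binv (real j)"
      have B: "?B > 0" "s + \<bar>y0\<bar> < e * ?B" using j e by (auto simp: pos_divide_less_eq mult.commute)
      have f: "of_int \<lfloor>x * ?B / s\<rfloor> \<le> x * ?B / s" "x * ?B / s < of_int \<lfloor>x * ?B / s\<rfloor> + 1" by linarith+
      have "s * of_int \<lfloor>x * ?B / s\<rfloor> \<le> s * (x * ?B / s)"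
        by (rule mult_left_mono[OF f(1)]) (use s in simp)
      moreover have "s * (x * ?B / s) < s * (of_int \<lfloor>x * ?B / s\<rfloor> + 1)"
        by (rule mult_strict_left_mono[OF f(2) s])
      ultimately have "\<bar>kk j x - x * ?B\<bar> \<le> s + \<bar>y0\<bar>" using s by (simp add: kk_def distrib_left)
      then have "\<bar>kk j x - x * ?B\<bar> < e * ?B" using B by linarith
      then have "\<bar>kk j x - x * ?B\<bar> / ?B < e" using B by (simp add: pos_divide_less_eq)
      moreover have "kk j x / ?B - x = (kk j x - x * ?B) / ?B" using B by (simp add: diff_divide_distrib)
      ultimately show "dist (kk j x / ?B) x < e" using B by (simp add: dist_real_def abs_divide)
    qed
  qed
  have "AE w in \<mu>. \<forall>i. uniform_limit (D i)
      (\<lambda>n x. binv (real n) * local_prob \<mu> \<tau> r A {\<alpha>..<\<beta>} n (kk n x) w - fZ x * measure \<mu> A * \<eta> n (kk n x)) (\<lambda>x. 0) sequentially"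
    unfolding AE_all_countable
  proof
    fix i
    have "1 / real (i + 2) < 1" "1 < real (i + 2)" by auto
    then have "1 / real (i + 2) < real (i + 2)" by linarith
    then show "AE w in \<mu>. uniform_limit (D i)
      (\<lambda>n x. binv (real n) * local_prob \<mu> \<tau> r A {\<alpha>..<\<beta>} n (kk n x) w - fZ x * measure \<mu> A * \<eta> n (kk n x)) (\<lambda>x. 0) sequentially"
      by (intro lim[rule_format, of "1 / real (i + 2)" "real (i + 2)"] conjI unif)
         (auto simp: D_def countable_rat intro: countable_Int1)
  qed
  then show ?thesis
  proof (rule eventually_mono, intro allI impI)
    fix w and l :: real and k :: "nat \<Rightarrow> nat"
    assume U: "\<forall>i. uniform_limit (D i)
      (\<lambda>n x. binv (real n) * local_prob \<mu> \<tau> r A {\<alpha>..<\<beta>} n (kk n x) w - fZ x * measure \<mu> A * \<eta> n (kk n x)) (\<lambda>x. 0) sequentially"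
      and l: "0 < l" and kl: "(\<lambda>n. real (k n) / b (real n * s)) \<longlonglongrightarrow> l"
    let ?lp = "\<lambda>n. local_prob \<mu> \<tau> r A {\<alpha>..<\<beta>} (k n) (real n * s - y0) w"
    define X where "X = l powr (- 1 / \<gamma>)"
    have X: "X > 0" using l by (simp add: X_def)
    define \<rho> where "\<rho> n = real n * s / binv (real (k n))" for n
    have "(\<lambda>n. binv (real (k n)) / (real n * s)) \<longlonglongrightarrow> l powr (1 / \<gamma>)"
      by (rule binv_ratio[OF ns_inf kl l])
    then have "(\<lambda>n. inverse (binv (real (k n)) / (real n * s))) \<longlonglongrightarrow> inverse (l powr (1 / \<gamma>))"
      using l by (intro tendsto_inverse) auto
    then have \<rho>: "\<rho> \<longlonglongrightarrow> X" by (simp add: \<rho>_def[abs_def] X_def powr_minus)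
    have k_inf: "filterlim (\<lambda>n. real (k n)) at_top sequentially"
    proof -
      have "filterlim (\<lambda>n. b (real n * s)) at_top sequentially" by (rule filterlim_compose[OF b_inf ns_inf])
      from filterlim_tendsto_pos_mult_at_top[OF kl l this]
      show ?thesis using b_pos by (simp add: order_less_imp_not_eq2)
    qed
    then have k_nat: "\<forall>\<^sub>F n in sequentially. J \<le> k n" for J
      unfolding filterlim_at_top by (auto dest: spec[of _ "real J"])
    have bk: "filterlim (\<lambda>n. binv (real (k n))) at_top sequentially"
      by (rule filterlim_compose[OF binv_inf k_inf])
    obtain i :: nat where i: "1 / real (i + 2) < X" "X < real (i + 2)"
    proof -
      obtain i :: nat where "real i \<ge> max X (1 / X)" using real_arch_simple by blast
      then have "X < real (i + 2)" "1 / X < real (i + 2)" by auto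
      then show ?thesis using X that[of i] by (simp add: field_simps)
    qed
    define P where "P n \<longleftrightarrow> 1 / real (i + 2) < \<rho> n \<and> \<rho> n < real (i + 2) \<and> 0 < binv (real (k n))" for n
    have P: "\<forall>\<^sub>F n in sequentially. P n"
      using order_tendstoD(1)[OF \<rho> i(1)] order_tendstoD(2)[OF \<rho> i(2)]
        filterlim_at_top_dense[THEN iffD1, rule_format, OF bk, of 0]
      by eventually_elim (simp add: P_def)
    \<comment> \<open>Rationals strictly between \<open>\<rho> n\<close> and
      \<open>\<rho> n + s / binv (k n)\<close> lie in the grid cell of index \<open>n\<close>, so
      that \<open>kk (k n) (x n) = n * s - y0\<close>.\<close>
    have "\<forall>n. \<exists>x. P n \<longrightarrow> x \<in> \<rat> \<and> \<rho> n < x \<and> x < min (\<rho> n + s / binv (real (k n))) (real (i + 2))"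
    proof
      fix n
      show "\<exists>x. P n \<longrightarrow> x \<in> \<rat> \<and> \<rho> n < x \<and> x < min (\<rho> n + s / binv (real (k n))) (real (i + 2))"
      proof (cases "P n")
        case True
        then have "\<rho> n < min (\<rho> n + s / binv (real (k n))) (real (i + 2))" using s by (simp add: P_def)
        from Rats_dense_in_real[OF this] show ?thesis by blast
      qed simp
    qed
    then obtain x where x: "\<And>n. P n \<Longrightarrow> x n \<in> \<rat> \<and> \<rho> n < x n \<and> x n < min (\<rho> n + s / binv (real (k n))) (real (i + 2))"
      by metis
    have xD: "x n \<in> D i" and kkx: "kk (k n) (x n) = real n * s - y0" if "P n" for n
    proof -
      have B: "0 < binv (real (k n))" using that by (simp add: P_def)
      show "x n \<in> D i" using x[OF that] that by (auto simp: D_def P_def)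
      have "real n * s < x n * binv (real (k n))" using x[OF that] B by (auto simp: \<rho>_def pos_divide_less_eq)
      moreover have "\<rho> n + s / binv (real (k n)) = (real n * s + s) / binv (real (k n))" by (simp add: \<rho>_def add_divide_distrib)
      then have "x n * binv (real (k n)) < real n * s + s" using x[OF that] B by (auto simp: pos_less_divide_eq)
      ultimately have "\<lfloor>x n * binv (real (k n)) / s\<rfloor> = int n"
        using s by (intro floor_unique) (auto simp: pos_le_divide_eq pos_divide_less_eq distrib_right)
      then show "kk (k n) (x n) = real n * s - y0" by (simp add: kk_def mult.commute)
    qed
    have xX: "x \<longlonglongrightarrow> X"
    proof (rule tendsto_sandwich[of \<rho> _ _ "\<lambda>n. \<rho> n + s * inverse (binv (real (k n)))"])
      show "\<forall>\<^sub>F n in sequentially. \<rho> n \<le> x n" using P by eventually_elim (use x in force)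
      show "\<forall>\<^sub>F n in sequentially. x n \<le> \<rho> n + s * inverse (binv (real (k n)))"
        using P by eventually_elim (use x in \<open>force simp: divide_inverse\<close>)
      show "(\<lambda>n. \<rho> n + s * inverse (binv (real (k n)))) \<longlonglongrightarrow> X"
        using tendsto_add[OF \<rho> tendsto_mult[OF tendsto_const tendsto_inverse_0_at_top[OF bk]], of s] by simp
    qed (rule \<rho>)
    define d where "d n = binv (real (k n)) * ?lp n - fZ (x n) * measure \<mu> A * \<eta> (k n) (real n * s - y0)" for n
    have d0: "d \<longlonglongrightarrow> 0"
    proof (rule tendstoI)
      fix e :: real assume "e > 0"
      from uniform_limitD[OF U[rule_format, of i] this]
      obtain J where J: "\<And>j x. j \<ge> J \<Longrightarrow> x \<in> D i \<Longrightarrow>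
        \<bar>binv (real j) * local_prob \<mu> \<tau> r A {\<alpha>..<\<beta>} j (kk j x) w - fZ x * measure \<mu> A * \<eta> j (kk j x)\<bar> < e"
        by (auto simp: eventually_sequentially dist_real_def)
      from k_nat[of J] P show "\<forall>\<^sub>F n in sequentially. dist (d n) 0 < e"
      proof eventually_elim
        fix n assume n: "J \<le> k n" "P n"
        show "dist (d n) 0 < e" using J[OF n(1) xD[OF n(2)]] by (simp add: d_def kkx[OF n(2)] dist_real_def)
      qed
    qed
    have fx: "(\<lambda>n. fZ (x n)) \<longlonglongrightarrow> fZ X"
    proof -
      have "isCont fZ X" using fZ_cont X by (simp add: continuous_on_eq_continuous_at)
      then show ?thesis using xX by (rule isCont_tendsto_compose)
    qed
    \<comment> \<open>The error in replacing \<open>\<rho> n * fZ (x n)\<close> by its limit; the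
      weights \<eta> may oscillate but are bounded by \<open>C\<close>.\<close>
    let ?E = "\<lambda>n. (\<rho> n * fZ (x n) - X * fZ X) * measure \<mu> A * \<eta> (k n) (real n * s - y0)"
    have E0: "?E \<longlonglongrightarrow> 0"
    proof (rule Lim_null_comparison)
      show "\<forall>\<^sub>F n in sequentially. norm (?E n) \<le> \<bar>\<rho> n * fZ (x n) - X * fZ X\<bar> * (measure \<mu> A * C)"
        using eta by (intro always_eventually allI) (auto simp: abs_mult mult.assoc intro!: mult_left_mono)
      have "(\<lambda>n. \<bar>\<rho> n * fZ (x n) - X * fZ X\<bar> * (measure \<mu> A * C)) \<longlonglongrightarrow> \<bar>X * fZ X - X * fZ X\<bar> * (measure \<mu> A * C)"
        by (intro tendsto_intros \<rho> fx)
      then show "(\<lambda>n. \<bar>\<rho> n * fZ (x n) - X * fZ X\<bar> * (measure \<mu> A * C)) \<longlonglongrightarrow> 0" by simp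
    qed
    have "(\<lambda>n. \<rho> n * d n + ?E n) \<longlonglongrightarrow> 0" using tendsto_add[OF tendsto_mult[OF \<rho> d0] E0] by simp
    moreover have "\<forall>\<^sub>F n in sequentially. \<rho> n * d n + ?E n
      = real n * s * ?lp n - X * fZ X * measure \<mu> A * \<eta> (k n) (real n * s - y0)"
      using P
    proof eventually_elim
      fix n assume "P n"
      then have "\<rho> n * binv (real (k n)) = real n * s" by (simp add: P_def \<rho>_def)
      moreover have "\<rho> n * d n = (\<rho> n * binv (real (k n))) * ?lp n - \<rho> n * fZ (x n) * measure \<mu> A * \<eta> (k n) (real n * s - y0)"
        by (simp add: d_def right_diff_distrib mult_ac)
      ultimately show "\<rho> n * d n + ?E n
        = real n * s * ?lp n - X * fZ X * measure \<mu> A * \<eta> (k n) (real n * s - y0)"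
        by (simp add: left_diff_distrib)
    qed
    ultimately show "(\<lambda>n. real n * s * ?lp n
      - l powr (- 1 / \<gamma>) * fZ (l powr (- 1 / \<gamma>)) * measure \<mu> A * \<eta> (k n) (real n * s - y0)) \<longlonglongrightarrow> 0"
      unfolding X_def[symmetric] by (rule Lim_transform_eventually)
  qed
qed

text \<open>After division by \<open>\<gamma> * b (n * s) / (n * s)\<close>, the term with
  \<open>k\<close> near \<open>l * b (n * s)\<close> is of order \<open>1 / b (n * s)\<close>, with
  the stated profile in \<open>l\<close> up to the oscillating weights. Averaging over blocks of
  \<open>L\<close> indices replaces these weights by the length of the interval at the cost of
  \<epsilon>, and \<open>sum_fatou\<close> gives the bound for the sum.\<close>

lemma local_limits_fatou:
  assumes ll: "local_limits \<mu> \<tau> r binv fZ A \<alpha> \<beta>"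
    and fZ_meas: "fZ \<in> borel_measurable borel"
    and g: "continuous_on UNIV g" "\<And>x. 0 \<le> g x" "\<And>x. g x \<le> 1" and e: "0 < \<epsilon>"
  shows "AE w in \<mu>. \<forall>c. c < (\<integral>\<^sup>+l. indicator {0<..} l *
        ennreal (1 / \<gamma> * l powr (- 1 / \<gamma>) * fZ (l powr (- 1 / \<gamma>)) * g l * (measure \<mu> A * (\<beta> - \<alpha> - \<epsilon>))) \<partial>lborel) \<longrightarrow>
    (\<forall>\<^sub>F n in sequentially. c < (\<Sum>k. ennreal (g (real k / b (real n * s)) *
        local_prob \<mu> \<tau> r A {\<alpha>..<\<beta>} k (real n * s - y0) w / (\<gamma> * b (real n * s) / (real n * s)))))"
proof -
  from ll obtain \<eta> C where eta': "\<forall>j k. 0 \<le> \<eta> j k \<and> \<eta> j k \<le> C"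
    and blocks: "\<forall>\<epsilon>>0. \<exists>L\<ge>1. \<forall>j k. \<beta> - \<alpha> - \<epsilon> \<le> 1 / real L * (\<Sum>i<L. \<eta> (j + i) k)"
    and lim: "\<forall>c d D k. 0 < c \<and> c < d \<and> countable D \<and> D \<subseteq> {c..d} \<and>
            uniform_limit D (\<lambda>n x. k n x / binv (real n)) (\<lambda>x. x) sequentially \<longrightarrow>
           (AE w in \<mu>. uniform_limit D
             (\<lambda>n x. binv (real n) * local_prob \<mu> \<tau> r A {\<alpha>..<\<beta>} n (k n x) w - fZ x * measure \<mu> A * \<eta> n (k n x))
             (\<lambda>x. 0) sequentially)"
    unfolding local_limits_def by - (elim exE conjE, rule that, assumption+)
  have eta: "\<And>j k. 0 \<le> \<eta> j k" "\<And>j k. \<eta> j k \<le> C" using eta' by auto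
  obtain L where L: "L \<ge> 1" and Lb: "\<And>j k. \<beta> - \<alpha> - \<epsilon> \<le> 1 / real L * (\<Sum>i<L. \<eta> (j + i) k)"
    using blocks[rule_format, OF e] by blast
  have "AE w in \<mu>. \<forall>n k. 0 \<le> local_prob \<mu> \<tau> r A {\<alpha>..<\<beta>} k (real n * s - y0) w"
    unfolding AE_all_countable by (intro allI local_prob_nonneg)
  with local_limits_sequence[OF lim eta] show ?thesis
  proof (rule eventually_elim2, intro allI impI)
    fix w c
    let ?lp = "\<lambda>n k. local_prob \<mu> \<tau> r A {\<alpha>..<\<beta>} k (real n * s - y0) w"
    let ?B = "\<lambda>n. b (real n * s)"
    let ?K = "\<lambda>l. l powr (- 1 / \<gamma>) * fZ (l powr (- 1 / \<gamma>)) * measure \<mu> A"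
    assume seq: "\<forall>l k. 0 < l \<longrightarrow> ((\<lambda>n. real (k n) / ?B n) \<longlonglongrightarrow> l) \<longrightarrow>
        ((\<lambda>n. real n * s * ?lp n (k n) - ?K l * \<eta> (k n) (real n * s - y0)) \<longlonglongrightarrow> 0)"
      and lp0: "\<forall>n k. 0 \<le> ?lp n k"
      and c: "c < (\<integral>\<^sup>+l. indicator {0<..} l *
        ennreal (1 / \<gamma> * l powr (- 1 / \<gamma>) * fZ (l powr (- 1 / \<gamma>)) * g l * (measure \<mu> A * (\<beta> - \<alpha> - \<epsilon>))) \<partial>lborel)"
    have g_meas [measurable]: "g \<in> borel_measurable borel" using g(1) by (rule borel_measurable_continuous_onI)
    note [measurable] = fZ_meas
    show "\<forall>\<^sub>F n in sequentially. c < (\<Sum>k. ennreal (g (real k / ?B n) * ?lp n k / (\<gamma> * ?B n / (real n * s))))"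
    proof (rule sum_fatou[OF _ _ _ _ _ c, where L = L and B = ?B])
      show "0 < L" using L by simp
      show "0 < ?B n" for n by (rule b_pos)
      show "0 \<le> g (real k / ?B n) * ?lp n k / (\<gamma> * ?B n / (real n * s))" for n k
        using g lp0 b_pos[of "real n * s"] gamma s by (auto intro!: divide_nonneg_nonneg mult_nonneg_nonneg less_imp_le[OF b_pos])
      fix l e :: real assume l: "0 < l" and e: "0 < e"
      \<comment> \<open>Indices of the block assigned to \<open>l\<close>; each of them is
        asymptotic to \<open>l * ?B n\<close>, so the values of \<open>g\<close> and
        \<open>fZ\<close> do not vary along the block in the limit.\<close>
      define k where "k i n = L * nat \<lfloor>l * (?B n / L)\<rfloor> + i" for i n
      have Binf: "filterlim ?B at_top sequentially" by (rule filterlim_compose[OF b_inf ns_inf])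
      have kl: "(\<lambda>n. real (k i n) / ?B n) \<longlonglongrightarrow> l" for i
      proof (rule Lim_transform_eventually[of "\<lambda>n. (real (k i n) - l * ?B n) * inverse (?B n) + l"])
        have "(\<lambda>n. (real (k i n) - l * ?B n) * inverse (?B n)) \<longlonglongrightarrow> 0"
        proof (rule Lim_null_comparison)
          show "\<forall>\<^sub>F n in sequentially. norm ((real (k i n) - l * ?B n) * inverse (?B n)) \<le> (real L + real i) * inverse (?B n)"
          proof (intro always_eventually allI)
            fix n
            let ?f = "nat \<lfloor>l * (?B n / L)\<rfloor>"
            have "0 \<le> l * (?B n / L)" using l b_pos[of "real n * s"] by (simp add: less_imp_le)
            then have f: "real ?f \<le> l * (?B n / L)" "l * (?B n / L) \<le> real ?f + 1" by linarith+
            have "real L * real ?f \<le> real L * (l * (?B n / L))" by (rule mult_left_mono[OF f(1)]) simp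
            moreover have "real L * (l * (?B n / L)) \<le> real L * (real ?f + 1)" by (rule mult_left_mono[OF f(2)]) simp
            moreover have "real L * (l * (?B n / L)) = l * ?B n" using L by simp
            ultimately have "\<bar>real (k i n) - l * ?B n\<bar> \<le> real L + real i" by (simp add: k_def distrib_left)
            then show "norm ((real (k i n) - l * ?B n) * inverse (?B n)) \<le> (real L + real i) * inverse (?B n)"
              using b_pos[of "real n * s"] by (simp add: abs_mult mult_right_mono)
          qed
          show "(\<lambda>n. (real L + real i) * inverse (?B n)) \<longlonglongrightarrow> 0"
            using tendsto_mult[OF tendsto_const tendsto_inverse_0_at_top[OF Binf], of "real L + real i"] by simp
        qed
        then show "(\<lambda>n. (real (k i n) - l * ?B n) * inverse (?B n) + l) \<longlonglongrightarrow> l"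
          using tendsto_add[OF _ tendsto_const[of l]] by fastforce
        show "\<forall>\<^sub>F n in sequentially. (real (k i n) - l * ?B n) * inverse (?B n) + l = real (k i n) / ?B n"
          using b_pos by (intro always_eventually allI) (simp add: divide_inverse left_diff_distrib order_less_imp_not_eq2)
      qed
      define H where "H i n = real n * s * ?lp n (k i n) - ?K l * \<eta> (k i n) (real n * s - y0)" for i n
      have H0: "H i \<longlonglongrightarrow> 0" for i
        unfolding H_def by (rule seq[rule_format, OF l kl])
      have gk: "(\<lambda>n. g (real (k i n) / ?B n)) \<longlonglongrightarrow> g l" for i
      proof -
        have "isCont g l" using g(1) by (simp add: continuous_on_eq_continuous_at)
        then show ?thesis using kl by (rule isCont_tendsto_compose)
      qed
      let ?G = "\<lambda>i n. g (real (k i n) / ?B n)"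
      \<comment> \<open>Error of the term with index \<open>i\<close>: one part from the local
        limit, one from replacing \<open>g\<close> by its value at \<open>l\<close>.\<close>
      define R where "R i n = ?G i n * H i n + (?G i n - g l) * ?K l * \<eta> (k i n) (real n * s - y0)" for i n
      have K0: "0 \<le> ?K l" using fZ_nonneg by simp
      have R0: "R i \<longlonglongrightarrow> 0" for i
      proof -
        have "(\<lambda>n. (?G i n - g l) * ?K l * \<eta> (k i n) (real n * s - y0)) \<longlonglongrightarrow> 0"
        proof (rule Lim_null_comparison)
          show "\<forall>\<^sub>F n in sequentially. norm ((?G i n - g l) * ?K l * \<eta> (k i n) (real n * s - y0)) \<le> \<bar>?G i n - g l\<bar> * (?K l * C)"
          proof (intro always_eventually allI)
            fix n
            have "\<bar>?G i n - g l\<bar> * (?K l * \<eta> (k i n) (real n * s - y0)) \<le> \<bar>?G i n - g l\<bar> * (?K l * C)"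
              by (intro mult_left_mono K0 eta) auto
            then show "norm ((?G i n - g l) * ?K l * \<eta> (k i n) (real n * s - y0)) \<le> \<bar>?G i n - g l\<bar> * (?K l * C)"
              using K0 eta by (simp add: abs_mult mult.assoc fZ_nonneg)
          qed
          have "(\<lambda>n. \<bar>?G i n - g l\<bar> * (?K l * C)) \<longlonglongrightarrow> \<bar>g l - g l\<bar> * (?K l * C)"
            by (intro tendsto_intros gk)
          then show "(\<lambda>n. \<bar>?G i n - g l\<bar> * (?K l * C)) \<longlonglongrightarrow> 0" by simp
        qed
        with tendsto_mult[OF gk H0] show ?thesis unfolding R_def using tendsto_add by fastforce
      qed
      have "(\<lambda>n. 1 / (\<gamma> * L) * (\<Sum>i<L. R i n)) \<longlonglongrightarrow> 1 / (\<gamma> * L) * (\<Sum>i<L. 0)"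
        by (intro tendsto_intros R0)
      then have "\<forall>\<^sub>F n in sequentially. - e < 1 / (\<gamma> * L) * (\<Sum>i<L. R i n)"
        using order_tendstoD(1)[of _ 0 sequentially "-e"] e by simp
      then show "\<forall>\<^sub>F n in sequentially.
          1 / \<gamma> * l powr (- 1 / \<gamma>) * fZ (l powr (- 1 / \<gamma>)) * g l * (measure \<mu> A * (\<beta> - \<alpha> - \<epsilon>)) - e
          \<le> ?B n / real L * (\<Sum>i<L. g (real (L * nat \<lfloor>l * (?B n / real L)\<rfloor> + i) / ?B n) *
              ?lp n (L * nat \<lfloor>l * (?B n / real L)\<rfloor> + i) / (\<gamma> * ?B n / (real n * s)))"
        using eventually_ge_at_top[of 1]
      proof eventually_elim
        fix n :: nat assume Rn: "- e < 1 / (\<gamma> * L) * (\<Sum>i<L. R i n)" and n: "1 \<le> n"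
        have "(\<Sum>i<L. R i n) + g l * ?K l * (\<Sum>i<L. \<eta> (k i n) (real n * s - y0))
            = (\<Sum>i<L. real n * s * (?G i n * ?lp n (k i n)))"
          unfolding sum_distrib_left sum.distrib[symmetric]
          by (rule sum.cong) (auto simp: R_def H_def algebra_simps)
        moreover have "?B n / real L * (\<Sum>i<L. ?G i n * ?lp n (k i n) / (\<gamma> * ?B n / (real n * s)))
            = 1 / (\<gamma> * L) * (\<Sum>i<L. real n * s * (?G i n * ?lp n (k i n)))"
          unfolding sum_distrib_left
          using b_pos[of "real n * s"] L gamma s n by (intro sum.cong) (auto simp: field_simps)
        ultimately have "?B n / real L * (\<Sum>i<L. ?G i n * ?lp n (k i n) / (\<gamma> * ?B n / (real n * s)))
            = 1 / (\<gamma> * L) * (\<Sum>i<L. R i n) + g l * ?K l / \<gamma> * (1 / real L * (\<Sum>i<L. \<eta> (k i n) (real n * s - y0)))"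
          by (simp add: distrib_left flip: \<open>(\<Sum>i<L. R i n) + _ = _\<close>)
        moreover have "g l * ?K l / \<gamma> * (\<beta> - \<alpha> - \<epsilon>) \<le> g l * ?K l / \<gamma> * (1 / real L * (\<Sum>i<L. \<eta> (k i n) (real n * s - y0)))"
        proof (rule mult_left_mono)
          show "\<beta> - \<alpha> - \<epsilon> \<le> 1 / real L * (\<Sum>i<L. \<eta> (k i n) (real n * s - y0))"
            unfolding k_def by (rule Lb)
          show "0 \<le> g l * ?K l / \<gamma>" using g gamma fZ_nonneg by (intro divide_nonneg_pos mult_nonneg_nonneg) auto
        qed
        ultimately show "1 / \<gamma> * l powr (- 1 / \<gamma>) * fZ (l powr (- 1 / \<gamma>)) * g l * (measure \<mu> A * (\<beta> - \<alpha> - \<epsilon>)) - e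
          \<le> ?B n / real L * (\<Sum>i<L. g (real (L * nat \<lfloor>l * (?B n / real L)\<rfloor> + i) / ?B n) *
              ?lp n (L * nat \<lfloor>l * (?B n / real L)\<rfloor> + i) / (\<gamma> * ?B n / (real n * s)))"
          using Rn unfolding k_def[symmetric] by (simp add: mult_ac)
      qed
    qed measurable
  qed
qed

end

end

section \<open>Suspended semiflows\<close>

text \<open>The number of returns to the base during (0, T]; a start on the base is not counted. The
  least index makes measurability immediate for any measurable roof, and on the orbits considered
  below it is the index selected by \<open>suspension_flow\<close>.\<close>

definition crossings :: "('w \<Rightarrow> 'w) \<Rightarrow> ('w \<Rightarrow> real) \<Rightarrow> real \<Rightarrow> 'w \<times> real \<Rightarrow> nat" where
  "crossings \<tau> r T z = (LEAST n. snd z + T < birkhoff_sum \<tau> (Suc n) r (fst z))"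

lemma birkhoff_sum_plus:
  "birkhoff_sum \<tau> (k + j) r x = birkhoff_sum \<tau> k r x + birkhoff_sum \<tau> j r ((\<tau> ^^ k) x)"
proof -
  have "(\<Sum>i<k + j. r ((\<tau> ^^ i) x)) = (\<Sum>i<k. r ((\<tau> ^^ i) x)) + (\<Sum>i<j. r ((\<tau> ^^ (k + i)) x))"
    by (induction j) (auto simp: add.assoc)
  moreover have "(\<tau> ^^ (k + i)) x = (\<tau> ^^ i) ((\<tau> ^^ k) x)" for i
    by (simp add: funpow_add add.commute[of k])
  ultimately show ?thesis by (simp add: birkhoff_sum_def)
qed

text \<open>Almost every orbit of a standard section is of this kind. The bound at all iterates, not
  only at the first point, keeps consecutive return times at least \<open>c\<close> apart.\<close>

locale tame_orbit =
  fixes \<tau> :: "'w \<Rightarrow> 'w" and r :: "'w \<Rightarrow> real" and c :: real and x :: 'w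
  assumes c: "0 < c" and roof: "\<And>k. c \<le> r ((\<tau> ^^ k) x)"
begin

lemma returns_Suc: "birkhoff_sum \<tau> k r x + c \<le> birkhoff_sum \<tau> (Suc k) r x"
  using roof[of k] by (simp add: birkhoff_sum_def)

lemma returns_mono: "j \<le> k \<Longrightarrow> birkhoff_sum \<tau> j r x \<le> birkhoff_sum \<tau> k r x"
  by (rule lift_Suc_mono_le[of "\<lambda>k. birkhoff_sum \<tau> k r x"]) (use returns_Suc c in \<open>smt (verit)\<close>)

lemma returns_ge: "real k * c \<le> birkhoff_sum \<tau> k r x"
proof (induction k)
  case 0 show ?case by (simp add: birkhoff_sum_def)
next
  case (Suc k) then show ?case using returns_Suc[of k] by (simp add: distrib_right)
qed

lemma crossings_upper: "y + T < birkhoff_sum \<tau> (Suc (crossings \<tau> r T (x, y))) r x"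
proof -
  obtain n :: nat where "y + T < real n * c" using c reals_Archimedean3 by blast
  also have "\<dots> \<le> real (Suc n) * c" using c by simp
  also have "\<dots> \<le> birkhoff_sum \<tau> (Suc n) r x" by (rule returns_ge)
  finally show ?thesis
    unfolding crossings_def fst_conv snd_conv by (rule LeastI[where P = "\<lambda>n. y + T < birkhoff_sum \<tau> (Suc n) r x"])
qed

text \<open>Inverse relation between the counting process and the return times; monotonicity of the
  return times is what makes the least index behave as a count.\<close>

lemma crossings_ge_iff:
  assumes "0 \<le> y" "0 \<le> T"
  shows "k \<le> crossings \<tau> r T (x, y) \<longleftrightarrow> birkhoff_sum \<tau> k r x \<le> y + T"
proof
  assume k: "k \<le> crossings \<tau> r T (x, y)"
  show "birkhoff_sum \<tau> k r x \<le> y + T"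
  proof (cases k)
    case 0 then show ?thesis using assms by (simp add: birkhoff_sum_def)
  next
    case (Suc j)
    then have "j < (LEAST n. y + T < birkhoff_sum \<tau> (Suc n) r x)" using k by (simp add: crossings_def)
    from not_less_Least[OF this] show ?thesis using Suc by simp
  qed
next
  assume a: "birkhoff_sum \<tau> k r x \<le> y + T"
  show "k \<le> crossings \<tau> r T (x, y)"
  proof (rule ccontr)
    assume "\<not> k \<le> crossings \<tau> r T (x, y)"
    then have "birkhoff_sum \<tau> (Suc (crossings \<tau> r T (x, y))) r x \<le> birkhoff_sum \<tau> k r x" by (intro returns_mono) simp
    then show False using a crossings_upper[of y T] by simp
  qed
qed

lemma crossings_iff:
  assumes "0 \<le> y" "0 \<le> T"
  shows "crossings \<tau> r T (x, y) = k \<longleftrightarrow> birkhoff_sum \<tau> k r x \<le> y + T \<and> y + T < birkhoff_sum \<tau> (Suc k) r x"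
proof -
  have "crossings \<tau> r T (x, y) = k \<longleftrightarrow> k \<le> crossings \<tau> r T (x, y) \<and> \<not> Suc k \<le> crossings \<tau> r T (x, y)" by auto
  then show ?thesis unfolding crossings_ge_iff[OF assms] by (simp add: not_le)
qed

lemma suspension_flow_eq:
  assumes "0 \<le> y" "0 \<le> T"
  shows "suspension_flow \<tau> r T (x, y) = ((\<tau> ^^ crossings \<tau> r T (x, y)) x, y + T - birkhoff_sum \<tau> (crossings \<tau> r T (x, y)) r x)"
proof -
  have "(THE n. birkhoff_sum \<tau> n r x \<le> y + T \<and> y + T < birkhoff_sum \<tau> (Suc n) r x) = crossings \<tau> r T (x, y)"
  proof (rule the_equality)
    fix n assume "birkhoff_sum \<tau> n r x \<le> y + T \<and> y + T < birkhoff_sum \<tau> (Suc n) r x"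
    then show "n = crossings \<tau> r T (x, y)" using crossings_iff[OF assms, of n] by blast
  qed (use crossings_iff[OF assms] in blast)
  then show ?thesis by (simp add: suspension_flow_def Let_def)
qed

text \<open>At time \<open>T\<close> the orbit sits over the \<open>k\<close>-th iterate at the
  remaining height \<open>y'\<close>, and counting restarts from there.\<close>

lemma crossings_add:
  assumes "0 \<le> y" "0 \<le> T" "0 \<le> S"
  shows "crossings \<tau> r (T + S) (x, y) = crossings \<tau> r T (x, y) + crossings \<tau> r S (suspension_flow \<tau> r T (x, y))"
proof -
  define k where "k = crossings \<tau> r T (x, y)"
  define y' where "y' = y + T - birkhoff_sum \<tau> k r x"
  have y': "0 \<le> y'" using crossings_iff[OF assms(1,2), of k] by (simp add: y'_def k_def)
  have fl: "suspension_flow \<tau> r T (x, y) = ((\<tau> ^^ k) x, y')"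
    unfolding suspension_flow_eq[OF assms(1,2)] by (simp add: k_def y'_def)
  interpret shifted: tame_orbit \<tau> r c "(\<tau> ^^ k) x"
  proof
    show "c \<le> r ((\<tau> ^^ i) ((\<tau> ^^ k) x))" for i using roof[of "i + k"] by (simp add: funpow_add)
  qed (rule c)
  define j where "j = crossings \<tau> r S ((\<tau> ^^ k) x, y')"
  have "birkhoff_sum \<tau> j r ((\<tau> ^^ k) x) \<le> y' + S" "y' + S < birkhoff_sum \<tau> (Suc j) r ((\<tau> ^^ k) x)"
    using shifted.crossings_iff[OF y' assms(3), of j] by (auto simp: j_def)
  then have "birkhoff_sum \<tau> (k + j) r x \<le> y + (T + S)" "y + (T + S) < birkhoff_sum \<tau> (Suc (k + j)) r x"
    using birkhoff_sum_plus[of \<tau> k j r x] birkhoff_sum_plus[of \<tau> k "Suc j" r x] by (auto simp: y'_def)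
  then have "crossings \<tau> r (T + S) (x, y) = k + j"
    using assms by (subst crossings_iff) auto
  then show ?thesis by (simp add: fl j_def) (simp add: k_def)
qed

text \<open>Within a time of at most \<open>c\<close> a second return is impossible.\<close>

lemma crossings_small:
  assumes "0 \<le> y" "y < r x" "0 \<le> s" "s \<le> c"
  shows "crossings \<tau> r s (x, y) = (if r x \<le> y + s then 1 else 0)"
proof (cases "r x \<le> y + s")
  case True
  have "y + s < birkhoff_sum \<tau> (Suc 1) r x" using assms roof[of 1] by (simp add: birkhoff_sum_def)
  then have "crossings \<tau> r s (x, y) = 1" using True assms by (subst crossings_iff) (auto simp: birkhoff_sum_def)
  then show ?thesis using True by simp
next
  case False
  then have "crossings \<tau> r s (x, y) = 0" using assms by (subst crossings_iff) (auto simp: birkhoff_sum_def)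
  then show ?thesis using False by simp
qed

end

section \<open>Duality for nonnegative integrals\<close>

lemma (in mp_system) Th_dual_nn:
  assumes f: "integrable M f" "AE x in M. 0 \<le> f x" and A: "A \<in> sets M"
  shows "(\<integral>\<^sup>+x. ennreal (Th n f x) * indicator A x \<partial>M) = (\<integral>\<^sup>+x. ennreal (f x) * indicator A ((T ^^ n) x) \<partial>M)"
proof -
  note [measurable] = A
  have 1: "integrable M (\<lambda>x. Th n f x * indicator A x)"
    using integrable_real_mult_indicator[OF A Th_integrable[OF f(1)]] .
  have 2: "integrable M (\<lambda>x. f x * indicator A ((T ^^ n) x))"
    by (rule integrable_bounded_mult[where B = 1]) (use f in \<open>auto simp: indicator_def\<close>)
  have "(\<integral>\<^sup>+x. ennreal (Th n f x) * indicator A x \<partial>M) = (\<integral>\<^sup>+x. ennreal (Th n f x * indicator A x) \<partial>M)"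
    by (rule nn_integral_cong) (auto simp: indicator_def)
  also have "\<dots> = ennreal (\<integral>x. Th n f x * indicator A x \<partial>M)"
    by (rule nn_integral_eq_integral[OF 1], rule eventually_mono[OF Th_nonneg[OF f, of n]]) simp
  also have "\<dots> = ennreal (\<integral>x. f x * indicator A ((T ^^ n) x) \<partial>M)" by (simp only: Th_dual_set[OF f(1) A])
  also have "\<dots> = (\<integral>\<^sup>+x. ennreal (f x * indicator A ((T ^^ n) x)) \<partial>M)"
    by (rule nn_integral_eq_integral[OF 2, symmetric]) (use f in \<open>auto elim!: eventually_mono\<close>)
  also have "\<dots> = (\<integral>\<^sup>+x. ennreal (f x) * indicator A ((T ^^ n) x) \<partial>M)"
    by (rule nn_integral_cong) (auto simp: indicator_def)
  finally show ?thesis .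
qed

text \<open>A pointwise lower bound for a transfer image amounts to an inequality of integrals over
  sets. Nonnegative integrals are used so that Tonelli's theorem can be applied to them
  directly.\<close>

lemma (in mp_system) Th_ge_nn:
  assumes f: "integrable M f" "AE x in M. 0 \<le> f x" and h: "integrable M h" "AE x in M. 0 \<le> h x"
    and le: "\<And>A. A \<in> sets M \<Longrightarrow> (\<integral>\<^sup>+x. ennreal (h x) * indicator A x \<partial>M) \<le> (\<integral>\<^sup>+x. ennreal (f x) * indicator A ((T ^^ n) x) \<partial>M)"
  shows "AE x in M. h x \<le> Th n f x"
proof (rule AE_le_if_set_integrals_le[OF h(1) Th_integrable[OF f(1)]])
  fix A assume A[measurable]: "A \<in> sets M"
  have nn: "ennreal (\<integral>x. k x * indicator A x \<partial>M) = (\<integral>\<^sup>+x. ennreal (k x) * indicator A x \<partial>M)"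
    if k: "integrable M k" "AE x in M. 0 \<le> k x" for k :: "'a \<Rightarrow> real"
  proof -
    have "(\<integral>\<^sup>+x. ennreal (k x * indicator A x) \<partial>M) = ennreal (\<integral>x. k x * indicator A x \<partial>M)"
      by (rule nn_integral_eq_integral) (use k A in \<open>auto intro!: integrable_real_mult_indicator elim!: eventually_mono\<close>)
    moreover have "(\<integral>\<^sup>+x. ennreal (k x * indicator A x) \<partial>M) = (\<integral>\<^sup>+x. ennreal (k x) * indicator A x \<partial>M)"
      by (rule nn_integral_cong) (auto simp: indicator_def)
    ultimately show ?thesis by simp
  qed
  have "ennreal (\<integral>x. h x * indicator A x \<partial>M) \<le> ennreal (\<integral>x. Th n f x * indicator A x \<partial>M)"
    unfolding nn[OF h] nn[OF Th_integrable[OF f(1)] Th_nonneg[OF f]] Th_dual_nn[OF f A] by (rule le[OF A])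
  moreover have "0 \<le> (\<integral>x. Th n f x * indicator A x \<partial>M)"
    by (rule integral_nonneg_AE, rule eventually_mono[OF Th_nonneg[OF f, of n]]) simp
  ultimately show "(\<integral>x. h x * indicator A x \<partial>M) \<le> (\<integral>x. Th n f x * indicator A x \<partial>M)" by simp
qed

section \<open>The suspension measure and the flow\<close>

locale suspension =
  fixes m :: "('w::polish_space \<times> real) measure" and \<Psi> :: "real \<Rightarrow> 'w \<times> real \<Rightarrow> 'w \<times> real"
    and \<mu> :: "'w measure" and \<tau> :: "'w \<Rightarrow> 'w" and r :: "'w \<Rightarrow> real" and c :: real
  assumes semiflow: "mp_semiflow m \<Psi>" and sec: "is_section m \<Psi> \<mu> \<tau> r"
    and c_pos: "0 < c" and c_le: "AE x in \<mu>. c \<le> r x"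
begin

lemma mps_base: "mp_system \<mu> \<tau>" and prob_base: "prob_space \<mu>"
  using sec by (auto simp: is_section_def prob_preserving_def polish_measure_space_def mp_system_def mp_system_axioms_def)

sublocale base: mp_system \<mu> \<tau> by (rule mps_base)
sublocale base: prob_space \<mu> by (rule prob_base)
sublocale pair: pair_sigma_finite \<mu> lborel ..

lemma mps_flow: "0 \<le> t \<Longrightarrow> mp_system m (\<Psi> t)"
  using semiflow by (auto simp: mp_semiflow_def polish_measure_space_def mp_system_def mp_system_axioms_def)

lemma r_meas [measurable]: "r \<in> borel_measurable \<mu>"
  using sec by (simp add: is_section_def)

lemma m_eq: "m = restrict_space (\<mu> \<Otimes>\<^sub>M lborel) {(x, s). x \<in> space \<mu> \<and> 0 \<le> s \<and> s < r x}"
  using sec by (simp add: is_section_def suspension_measure_def)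

lemma space_m: "space m = {(x, s). x \<in> space \<mu> \<and> 0 \<le> s \<and> s < r x}"
  unfolding m_eq by (auto simp: space_restrict_space space_pair_measure)

lemma space_m_sets: "space m \<in> sets (\<mu> \<Otimes>\<^sub>M lborel)"
proof -
  have "space m = {z \<in> space (\<mu> \<Otimes>\<^sub>M lborel). 0 \<le> snd z \<and> snd z < r (fst z)}"
    by (auto simp: space_m space_pair_measure)
  also have "\<dots> \<in> sets (\<mu> \<Otimes>\<^sub>M lborel)" by measurable
  finally show ?thesis .
qed

lemma m_restrict: "m = restrict_space (\<mu> \<Otimes>\<^sub>M lborel) (space m)"
  unfolding space_m by (rule m_eq)

lemma sets_m_prod: "B \<in> sets m \<Longrightarrow> B \<in> sets (\<mu> \<Otimes>\<^sub>M lborel) \<and> B \<subseteq> space m"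
  using sets_restrict_space_iff[of "space m" "\<mu> \<Otimes>\<^sub>M lborel" B] space_m_sets sets.Int_space_eq2[OF space_m_sets]
  by (simp add: m_restrict[symmetric])

lemma measurable_m: "f \<in> measurable (\<mu> \<Otimes>\<^sub>M lborel) N \<Longrightarrow> f \<in> measurable m N"
  by (subst m_restrict) (rule measurable_restrict_space1)

lemma fst_meas [measurable]: "fst \<in> measurable m \<mu>" and snd_meas [measurable]: "snd \<in> borel_measurable m"
  by (rule measurable_m, simp)+

lemma nn_integral_m:
  assumes f: "f \<in> borel_measurable m"
  shows "(\<integral>\<^sup>+z. f z \<partial>m) = (\<integral>\<^sup>+x. \<integral>\<^sup>+y. f (x, y) * indicator {0..<r x} y \<partial>lborel \<partial>\<mu>)"
proof -
  let ?P = "\<mu> \<Otimes>\<^sub>M lborel"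
  have S: "space m \<inter> space ?P \<in> sets ?P" using space_m_sets by simp
  have fm: "(\<lambda>z. f z * indicator (space m) z) \<in> borel_measurable ?P"
    using f borel_measurable_restrict_space_iff_ennreal[OF S, of f] by (simp add: m_restrict[symmetric])
  have "(\<integral>\<^sup>+z. f z \<partial>m) = (\<integral>\<^sup>+z. f z * indicator (space m) z \<partial>?P)"
    by (subst m_restrict) (rule nn_integral_restrict_space[OF S])
  also have "\<dots> = (\<integral>\<^sup>+x. \<integral>\<^sup>+y. f (x, y) * indicator (space m) (x, y) \<partial>lborel \<partial>\<mu>)"
    by (rule lborel.nn_integral_fst[OF fm, symmetric])
  also have "\<dots> = (\<integral>\<^sup>+x. \<integral>\<^sup>+y. f (x, y) * indicator {0..<r x} y \<partial>lborel \<partial>\<mu>)"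
    by (intro nn_integral_cong) (auto simp: space_m indicator_def)
  finally show ?thesis .
qed

lemma AE_m_fst: assumes "AE x in \<mu>. P x" shows "AE z in m. P (fst z)"
proof -
  obtain N where N: "\<And>x. x \<in> space \<mu> - N \<Longrightarrow> P x" "N \<in> null_sets \<mu>" using AE_E3[OF assms] by blast
  have [measurable]: "N \<in> sets \<mu>" using N by auto
  let ?B = "{z \<in> space m. fst z \<in> N}"
  have B: "?B \<in> sets m" by measurable
  have "emeasure m ?B = (\<integral>\<^sup>+z. indicator ?B z \<partial>m)" using B by simp
  also have "\<dots> = (\<integral>\<^sup>+x. \<integral>\<^sup>+y. indicator ?B (x, y) * indicator {0..<r x} y \<partial>lborel \<partial>\<mu>)"
    by (rule nn_integral_m) (use B in simp)
  also have "\<dots> = (\<integral>\<^sup>+x. 0 \<partial>\<mu>)"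
  proof (rule nn_integral_cong_AE)
    show "AE x in \<mu>. (\<integral>\<^sup>+y. indicator ?B (x, y) * indicator {0..<r x} y \<partial>lborel) = 0"
      using AE_not_in[OF N(2)] by eventually_elim (simp add: indicator_def)
  qed
  finally have "?B \<in> null_sets m" using B by (auto simp: null_sets_def)
  then show ?thesis
  proof (rule AE_I')
    show "{z \<in> space m. \<not> P (fst z)} \<subseteq> ?B"
    proof
      fix z assume "z \<in> {z \<in> space m. \<not> P (fst z)}"
      then show "z \<in> ?B" using N(1)[of "fst z"] by (cases "fst z \<in> N") (auto simp: space_m)
    qed
  qed
qed

lemma AE_tame_base: "AE x in \<mu>. tame_orbit \<tau> r c x"
proof -
  have "AE x in \<mu>. \<forall>k. c \<le> r ((\<tau> ^^ k) x)"
    unfolding AE_all_countable by (intro allI base.AE_iter c_le)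
  then show ?thesis using c_pos by (auto simp: tame_orbit_def)
qed

lemma AE_tame: "AE z in m. tame_orbit \<tau> r c (fst z) \<and> fst z \<in> space \<mu> \<and> 0 \<le> snd z \<and> snd z < r (fst z)"
  using AE_m_fst[OF AE_tame_base] AE_space by eventually_elim (auto simp: space_m)

lemma crossings_meas [measurable]: "crossings \<tau> r T \<in> measurable m (count_space UNIV)"
  unfolding crossings_def[abs_def] by measurable

lemma flow_add: "0 \<le> s \<Longrightarrow> 0 \<le> t \<Longrightarrow> AE z in m. \<Psi> (s + t) z = \<Psi> s (\<Psi> t z)"
  using semiflow by (simp add: mp_semiflow_def)

lemma flow_iter: assumes t: "0 \<le> t" shows "AE z in m. (\<Psi> t ^^ n) z = \<Psi> (real n * t) z"
proof (induction n)
  case 0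
  then show ?case using semiflow by (auto simp: mp_semiflow_def elim!: eventually_mono)
next
  case (Suc n)
  have "AE z in m. \<Psi> (t + real n * t) z = \<Psi> t (\<Psi> (real n * t) z)" using t by (intro flow_add) auto
  with Suc show ?case by eventually_elim (simp add: distrib_right)
qed

lemma flow_eq:
  assumes "0 \<le> T"
  shows "AE z in m. \<Psi> T z = ((\<tau> ^^ crossings \<tau> r T z) (fst z), snd z + T - birkhoff_sum \<tau> (crossings \<tau> r T z) r (fst z))"
proof -
  have "AE z in m. \<Psi> T z = suspension_flow \<tau> r T z" using sec assms by (simp add: is_section_def)
  with AE_tame show ?thesis
  proof eventually_elim
    fix z assume z: "tame_orbit \<tau> r c (fst z) \<and> fst z \<in> space \<mu> \<and> 0 \<le> snd z \<and> snd z < r (fst z)"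
      and eq: "\<Psi> T z = suspension_flow \<tau> r T z"
    interpret tame_orbit \<tau> r c "fst z" using z by simp
    show "\<Psi> T z = ((\<tau> ^^ crossings \<tau> r T z) (fst z), snd z + T - birkhoff_sum \<tau> (crossings \<tau> r T z) r (fst z))"
      using suspension_flow_eq[of "snd z" T] z assms eq by simp
  qed
qed

section \<open>Crossings as a cocycle over the flow\<close>

lemma crossings_cocycle:
  assumes "0 \<le> T" "0 \<le> S"
  shows "AE z in m. crossings \<tau> r (T + S) z = crossings \<tau> r T z + crossings \<tau> r S (\<Psi> T z)"
proof -
  have "AE z in m. \<Psi> T z = suspension_flow \<tau> r T z" using sec assms by (simp add: is_section_def)
  with AE_tame show ?thesis
  proof eventually_elim
    fix z assume z: "tame_orbit \<tau> r c (fst z) \<and> fst z \<in> space \<mu> \<and> 0 \<le> snd z \<and> snd z < r (fst z)"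
      and eq: "\<Psi> T z = suspension_flow \<tau> r T z"
    interpret tame_orbit \<tau> r c "fst z" using z by simp
    show "crossings \<tau> r (T + S) z = crossings \<tau> r T z + crossings \<tau> r S (\<Psi> T z)"
      using crossings_add[of "snd z" T S] z assms eq by simp
  qed
qed

text \<open>Iterated cocycle identity: the count up to time \<open>n * t\<close> is a Birkhoff sum
  for \<open>\<Psi> t\<close>, hence available as the denominator in the ratio ergodic
  theorem.\<close>

lemma birkhoff_crossings:
  assumes t: "0 \<le> t"
  shows "AE z in m. birkhoff_sum (\<Psi> t) n (\<lambda>z. real (crossings \<tau> r t z)) z = real (crossings \<tau> r (real n * t) z)"
proof -
  interpret F: mp_system m "\<Psi> t" by (rule mps_flow[OF t])
  show ?thesis
  proof (induction n)
    case 0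
    show ?case using AE_tame
    proof eventually_elim
      fix z assume z: "tame_orbit \<tau> r c (fst z) \<and> fst z \<in> space \<mu> \<and> 0 \<le> snd z \<and> snd z < r (fst z)"
      interpret tame_orbit \<tau> r c "fst z" using z by simp
      have "crossings \<tau> r 0 (fst z, snd z) = 0" using z by (subst crossings_iff) (auto simp: birkhoff_sum_def)
      then show "birkhoff_sum (\<Psi> t) 0 (\<lambda>z. real (crossings \<tau> r t z)) z = real (crossings \<tau> r (real 0 * t) z)"
        by (simp add: birkhoff_sum_def)
    qed
  next
    case (Suc n)
    have "AE z in m. crossings \<tau> r (t + real n * t) z = crossings \<tau> r t z + crossings \<tau> r (real n * t) (\<Psi> t z)"
      using t by (intro crossings_cocycle) auto
    with F.AE_T[OF Suc] show ?case
      by eventually_elim (simp add: F.birkhoff_sum_Suc distrib_right)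
  qed
qed

lemma crossings_at_top:
  assumes t: "0 < t"
  shows "AE z in m. filterlim (\<lambda>n. real (crossings \<tau> r (real n * t) z)) at_top sequentially"
  using AE_tame
proof eventually_elim
  fix z assume z: "tame_orbit \<tau> r c (fst z) \<and> fst z \<in> space \<mu> \<and> 0 \<le> snd z \<and> snd z < r (fst z)"
  interpret tame_orbit \<tau> r c "fst z" using z by simp
  show "filterlim (\<lambda>n. real (crossings \<tau> r (real n * t) z)) at_top sequentially"
    unfolding filterlim_at_top
  proof
    fix Z :: real
    obtain k :: nat where k: "Z \<le> real k" using real_arch_simple by blast
    obtain n0 :: nat where n0: "birkhoff_sum \<tau> k r (fst z) < real n0 * t" using t reals_Archimedean3 by blast
    have "Z \<le> real (crossings \<tau> r (real n * t) z)" if "n \<ge> n0" for n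
    proof -
      have "real n0 * t \<le> real n * t" using that t by simp
      then have "birkhoff_sum \<tau> k r (fst z) \<le> snd z + real n * t" using n0 z by linarith
      then have "k \<le> crossings \<tau> r (real n * t) (fst z, snd z)"
        using z t by (subst crossings_ge_iff) auto
      then show ?thesis using k by simp
    qed
    then show "\<forall>\<^sub>F n in sequentially. Z \<le> real (crossings \<tau> r (real n * t) z)"
      unfolding eventually_sequentially by blast
  qed
qed

text \<open>The rectangle lies below the roof almost everywhere, so its measure is that of the
  product.\<close>

lemma nn_integral_low:
  assumes A: "A \<in> sets \<mu>" and ab: "0 \<le> \<alpha>" "\<alpha> \<le> \<beta>" "\<beta> \<le> c"
  shows "(\<integral>\<^sup>+z. indicator (A \<times> {\<alpha>..<\<beta>}) z \<partial>m) = ennreal ((\<beta> - \<alpha>) * measure \<mu> A)"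
proof -
  note [measurable] = A
  have "(\<integral>\<^sup>+z. indicator (A \<times> {\<alpha>..<\<beta>}) z \<partial>m)
      = (\<integral>\<^sup>+x. \<integral>\<^sup>+y. indicator (A \<times> {\<alpha>..<\<beta>}) (x, y) * indicator {0..<r x} y \<partial>lborel \<partial>\<mu>)"
    by (rule nn_integral_m, rule measurable_m) simp
  also have "\<dots> = (\<integral>\<^sup>+x. ennreal (\<beta> - \<alpha>) * indicator A x \<partial>\<mu>)"
  proof (rule nn_integral_cong_AE)
    show "AE x in \<mu>. (\<integral>\<^sup>+y. indicator (A \<times> {\<alpha>..<\<beta>}) (x, y) * indicator {0..<r x} y \<partial>lborel) = ennreal (\<beta> - \<alpha>) * indicator A x"
      using c_le
    proof eventually_elim
      fix x assume "c \<le> r x"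
      then have "(\<integral>\<^sup>+y. indicator (A \<times> {\<alpha>..<\<beta>}) (x, y) * indicator {0..<r x} y \<partial>lborel)
          = (\<integral>\<^sup>+y. indicator A x * indicator {\<alpha>..<\<beta>} y \<partial>lborel)"
        using ab by (intro nn_integral_cong) (auto simp: indicator_def)
      also have "\<dots> = ennreal (\<beta> - \<alpha>) * indicator A x"
        using ab by (simp add: nn_integral_cmult_indicator mult.commute)
      finally show "(\<integral>\<^sup>+y. indicator (A \<times> {\<alpha>..<\<beta>}) (x, y) * indicator {0..<r x} y \<partial>lborel) = ennreal (\<beta> - \<alpha>) * indicator A x" .
    qed
  qed
  also have "\<dots> = ennreal (\<beta> - \<alpha>) * emeasure \<mu> A" by (rule nn_integral_cmult_indicator) simp
  also have "\<dots> = ennreal ((\<beta> - \<alpha>) * measure \<mu> A)" using ab by (simp add: base.emeasure_eq_measure ennreal_mult)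
  finally show ?thesis .
qed

lemma integral_low:
  assumes A: "A \<in> sets \<mu>" and ab: "0 \<le> \<alpha>" "\<alpha> \<le> \<beta>" "\<beta> \<le> c"
  shows "integrable m (indicator (A \<times> {\<alpha>..<\<beta>}) :: _ \<Rightarrow> real)"
    and "(\<integral>z. indicator (A \<times> {\<alpha>..<\<beta>}) z \<partial>m) = (\<beta> - \<alpha>) * measure \<mu> A"
proof -
  note [measurable] = A
  have [measurable]: "(indicator (A \<times> {\<alpha>..<\<beta>}) :: _ \<Rightarrow> real) \<in> borel_measurable m"
    by (rule measurable_m) simp
  have nn: "(\<integral>\<^sup>+z. ennreal (indicator (A \<times> {\<alpha>..<\<beta>}) z) \<partial>m) = ennreal ((\<beta> - \<alpha>) * measure \<mu> A)"
    using nn_integral_low[OF A ab] by (simp add: ennreal_indicator)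
  show "integrable m (indicator (A \<times> {\<alpha>..<\<beta>}) :: _ \<Rightarrow> real)"
    by (rule integrableI_nonneg) (auto simp: nn)
  show "(\<integral>z. indicator (A \<times> {\<alpha>..<\<beta>}) z \<partial>m) = (\<beta> - \<alpha>) * measure \<mu> A"
    by (subst integral_eq_nn_integral) (use ab in \<open>auto simp: nn\<close>)
qed

text \<open>A time of at most \<open>c\<close> allows one crossing, and it has happened exactly when
  the height at the end is below \<open>s\<close>. Visits of the orbit to the strip and crossings of
  the section are thereby the same count.\<close>

lemma crossings_small_AE:
  assumes s: "0 < s" "s \<le> c"
  shows "AE z in m. real (crossings \<tau> r s z) = indicator (space \<mu> \<times> {0..<s}) (\<Psi> s z)"
  using AE_tame flow_eq[OF less_imp_le[OF s(1)]]
proof eventually_elim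
  fix z assume z: "tame_orbit \<tau> r c (fst z) \<and> fst z \<in> space \<mu> \<and> 0 \<le> snd z \<and> snd z < r (fst z)"
    and eq: "\<Psi> s z = ((\<tau> ^^ crossings \<tau> r s z) (fst z), snd z + s - birkhoff_sum \<tau> (crossings \<tau> r s z) r (fst z))"
  interpret tame_orbit \<tau> r c "fst z" using z by simp
  have "crossings \<tau> r s (fst z, snd z) = (if r (fst z) \<le> snd z + s then 1 else 0)"
    using z s by (intro crossings_small) auto
  then show "real (crossings \<tau> r s z) = indicator (space \<mu> \<times> {0..<s}) (\<Psi> s z)"
    using z s base.T_space[of "fst z"] unfolding eq by (auto simp: birkhoff_sum_def indicator_def)
qed

lemma crossings_small_integral:
  assumes s: "0 < s" "s \<le> c"
  shows "integrable m (\<lambda>z. real (crossings \<tau> r s z))" and "(\<integral>z. real (crossings \<tau> r s z) \<partial>m) = s"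
proof -
  interpret F: mp_system m "\<Psi> s" using s by (intro mps_flow) simp
  let ?i = "indicator (space \<mu> \<times> {0..<s}) :: _ \<Rightarrow> real"
  have i: "integrable m ?i" "(\<integral>z. ?i z \<partial>m) = s"
    using integral_low[of "space \<mu>" 0 s] s base.prob_space by auto
  have iT: "integrable m (\<lambda>z. ?i (\<Psi> s z))" using F.integrable_iter[OF i(1), of 1] by simp
  show "integrable m (\<lambda>z. real (crossings \<tau> r s z))"
    by (rule integrable_cong_AE_imp[OF iT]) (use crossings_small_AE[OF s] in \<open>auto elim: eventually_mono\<close>)
  have "(\<integral>z. real (crossings \<tau> r s z) \<partial>m) = (\<integral>z. ?i (\<Psi> s z) \<partial>m)"
    by (rule integral_cong_AE) (use crossings_small_AE[OF s] iT in \<open>auto\<close>)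
  also have "\<dots> = s" using F.integral_iter[of ?i 1] i by auto
  finally show "(\<integral>z. real (crossings \<tau> r s z) \<partial>m) = s" .
qed

text \<open>For steps of length at most \<open>c\<close> the mean is the measure of the strip; a
  longer time is divided into \<open>q\<close> such steps and invariance is used.\<close>

lemma crossings_integral:
  assumes t: "0 < t"
  shows "integrable m (\<lambda>z. real (crossings \<tau> r t z))" and "(\<integral>z. real (crossings \<tau> r t z) \<partial>m) = t"
proof -
  obtain q :: nat where q: "t / c < real q" using reals_Archimedean2 by blast
  have q0: "0 < real q" using q t c_pos by (meson divide_pos_pos less_trans)
  define s where "s = t / real q"
  have s: "0 < s" "s \<le> c" "real q * s = t" using q q0 t c_pos by (auto simp: s_def field_simps)
  interpret F: mp_system m "\<Psi> s" using s by (intro mps_flow) simp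
  let ?p = "\<lambda>z. real (crossings \<tau> r s z)"
  have p: "integrable m ?p" "(\<integral>z. ?p z \<partial>m) = s" by (rule crossings_small_integral[OF s(1,2)])+
  have pk: "integrable m (\<lambda>z. ?p ((\<Psi> s ^^ k) z))" for k by (rule F.integrable_iter[OF p(1)])
  have eq: "AE z in m. real (crossings \<tau> r t z) = (\<Sum>k<q. ?p ((\<Psi> s ^^ k) z))"
    using birkhoff_crossings[of s q] s unfolding birkhoff_sum_def by (auto elim: eventually_mono)
  have i: "integrable m (\<lambda>z. \<Sum>k<q. ?p ((\<Psi> s ^^ k) z))" using pk by auto
  show "integrable m (\<lambda>z. real (crossings \<tau> r t z))"
    by (rule integrable_cong_AE_imp[OF i]) (use eq in \<open>auto elim: eventually_mono\<close>)
  have "(\<integral>z. real (crossings \<tau> r t z) \<partial>m) = (\<integral>z. (\<Sum>k<q. ?p ((\<Psi> s ^^ k) z)) \<partial>m)"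
    by (rule integral_cong_AE) (use eq i in auto)
  also have "\<dots> = (\<Sum>k<q. \<integral>z. ?p ((\<Psi> s ^^ k) z) \<partial>m)" by (rule Bochner_Integration.integral_sum) (rule pk)
  also have "\<dots> = (\<Sum>k<q. s)" using F.integral_iter[of ?p] p by simp
  finally show "(\<integral>z. real (crossings \<tau> r t z) \<partial>m) = t" using s by simp
qed

text \<open>
  A point over \<open>A\<close> at height in \<open>[\<alpha>, \<beta>)\<close> that returns \<open>k\<close> times and lands at height \<open>y\<close> has
  \<open>k\<close>-th return time in \<open>n s - y + [\<alpha>, \<beta>)\<close>. As \<open>local_prob\<close> is determined only up to null sets
  for each value of its last argument, \<open>y\<close> is replaced by a constant \<open>y0\<close>.
\<close>

lemma transfer_lower:
  assumes A: "A \<in> sets \<mu>" and ab: "0 \<le> \<alpha>" "\<alpha> \<le> \<beta>" "\<beta> \<le> c" and s: "0 < s"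
  shows "AE z in m. y0 \<le> snd z \<longrightarrow> snd z < y0 + \<eta> \<longrightarrow>
    local_prob \<mu> \<tau> r A {\<alpha>..<\<beta> - \<eta>} k (real n * s - y0) (fst z)
    \<le> (transfer_op m (\<Psi> s) ^^ n)
        (\<lambda>z. indicator (A \<times> {\<alpha>..<\<beta>}) z * indicator {z. crossings \<tau> r (real n * s) z = k} z) z"
proof -
  note [measurable] = A
  interpret F: mp_system m "\<Psi> s" using s by (intro mps_flow) simp
  define T where "T = real n * s"
  have T: "0 \<le> T" using s by (simp add: T_def)
  \<comment> \<open>A \<open>k\<close>-th return time in this interval together with a landing
    height in \<open>[y0, y0 + \<eta>)\<close> forces a starting height in
    \<open>[\<alpha>, \<beta>)\<close>; the interval is shortened by \<eta> for that
    purpose.\<close>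
  define E where "E = A \<inter> {x \<in> space \<mu>. birkhoff_sum \<tau> k r x \<in> {T - y0 + \<alpha>..<T - y0 + (\<beta> - \<eta>)}}"
  have E[measurable]: "E \<in> sets \<mu>" unfolding E_def by measurable
  define q where "q = base.Th k (indicator E :: _ \<Rightarrow> real)"
  have q_eq: "local_prob \<mu> \<tau> r A {\<alpha>..<\<beta> - \<eta>} k (real n * s - y0) = q"
    unfolding local_prob_def q_def E_def T_def image_add_atLeastLessThan by (simp add: add.commute)
  have iE: "integrable \<mu> (indicator E :: _ \<Rightarrow> real)" "AE x in \<mu>. 0 \<le> (indicator E x :: real)"
    by (auto simp: base.emeasure_eq_measure)
  have q: "integrable \<mu> q" "AE x in \<mu>. 0 \<le> q x"
    unfolding q_def using iE by (auto intro!: base.Th_nonneg)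
  have [measurable]: "q \<in> borel_measurable \<mu>" using q by auto
  define h where "h z = indicator {y0..<y0 + \<eta>} (snd z) * q (fst z)" for z
  define f where "f z = (indicator (A \<times> {\<alpha>..<\<beta>}) z * indicator {z. crossings \<tau> r T z = k} z :: real)" for z
  have AB: "(indicator (A \<times> {\<alpha>..<\<beta>}) :: _ \<Rightarrow> real) \<in> borel_measurable m" by (rule measurable_m) simp
  have f: "integrable m f" unfolding f_def
    by (rule F.integrable_bounded_mult[where B = 1, OF integral_low(1)[OF A ab]]) (auto simp: indicator_def)
  have h_meas[measurable]: "h \<in> borel_measurable m" unfolding h_def by measurable
  have h: "integrable m h"
  proof (rule integrableI_bounded)
    have "(\<integral>\<^sup>+z. ennreal (norm (h z)) \<partial>m) = (\<integral>\<^sup>+x. \<integral>\<^sup>+y. ennreal (norm (h (x, y))) * indicator {0..<r x} y \<partial>lborel \<partial>\<mu>)"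
      by (rule nn_integral_m) simp
    also have "\<dots> \<le> (\<integral>\<^sup>+x. \<integral>\<^sup>+y. ennreal (norm (q x)) * indicator {y0..<y0 + \<eta>} y \<partial>lborel \<partial>\<mu>)"
      by (intro nn_integral_mono) (auto simp: h_def indicator_def)
    also have "\<dots> = (\<integral>\<^sup>+x. ennreal (norm (q x)) * emeasure lborel {y0..<y0 + \<eta>} \<partial>\<mu>)"
      by (intro nn_integral_cong nn_integral_cmult_indicator) simp
    also have "\<dots> = (\<integral>\<^sup>+x. ennreal (norm (q x)) \<partial>\<mu>) * emeasure lborel {y0..<y0 + \<eta>}"
      by (rule nn_integral_multc) simp
    also have "\<dots> < \<infinity>"
      using q(1) emeasure_bounded_finite[of "{y0..<y0 + \<eta>}"]
      by (simp add: ennreal_mult_less_top integrable_iff_bounded)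
    finally show "(\<integral>\<^sup>+z. ennreal (norm (h z)) \<partial>m) < \<infinity>" .
  qed simp
  have h0: "AE z in m. 0 \<le> h z" using AE_m_fst[OF q(2)] by eventually_elim (simp add: h_def)
  have "AE z in m. h z \<le> F.Th n f z"
  proof (rule F.Th_ge_nn[OF f _ h h0])
    show "AE z in m. 0 \<le> f z" by (simp add: f_def)
    fix B assume B: "B \<in> sets m"
    have BP[measurable]: "B \<in> sets (\<mu> \<Otimes>\<^sub>M lborel)" and Bsub: "B \<subseteq> space m" using sets_m_prod[OF B] by auto
    note [measurable] = B
    let ?H = "\<lambda>x y. indicator {y0..<y0 + \<eta>} y * (indicator E x * indicator B ((\<tau> ^^ k) x, y)) :: ennreal"
    have Hm: "(\<lambda>(x, y). ?H x y) \<in> borel_measurable (\<mu> \<Otimes>\<^sub>M lborel)" by measurable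
    have "(\<integral>\<^sup>+z. ennreal (h z) * indicator B z \<partial>m)
        = (\<integral>\<^sup>+x. \<integral>\<^sup>+y. ennreal (h (x, y)) * indicator B (x, y) * indicator {0..<r x} y \<partial>lborel \<partial>\<mu>)"
      by (rule nn_integral_m) simp
    also have "\<dots> = (\<integral>\<^sup>+x. \<integral>\<^sup>+y. indicator {y0..<y0 + \<eta>} y * (ennreal (q x) * indicator B (x, y)) \<partial>lborel \<partial>\<mu>)"
      using Bsub by (intro nn_integral_cong) (auto simp: h_def indicator_def space_m)
    also have "\<dots> = (\<integral>\<^sup>+y. \<integral>\<^sup>+x. indicator {y0..<y0 + \<eta>} y * (ennreal (q x) * indicator B (x, y)) \<partial>\<mu> \<partial>lborel)"
      by (rule pair.Fubini'[symmetric]) measurable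
    \<comment> \<open>For each fixed landing height, the duality of the base transfer operator is
      applied to the horizontal section of \<open>B\<close>.\<close>
    also have "\<dots> = (\<integral>\<^sup>+y. \<integral>\<^sup>+x. ?H x y \<partial>\<mu> \<partial>lborel)"
    proof (rule nn_integral_cong)
      fix y :: real
      let ?By = "(\<lambda>x. (x, y)) -` B \<inter> space \<mu>"
      have By[measurable]: "?By \<in> sets \<mu>" using sets_Pair2[OF BP, of y] by auto
      have ind: "indicator ?By x = (indicator B (x, y) :: ennreal)" if "x \<in> space \<mu>" for x using that by (simp add: indicator_def)
      have "(\<integral>\<^sup>+x. ennreal (q x) * indicator B (x, y) \<partial>\<mu>) = (\<integral>\<^sup>+x. ennreal (q x) * indicator ?By x \<partial>\<mu>)"
        by (rule nn_integral_cong) (simp add: ind)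
      also have "\<dots> = (\<integral>\<^sup>+x. ennreal (indicator E x) * indicator ?By ((\<tau> ^^ k) x) \<partial>\<mu>)"
        unfolding q_def by (rule base.Th_dual_nn[OF iE By])
      also have "\<dots> = (\<integral>\<^sup>+x. indicator E x * indicator B ((\<tau> ^^ k) x, y) \<partial>\<mu>)"
        by (rule nn_integral_cong) (simp add: ind base.iter_space ennreal_indicator)
      finally show "(\<integral>\<^sup>+x. indicator {y0..<y0 + \<eta>} y * (ennreal (q x) * indicator B (x, y)) \<partial>\<mu>) = (\<integral>\<^sup>+x. ?H x y \<partial>\<mu>)"
        using BP by (subst (1 2) nn_integral_cmult) auto
    qed
    also have "\<dots> = (\<integral>\<^sup>+x. \<integral>\<^sup>+y. ?H x y \<partial>lborel \<partial>\<mu>)" by (rule pair.Fubini'[OF Hm])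
    also have "\<dots> \<le> (\<integral>\<^sup>+x. \<integral>\<^sup>+y. indicator (A \<times> {\<alpha>..<\<beta>}) (x, y)
          * indicator B ((\<tau> ^^ k) x, y + T - birkhoff_sum \<tau> k r x) * indicator {0..<r x} y \<partial>lborel \<partial>\<mu>)"
    proof (rule nn_integral_mono_AE)
      show "AE x in \<mu>. (\<integral>\<^sup>+y. ?H x y \<partial>lborel) \<le> (\<integral>\<^sup>+y. indicator (A \<times> {\<alpha>..<\<beta>}) (x, y)
          * indicator B ((\<tau> ^^ k) x, y + T - birkhoff_sum \<tau> k r x) * indicator {0..<r x} y \<partial>lborel)"
        using c_le AE_space
      proof eventually_elim
        fix x assume cr: "c \<le> r x" and x: "x \<in> space \<mu>"
        let ?R = "birkhoff_sum \<tau> k r x"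
        have "{y. ((\<tau> ^^ k) x, y) \<in> B} \<in> sets borel"
          using sets_Pair1[OF BP, of "(\<tau> ^^ k) x"] by (simp add: vimage_def)
        moreover have "(\<lambda>y. indicator B ((\<tau> ^^ k) x, y) :: ennreal) = indicator {y. ((\<tau> ^^ k) x, y) \<in> B}"
          by (auto simp: indicator_def fun_eq_iff)
        ultimately have sec: "(\<lambda>y. indicator B ((\<tau> ^^ k) x, y) :: ennreal) \<in> borel_measurable borel" by simp
        have "(\<integral>\<^sup>+y. indicator (A \<times> {\<alpha>..<\<beta>}) (x, y) * indicator B ((\<tau> ^^ k) x, y + T - ?R) * indicator {0..<r x} y \<partial>lborel)
            = (\<integral>\<^sup>+y. indicator A x * indicator {\<alpha>..<\<beta>} y * indicator B ((\<tau> ^^ k) x, y + T - ?R) \<partial>lborel)"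
          using ab cr by (intro nn_integral_cong) (auto simp: indicator_def)
        \<comment> \<open>The starting height is replaced by the landing height as the variable, a
          translation by \<open>?R - T\<close>.\<close>
        also have "\<dots> = ennreal \<bar>1\<bar> * (\<integral>\<^sup>+y. indicator A x * indicator {\<alpha>..<\<beta>} (?R - T + 1 * y) * indicator B ((\<tau> ^^ k) x, (?R - T + 1 * y) + T - ?R) \<partial>lborel)"
          by (rule nn_integral_real_affine) (auto intro!: borel_measurable_times_ennreal measurable_compose[OF _ sec])
        also have "\<dots> = (\<integral>\<^sup>+y. indicator A x * indicator {\<alpha>..<\<beta>} (?R - T + y) * indicator B ((\<tau> ^^ k) x, y) \<partial>lborel)"
          by simp
        also have "\<dots> \<ge> (\<integral>\<^sup>+y. ?H x y \<partial>lborel)"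
          by (rule nn_integral_mono) (auto simp: E_def indicator_def)
        finally show "(\<integral>\<^sup>+y. ?H x y \<partial>lborel) \<le> (\<integral>\<^sup>+y. indicator (A \<times> {\<alpha>..<\<beta>}) (x, y)
          * indicator B ((\<tau> ^^ k) x, y + T - ?R) * indicator {0..<r x} y \<partial>lborel)" .
      qed
    qed
    also have "\<dots> = (\<integral>\<^sup>+z. indicator (A \<times> {\<alpha>..<\<beta>}) z * indicator B ((\<tau> ^^ k) (fst z), snd z + T - birkhoff_sum \<tau> k r (fst z)) \<partial>m)"
    proof (subst nn_integral_m)
      have "(\<lambda>z. ((\<tau> ^^ k) (fst z), snd z + T - birkhoff_sum \<tau> k r (fst z))) \<in> measurable (\<mu> \<Otimes>\<^sub>M lborel) (\<mu> \<Otimes>\<^sub>M lborel)"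
        by measurable
      then show "(\<lambda>z. indicator (A \<times> {\<alpha>..<\<beta>}) z * indicator B ((\<tau> ^^ k) (fst z), snd z + T - birkhoff_sum \<tau> k r (fst z)) :: ennreal) \<in> borel_measurable m"
        by (intro measurable_m borel_measurable_times_ennreal measurable_compose[OF _ borel_measurable_indicator[OF BP]]) auto
    qed simp
    also have "\<dots> = (\<integral>\<^sup>+z. ennreal (f z) * indicator B ((\<Psi> s ^^ n) z) \<partial>m)"
    proof (rule nn_integral_cong_AE)
      show "AE z in m. indicator (A \<times> {\<alpha>..<\<beta>}) z * indicator B ((\<tau> ^^ k) (fst z), snd z + T - birkhoff_sum \<tau> k r (fst z))
          = ennreal (f z) * indicator B ((\<Psi> s ^^ n) z)"
        using AE_tame flow_iter[OF less_imp_le[OF s], of n] flow_eq[OF T]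
      proof eventually_elim
        fix z assume z: "tame_orbit \<tau> r c (fst z) \<and> fst z \<in> space \<mu> \<and> 0 \<le> snd z \<and> snd z < r (fst z)"
          and 1: "(\<Psi> s ^^ n) z = \<Psi> (real n * s) z"
          and 2: "\<Psi> T z = ((\<tau> ^^ crossings \<tau> r T z) (fst z), snd z + T - birkhoff_sum \<tau> (crossings \<tau> r T z) r (fst z))"
        interpret tame_orbit \<tau> r c "fst z" using z by simp
        have iff: "crossings \<tau> r T z = j \<longleftrightarrow> birkhoff_sum \<tau> j r (fst z) \<le> snd z + T \<and> snd z + T < birkhoff_sum \<tau> (Suc j) r (fst z)" for j
          using crossings_iff[of "snd z" T j] z T by simp
        \<comment> \<open>\<open>B\<close> lies below the roof, so landing in \<open>B\<close> after
          \<open>k\<close> iterates fixes the number of crossings as \<open>k\<close>.\<close>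
        have 3: "crossings \<tau> r T z = k" if "((\<tau> ^^ k) (fst z), snd z + T - birkhoff_sum \<tau> k r (fst z)) \<in> B"
        proof -
          have "0 \<le> snd z + T - birkhoff_sum \<tau> k r (fst z)" "snd z + T - birkhoff_sum \<tau> k r (fst z) < r ((\<tau> ^^ k) (fst z))"
            using that Bsub by (auto simp: space_m)
          then show ?thesis unfolding iff by (simp add: birkhoff_sum_def)
        qed
        show "indicator (A \<times> {\<alpha>..<\<beta>}) z * indicator B ((\<tau> ^^ k) (fst z), snd z + T - birkhoff_sum \<tau> k r (fst z))
          = ennreal (f z) * indicator B ((\<Psi> s ^^ n) z)"
          using 3 unfolding 1 T_def[symmetric] 2 f_def by (auto simp: indicator_def)
      qed
    qed
    finally show "(\<integral>\<^sup>+z. ennreal (h z) * indicator B z \<partial>m) \<le> (\<integral>\<^sup>+z. ennreal (f z) * indicator B ((\<Psi> s ^^ n) z) \<partial>m)" .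
  qed
  then show ?thesis unfolding q_eq unfolding T_def[symmetric] f_def[symmetric]
    by eventually_elim (auto simp: h_def)
qed

end

section \<open>The return sequence and the tail of the roof function\<close>

text \<open>Twice the sum over pairs of indices \<open>j \<le> i\<close>; the inner sums are
  lengthened to \<open>n\<close> terms, which makes them Birkhoff sums restarted at time
  \<open>j\<close> when \<open>x\<close> is read along an orbit.\<close>

lemma square_sum_le:
  fixes x :: "nat \<Rightarrow> real"
  assumes "\<And>j. 0 \<le> x j"
  shows "(\<Sum>j<n. x j)\<^sup>2 \<le> 2 * (\<Sum>j<n. x j * (\<Sum>i<n. x (j + i)))"
proof -
  have "(\<Sum>j<n. x j)\<^sup>2 \<le> 2 * (\<Sum>j<n. x j * (\<Sum>i\<in>{j..<n}. x i))"
  proof (induction n)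
    case 0 then show ?case by simp
  next
    case (Suc n)
    have "(\<Sum>j<Suc n. x j * (\<Sum>i\<in>{j..<Suc n}. x i)) = (\<Sum>j<n. x j * (\<Sum>i\<in>{j..<n}. x i)) + x n * (\<Sum>j<n. x j) + (x n)\<^sup>2"
      by (simp add: distrib_left sum.distrib sum_distrib_left power2_eq_square mult.commute)
    moreover have "(\<Sum>j<Suc n. x j)\<^sup>2 = (\<Sum>j<n. x j)\<^sup>2 + 2 * (x n * (\<Sum>j<n. x j)) + (x n)\<^sup>2"
      by (simp add: power2_eq_square algebra_simps)
    moreover have "0 \<le> (x n)\<^sup>2" by simp
    ultimately show ?case using Suc by linarith
  qed
  also have "\<dots> \<le> 2 * (\<Sum>j<n. x j * (\<Sum>i<n. x (j + i)))"
  proof (intro mult_left_mono sum_mono)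
    fix j
    have "(\<Sum>i\<in>{j..<n}. x i) = (\<Sum>i<n - j. x (j + i))"
      by (rule sum.reindex_bij_witness[of _ "\<lambda>i. j + i" "\<lambda>i. i - j"]) auto
    also have "\<dots> \<le> (\<Sum>i<n. x (j + i))" using assms by (intro sum_mono2) auto
    finally show "(\<Sum>i\<in>{j..<n}. x i) \<le> (\<Sum>i<n. x (j + i))" .
  qed (use assms in auto)
  finally show ?thesis .
qed

text \<open>
  Uniform integrability from a bound on second moments by the squares of the means, which are
  not assumed to be bounded.
\<close>

lemma expectation_limit:
  fixes D :: "nat \<Rightarrow> 'a \<Rightarrow> real"
  assumes M: "prob_space M" and Y: "real_distribution Y" "AE y in Y. 0 < y" "integrable Y (\<lambda>y. y)" "(\<integral>y. y \<partial>Y) = 1"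
    and D: "\<And>n. integrable M (D n)" "\<And>n. integrable M (\<lambda>x. (D n x)\<^sup>2)" "\<And>n x. 0 \<le> D n x"
    and weak: "weak_conv_m (\<lambda>n. distr M borel (D n)) Y"
    and sq: "0 < C" "\<forall>\<^sub>F n in sequentially. (\<integral>x. (D n x)\<^sup>2 \<partial>M) \<le> C * (\<integral>x. D n x \<partial>M)\<^sup>2"
  shows "(\<lambda>n. \<integral>x. D n x \<partial>M) \<longlonglongrightarrow> 1"
proof -
  interpret M: prob_space M by (rule M)
  interpret Y: real_distribution Y by (rule Y(1))
  have [measurable]: "D n \<in> borel_measurable M" for n using D(1) by auto
  define \<rho> where "\<rho> n = (\<integral>x. D n x \<partial>M)" for n
  have \<rho>0: "0 \<le> \<rho> n" for n unfolding \<rho>_def by (rule integral_nonneg_AE) (use D in auto)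
  define t where "t K n = (\<integral>x. min (D n x) K \<partial>M)" for K n
  define y where "y K = (\<integral>z. min (max 0 z) K \<partial>Y)" for K
  have imin: "integrable M (\<lambda>x. min (D n x) K)" for n K using D(1)[of n] by auto
  have t_le: "t K n \<le> \<rho> n" for K n unfolding t_def \<rho>_def by (rule integral_mono) (use imin D in auto)
  have ty: "t K \<longlonglongrightarrow> y K" if "0 < K" for K
  proof -
    have "(\<lambda>n. \<integral>z. min (max 0 z) K \<partial>distr M borel (D n)) \<longlonglongrightarrow> y K"
      unfolding y_def
    proof (rule weak_conv_imp_integral_bdd_continuous_conv[OF _ Y(1) weak])
      show "isCont (\<lambda>z. min (max 0 z) K) x" for x :: real by (intro continuous_intros)
      show "norm (min (max 0 z) K) \<le> K" for z :: real using that by auto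
    qed simp
    moreover have "(\<integral>z. min (max 0 z) K \<partial>distr M borel (D n)) = t K n" for n
      unfolding t_def using D(3) by (subst integral_distr) (auto simp: max_absorb2)
    ultimately show ?thesis by simp
  qed
  have imax: "integrable Y (\<lambda>z. min (max 0 z) K)" for K using Y(3) by auto
  have mean: "(\<integral>z. max 0 z \<partial>Y) = 1"
  proof -
    have "(\<integral>z. max 0 z \<partial>Y) = (\<integral>z. z \<partial>Y)" by (rule integral_cong_AE) (use Y(2) in auto)
    then show ?thesis using Y(4) by simp
  qed
  have y_le: "y K \<le> 1" for K
    unfolding y_def mean[symmetric] by (rule integral_mono) (use Y(3) imax in auto)
  have "(\<lambda>k. y (real k)) \<longlonglongrightarrow> (\<integral>z. max 0 z \<partial>Y)"
    unfolding y_def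
  proof (rule integral_dominated_convergence[where w = "\<lambda>z. max 0 z"])
    show "AE z in Y. (\<lambda>k. min (max 0 z) (real k)) \<longlonglongrightarrow> max 0 z"
    proof (rule AE_I2, rule tendsto_eventually)
      fix z :: real
      obtain k0 :: nat where "max 0 z \<le> real k0" using real_arch_simple by blast
      then show "\<forall>\<^sub>F k in sequentially. min (max 0 z) (real k) = max 0 z"
        unfolding eventually_sequentially by (intro exI[of _ k0]) (auto simp: min_def)
    qed
    show "AE z in Y. norm (min (max 0 z) (real k)) \<le> max 0 z" for k by auto
    show "integrable Y (\<lambda>z. max 0 z)" using Y(3) by auto
  qed simp_all
  then have y_lim: "(\<lambda>k. y (real k)) \<longlonglongrightarrow> 1" by (simp only: mean)
  \<comment> \<open>Beyond the level \<open>K\<close>, a value is at most its square divided by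
    \<open>K\<close>.\<close>
  have trunc: "\<forall>\<^sub>F n in sequentially. \<forall>K>0. \<rho> n \<le> t K n + C * (\<rho> n)\<^sup>2 / K"
    using sq(2)
  proof eventually_elim
    fix n assume le: "(\<integral>x. (D n x)\<^sup>2 \<partial>M) \<le> C * (\<integral>x. D n x \<partial>M)\<^sup>2"
    show "\<forall>K>0. \<rho> n \<le> t K n + C * (\<rho> n)\<^sup>2 / K"
    proof (intro allI impI)
      fix K :: real assume K: "0 < K"
      have "\<rho> n \<le> (\<integral>x. min (D n x) K + (D n x)\<^sup>2 / K \<partial>M)"
        unfolding \<rho>_def
      proof (rule integral_mono)
        fix x
        show "D n x \<le> min (D n x) K + (D n x)\<^sup>2 / K"
        proof (cases "D n x \<le> K")
          case False
          then have "D n x * K \<le> D n x * D n x" using D(3) by (intro mult_left_mono) auto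
          then have "D n x \<le> (D n x)\<^sup>2 / K" using K by (simp add: pos_le_divide_eq power2_eq_square)
          then show ?thesis using False K by simp
        qed (use K in simp)
      qed (use imin D in auto)
      also have "\<dots> = t K n + (\<integral>x. (D n x)\<^sup>2 \<partial>M) / K" unfolding t_def using imin D by simp
      also have "\<dots> \<le> t K n + C * (\<rho> n)\<^sup>2 / K" using le K by (simp add: \<rho>_def divide_right_mono)
      finally show "\<rho> n \<le> t K n + C * (\<rho> n)\<^sup>2 / K" .
    qed
  qed
  \<comment> \<open>The second moment bound is in terms of the unknown means, so large means must be
    excluded first. At the truncation level \<open>2 * C * \<rho> n\<close> the tail contributes at
    most half of the mean. If the mean were at least 8, the truncated part would be less than a
    quarter of it, since truncation at \<open>16 * C\<close> has a limit of at most 1 and is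
    eventually below 2.\<close>
  have bounded: "\<forall>\<^sub>F n in sequentially. \<rho> n < 8"
  proof -
    have "\<forall>\<^sub>F n in sequentially. t (16 * C) n < 2"
      using order_tendstoD(2)[OF ty[of "16 * C"], of 2] y_le[of "16 * C"] sq(1) by simp
    then show ?thesis using trunc
    proof eventually_elim
      fix n assume t2: "t (16 * C) n < 2" and tr: "\<forall>K>0. \<rho> n \<le> t K n + C * (\<rho> n)\<^sup>2 / K"
      show "\<rho> n < 8"
      proof (rule ccontr)
        assume "\<not> \<rho> n < 8"
        then have \<rho>: "8 \<le> \<rho> n" by simp
        have "t (2 * C * \<rho> n) n \<le> (\<integral>x. (\<rho> n / 8) * min (D n x) (16 * C) \<partial>M)"
          unfolding t_def
        proof (rule integral_mono)
          fix x
          have "1 * D n x \<le> \<rho> n / 8 * D n x" using \<rho> D(3) by (intro mult_right_mono) auto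
          moreover have "\<rho> n / 8 * (16 * C) = 2 * C * \<rho> n" by simp
          ultimately show "min (D n x) (2 * C * \<rho> n) \<le> (\<rho> n / 8) * min (D n x) (16 * C)"
            by (auto simp: min_def)
        qed (use imin in auto)
        also have "\<dots> = \<rho> n / 8 * t (16 * C) n" unfolding t_def by simp
        also have "\<dots> < \<rho> n / 8 * 2" using t2 \<rho> by (intro mult_strict_left_mono) auto
        finally have 1: "t (2 * C * \<rho> n) n < \<rho> n / 4" by simp
        have "\<rho> n \<le> t (2 * C * \<rho> n) n + C * (\<rho> n)\<^sup>2 / (2 * C * \<rho> n)" using \<rho> sq(1) by (intro tr[rule_format]) simp
        also have "C * (\<rho> n)\<^sup>2 / (2 * C * \<rho> n) = \<rho> n / 2" using \<rho> sq(1) by (simp add: power2_eq_square)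
        finally show False using 1 \<rho> by simp
      qed
    qed
  qed
  have "\<rho> \<longlonglongrightarrow> 1"
  proof (rule tendstoI)
    fix e :: real assume e: "e > 0"
    have "\<forall>\<^sub>F k in sequentially. 1 - e / 2 < y (real k)" using order_tendstoD(1)[OF y_lim, of "1 - e / 2"] e by simp
    moreover obtain k1 :: nat where k1: "128 * C / e < real k1" using reals_Archimedean2 by blast
    ultimately obtain k where k: "k \<ge> max 1 k1" "1 - e / 2 < y (real k)"
      by (auto simp: eventually_sequentially) (meson max.cobounded1 max.cobounded2 order_trans nat_le_linear)
    have k0: "0 < real k" and "128 * C / e < real k" using k(1) k1 by auto
    then have Ck: "64 * C / real k < e / 2" using e by (simp add: field_simps)
    have "\<forall>\<^sub>F n in sequentially. 1 - e < t (real k) n" "\<forall>\<^sub>F n in sequentially. t (real k) n < 1 + e / 2"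
      using order_tendstoD[OF ty[OF k0]] k(2) y_le[of "real k"] e by (auto)
    then show "\<forall>\<^sub>F n in sequentially. dist (\<rho> n) 1 < e" using bounded trunc
    proof eventually_elim
      fix n assume 1: "1 - e < t (real k) n" "t (real k) n < 1 + e / 2" "\<rho> n < 8" and tr: "\<forall>K>0. \<rho> n \<le> t K n + C * (\<rho> n)\<^sup>2 / K"
      have "(\<rho> n)\<^sup>2 \<le> 8\<^sup>2" using 1 \<rho>0 by (intro power_mono) auto
      then have "C * (\<rho> n)\<^sup>2 / real k \<le> C * 64 / real k" using sq(1) k0 by (intro divide_right_mono mult_left_mono) auto
      moreover have "C * 64 / real k < e / 2" using Ck by (simp only: mult.commute)
      ultimately have "\<rho> n < 1 + e" using tr[rule_format, OF k0] 1 by linarith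
      moreover have "1 - e < \<rho> n" using 1 t_le[of "real k" n] by linarith
      ultimately show "dist (\<rho> n) 1 < e" by (auto simp: dist_real_def abs_less_iff)
    qed
  qed
  then show ?thesis unfolding \<rho>_def .
qed

section \<open>Weak limit of the number of crossings\<close>

context suspension
begin

lemma crossings_base_meas [measurable]: "(\<lambda>x. crossings \<tau> r T (x, y)) \<in> measurable \<mu> (count_space UNIV)"
  unfolding crossings_def fst_conv snd_conv by measurable

text \<open>Counting and return times are inverse to each other: at most \<open>l * b T\<close>
  crossings up to \<open>T\<close> means that a return time of index about \<open>l * b T\<close>
  exceeds \<open>T\<close>. Dividing by \<open>binv\<close> turns this into the stable limit at the
  point \<open>l powr (- 1 / \<gamma>)\<close>, and the law of \<open>Y\<close> is the image of the
  stable law under the inverse power.\<close>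

lemma crossings_weak_limit:
  assumes rv: "monotone_rv \<gamma> b binv" and s: "0 < s"
    and Y: "real_distribution Y" "AE y in Y. 0 < y"
    and weak: "weak_conv_m (\<lambda>n. distr \<mu> borel (\<lambda>x. birkhoff_sum \<tau> n r x / binv (real n))) (stable_law \<gamma> Y)"
    and tail: "((\<lambda>t. measure \<mu> {x \<in> space \<mu>. r x > t}) \<longlongrightarrow> 0) at_top"
  shows "weak_conv_m (\<lambda>n. distr \<mu> borel (\<lambda>x. real (crossings \<tau> r (real n * s) (x, 0)) / b (real n * s))) Y"
proof -
  interpret rv: monotone_rv \<gamma> b binv by (rule rv)
  interpret Y: real_distribution Y by (rule Y(1))
  let ?D = "\<lambda>n x. real (crossings \<tau> r (real n * s) (x, 0)) / b (real n * s)"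
  let ?X = "\<lambda>n x. birkhoff_sum \<tau> n r x / binv (real n)"
  have Dm: "?D n \<in> borel_measurable \<mu>" for n by measurable
  have Xm: "?X n \<in> borel_measurable \<mu>" for n by measurable
  have ns: "filterlim (\<lambda>n. real n * s) at_top sequentially"
    using filterlim_tendsto_pos_mult_at_top[OF tendsto_const s filterlim_real_sequentially] by (simp add: mult.commute)
  have bns: "filterlim (\<lambda>n. b (real n * s)) at_top sequentially"
    by (rule filterlim_compose[OF rv.b_inf ns])
  have cdfD: "cdf (distr \<mu> borel (?D n)) l = measure \<mu> {x \<in> space \<mu>. ?D n x \<le> l}" for n l
    unfolding cdf_def by (subst measure_distr[OF Dm]) (auto intro!: arg_cong[where f = "measure \<mu>"])
  have cdfX: "cdf (distr \<mu> borel (?X n)) l = measure \<mu> {x \<in> space \<mu>. ?X n x \<le> l}" for n l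
    unfolding cdf_def by (subst measure_distr[OF Xm]) (auto intro!: arg_cong[where f = "measure \<mu>"])
  have compl: "measure \<mu> {x \<in> space \<mu>. real k \<le> real (crossings \<tau> r T (x, 0))} = measure \<mu> {x \<in> space \<mu>. birkhoff_sum \<tau> k r x \<le> T}"
    if "0 \<le> T" for k T
  proof (rule measure_eq_AE)
    show "AE x in \<mu>. (x \<in> {x \<in> space \<mu>. real k \<le> real (crossings \<tau> r T (x, 0))}) = (x \<in> {x \<in> space \<mu>. birkhoff_sum \<tau> k r x \<le> T})"
      using AE_tame_base
    proof eventually_elim
      fix x assume "tame_orbit \<tau> r c x"
      then interpret tame_orbit \<tau> r c x .
      show "(x \<in> {x \<in> space \<mu>. real k \<le> real (crossings \<tau> r T (x, 0))}) = (x \<in> {x \<in> space \<mu>. birkhoff_sum \<tau> k r x \<le> T})"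
        using crossings_ge_iff[of 0 T k] that by simp
    qed
  qed measurable
  show ?thesis
    unfolding weak_conv_m_def weak_conv_def
  proof (intro allI impI)
    fix l assume cont: "isCont (cdf Y) l"
    then have atom: "measure Y {l} = 0" by (simp add: Y.isCont_cdf)
    consider "l < 0" | "l = 0" | "0 < l" by linarith
    then show "(\<lambda>n. cdf (distr \<mu> borel (?D n)) l) \<longlonglongrightarrow> cdf Y l"
    proof cases
      case 1
      have "measure \<mu> {x \<in> space \<mu>. ?D n x \<le> l} = 0" for n
      proof -
        have "0 \<le> ?D n x" for x using less_imp_le[OF rv.b_pos] by (intro divide_nonneg_nonneg) auto
        then have "{x \<in> space \<mu>. ?D n x \<le> l} = {}" using 1 by (auto simp: not_le intro: less_le_trans)
        then show ?thesis by (simp only: measure_empty)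
      qed
      moreover have "cdf Y l = 0"
      proof -
        have "AE y in Y. y \<notin> {..l}" using Y(2) by eventually_elim (use 1 in auto)
        then show ?thesis unfolding cdf_def using Y.prob_eq_0[of "{..l}"] by (simp add: measure_def)
      qed
      ultimately show ?thesis unfolding cdfD by simp
    next
      \<comment> \<open>At 0 the event is that no return has happened, so the tail of
        \<open>r\<close> decides.\<close>
      case 2
      have "cdf Y l = 0"
      proof -
        have "AE y in Y. y \<notin> {..l}" using Y(2) by eventually_elim (use 2 in auto)
        then show ?thesis unfolding cdf_def using Y.prob_eq_0[of "{..l}"] by (simp add: measure_def)
      qed
      moreover have "(\<lambda>n. measure \<mu> {x \<in> space \<mu>. r x > real n * s}) \<longlonglongrightarrow> 0"
        by (rule filterlim_compose[OF tail ns])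
      moreover have "measure \<mu> {x \<in> space \<mu>. ?D n x \<le> l} = measure \<mu> {x \<in> space \<mu>. r x > real n * s}" for n
      proof (rule measure_eq_AE)
        show "AE x in \<mu>. (x \<in> {x \<in> space \<mu>. ?D n x \<le> l}) = (x \<in> {x \<in> space \<mu>. r x > real n * s})"
          using AE_tame_base
        proof eventually_elim
          fix x assume "tame_orbit \<tau> r c x"
          then interpret tame_orbit \<tau> r c x .
          have "?D n x \<le> l \<longleftrightarrow> \<not> 1 \<le> crossings \<tau> r (real n * s) (x, 0)"
            using 2 rv.b_pos[of "real n * s"] by (auto simp: divide_le_0_iff not_le)
          also have "\<dots> \<longleftrightarrow> r x > real n * s" using crossings_ge_iff[of 0 "real n * s" 1] s by (simp add: birkhoff_sum_def not_le)
          finally show "(x \<in> {x \<in> space \<mu>. ?D n x \<le> l}) = (x \<in> {x \<in> space \<mu>. r x > real n * s})" by simp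
        qed
      qed measurable
      ultimately show ?thesis unfolding cdfD by simp
    next
      case 3
      \<comment> \<open>The successor of the floor makes \<open>N \<le> l * b (n * s)\<close>
        equivalent to \<open>N < k n\<close> for natural numbers \<open>N\<close>.\<close>
      define k where "k n = Suc (nat \<lfloor>l * b (real n * s)\<rfloor>)" for n
      have kb: "l * b (real n * s) < real (k n)" "real (k n) \<le> l * b (real n * s) + 1" for n
      proof -
        have "0 \<le> l * b (real n * s)" using 3 rv.b_pos[of "real n * s"] by simp
        then show "l * b (real n * s) < real (k n)" "real (k n) \<le> l * b (real n * s) + 1" unfolding k_def of_nat_Suc by linarith+
      qed
      have kl: "(\<lambda>n. real (k n) / b (real n * s)) \<longlonglongrightarrow> l"
      proof (rule tendsto_sandwich[of "\<lambda>n. l" _ _ "\<lambda>n. l + inverse (b (real n * s))"])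
        show "\<forall>\<^sub>F n in sequentially. l \<le> real (k n) / b (real n * s)"
          using kb rv.b_pos by (intro always_eventually allI) (simp add: pos_le_divide_eq less_imp_le)
        show "\<forall>\<^sub>F n in sequentially. real (k n) / b (real n * s) \<le> l + inverse (b (real n * s))"
          using kb rv.b_pos by (intro always_eventually allI) (simp add: pos_divide_le_eq distrib_right less_imp_neq[symmetric])
        show "(\<lambda>n. l + inverse (b (real n * s))) \<longlonglongrightarrow> l"
          using tendsto_add[OF tendsto_const tendsto_inverse_0_at_top[OF bns], of l] by simp
      qed simp
      define X where "X = l powr (- 1 / \<gamma>)"
      have X: "0 < X" using 3 by (simp add: X_def)
      have k_inf: "filterlim (\<lambda>n. real (k n)) at_top sequentially"
      proof -
        from filterlim_tendsto_pos_mult_at_top[OF kl 3 bns]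
        show ?thesis using rv.b_pos by (simp add: order_less_imp_not_eq2)
      qed
      have k_nat: "filterlim k at_top sequentially"
        unfolding filterlim_at_top
      proof
        fix J :: nat
        have "\<forall>\<^sub>F n in sequentially. real J \<le> real (k n)" using k_inf unfolding filterlim_at_top by blast
        then show "\<forall>\<^sub>F n in sequentially. J \<le> k n" by simp
      qed
      define x where "x n = real n * s / binv (real (k n))" for n
      have "(\<lambda>n. inverse (binv (real (k n)) / (real n * s))) \<longlonglongrightarrow> inverse (l powr (1 / \<gamma>))"
        using 3 by (intro tendsto_inverse rv.binv_ratio[OF ns kl]) auto
      then have xX: "x \<longlonglongrightarrow> X" by (simp add: x_def[abs_def] X_def powr_minus)
      let ?G = "\<lambda>j. cdf (distr \<mu> borel (?X j))" and ?Z = "stable_law \<gamma> Y"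
      interpret Z: real_distribution ?Z unfolding stable_law_def by (rule Y.real_distribution_distr) simp
      have mZ: "measure ?Z A = measure Y {y. y powr (- 1 / \<gamma>) \<in> A}" if "A \<in> sets borel" for A
        unfolding stable_law_def using that by (subst measure_distr) (auto simp: vimage_def)
      have "measure ?Z {X} = measure Y {l}"
      proof (subst mZ)
        show "measure Y {y. y powr (- 1 / \<gamma>) \<in> {X}} = measure Y {l}"
        proof (rule measure_eq_AE)
          show "AE y in Y. (y \<in> {y. y powr (- 1 / \<gamma>) \<in> {X}}) = (y \<in> {l})"
            using Y(2)
          proof eventually_elim
            fix y :: real assume y: "0 < y"
            have "y = l" if "y powr (- 1 / \<gamma>) = l powr (- 1 / \<gamma>)"
            proof -
              have "(y powr (- 1 / \<gamma>)) powr (- \<gamma>) = (l powr (- 1 / \<gamma>)) powr (- \<gamma>)" using that by simp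
              then show ?thesis using y 3 rv.gamma by (simp add: powr_powr)
            qed
            then show "(y \<in> {y. y powr (- 1 / \<gamma>) \<in> {X}}) = (y \<in> {l})" by (auto simp: X_def)
          qed
        qed auto
      qed simp
      then have contZ: "isCont (cdf ?Z) X" using atom by (simp add: Z.isCont_cdf)
      have GX: "cdf ?Z X = 1 - cdf Y l"
      proof -
        have "cdf ?Z X = measure Y {y. y powr (- 1 / \<gamma>) \<in> {..X}}" unfolding cdf_def by (rule mZ) simp
        also have "\<dots> = measure Y (space Y - {..<l})"
        proof (rule measure_eq_AE)
          show "AE y in Y. (y \<in> {y. y powr (- 1 / \<gamma>) \<in> {..X}}) = (y \<in> space Y - {..<l})"
            using Y(2)
          proof eventually_elim
            fix y :: real assume y: "0 < y"
            have "y powr (- 1 / \<gamma>) \<le> l powr (- 1 / \<gamma>) \<longleftrightarrow> l \<le> y"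
            proof
              assume "l \<le> y" then show "y powr (- 1 / \<gamma>) \<le> l powr (- 1 / \<gamma>)"
                using 3 rv.gamma by (intro powr_mono2') auto
            next
              assume le: "y powr (- 1 / \<gamma>) \<le> l powr (- 1 / \<gamma>)"
              show "l \<le> y"
              proof (rule ccontr)
                assume "\<not> l \<le> y"
                then have "l powr (- 1 / \<gamma>) < y powr (- 1 / \<gamma>)" using y rv.gamma by (intro powr_less_mono2_neg) auto
                then show False using le by simp
              qed
            qed
            then show "(y \<in> {y. y powr (- 1 / \<gamma>) \<in> {..X}}) = (y \<in> space Y - {..<l})" by (auto simp: X_def)
          qed
        qed auto
        also have "\<dots> = 1 - measure Y {..<l}" by (rule Y.prob_compl) simp
        also have "measure Y {..<l} = measure Y {..l}"
        proof -
          have "measure Y ({..<l} \<union> {l}) = measure Y {..<l} + measure Y {l}"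
            by (rule Y.finite_measure_Union) auto
          moreover have "{..<l} \<union> {l} = {..l}" by auto
          ultimately show ?thesis using atom by simp
        qed
        finally show ?thesis by (simp add: cdf_def)
      qed
      have mono: "?G j u \<le> ?G j v" if "u \<le> v" for j u v
      proof -
        interpret P: prob_space "distr \<mu> borel (?X j)" by (rule base.prob_space_distr[OF Xm])
        interpret F: finite_borel_measure "distr \<mu> borel (?X j)" by standard simp
        show ?thesis by (rule F.cdf_nondecreasing[OF that])
      qed
      \<comment> \<open>The argument \<open>x n\<close> moves with \<open>n\<close>, so weak
        convergence is used at two fixed continuity points on either side of
        \<open>X\<close>.\<close>
      have "(\<lambda>n. ?G (k n) (x n)) \<longlonglongrightarrow> cdf ?Z X"
      proof (rule tendstoI)
        fix e :: real assume e: "e > 0"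
        obtain d where d: "d > 0" "\<And>u. dist u X < d \<Longrightarrow> dist (cdf ?Z u) (cdf ?Z X) < e / 2"
          using contZ e unfolding continuous_at_eps_delta by (metis half_gt_zero)
        have cnt: "countable {u. \<not> isCont (cdf ?Z) u}"
          using Z.countable_support by (simp add: Z.isCont_cdf)
        obtain u where u: "u \<in> {X - d<..<X}" "isCont (cdf ?Z) u"
          using real_interval_avoid_countable_set[of "X - d" X, OF _ cnt] d(1) by auto
        obtain v where v: "v \<in> {X<..<X + d}" "isCont (cdf ?Z) v"
          using real_interval_avoid_countable_set[of X "X + d", OF _ cnt] d(1) by auto
        have "(\<lambda>j. ?G j u) \<longlonglongrightarrow> cdf ?Z u" "(\<lambda>j. ?G j v) \<longlonglongrightarrow> cdf ?Z v"
          using weak u v unfolding weak_conv_m_def weak_conv_def by auto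
        then have l1: "(\<lambda>n. ?G (k n) u) \<longlonglongrightarrow> cdf ?Z u" and l2: "(\<lambda>n. ?G (k n) v) \<longlonglongrightarrow> cdf ?Z v"
          using filterlim_compose[OF _ k_nat] by blast+
        have "dist (cdf ?Z u) (cdf ?Z X) < e / 2" "dist (cdf ?Z v) (cdf ?Z X) < e / 2"
          using u v d by (auto simp: dist_real_def)
        then have "cdf ?Z X - e < cdf ?Z u" "cdf ?Z v < cdf ?Z X + e" using e unfolding dist_real_def abs_less_iff by linarith+
        then have "\<forall>\<^sub>F n in sequentially. cdf ?Z X - e < ?G (k n) u" "\<forall>\<^sub>F n in sequentially. ?G (k n) v < cdf ?Z X + e"
          using order_tendstoD[OF l1] order_tendstoD[OF l2] by auto
        moreover have "\<forall>\<^sub>F n in sequentially. u < x n" "\<forall>\<^sub>F n in sequentially. x n < v"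
          using order_tendstoD[OF xX] u v by auto
        ultimately show "\<forall>\<^sub>F n in sequentially. dist (?G (k n) (x n)) (cdf ?Z X) < e"
        proof eventually_elim
          fix n assume "cdf ?Z X - e < ?G (k n) u" "?G (k n) v < cdf ?Z X + e" "u < x n" "x n < v"
          moreover have "?G (k n) u \<le> ?G (k n) (x n)" "?G (k n) (x n) \<le> ?G (k n) v"
            using \<open>u < x n\<close> \<open>x n < v\<close> by (auto intro!: mono)
          ultimately show "dist (?G (k n) (x n)) (cdf ?Z X) < e" unfolding dist_real_def abs_less_iff by linarith
        qed
      qed
      then have "(\<lambda>n. 1 - ?G (k n) (x n)) \<longlonglongrightarrow> 1 - cdf ?Z X" by (intro tendsto_intros)
      then have "(\<lambda>n. 1 - ?G (k n) (x n)) \<longlonglongrightarrow> cdf Y l" by (simp add: GX)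
      moreover have "\<forall>\<^sub>F n in sequentially. 1 - ?G (k n) (x n) = cdf (distr \<mu> borel (?D n)) l"
        using filterlim_at_top_dense[THEN iffD1, rule_format, OF filterlim_compose[OF rv.binv_inf k_inf], of 0]
      proof eventually_elim
        fix n assume bp: "0 < binv (real (k n))"
        have "?G (k n) (x n) = measure \<mu> {y \<in> space \<mu>. birkhoff_sum \<tau> (k n) r y \<le> real n * s}"
          unfolding cdfX x_def using bp by (simp add: divide_le_cancel)
        also have "\<dots> = measure \<mu> {y \<in> space \<mu>. real (k n) \<le> real (crossings \<tau> r (real n * s) (y, 0))}"
          using compl[of "real n * s" "k n"] s by simp
        also have "1 - \<dots> = measure \<mu> (space \<mu> - {y \<in> space \<mu>. real (k n) \<le> real (crossings \<tau> r (real n * s) (y, 0))})"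
          by (rule base.prob_compl[symmetric]) measurable
        also have "space \<mu> - {y \<in> space \<mu>. real (k n) \<le> real (crossings \<tau> r (real n * s) (y, 0))} = {y \<in> space \<mu>. ?D n y \<le> l}"
        proof -
          have "\<not> real (k n) \<le> real N \<longleftrightarrow> real N / b (real n * s) \<le> l" for N
          proof -
            have "real N / b (real n * s) \<le> l \<longleftrightarrow> real N \<le> l * b (real n * s)" using rv.b_pos by (simp add: pos_divide_le_eq)
            also have "\<dots> \<longleftrightarrow> \<not> k n \<le> N"
            proof
              assume "real N \<le> l * b (real n * s)" then show "\<not> k n \<le> N" using kb(1)[of n] by simp
            next
              assume "\<not> k n \<le> N"
              then have "real N + 1 \<le> real (k n)" by simp
              then show "real N \<le> l * b (real n * s)" using kb(2)[of n] by simp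
            qed
            finally show ?thesis by simp
          qed
          then show ?thesis by auto
        qed
        finally show "1 - ?G (k n) (x n) = cdf (distr \<mu> borel (?D n)) l" unfolding cdfD .
      qed
      ultimately show ?thesis by (rule Lim_transform_eventually)
    qed
  qed
qed


section \<open>Comparison of return sequences\<close>

lemma AE_snd_neq: "AE z in m. snd z \<noteq> y0"
proof -
  let ?B = "{z \<in> space m. snd z = y0}"
  have B: "?B \<in> sets m" by measurable
  have "emeasure m ?B = (\<integral>\<^sup>+z. indicator ?B z \<partial>m)" using B by simp
  also have "\<dots> = (\<integral>\<^sup>+x. \<integral>\<^sup>+y. indicator ?B (x, y) * indicator {0..<r x} y \<partial>lborel \<partial>\<mu>)"
    by (rule nn_integral_m) (use B in simp)
  also have "\<dots> \<le> (\<integral>\<^sup>+x. \<integral>\<^sup>+y. indicator {y0} y \<partial>lborel \<partial>\<mu>)"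
    by (intro nn_integral_mono) (auto simp: indicator_def)
  also have "\<dots> = 0" by simp
  finally have "?B \<in> null_sets m" using B by (auto simp: null_sets_def)
  then show ?thesis by (rule AE_I') auto
qed

text \<open>The measure is nonzero, so an almost sure statement holds somewhere. This extracts
  limits of numerical sequences from pointwise limits.\<close>

lemma AE_base_positive: "AE z in m. P z \<Longrightarrow> \<exists>z\<in>space m. P z"
proof (rule ccontr)
  assume "AE z in m. P z" "\<not> (\<exists>z\<in>space m. P z)"
  from \<open>AE z in m. P z\<close> AE_space have "AE z in m. False"
    by eventually_elim (use \<open>\<not> (\<exists>z\<in>space m. P z)\<close> in auto)
  then have "AE z in m. indicator (space \<mu> \<times> {0..<c}) z = (0::ennreal)" by eventually_elim simp
  then have "(\<integral>\<^sup>+z. indicator (space \<mu> \<times> {0..<c}) z \<partial>m) = (\<integral>\<^sup>+z. 0 \<partial>m)" by (rule nn_integral_cong_AE)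
  then show False using nn_integral_low[of "space \<mu>" 0 c] c_pos base.prob_space by simp
qed

text \<open>At a single point, the two normalizations of the same sums have the same positive
  limit.\<close>

lemma return_sequence_unique:
  assumes s: "0 \<le> s" and a: "return_sequence m (\<Psi> s) a" and a': "return_sequence m (\<Psi> s) a'"
  shows "(\<lambda>n. a n / a' n) \<longlonglongrightarrow> 1"
proof -
  let ?J = "indicator (space \<mu> \<times> {0..<c}) :: _ \<Rightarrow> real"
  let ?S = "\<lambda>n z. \<Sum>k<n. (transfer_op m (\<Psi> s) ^^ k) ?J z"
  have J: "integrable m ?J" "(\<integral>z. ?J z \<partial>m) = c"
    using integral_low[of "space \<mu>" 0 c] c_pos base.prob_space by auto
  have "AE z in m. (\<lambda>n. (1 / a n) * ?S n z) \<longlonglongrightarrow> (\<integral>z. ?J z \<partial>m)"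
    "AE z in m. (\<lambda>n. (1 / a' n) * ?S n z) \<longlonglongrightarrow> (\<integral>z. ?J z \<partial>m)"
    using a a' J(1) unfolding return_sequence_def by blast+
  then have "AE z in m. (\<lambda>n. (1 / a n) * ?S n z) \<longlonglongrightarrow> c \<and> (\<lambda>n. (1 / a' n) * ?S n z) \<longlonglongrightarrow> c"
    unfolding J(2) by eventually_elim simp
  from AE_base_positive[OF this] obtain z where z: "(\<lambda>n. (1 / a n) * ?S n z) \<longlonglongrightarrow> c" "(\<lambda>n. (1 / a' n) * ?S n z) \<longlonglongrightarrow> c"
    by auto
  have "(\<lambda>n. ((1 / a' n) * ?S n z) / ((1 / a n) * ?S n z)) \<longlonglongrightarrow> c / c"
    using c_pos by (intro tendsto_divide z) auto
  moreover have "\<forall>\<^sub>F n in sequentially. ((1 / a' n) * ?S n z) / ((1 / a n) * ?S n z) = a n / a' n"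
    using order_tendstoD(1)[OF z(1), of 0, OF c_pos] eventually_ge_at_top[of 1]
  proof eventually_elim
    fix n :: nat assume "0 < (1 / a n) * ?S n z" "1 \<le> n"
    then have "?S n z \<noteq> 0" by auto
    then show "((1 / a' n) * ?S n z) / ((1 / a n) * ?S n z) = a n / a' n" by simp
  qed
  ultimately have "(\<lambda>n. a n / a' n) \<longlonglongrightarrow> c / c" by (rule Lim_transform_eventually)
  then show ?thesis using c_pos by simp
qed

text \<open>Starting at a height below \<open>s\<close> instead of 0 brings the returns forward by
  less than \<open>c\<close>, the least distance between two of them.\<close>

lemma crossings_base_bounds:
  assumes s: "0 < s" "s \<le> c"
  shows "AE z in m. snd z < s \<longrightarrow> crossings \<tau> r (real n * s) (fst z, 0) \<le> crossings \<tau> r (real n * s) z \<and>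
     crossings \<tau> r (real n * s) z \<le> crossings \<tau> r (real n * s) (fst z, 0) + 1"
  using AE_tame
proof (eventually_elim, intro impI)
  fix z assume z: "tame_orbit \<tau> r c (fst z) \<and> fst z \<in> space \<mu> \<and> 0 \<le> snd z \<and> snd z < r (fst z)" and y: "snd z < s"
  interpret tame_orbit \<tau> r c "fst z" using z by simp
  let ?N = "crossings \<tau> r (real n * s) (fst z, 0)" and ?N' = "crossings \<tau> r (real n * s) (fst z, snd z)"
  have T: "0 \<le> real n * s" using s by simp
  have 1: "birkhoff_sum \<tau> ?N r (fst z) \<le> 0 + real n * s" "0 + real n * s < birkhoff_sum \<tau> (Suc ?N) r (fst z)"
    using crossings_iff[of 0 "real n * s" ?N] T by auto
  have "?N \<le> ?N'" using 1 z T by (subst crossings_ge_iff) auto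
  moreover have "\<not> ?N + 2 \<le> ?N'"
  proof
    assume "?N + 2 \<le> ?N'"
    then have "birkhoff_sum \<tau> (Suc (Suc ?N)) r (fst z) \<le> snd z + real n * s" using z T crossings_ge_iff[of "snd z" "real n * s" "?N + 2"] by simp
    then show False using returns_Suc[of "Suc ?N"] 1 y s by simp
  qed
  ultimately show "?N \<le> crossings \<tau> r (real n * s) z \<and> crossings \<tau> r (real n * s) z \<le> ?N + 1" by simp
qed

lemma integral_strip:
  assumes k: "integrable \<mu> k" "\<And>x. 0 \<le> k x" and s: "0 < s" "s \<le> c"
  shows "integrable m (\<lambda>z. indicator (space \<mu> \<times> {0..<s}) z * k (fst z))"
    and "(\<integral>z. indicator (space \<mu> \<times> {0..<s}) z * k (fst z) \<partial>m) = s * (\<integral>x. k x \<partial>\<mu>)"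
proof -
  have [measurable]: "k \<in> borel_measurable \<mu>" using k(1) by auto
  have [measurable]: "(indicator (space \<mu> \<times> {0..<s}) :: _ \<Rightarrow> real) \<in> borel_measurable m"
    by (rule measurable_m) simp
  have kf: "(\<lambda>z. k (fst z)) \<in> borel_measurable m" by measurable
  have "(\<integral>\<^sup>+z. ennreal (indicator (space \<mu> \<times> {0..<s}) z * k (fst z)) \<partial>m)
      = (\<integral>\<^sup>+x. \<integral>\<^sup>+y. ennreal (indicator (space \<mu> \<times> {0..<s}) (x, y) * k (fst (x, y))) * indicator {0..<r x} y \<partial>lborel \<partial>\<mu>)"
    by (rule nn_integral_m) simp
  also have "\<dots> = (\<integral>\<^sup>+x. ennreal (k x) * ennreal s \<partial>\<mu>)"
  proof (rule nn_integral_cong_AE)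
    show "AE x in \<mu>. (\<integral>\<^sup>+y. ennreal (indicator (space \<mu> \<times> {0..<s}) (x, y) * k (fst (x, y))) * indicator {0..<r x} y \<partial>lborel)
      = ennreal (k x) * ennreal s"
      using c_le AE_space
    proof eventually_elim
      fix x assume "c \<le> r x" "x \<in> space \<mu>"
      then have "(\<integral>\<^sup>+y. ennreal (indicator (space \<mu> \<times> {0..<s}) (x, y) * k (fst (x, y))) * indicator {0..<r x} y \<partial>lborel)
        = (\<integral>\<^sup>+y. ennreal (k x) * indicator {0..<s} y \<partial>lborel)"
        using s by (intro nn_integral_cong) (auto simp: indicator_def)
      also have "\<dots> = ennreal (k x) * ennreal s" using s by (simp add: nn_integral_cmult_indicator)
      finally show "(\<integral>\<^sup>+y. ennreal (indicator (space \<mu> \<times> {0..<s}) (x, y) * k (fst (x, y))) * indicator {0..<r x} y \<partial>lborel)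
        = ennreal (k x) * ennreal s" .
    qed
  qed
  also have "\<dots> = (\<integral>\<^sup>+x. ennreal (k x) \<partial>\<mu>) * ennreal s" by (rule nn_integral_multc) simp
  also have "\<dots> = ennreal (s * (\<integral>x. k x \<partial>\<mu>))"
    using k s by (subst nn_integral_eq_integral) (auto simp: ennreal_mult mult.commute)
  finally have nn: "(\<integral>\<^sup>+z. ennreal (indicator (space \<mu> \<times> {0..<s}) z * k (fst z)) \<partial>m) = ennreal (s * (\<integral>x. k x \<partial>\<mu>))" .
  show "integrable m (\<lambda>z. indicator (space \<mu> \<times> {0..<s}) z * k (fst z))"
    by (rule integrableI_nonneg) (use k nn kf in auto)
  show "(\<integral>z. indicator (space \<mu> \<times> {0..<s}) z * k (fst z) \<partial>m) = s * (\<integral>x. k x \<partial>\<mu>)"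
    by (subst integral_eq_nn_integral) (use k s nn kf in \<open>auto intro!: enn2real_ennreal mult_nonneg_nonneg\<close>)
qed

text \<open>Let \<open>J\<close> be the indicator of the strip. The Darling-Kac property makes the
  mean number \<open>p n\<close> of visits from the strip to itself asymptotic to
  \<open>s^2 * a' n\<close>; up to a bounded error it is \<open>s\<close> times the mean
  \<open>e n\<close> of the crossings from the base. The normalized crossings converge weakly to a
  variable of mean 1, and once their second moments are bounded by a multiple of the squared means,
  \<open>e n\<close> is asymptotic to \<open>b (n * s)\<close>.\<close>

lemma darling_kac_return_sequence:
  assumes rv: "monotone_rv \<gamma> b binv" and s: "0 < s" "s \<le> c"
    and Y: "real_distribution Y" "AE y in Y. 0 < y" "integrable Y (\<lambda>y. y)" "(\<integral>y. y \<partial>Y) = 1"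
    and weak: "weak_conv_m (\<lambda>n. distr \<mu> borel (\<lambda>x. birkhoff_sum \<tau> n r x / binv (real n))) (stable_law \<gamma> Y)"
    and tail: "((\<lambda>t. measure \<mu> {x \<in> space \<mu>. r x > t}) \<longlongrightarrow> 0) at_top"
    and dk: "darling_kac_set m (\<Psi> s) ((space \<mu> \<times> {0..s}) \<inter> space m)"
    and a: "return_sequence m (\<Psi> s) a"
  shows "(\<lambda>n. a n * s / b (real n * s)) \<longlonglongrightarrow> 1"
proof -
  interpret rv: monotone_rv \<gamma> b binv by (rule rv)
  interpret F: mp_system m "\<Psi> s" using s by (intro mps_flow) simp
  let ?K = "(space \<mu> \<times> {0..s}) \<inter> space m"
  define J where "J = (indicator (space \<mu> \<times> {0..<s}) :: _ \<Rightarrow> real)"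
  have J: "integrable m J" "(\<integral>z. J z \<partial>m) = s"
    using integral_low[of "space \<mu>" 0 s] s base.prob_space by (auto simp: J_def)
  have J01: "J z = 0 \<or> J z = 1" "0 \<le> J z" "\<bar>J z\<bar> \<le> 1" for z by (auto simp: J_def indicator_def)
  have [measurable]: "J \<in> borel_measurable m" using J by auto
  \<comment> \<open>The Darling-Kac set is the closed strip, while the crossings lead to the
    half-open one; the difference lies in a null set of constant height.\<close>
  have JK: "AE z in m. indicator ?K z = J z"
    using AE_snd_neq[of s] AE_space by eventually_elim (auto simp: J_def indicator_def)
  obtain a' where a': "return_sequence m (\<Psi> s) a'" and K: "?K \<in> finite_pos_sets m"
    and unif: "\<And>e. e > 0 \<Longrightarrow> \<forall>\<^sub>F n in sequentially. AE x in m. x \<in> ?K \<longrightarrow>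
           \<bar>(1 / a' n) * (\<Sum>k<n. (transfer_op m (\<Psi> s) ^^ k) (indicator ?K) x) - measure m ?K\<bar> < e"
    using dk unfolding darling_kac_set_def by blast
  have a'pos: "0 < a' n" if "n \<ge> 1" for n using a' that by (simp add: return_sequence_def)
  have Ki: "integrable m (indicator ?K :: _ \<Rightarrow> real)" using K by (auto simp: finite_pos_sets_def)
  have mK: "measure m ?K = s"
  proof -
    have "(\<integral>z. indicator ?K z \<partial>m) = (\<integral>z. J z \<partial>m)" by (rule integral_cong_AE) (use JK Ki in auto)
    then show ?thesis using J by simp
  qed
  define S where "S n z = (\<Sum>k<n. F.Th k J z)" for n z
  have Si: "integrable m (S n)" for n unfolding S_def[abs_def] using J by auto
  have unifJ: "\<forall>\<^sub>F n in sequentially. AE z in m. J z = 1 \<longrightarrow> \<bar>(1 / a' n) * S n z - s\<bar> < e" if "e > 0" for e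
  proof -
    have "AE z in m. \<forall>k. F.Th k (indicator ?K) z = F.Th k J z"
      unfolding AE_all_countable by (intro allI F.Th_cong_AE Ki J JK)
    then have "AE z in m. \<forall>n. (\<Sum>k<n. F.Th k (indicator ?K) z) = S n z" by eventually_elim (simp add: S_def)
    with JK have *: "AE z in m. (J z = 1 \<longrightarrow> z \<in> ?K) \<and> (\<forall>n. (\<Sum>k<n. F.Th k (indicator ?K) z) = S n z)"
      by eventually_elim (auto simp: indicator_def split: if_splits)
    from unif[OF that] show ?thesis
    proof eventually_elim
      fix n assume "AE x in m. x \<in> ?K \<longrightarrow> \<bar>(1 / a' n) * (\<Sum>k<n. (transfer_op m (\<Psi> s) ^^ k) (indicator ?K) x) - measure m ?K\<bar> < e"
      with * show "AE z in m. J z = 1 \<longrightarrow> \<bar>(1 / a' n) * S n z - s\<bar> < e"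
        by eventually_elim (auto simp: mK)
    qed
  qed
  \<comment> \<open>Visits to the strip at multiples of \<open>s\<close>; \<open>M\<close> below
    counts crossings from height 0 and depends on the base point only.\<close>
  define X where "X n = birkhoff_sum (\<Psi> s) n J" for n
  have X0: "0 \<le> X n z" "X n z \<le> real n" for n z
  proof -
    show "0 \<le> X n z" unfolding X_def birkhoff_sum_def by (intro sum_nonneg J01)
    have "X n z \<le> (\<Sum>k<n. 1)" unfolding X_def birkhoff_sum_def by (intro sum_mono) (use J01 in \<open>metis order_refl zero_le_one\<close>)
    then show "X n z \<le> real n" by simp
  qed
  have [measurable]: "X n \<in> borel_measurable m" for n unfolding X_def by measurable
  define M where "M n x = real (crossings \<tau> r (real n * s) (x, 0))" for n x
  have [measurable]: "M n \<in> borel_measurable \<mu>" for n unfolding M_def by measurable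
  have M0: "0 \<le> M n x" for n x by (simp add: M_def)
  have Mb: "AE x in \<mu>. \<bar>M n x\<bar> \<le> real n * s / c" for n
    using AE_tame_base
  proof eventually_elim
    fix x assume "tame_orbit \<tau> r c x"
    then interpret tame_orbit \<tau> r c x .
    have "M n x * c \<le> real n * s"
      using returns_ge[of "crossings \<tau> r (real n * s) (x, 0)"] crossings_iff[of 0 "real n * s" "crossings \<tau> r (real n * s) (x, 0)"] s
      by (simp add: M_def)
    then show "\<bar>M n x\<bar> \<le> real n * s / c" using c_pos M0 by (simp add: pos_le_divide_eq)
  qed
  have Mi: "integrable \<mu> (M n)" for n
    by (rule base.integrable_const_bound[of _ "real n * s / c"]) (use Mb in auto)
  have Mi2: "integrable \<mu> (\<lambda>x. (M n x)\<^sup>2)" for n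
    using base.integrable_bounded_mult[OF Mi[of n] _ Mb[of n]] by (simp add: power2_eq_square)
  \<comment> \<open>One unit comes from the starting height, one from counting the visit at time 0
    instead of the one at time \<open>n\<close>.\<close>
  have XM: "AE z in m. J z = 1 \<longrightarrow> \<bar>X n z - M n (fst z)\<bar> \<le> 2" for n
  proof -
    have "AE z in m. \<forall>k. real (crossings \<tau> r s ((\<Psi> s ^^ k) z)) = J (\<Psi> s ((\<Psi> s ^^ k) z))"
      unfolding AE_all_countable J_def by (intro allI F.AE_iter crossings_small_AE s)
    with birkhoff_crossings[OF less_imp_le[OF s(1)], of n] crossings_base_bounds[OF s, of n]
    show ?thesis
    proof (eventually_elim, intro impI)
      fix z assume 1: "birkhoff_sum (\<Psi> s) n (\<lambda>z. real (crossings \<tau> r s z)) z = real (crossings \<tau> r (real n * s) z)"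
        and 2: "snd z < s \<longrightarrow> crossings \<tau> r (real n * s) (fst z, 0) \<le> crossings \<tau> r (real n * s) z \<and>
           crossings \<tau> r (real n * s) z \<le> crossings \<tau> r (real n * s) (fst z, 0) + 1"
        and 3: "\<forall>k. real (crossings \<tau> r s ((\<Psi> s ^^ k) z)) = J (\<Psi> s ((\<Psi> s ^^ k) z))" and Jz: "J z = 1"
      have "snd z < s" using Jz by (auto simp: J_def indicator_def split: if_splits)
      then have 2: "M n (fst z) \<le> real (crossings \<tau> r (real n * s) z)" "real (crossings \<tau> r (real n * s) z) \<le> M n (fst z) + 1"
        using 2 by (auto simp: M_def)
      have "real (crossings \<tau> r (real n * s) z) = (\<Sum>k<n. J ((\<Psi> s ^^ Suc k) z))"
        unfolding 1[symmetric] birkhoff_sum_def by (rule sum.cong) (use 3 in auto)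
      also have "\<dots> = (\<Sum>k<Suc n. J ((\<Psi> s ^^ k) z)) - J z" by (subst sum.lessThan_Suc_shift) simp
      also have "\<dots> = X n z + J ((\<Psi> s ^^ n) z) - J z" by (simp add: X_def birkhoff_sum_def)
      finally have "\<bar>real (crossings \<tau> r (real n * s) z) - X n z\<bar> \<le> 1"
        using J01(1)[of z] J01(1)[of "(\<Psi> s ^^ n) z"] by auto
      then show "\<bar>X n z - M n (fst z)\<bar> \<le> 2" using 2 by linarith
    qed
  qed
  define p where "p n = (\<integral>z. J z * X n z \<partial>m)" for n
  define e where "e n = (\<integral>x. M n x \<partial>\<mu>)" for n
  have JX: "integrable m (\<lambda>z. J z * X n z)" for n
    by (rule F.integrable_bounded_mult[OF J(1), where B = "real n"]) (use X0 in auto)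
  have JX2: "integrable m (\<lambda>z. J z * (X n z)\<^sup>2)" for n
  proof (rule F.integrable_bounded_mult[OF J(1), where B = "(real n)\<^sup>2"])
    show "AE z in m. \<bar>(X n z)\<^sup>2\<bar> \<le> (real n)\<^sup>2" using X0 by (auto intro!: power_mono)
  qed simp
  have JM: "integrable m (\<lambda>z. J z * M n (fst z))" "(\<integral>z. J z * M n (fst z) \<partial>m) = s * e n" for n
    unfolding J_def e_def by (rule integral_strip[OF Mi M0 s])+
  have JM2: "integrable m (\<lambda>z. J z * (M n (fst z))\<^sup>2)" "(\<integral>z. J z * (M n (fst z))\<^sup>2 \<partial>m) = s * (\<integral>x. (M n x)\<^sup>2 \<partial>\<mu>)" for n
    unfolding J_def by (rule integral_strip[OF Mi2 _ s], simp)+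
  have pe: "\<bar>p n - s * e n\<bar> \<le> 2 * s" for n
  proof -
    have "\<bar>p n - s * e n\<bar> = \<bar>\<integral>z. J z * X n z - J z * M n (fst z) \<partial>m\<bar>" using JX JM by (simp add: p_def)
    also have "\<dots> \<le> (\<integral>z. \<bar>J z * X n z - J z * M n (fst z)\<bar> \<partial>m)" by (rule integral_abs_bound)
    also have "\<dots> \<le> (\<integral>z. 2 * J z \<partial>m)"
    proof (rule integral_mono_AE)
      show "AE z in m. \<bar>J z * X n z - J z * M n (fst z)\<bar> \<le> 2 * J z"
        using XM[of n]
      proof eventually_elim
        fix z assume "J z = 1 \<longrightarrow> \<bar>X n z - M n (fst z)\<bar> \<le> 2"
        then show "\<bar>J z * X n z - J z * M n (fst z)\<bar> \<le> 2 * J z" using J01(1)[of z] by auto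
      qed
    qed (use JX JM J in auto)
    also have "\<dots> = 2 * s" using J by simp
    finally show ?thesis .
  qed
  have p_S: "p n = (\<integral>z. S n z * J z \<partial>m)" for n
  proof -
    have i: "integrable m (\<lambda>z. J z * J ((\<Psi> s ^^ k) z))" "integrable m (\<lambda>z. F.Th k J z * J z)" for k
      by (rule F.integrable_bounded_mult[where B = 1]; use J J01 in auto)+
    have "p n = (\<integral>z. (\<Sum>k<n. J z * J ((\<Psi> s ^^ k) z)) \<partial>m)" by (simp add: p_def X_def birkhoff_sum_def sum_distrib_left)
    also have "\<dots> = (\<Sum>k<n. \<integral>z. J z * J ((\<Psi> s ^^ k) z) \<partial>m)" by (rule Bochner_Integration.integral_sum) (rule i)
    also have "\<dots> = (\<Sum>k<n. \<integral>z. F.Th k J z * J z \<partial>m)"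
      by (rule sum.cong[OF refl], rule F.Th_dual[OF J(1), where B = 1, symmetric]) (use J01 in auto)
    also have "\<dots> = (\<integral>z. (\<Sum>k<n. F.Th k J z * J z) \<partial>m)" by (rule Bochner_Integration.integral_sum[symmetric]) (rule i)
    finally show ?thesis by (simp add: S_def sum_distrib_right)
  qed
  have SJ: "integrable m (\<lambda>z. S n z * J z)" for n
    by (rule F.integrable_bounded_mult[OF Si, where B = 1]) (use J01 in auto)
  \<comment> \<open>Pointwise convergence would not allow the integration of
    \<open>S n / a' n\<close> over the strip; the uniform convergence of the Darling-Kac property
    does.\<close>
  have pa: "(\<lambda>n. p n / a' n) \<longlonglongrightarrow> s\<^sup>2"
  proof (rule tendstoI)
    fix \<epsilon> :: real assume "\<epsilon> > 0"
    then have "\<epsilon> / (2 * s) > 0" using s by simp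
    from unifJ[OF this] show "\<forall>\<^sub>F n in sequentially. dist (p n / a' n) (s\<^sup>2) < \<epsilon>"
    proof eventually_elim
      fix n assume le: "AE z in m. J z = 1 \<longrightarrow> \<bar>(1 / a' n) * S n z - s\<bar> < \<epsilon> / (2 * s)"
      have "p n / a' n - s\<^sup>2 = (\<integral>z. (1 / a' n) * (S n z * J z) - s * J z \<partial>m)"
        using SJ J by (simp add: p_S power2_eq_square)
      also have "\<bar>\<dots>\<bar> \<le> (\<integral>z. \<bar>(1 / a' n) * (S n z * J z) - s * J z\<bar> \<partial>m)" by (rule integral_abs_bound)
      also have "\<dots> \<le> (\<integral>z. \<epsilon> / (2 * s) * J z \<partial>m)"
      proof (rule integral_mono_AE)
        show "AE z in m. \<bar>(1 / a' n) * (S n z * J z) - s * J z\<bar> \<le> \<epsilon> / (2 * s) * J z"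
          using le
        proof eventually_elim
          fix z assume "J z = 1 \<longrightarrow> \<bar>(1 / a' n) * S n z - s\<bar> < \<epsilon> / (2 * s)"
          then show "\<bar>(1 / a' n) * (S n z * J z) - s * J z\<bar> \<le> \<epsilon> / (2 * s) * J z"
            using J01(1)[of z] by auto
        qed
      qed (use SJ J in auto)
      also have "\<dots> = \<epsilon> / 2" using J s by simp
      finally show "dist (p n / a' n) (s\<^sup>2) < \<epsilon>" using \<open>\<epsilon> > 0\<close> by (simp add: dist_real_def)
    qed
  qed
  \<comment> \<open>By the Darling-Kac property \<open>S n\<close> is at most
    \<open>2 * s * a' n\<close> on the strip; with the inequality for squares and duality, the
    second moment is at most \<open>4 * s * a' n * p n\<close>.\<close>
  have second: "\<forall>\<^sub>F n in sequentially. (\<integral>z. J z * (X n z)\<^sup>2 \<partial>m) \<le> 4 * s * a' n * p n"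
    using unifJ[OF s(1)] eventually_ge_at_top[of 1]
  proof eventually_elim
    fix n :: nat assume le: "AE z in m. J z = 1 \<longrightarrow> \<bar>(1 / a' n) * S n z - s\<bar> < s" and n: "1 \<le> n"
    let ?k = "\<lambda>z. J z * X n z"
    have kb: "\<bar>?k z\<bar> \<le> real n" for z using X0[of n z] J01(1)[of z] by auto
    have i: "integrable m (\<lambda>z. J z * ?k ((\<Psi> s ^^ j) z))" "integrable m (\<lambda>z. F.Th j J z * ?k z)" for j
      by (rule F.integrable_bounded_mult[where B = "real n"]; use J kb in auto)+
    have "(\<integral>z. J z * (X n z)\<^sup>2 \<partial>m) \<le> (\<integral>z. 2 * (\<Sum>j<n. J z * ?k ((\<Psi> s ^^ j) z)) \<partial>m)"
    proof (rule integral_mono)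
      fix z
      have "(X n z)\<^sup>2 \<le> 2 * (\<Sum>j<n. J ((\<Psi> s ^^ j) z) * (\<Sum>i<n. J ((\<Psi> s ^^ (j + i)) z)))"
        unfolding X_def birkhoff_sum_def by (rule square_sum_le) (rule J01)
      also have "(\<Sum>j<n. J ((\<Psi> s ^^ j) z) * (\<Sum>i<n. J ((\<Psi> s ^^ (j + i)) z))) = (\<Sum>j<n. ?k ((\<Psi> s ^^ j) z))"
      proof -
        have "(\<Psi> s ^^ (j + i)) z = (\<Psi> s ^^ i) ((\<Psi> s ^^ j) z)" for i j
          by (simp add: funpow_add add.commute[of j])
        then show ?thesis by (simp add: X_def birkhoff_sum_def)
      qed
      finally have "J z * (X n z)\<^sup>2 \<le> J z * (2 * (\<Sum>j<n. ?k ((\<Psi> s ^^ j) z)))" by (intro mult_left_mono J01)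
      then show "J z * (X n z)\<^sup>2 \<le> 2 * (\<Sum>j<n. J z * ?k ((\<Psi> s ^^ j) z))" by (simp add: sum_distrib_left mult_ac)
    qed (use JX2 i in auto)
    also have "\<dots> = 2 * (\<Sum>j<n. \<integral>z. J z * ?k ((\<Psi> s ^^ j) z) \<partial>m)" using i by simp
    also have "(\<Sum>j<n. \<integral>z. J z * ?k ((\<Psi> s ^^ j) z) \<partial>m) = (\<Sum>j<n. \<integral>z. F.Th j J z * ?k z \<partial>m)"
      by (rule sum.cong[OF refl], rule F.Th_dual[OF J(1), where B = "real n", symmetric]) (use kb in auto)
    also have "\<dots> = (\<integral>z. (\<Sum>j<n. F.Th j J z * ?k z) \<partial>m)" by (rule Bochner_Integration.integral_sum[symmetric]) (rule i)
    also have "\<dots> \<le> (\<integral>z. 2 * s * a' n * ?k z \<partial>m)"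
    proof (rule integral_mono_AE)
      show "AE z in m. (\<Sum>j<n. F.Th j J z * ?k z) \<le> 2 * s * a' n * ?k z"
        using le
      proof eventually_elim
        fix z assume le: "J z = 1 \<longrightarrow> \<bar>(1 / a' n) * S n z - s\<bar> < s"
        show "(\<Sum>j<n. F.Th j J z * ?k z) \<le> 2 * s * a' n * ?k z"
        proof (cases "J z = 1")
          case True
          then have "S n z / a' n \<le> 2 * s" using le by (auto simp: abs_less_iff)
          then have "S n z \<le> 2 * s * a' n" using a'pos[OF n] by (simp add: pos_divide_le_eq)
          then have "S n z * ?k z \<le> 2 * s * a' n * ?k z" using X0 J01 by (intro mult_right_mono) auto
          then show ?thesis by (simp add: S_def sum_distrib_right)
        next
          case False then show ?thesis using J01(1)[of z] by auto
        qed
      qed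
    qed (use i JX in auto)
    also have "\<dots> = 2 * s * a' n * p n" using JX by (simp add: p_def)
    finally show "(\<integral>z. J z * (X n z)\<^sup>2 \<partial>m) \<le> 4 * s * a' n * p n" by simp
  qed
  \<comment> \<open>Almost every point returns infinitely often, so the truncated counts converge to
    the truncation level.\<close>
  have e_inf: "filterlim e at_top sequentially"
    unfolding filterlim_at_top_dense
  proof
    fix Z :: real
    define K where "K = max 0 Z + 1"
    have "(\<lambda>n. \<integral>x. min (M n x) K \<partial>\<mu>) \<longlonglongrightarrow> (\<integral>x. K \<partial>\<mu>)"
    proof (rule integral_dominated_convergence[where w = "\<lambda>_. K"])
      show "AE x in \<mu>. (\<lambda>n. min (M n x) K) \<longlonglongrightarrow> K"
        using AE_tame_base
      proof eventually_elim
        fix x assume "tame_orbit \<tau> r c x"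
        then interpret tame_orbit \<tau> r c x .
        obtain k :: nat where k: "K \<le> real k" using real_arch_simple by blast
        obtain n0 :: nat where n0: "birkhoff_sum \<tau> k r x < real n0 * s" using s reals_Archimedean3 by blast
        have "min (M n x) K = K" if "n \<ge> n0" for n
        proof -
          have "real n0 * s \<le> real n * s" using that s by simp
          then have "birkhoff_sum \<tau> k r x \<le> 0 + real n * s" using n0 by linarith
          then have "k \<le> crossings \<tau> r (real n * s) (x, 0)" using s by (subst crossings_ge_iff) auto
          then show ?thesis using k by (simp add: M_def)
        qed
        then show "(\<lambda>n. min (M n x) K) \<longlonglongrightarrow> K"
          by (intro tendsto_eventually) (auto simp: eventually_sequentially)
      qed
      show "AE x in \<mu>. norm (min (M n x) K) \<le> K" for n using M0 by (auto simp: K_def)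
    qed auto
    then have l: "(\<lambda>n. \<integral>x. min (M n x) K \<partial>\<mu>) \<longlonglongrightarrow> K" using base.prob_space by simp
    have "\<forall>\<^sub>F n in sequentially. Z < (\<integral>x. min (M n x) K \<partial>\<mu>)"
      using order_tendstoD(1)[OF l, of Z] by (simp add: K_def)
    then show "\<forall>\<^sub>F n in sequentially. Z < e n"
    proof eventually_elim
      fix n assume "Z < (\<integral>x. min (M n x) K \<partial>\<mu>)"
      also have "\<dots> \<le> e n" unfolding e_def by (rule integral_mono) (use Mi in auto)
      finally show "Z < e n" .
    qed
  qed
  have e1: "\<forall>\<^sub>F n in sequentially. 1 \<le> e n" using e_inf unfolding filterlim_at_top by blast
  have pe1: "(\<lambda>n. p n / (s * e n)) \<longlonglongrightarrow> 1"
  proof -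
    have "(\<lambda>n. p n / (s * e n) - 1) \<longlonglongrightarrow> 0"
    proof (rule Lim_null_comparison)
      show "\<forall>\<^sub>F n in sequentially. norm (p n / (s * e n) - 1) \<le> 2 * inverse (e n)"
        using e1
      proof eventually_elim
        fix n assume "1 \<le> e n"
        then have "p n / (s * e n) - 1 = (p n - s * e n) / (s * e n)" using s by (simp add: diff_divide_distrib)
        moreover have "\<bar>p n - s * e n\<bar> / (s * e n) \<le> 2 * s / (s * e n)"
          using pe[of n] s \<open>1 \<le> e n\<close> by (intro divide_right_mono) auto
        moreover have "\<bar>(p n - s * e n) / (s * e n)\<bar> = \<bar>p n - s * e n\<bar> / (s * e n)"
          using s \<open>1 \<le> e n\<close> by (simp add: abs_divide abs_mult)
        moreover have "2 * s / (s * e n) = 2 * inverse (e n)" using s by (simp add: divide_inverse)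
        ultimately show "norm (p n / (s * e n) - 1) \<le> 2 * inverse (e n)"
          by (simp only: real_norm_def)
      qed
      show "(\<lambda>n. 2 * inverse (e n)) \<longlonglongrightarrow> 0"
        using tendsto_mult[OF tendsto_const tendsto_inverse_0_at_top[OF e_inf], of 2] by simp
    qed
    then show ?thesis by (simp add: LIM_zero_iff)
  qed
  have s2: "s\<^sup>2 / 2 < s\<^sup>2" "0 < s\<^sup>2" using s by auto
  \<comment> \<open>Constants: \<open>p n\<close> exceeds \<open>s^2 / 2 * a' n\<close> and is at
    most \<open>3 * s * e n\<close>, so the second moment of \<open>X\<close> is at most
    \<open>72 * s * (e n)^2\<close>; passing to \<open>M\<close> doubles this and adds
    \<open>8 * s\<close>, which gives \<open>144 + 8 = 152\<close> as \<open>e n\<close> is at least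
    1.\<close>
  have sq: "\<forall>\<^sub>F n in sequentially. (\<integral>x. (M n x)\<^sup>2 \<partial>\<mu>) \<le> 152 * (e n)\<^sup>2"
    using second e1 order_tendstoD(1)[OF pa s2(1)] eventually_ge_at_top[of 1]
  proof eventually_elim
    case (elim n)
    have "s\<^sup>2 / 2 * a' n < p n" using elim(3) a'pos[OF elim(4)] by (simp add: pos_less_divide_eq)
    then have "4 * s * a' n * p n \<le> 8 / s * p n * p n"
    proof -
      assume "s\<^sup>2 / 2 * a' n < p n"
      then have "8 / s * (s\<^sup>2 / 2 * a' n) \<le> 8 / s * p n" using s by (intro mult_left_mono) auto
      moreover have "8 / s * (s\<^sup>2 / 2 * a' n) = 4 * s * a' n" using s by (simp add: power2_eq_square)
      moreover have "0 \<le> p n" unfolding p_def by (rule integral_nonneg_AE) (use X0 J01 in auto)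
      ultimately show ?thesis by (intro mult_right_mono) auto
    qed
    then have P2: "(\<integral>z. J z * (X n z)\<^sup>2 \<partial>m) \<le> 8 / s * (p n)\<^sup>2" using elim(1) by (simp add: power2_eq_square mult.assoc)
    have "p n \<le> s * e n + 2 * s" using pe[of n] by linarith
    also have "\<dots> \<le> 3 * s * e n" using mult_left_mono[OF elim(2), of s] s by simp
    finally have p3: "p n \<le> 3 * s * e n" .
    have p0: "0 \<le> p n" unfolding p_def by (rule integral_nonneg_AE) (use X0 J01 in auto)
    have "(p n)\<^sup>2 \<le> (3 * s * e n)\<^sup>2" using p3 p0 by (rule power_mono)
    then have "8 / s * (p n)\<^sup>2 \<le> 8 / s * (3 * s * e n)\<^sup>2" using s by (intro mult_left_mono) auto
    also have "8 / s * (3 * s * e n)\<^sup>2 = 72 * s * (e n)\<^sup>2" using s by (simp add: power2_eq_square)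
    finally have P2': "(\<integral>z. J z * (X n z)\<^sup>2 \<partial>m) \<le> 72 * s * (e n)\<^sup>2" using P2 by linarith
    have "s * (\<integral>x. (M n x)\<^sup>2 \<partial>\<mu>) = (\<integral>z. J z * (M n (fst z))\<^sup>2 \<partial>m)" using JM2 by simp
    also have "\<dots> \<le> (\<integral>z. 2 * (J z * (X n z)\<^sup>2) + 8 * J z \<partial>m)"
    proof (rule integral_mono_AE)
      show "AE z in m. J z * (M n (fst z))\<^sup>2 \<le> 2 * (J z * (X n z)\<^sup>2) + 8 * J z"
        using XM[of n]
      proof eventually_elim
        fix z assume le: "J z = 1 \<longrightarrow> \<bar>X n z - M n (fst z)\<bar> \<le> 2"
        show "J z * (M n (fst z))\<^sup>2 \<le> 2 * (J z * (X n z)\<^sup>2) + 8 * J z"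
        proof (cases "J z = 1")
          case True
          then have "M n (fst z) \<le> X n z + 2" using le by linarith
          then have "(M n (fst z))\<^sup>2 \<le> (X n z + 2)\<^sup>2" using M0 by (intro power_mono)
          also have "\<dots> \<le> 2 * (X n z)\<^sup>2 + 8"
            using zero_le_power2[of "X n z - 2"] by (simp add: power2_eq_square algebra_simps)
          finally show ?thesis using True by simp
        next
          case False then show ?thesis using J01(1)[of z] by auto
        qed
      qed
    qed (use JM2 JX2 J in auto)
    also have "\<dots> = 2 * (\<integral>z. J z * (X n z)\<^sup>2 \<partial>m) + 8 * s" using JX2 J by simp
    also have "\<dots> \<le> 144 * s * (e n)\<^sup>2 + 8 * s" using P2' by simp
    also have "\<dots> \<le> s * (152 * (e n)\<^sup>2)"
    proof -
      have "1\<^sup>2 \<le> (e n)\<^sup>2" using elim(2) by (intro power_mono) auto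
      then have "8 * s * 1 \<le> 8 * s * (e n)\<^sup>2" using s by (intro mult_left_mono) auto
      then show ?thesis by (simp add: algebra_simps)
    qed
    finally show ?case using s by simp
  qed
  have weakM: "weak_conv_m (\<lambda>n. distr \<mu> borel (\<lambda>x. M n x / b (real n * s))) Y"
    unfolding M_def by (rule crossings_weak_limit[OF rv s(1) Y(1,2) weak tail])
  have eb: "(\<lambda>n. \<integral>x. M n x / b (real n * s) \<partial>\<mu>) \<longlonglongrightarrow> 1"
  proof (rule expectation_limit[OF prob_base Y _ _ _ weakM])
    show "integrable \<mu> (\<lambda>x. M n x / b (real n * s))" for n using Mi by simp
    show "integrable \<mu> (\<lambda>x. (M n x / b (real n * s))\<^sup>2)" for n using Mi2 by (simp add: power_divide)
    show "0 \<le> M n x / b (real n * s)" for n x using M0 less_imp_le[OF rv.b_pos] by (rule divide_nonneg_nonneg)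
    show "\<forall>\<^sub>F n in sequentially. (\<integral>x. (M n x / b (real n * s))\<^sup>2 \<partial>\<mu>) \<le> 152 * (\<integral>x. M n x / b (real n * s) \<partial>\<mu>)\<^sup>2"
      using sq by eventually_elim (simp add: power_divide e_def divide_right_mono)
  qed simp
  \<comment> \<open>A telescoping product of ratios with known limits.\<close>
  have "(\<lambda>n. (a n / a' n) * (inverse (p n / a' n) * ((p n / (s * e n)) * (\<integral>x. M n x / b (real n * s) \<partial>\<mu>)) * s\<^sup>2))
      \<longlonglongrightarrow> 1 * (inverse (s\<^sup>2) * (1 * 1) * s\<^sup>2)"
    by (intro tendsto_intros return_sequence_unique[OF _ a a'] pa pe1 eb) (use s in auto)
  moreover have "1 * (inverse (s\<^sup>2) * (1 * 1) * s\<^sup>2) = 1" using s by simp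
  moreover have "\<forall>\<^sub>F n in sequentially. (a n / a' n) * (inverse (p n / a' n) * ((p n / (s * e n)) * (\<integral>x. M n x / b (real n * s) \<partial>\<mu>)) * s\<^sup>2)
      = a n * s / b (real n * s)"
    using e1 order_tendstoD(1)[OF pa s2(2)] eventually_ge_at_top[of 1]
  proof eventually_elim
    case (elim n)
    have "p n \<noteq> 0" "a' n \<noteq> 0" "e n \<noteq> 0" using elim a'pos[of n] s by auto
    moreover have "b (real n * s) \<noteq> 0" using rv.b_pos[of "real n * s"] by simp
    moreover have int: "(\<integral>x. M n x / b (real n * s) \<partial>\<mu>) = e n / b (real n * s)" by (simp add: e_def)
    ultimately show ?case unfolding int using s by (simp add: field_simps power2_eq_square)
  qed
  ultimately show ?thesis using Lim_transform_eventually by fastforce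
qed

end

section \<open>The averaged local limit for occupation numbers\<close>

lemma asymp_equiv_ratio:
  fixes f g :: "real \<Rightarrow> real"
  assumes "f \<sim>[F] g" "eventually (\<lambda>x. g x \<noteq> 0) F"
  shows "((\<lambda>x. f x / g x) \<longlongrightarrow> 1) F"
proof -
  have "((\<lambda>x. if f x = 0 \<and> g x = 0 then 1 else f x / g x) \<longlongrightarrow> 1) F"
    using assms(1) by (simp add: asymp_equiv_def)
  then show ?thesis by (rule Lim_transform_eventually) (use assms(2) in \<open>auto elim: eventually_mono\<close>)
qed

lemma tail_null:
  fixes r :: "'a \<Rightarrow> real"
  assumes P: "prob_space \<mu>" and r[measurable]: "r \<in> borel_measurable \<mu>"
  shows "((\<lambda>t. measure \<mu> {x \<in> space \<mu>. r x > t}) \<longlongrightarrow> 0) at_top"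
proof -
  interpret P: prob_space \<mu> by (rule P)
  interpret R: real_distribution "distr \<mu> borel r" by (rule P.real_distribution_distr) simp
  have "cdf (distr \<mu> borel r) t = 1 - measure \<mu> {x \<in> space \<mu>. r x > t}" for t
  proof -
    have "cdf (distr \<mu> borel r) t = measure \<mu> (space \<mu> - {x \<in> space \<mu>. r x > t})"
      unfolding cdf_def by (subst measure_distr) (auto intro!: arg_cong[where f = "measure \<mu>"])
    also have "\<dots> = 1 - measure \<mu> {x \<in> space \<mu>. r x > t}" by (rule P.prob_compl) measurable
    finally show ?thesis .
  qed
  then have "measure \<mu> {x \<in> space \<mu>. r x > t} = 1 - cdf (distr \<mu> borel r) t" for t by simp
  moreover have "((\<lambda>t. 1 - cdf (distr \<mu> borel r) t) \<longlongrightarrow> 1 - 1) at_top"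
    by (intro tendsto_intros R.cdf_lim_at_top_prob)
  ultimately show ?thesis by simp
qed

text \<open>The new function is \<kappa> divided by the tail, with \<kappa> from the tail
  asymptotics, so it is asymptotic to the given \<open>b\<close> and shares its regular variation
  and its asymptotic inverse. The tail never vanishes because it is nonincreasing and eventually
  positive.\<close>

lemma monotone_rv_if_stable:
  assumes g: "0 < \<gamma>" "\<gamma> < 1" and P: "prob_space \<mu>" and r[measurable]: "r \<in> borel_measurable \<mu>"
    and st: "asymptotically_stable \<gamma> Y \<mu> \<tau> r b binv"
  shows "\<exists>\<beta>. monotone_rv \<gamma> \<beta> binv"
proof -
  interpret P: prob_space \<mu> by (rule P)
  define H where "H t = measure \<mu> {x \<in> space \<mu>. r x > t}" for t
  define \<kappa> where "\<kappa> = 1 / (Gamma (1 + \<gamma>) * Gamma (1 - \<gamma>))"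
  have \<kappa>: "0 < \<kappa>" using g by (simp add: \<kappa>_def Gamma_real_pos)
  have rv: "regularly_varying \<gamma> b" and inv: "asymptotic_inverse b binv"
    and tail: "H \<sim>[at_top] (\<lambda>t. \<kappa> * (1 / b t))"
    using st by (auto simp: asymptotically_stable_def H_def[abs_def] \<kappa>_def)
  obtain x0 where x0: "\<And>x. x \<ge> x0 \<Longrightarrow> 0 < b x" using rv by (auto simp: regularly_varying_def)
  have b_pos: "\<forall>\<^sub>F x in at_top. 0 < b x" using eventually_ge_at_top[of x0] by eventually_elim (rule x0)
  have "((\<lambda>t. H t / (\<kappa> * (1 / b t))) \<longlongrightarrow> 1) at_top"
    by (rule asymp_equiv_ratio[OF tail]) (use b_pos \<kappa> in \<open>auto elim!: eventually_mono\<close>)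
  then have Hb: "((\<lambda>t. H t * b t / \<kappa>) \<longlongrightarrow> 1) at_top" by (simp add: field_simps)
  have H_mono: "H y \<le> H x" if "x \<le> y" for x y
    unfolding H_def by (rule P.finite_measure_mono) (use that in auto)
  have H_pos: "0 < H x" for x
  proof -
    have "\<forall>\<^sub>F t in at_top. 0 < H t * b t / \<kappa>" using order_tendstoD(1)[OF Hb, of 0] by simp
    then have "\<forall>\<^sub>F t in at_top. x \<le> t \<and> 0 < H t" using b_pos eventually_ge_at_top[of x]
      by eventually_elim (use \<kappa> in \<open>auto simp: zero_less_mult_iff zero_less_divide_iff\<close>)
    then obtain t where "x \<le> t" "0 < H t" using eventually_happens'[OF trivial_limit_at_top_linorder] by blast
    then show ?thesis using H_mono[of x t] by simp
  qed
  define \<beta> where "\<beta> t = \<kappa> / H t" for t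
  have \<beta>_pos: "0 < \<beta> t" for t using H_pos \<kappa> by (simp add: \<beta>_def)
  have "((\<lambda>t. inverse (H t * b t / \<kappa>)) \<longlongrightarrow> inverse 1) at_top" by (intro tendsto_intros Hb) simp
  then have \<beta>b: "((\<lambda>t. \<beta> t / b t) \<longlongrightarrow> 1) at_top"
    by (simp add: \<beta>_def field_simps)
  have b\<beta>: "((\<lambda>t. b t / \<beta> t) \<longlongrightarrow> 1) at_top" using Hb by (simp add: \<beta>_def field_simps)
  have "monotone_rv \<gamma> \<beta> binv"
  proof
    show "0 < \<gamma>" by (rule g(1))
    show "0 < \<beta> x" for x by (rule \<beta>_pos)
    show "mono \<beta>" unfolding mono_def \<beta>_def using H_mono H_pos \<kappa> by (auto intro!: divide_left_mono)
    show "filterlim \<beta> at_top at_top"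
    proof -
      have "filterlim (\<lambda>t. inverse (H t)) at_top at_top"
        by (rule filterlim_inverse_at_top) (use tail_null[OF P r] H_pos in \<open>auto simp: H_def[abs_def]\<close>)
      from filterlim_tendsto_pos_mult_at_top[OF tendsto_const \<kappa> this]
      show ?thesis by (simp add: \<beta>_def[abs_def] divide_inverse)
    qed
    show "filterlim binv at_top at_top" using inv by (simp add: asymptotic_inverse_def)
    have "((\<lambda>x. b (binv x) / x) \<longlongrightarrow> 1) at_top"
      by (rule asymp_equiv_ratio) (use inv eventually_gt_at_top[of "0::real"] in \<open>auto simp: asymptotic_inverse_def elim!: eventually_mono\<close>)
    moreover have "((\<lambda>x. \<beta> (binv x) / b (binv x)) \<longlongrightarrow> 1) at_top"
      using \<beta>b inv by (auto simp: asymptotic_inverse_def intro: filterlim_compose)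
    ultimately have l: "((\<lambda>x. \<beta> (binv x) / b (binv x) * (b (binv x) / x)) \<longlongrightarrow> 1 * 1) at_top" by (intro tendsto_mult)
    have "\<forall>\<^sub>F x in at_top. 0 < b (binv x)"
      using b_pos inv unfolding asymptotic_inverse_def filterlim_iff by blast
    then have "\<forall>\<^sub>F x in at_top. \<beta> (binv x) / b (binv x) * (b (binv x) / x) = \<beta> (binv x) / x"
      by eventually_elim simp
    with l show "((\<lambda>x. \<beta> (binv x) / x) \<longlongrightarrow> 1) at_top" using Lim_transform_eventually by fastforce
    fix d :: real assume d: "0 < d"
    have dx: "filterlim (\<lambda>x. d * x) at_top at_top"
      by (rule filterlim_tendsto_pos_mult_at_top[OF tendsto_const d filterlim_ident])
    have "((\<lambda>x. \<beta> (d * x) / b (d * x) * (b (d * x) / b x) * (b x / \<beta> x)) \<longlongrightarrow> 1 * d powr \<gamma> * 1) at_top"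
      using rv d by (intro tendsto_mult filterlim_compose[OF \<beta>b dx] b\<beta>) (auto simp: regularly_varying_def)
    moreover have "\<forall>\<^sub>F x in at_top. 0 < b (d * x)" using b_pos dx unfolding filterlim_iff by blast
    then have "\<forall>\<^sub>F x in at_top. \<beta> (d * x) / b (d * x) * (b (d * x) / b x) * (b x / \<beta> x) = \<beta> (d * x) / \<beta> x"
      using b_pos by eventually_elim simp
    ultimately show "((\<lambda>x. \<beta> (d * x) / \<beta> x) \<longlongrightarrow> d powr \<gamma>) at_top" using Lim_transform_eventually by fastforce
  qed
  then show ?thesis by blast
qed

text \<open>Two cylinders that meet are nested, the longer word giving the smaller set. With the
  empty set added, the cylinders form a system stable under intersections.\<close>

lemma cylinder_Int:
  assumes fs: "fibered_system \<mu> \<tau> \<aa>" and A: "A \<in> cylinders \<mu> \<tau> \<aa>" and B: "B \<in> cylinders \<mu> \<tau> \<aa>"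
  shows "A \<inter> B = {} \<or> A \<inter> B \<in> cylinders \<mu> \<tau> \<aa>"
proof -
  have disj: "a = a'" if "a \<in> \<aa>" "a' \<in> \<aa>" "x \<in> a" "x \<in> a'" for a a' x
  proof -
    have "disjoint \<aa>" using fs partition_onD2 unfolding fibered_system_def by auto
    from disjointD[OF this that(1,2)] show ?thesis using that(3,4) by blast
  qed
  have *: "A \<inter> B = {} \<or> A \<inter> B = B"
    if A: "A \<in> refined_partition \<mu> \<tau> \<aa> n" and B: "B \<in> refined_partition \<mu> \<tau> \<aa> n'" and le: "n \<le> n'" for A B n n'
  proof (cases "A \<inter> B = {}")
    case False
    obtain c where c: "A = {x \<in> space \<mu>. \<forall>k<n. (\<tau> ^^ k) x \<in> c k}" "\<forall>k<n. c k \<in> \<aa>"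
      using A by (auto simp: refined_partition_def)
    obtain d where d: "B = {x \<in> space \<mu>. \<forall>k<n'. (\<tau> ^^ k) x \<in> d k}" "\<forall>k<n'. d k \<in> \<aa>"
      using B by (auto simp: refined_partition_def)
    obtain x where x: "x \<in> A" "x \<in> B" using False by auto
    have "c k = d k" if k: "k < n" for k
    proof (rule disj)
      show "c k \<in> \<aa>" "d k \<in> \<aa>" using c(2) d(2) k le by auto
      show "(\<tau> ^^ k) x \<in> c k" using x(1) k unfolding c(1) by blast
      have "k < n'" using k le by simp
      then show "(\<tau> ^^ k) x \<in> d k" using x(2) unfolding d(1) by blast
    qed
    then have "B \<subseteq> A" using le by (auto simp: c d)
    then show ?thesis by auto
  qed simp
  obtain n where n: "n \<ge> 1" "A \<in> refined_partition \<mu> \<tau> \<aa> n" using A by (auto simp: cylinders_def)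
  obtain n' where n': "n' \<ge> 1" "B \<in> refined_partition \<mu> \<tau> \<aa> n'" using B by (auto simp: cylinders_def)
  show ?thesis
  proof (cases "n \<le> n'")
    case True
    then show ?thesis using *[OF n(2) n'(2)] B by auto
  next
    case False
    then show ?thesis using *[OF n'(2) n(2)] A by (auto simp: Int_commute)
  qed
qed

lemma partition_subset_cylinders:
  assumes "fibered_system \<mu> \<tau> \<aa>"
  shows "\<aa> \<subseteq> cylinders \<mu> \<tau> \<aa>"
proof
  fix A assume A: "A \<in> \<aa>"
  have "A \<subseteq> space \<mu>" "A \<noteq> {}" using assms A by (auto simp: fibered_system_def partition_on_def)
  then have "A = {x \<in> space \<mu>. \<forall>k<1. (\<tau> ^^ k) x \<in> A}" by auto
  then have "A \<in> refined_partition \<mu> \<tau> \<aa> 1"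
    using A \<open>A \<noteq> {}\<close> unfolding refined_partition_def by (auto intro!: exI[of _ "\<lambda>_. A"])
  then show "A \<in> cylinders \<mu> \<tau> \<aa>" by (auto simp: cylinders_def)
qed

lemma (in mp_system) cylinder_sets:
  assumes \<aa>: "\<aa> \<subseteq> sets M" and A: "A \<in> cylinders M T \<aa>"
  shows "A \<in> sets M"
proof -
  obtain n c where A: "A = {x \<in> space M. \<forall>k<n. (T ^^ k) x \<in> c k}" "\<forall>k<n. c k \<in> \<aa>"
    using A by (auto simp: cylinders_def refined_partition_def)
  have "A = {x \<in> space M. \<forall>k\<in>{..<n}. (T ^^ k) x \<in> c k}" using A by auto
  also have "\<dots> \<in> sets M"
  proof (rule sets.sets_Collect_finite_All)
    fix k assume "k \<in> {..<n}"
    then have [measurable]: "c k \<in> sets M" using A \<aa> by auto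
    show "{x \<in> space M. (T ^^ k) x \<in> c k} \<in> sets M" by measurable
  qed simp
  finally show ?thesis .
qed

text \<open>A fixed time step \<open>s\<close>, small enough for at most one crossing per step and
  for the intervals allowed in \<open>ll\<close>. The assumption \<open>ab\<close> is the comparison
  of the return sequence with the tail of the roof function, \<open>a n\<close> being asymptotic to
  \<open>b (n * s) / s\<close>.\<close>

locale gll_system = suspension m \<Psi> \<mu> \<tau> r c + rv: monotone_rv \<gamma> b binv
  for m :: "('w::polish_space \<times> real) measure" and \<Psi> \<mu> \<tau> r c \<gamma> b binv +
  fixes Y :: "real measure" and fZ :: "real \<Rightarrow> real" and \<aa> :: "'w set set" and s :: real and a :: "nat \<Rightarrow> real"
  assumes s: "0 < s" "s \<le> c" and Y: "mittag_leffler_law \<gamma> Y" and fZ: "stable_density \<gamma> Y fZ"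
    and fib: "fibered_system \<mu> \<tau> \<aa>"
    and ll: "\<And>A \<alpha> \<beta>. A \<in> cylinders \<mu> \<tau> \<aa> \<Longrightarrow> 0 \<le> \<alpha> \<Longrightarrow> \<alpha> < \<beta> \<Longrightarrow> \<beta> \<le> s \<Longrightarrow> local_limits \<mu> \<tau> r binv fZ A \<alpha> \<beta>"
    and rs: "return_sequence m (\<Psi> s) a" and ab: "(\<lambda>n. a n * s / b (real n * s)) \<longlonglongrightarrow> 1"
begin

sublocale F: mp_system m "\<Psi> s" using s by (intro mps_flow) simp

text \<open>Asymptotic to \<open>\<gamma> * a n / n\<close> by \<open>ab\<close>; at 0 it is 0
  through division by zero.\<close>

definition u :: "nat \<Rightarrow> real" where "u n = \<gamma> * b (real n * s) / (real n * s)"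

definition D :: "nat \<Rightarrow> 'w \<times> real \<Rightarrow> real" where
  "D n z = real (crossings \<tau> r (real n * s) z) / b (real n * s)"

definition EW :: "(real \<Rightarrow> real) \<Rightarrow> real" where "EW g = (\<integral>y. y * g y \<partial>Y)"

lemma D_meas [measurable]: "D n \<in> borel_measurable m" unfolding D_def by measurable

lemma D_nonneg: "0 \<le> D n z" unfolding D_def using less_imp_le[OF rv.b_pos] by (intro divide_nonneg_nonneg) auto

lemma u_pos: "n \<ge> 1 \<Longrightarrow> 0 < u n" using rv.gamma rv.b_pos s by (simp add: u_def)

lemma u_nonneg: "0 \<le> u n" using u_pos[of n] by (cases "n = 0") (auto simp: u_def)

lemma ns_inf: "filterlim (\<lambda>n. real n * s) at_top sequentially"
  using filterlim_tendsto_pos_mult_at_top[OF tendsto_const s(1) filterlim_real_sequentially] by (simp add: mult.commute)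

lemma bns_inf: "filterlim (\<lambda>n. b (real n * s)) at_top sequentially"
  by (rule filterlim_compose[OF rv.b_inf ns_inf])

lemma bns_shift: "(\<lambda>n. b (real (Suc n) * s) / b (real n * s)) \<longlonglongrightarrow> 1"
proof -
  have "(\<lambda>n. real (Suc n) * s / (real n * s)) \<longlonglongrightarrow> 1"
    using s LIMSEQ_Suc_n_over_n[where 'a = real] by simp
  from rv.b_ratio[OF ns_inf this] show ?thesis by simp
qed

lemma a_inf: "filterlim a at_top sequentially"
proof -
  have "filterlim (\<lambda>n. (a n * s / b (real n * s)) * b (real n * s)) at_top sequentially"
    by (rule filterlim_tendsto_pos_mult_at_top[OF ab _ bns_inf]) simp
  then have "filterlim (\<lambda>n. s * a n) at_top sequentially" using rv.b_pos by (simp add: order_less_imp_not_eq2 mult.commute)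
  from filterlim_tendsto_pos_mult_at_top[OF tendsto_const _ this, of "1 / s"] show ?thesis using s by simp
qed

lemma u_shift: "(\<lambda>n. u (Suc n) / u n) \<longlonglongrightarrow> 1"
proof -
  have "(\<lambda>n. (b (real (Suc n) * s) / b (real n * s)) * (real n / real (Suc n))) \<longlonglongrightarrow> 1 * 1"
    by (intro tendsto_mult bns_shift LIMSEQ_n_over_Suc_n)
  moreover have "\<forall>\<^sub>F n in sequentially. (b (real (Suc n) * s) / b (real n * s)) * (real n / real (Suc n)) = u (Suc n) / u n"
    using eventually_ge_at_top[of 1]
    by eventually_elim (use s rv.gamma rv.b_pos in \<open>simp add: u_def field_simps order_less_imp_not_eq2 del: of_nat_Suc\<close>)
  ultimately show ?thesis using Lim_transform_eventually by fastforce
qed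

text \<open>By the cocycle identity the counts differ by at most one, which is negligible after
  division by \<open>b\<close>. The other error comes from the quotient
  \<open>b (n * s) / b (Suc n * s)\<close> and is proportional to the value itself; hence the
  relative form.\<close>

lemma D_shift:
  assumes d: "d > 0"
  shows "\<forall>\<^sub>F n in sequentially. AE x in m. \<bar>D (Suc n) x - D n (\<Psi> s x)\<bar> \<le> d * (1 + D n (\<Psi> s x))"
proof -
  have "(\<lambda>n. inverse (b (real (Suc n) * s) / b (real n * s))) \<longlonglongrightarrow> inverse 1" by (intro tendsto_intros bns_shift) simp
  then have l: "(\<lambda>n. b (real n * s) / b (real (Suc n) * s)) \<longlonglongrightarrow> 1" by simp
  have "filterlim (\<lambda>n. b (real (Suc n) * s)) at_top sequentially"
    using filterlim_compose[OF bns_inf filterlim_Suc] by simp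
  then have l0: "(\<lambda>n. inverse (b (real (Suc n) * s))) \<longlonglongrightarrow> 0" by (rule tendsto_inverse_0_at_top)
  from tendstoD[OF l d] tendstoD[OF l0 d] show ?thesis
  proof eventually_elim
    fix n assume 1: "dist (b (real n * s) / b (real (Suc n) * s)) 1 < d" and 2: "dist (inverse (b (real (Suc n) * s))) 0 < d"
    let ?B = "b (real n * s)" and ?B' = "b (real (Suc n) * s)"
    have T: "0 \<le> real n * s" using s by simp
    have "AE z in m. real (crossings \<tau> r s z) \<le> 1"
      using crossings_small_AE[OF s] by eventually_elim (auto simp: indicator_def)
    with crossings_cocycle[OF less_imp_le[OF s(1)] T]
    show "AE x in m. \<bar>D (Suc n) x - D n (\<Psi> s x)\<bar> \<le> d * (1 + D n (\<Psi> s x))"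
    proof eventually_elim
      fix x assume c: "crossings \<tau> r (s + real n * s) x = crossings \<tau> r s x + crossings \<tau> r (real n * s) (\<Psi> s x)"
        and le: "real (crossings \<tau> r s x) \<le> 1"
      have ss: "real (Suc n) * s = s + real n * s" by (simp add: distrib_right)
      have "D (Suc n) x = real (crossings \<tau> r s x) * inverse ?B' + real (crossings \<tau> r (real n * s) (\<Psi> s x)) / ?B'"
        unfolding D_def ss c by (simp add: divide_inverse distrib_right)
      also have "real (crossings \<tau> r (real n * s) (\<Psi> s x)) / ?B' = D n (\<Psi> s x) * (?B / ?B')"
        using rv.b_pos[of "real n * s"] by (simp add: D_def)
      finally have "D (Suc n) x - D n (\<Psi> s x) = real (crossings \<tau> r s x) * inverse ?B' + D n (\<Psi> s x) * (?B / ?B' - 1)"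
        by (simp add: right_diff_distrib)
      moreover have "\<bar>real (crossings \<tau> r s x) * inverse ?B'\<bar> \<le> 1 * d"
        unfolding abs_mult using le 2 by (intro mult_mono) (auto simp: dist_real_def)
      moreover have "\<bar>D n (\<Psi> s x) * (?B / ?B' - 1)\<bar> \<le> D n (\<Psi> s x) * d"
        unfolding abs_mult using 1 D_nonneg[of n "\<Psi> s x"] by (intro mult_mono) (auto simp: dist_real_def)
      ultimately show "\<bar>D (Suc n) x - D n (\<Psi> s x)\<bar> \<le> d * (1 + D n (\<Psi> s x))"
        unfolding distrib_left by (simp add: mult.commute)
    qed
  qed
qed

lemma EW_bounds:
  assumes g: "g \<in> borel_measurable borel" "\<And>x. 0 \<le> g x" "\<And>x. g x \<le> 1"
  shows "integrable Y (\<lambda>y. y * g y)" "0 \<le> EW g" "EW g \<le> 1" "EW (\<lambda>x. 1 - g x) = 1 - EW g"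
proof -
  interpret Y: real_distribution Y using Y by (simp add: mittag_leffler_law_def)
  have pos: "AE y in Y. 0 < y" using Y by (simp add: mittag_leffler_law_def)
  note [measurable] = g(1)
  note mean = mittag_leffler_law_mean[OF rv.gamma Y]
  show i: "integrable Y (\<lambda>y. y * g y)"
  proof (rule Bochner_Integration.integrable_bound[OF mean(1)])
    show "AE y in Y. norm (y * g y) \<le> norm y"
      using g by (auto simp: abs_mult intro!: AE_I2 mult_left_le)
  qed simp
  show "0 \<le> EW g" unfolding EW_def by (rule integral_nonneg_AE) (use pos g in \<open>auto elim!: eventually_mono\<close>)
  have "EW g \<le> (\<integral>y. y \<partial>Y)" unfolding EW_def
    by (rule integral_mono_AE[OF i mean(1)]) (use pos g in \<open>auto elim!: eventually_mono intro!: mult_left_le\<close>)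
  then show "EW g \<le> 1" using mean by simp
  show "EW (\<lambda>x. 1 - g x) = 1 - EW g" unfolding EW_def using i mean by (simp add: right_diff_distrib)
qed

lemma indicator_prod_meas: "E \<in> sets (\<mu> \<Otimes>\<^sub>M lborel) \<Longrightarrow> (indicator E :: _ \<Rightarrow> real) \<in> borel_measurable m"
  by (rule measurable_m) simp

text \<open>Decomposition by the number \<open>k\<close> of crossings: each part is bounded from
  below by \<open>local_prob\<close> through \<open>transfer_lower\<close>, and the sum over
  \<open>k\<close> divided by \<open>u n\<close> is handled by \<open>local_limits_fatou\<close>.
  Heights are compared with the points of countable grids, so the exceptional null sets remain
  countable in number.\<close>

lemma lower_bound:
  assumes A: "A \<in> cylinders \<mu> \<tau> \<aa>" and ab: "0 \<le> \<alpha>" "\<alpha> < \<beta>" "\<beta> \<le> s"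
    and g: "continuous_on UNIV g" "\<And>x. 0 \<le> g x" "\<And>x. g x \<le> 1"
  shows "AE z in m. \<forall>\<epsilon>>0. \<forall>\<^sub>F n in sequentially.
    ((\<beta> - \<alpha>) * measure \<mu> A * EW g - \<epsilon>) * u n \<le> F.Th n (\<lambda>z. indicator (A \<times> {\<alpha>..<\<beta>}) z * g (D n z)) z"
proof -
  have As: "A \<in> sets \<mu>" by (rule base.cylinder_sets[OF _ A]) (use fib in \<open>simp add: fibered_system_def\<close>)
  have g_meas[measurable]: "g \<in> borel_measurable borel" using g(1) by (rule borel_measurable_continuous_onI)
  have fZc: "continuous_on {0<..} fZ" "\<And>x. 0 \<le> fZ x" using fZ by (auto simp: stable_density_def)
  have "distributed Y lborel (\<lambda>y. y powr (- 1 / \<gamma>)) (\<lambda>x. ennreal (fZ x))" using fZ by (simp add: stable_density_def)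
  from distributed_real_measurable[OF _ this] fZc have fZm: "fZ \<in> borel_measurable borel"
    by (simp add: measurable_lborel1)
  let ?F = "indicator (A \<times> {\<alpha>..<\<beta>}) :: _ \<Rightarrow> real"
  let ?C = "\<lambda>n k. indicator {z. crossings \<tau> r (real n * s) z = k} :: _ \<Rightarrow> real"
  let ?g = "\<lambda>n k. g (real k / b (real n * s))"
  have Fi: "integrable m ?F" using integral_low(1)[OF As ab(1)] ab s by simp
  have FCi: "integrable m (\<lambda>z. ?F z * ?C n k z)" for n k
    by (rule F.integrable_bounded_mult[OF Fi, where B = 1]) (auto simp: indicator_def)
  have Fgi: "integrable m (\<lambda>z. ?F z * g (D n z))" for n
    by (rule F.integrable_bounded_mult[OF Fi, where B = 1]) (use g in auto)
  \<comment> \<open>Mesh of the height grid; the points \<open>y0 i j\<close> are its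
    multiples.\<close>
  define \<eta> where "\<eta> i = 1 / real (Suc i)" for i
  have \<eta>: "0 < \<eta> i" for i by (simp add: \<eta>_def)
  define y0 where "y0 i j = real_of_int j * \<eta> i" for i j
  let ?lp = "\<lambda>i j n k. local_prob \<mu> \<tau> r A {\<alpha>..<\<beta> - \<eta> i} k (real n * s - y0 i j)"
  have ae1: "AE z in m. \<forall>i j n k. y0 i j \<le> snd z \<longrightarrow> snd z < y0 i j + \<eta> i \<longrightarrow>
     ?lp i j n k (fst z) \<le> F.Th n (\<lambda>z. ?F z * ?C n k z) z"
    unfolding AE_all_countable by (intro allI transfer_lower[OF As ab(1) _ _ s(1)]) (use ab s in auto)
  \<comment> \<open>Finite partial sums suffice because the bound for the series of nonnegative
    terms follows from them; infinitely many parts are never added under the transfer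
    operator.\<close>
  have ae2: "AE z in m. \<forall>n K. (\<Sum>k<K. ?g n k * F.Th n (\<lambda>z. ?F z * ?C n k z) z) \<le> F.Th n (\<lambda>z. ?F z * g (D n z)) z"
    unfolding AE_all_countable
  proof (intro allI)
    fix n K
    have i: "integrable m (\<lambda>z. ?g n k * (?F z * ?C n k z))" for k using FCi by simp
    have "AE z in m. F.Th n (\<lambda>z. \<Sum>k<K. ?g n k * (?F z * ?C n k z)) z \<le> F.Th n (\<lambda>z. ?F z * g (D n z)) z"
    proof (rule F.Th_mono[OF _ Fgi], use i in simp, rule AE_I2)
      fix z
      have "(\<Sum>k<K. ?g n k * (?F z * ?C n k z)) = (\<Sum>k\<in>{..<K} \<inter> {crossings \<tau> r (real n * s) z}. ?g n k * ?F z)"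
        by (subst sum.inter_restrict) (auto intro!: sum.cong simp: indicator_def)
      also have "\<dots> \<le> (\<Sum>k\<in>{crossings \<tau> r (real n * s) z}. ?g n k * ?F z)"
        using g by (intro sum_mono2) auto
      also have "\<dots> = ?F z * g (D n z)"
      proof -
        have "(\<Sum>k\<in>{N}. h k) = h N" for h :: "nat \<Rightarrow> real" and N by simp
        then show ?thesis unfolding D_def by (simp only: mult.commute)
      qed
      finally show "(\<Sum>k<K. ?g n k * (?F z * ?C n k z)) \<le> ?F z * g (D n z)" .
    qed
    moreover have "AE z in m. F.Th n (\<lambda>z. \<Sum>k<K. ?g n k * (?F z * ?C n k z)) z = (\<Sum>k<K. F.Th n (\<lambda>z. ?g n k * (?F z * ?C n k z)) z)"
      by (rule F.Th_sum) (use i in auto)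
    moreover have "AE z in m. \<forall>k. F.Th n (\<lambda>z. ?g n k * (?F z * ?C n k z)) z = ?g n k * F.Th n (\<lambda>z. ?F z * ?C n k z) z"
      unfolding AE_all_countable by (intro allI F.Th_cmult FCi)
    ultimately show "AE z in m. (\<Sum>k<K. ?g n k * F.Th n (\<lambda>z. ?F z * ?C n k z) z) \<le> F.Th n (\<lambda>z. ?F z * g (D n z)) z"
      by eventually_elim simp
  qed
  \<comment> \<open>One \<eta> is lost to the shortened interval in \<open>transfer_lower\<close>,
    the other is the \<epsilon> of the block averages.\<close>
  let ?\<phi> = "\<lambda>i l. 1 / \<gamma> * l powr (- 1 / \<gamma>) * fZ (l powr (- 1 / \<gamma>)) * g l * (measure \<mu> A * (\<beta> - \<eta> i - \<alpha> - \<eta> i))"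
  have ae3: "AE z in m. \<forall>i j. \<eta> i < \<beta> - \<alpha> \<longrightarrow> (\<forall>c. c < (\<integral>\<^sup>+l. indicator {0<..} l * ennreal (?\<phi> i l) \<partial>lborel) \<longrightarrow>
      (\<forall>\<^sub>F n in sequentially. c < (\<Sum>k. ennreal (?g n k * ?lp i j n k (fst z) / u n))))"
    unfolding AE_all_countable
  proof (intro allI)
    fix i j
    show "AE z in m. \<eta> i < \<beta> - \<alpha> \<longrightarrow> (\<forall>c. c < (\<integral>\<^sup>+l. indicator {0<..} l * ennreal (?\<phi> i l) \<partial>lborel) \<longrightarrow>
      (\<forall>\<^sub>F n in sequentially. c < (\<Sum>k. ennreal (?g n k * ?lp i j n k (fst z) / u n))))"
    proof (cases "\<eta> i < \<beta> - \<alpha>")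
      case True
      have "local_limits \<mu> \<tau> r binv fZ A \<alpha> (\<beta> - \<eta> i)" using True ab \<eta>[of i] by (intro ll A) auto
      from rv.local_limits_fatou[OF mps_base base.finite_measure_axioms r_meas As fZc s(1) this fZm g \<eta>[of i], where ?y0.0 = "y0 i j"]
      have "AE w in \<mu>. \<forall>c. c < (\<integral>\<^sup>+l. indicator {0<..} l * ennreal (?\<phi> i l) \<partial>lborel) \<longrightarrow>
        (\<forall>\<^sub>F n in sequentially. c < (\<Sum>k. ennreal (?g n k * ?lp i j n k w / u n)))"
        by (simp only: u_def)
      from AE_m_fst[OF this] show ?thesis by eventually_elim blast
    qed simp
  qed
  have ae0: "AE z in m. \<forall>i j n k. 0 \<le> ?lp i j n k (fst z)"
    unfolding AE_all_countable
    by (intro allI AE_m_fst rv.local_prob_nonneg[OF mps_base base.finite_measure_axioms r_meas As fZc s(1)])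
  have "AE z in m. \<forall>n. 0 \<le> F.Th n (\<lambda>z. ?F z * g (D n z)) z"
    unfolding AE_all_countable by (intro allI F.Th_nonneg Fgi) (use g in auto)
  with ae0 ae1 ae2 ae3 show ?thesis
  proof (eventually_elim, intro allI impI)
    fix z and \<epsilon> :: real
    assume 0: "\<forall>i j n k. 0 \<le> ?lp i j n k (fst z)"
      and 1: "\<forall>i j n k. y0 i j \<le> snd z \<longrightarrow> snd z < y0 i j + \<eta> i \<longrightarrow> ?lp i j n k (fst z) \<le> F.Th n (\<lambda>z. ?F z * ?C n k z) z"
      and 2: "\<forall>n K. (\<Sum>k<K. ?g n k * F.Th n (\<lambda>z. ?F z * ?C n k z) z) \<le> F.Th n (\<lambda>z. ?F z * g (D n z)) z"
      and 3: "\<forall>i j. \<eta> i < \<beta> - \<alpha> \<longrightarrow> (\<forall>c. c < (\<integral>\<^sup>+l. indicator {0<..} l * ennreal (?\<phi> i l) \<partial>lborel) \<longrightarrow>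
        (\<forall>\<^sub>F n in sequentially. c < (\<Sum>k. ennreal (?g n k * ?lp i j n k (fst z) / u n))))"
      and 4: "\<forall>n. 0 \<le> F.Th n (\<lambda>z. ?F z * g (D n z)) z" and e: "\<epsilon> > 0"
    let ?I = "(\<beta> - \<alpha>) * measure \<mu> A * EW g"
    show "\<forall>\<^sub>F n in sequentially. (?I - \<epsilon>) * u n \<le> F.Th n (\<lambda>z. ?F z * g (D n z)) z"
    \<comment> \<open>In the first case the left side is nonpositive; in the second
      \<open>?I - \<epsilon>\<close> is nonnegative and its conversion to \<open>ennreal\<close>
      loses nothing.\<close>
    proof (cases "?I < \<epsilon>")
      case True
      then show ?thesis using 4 u_nonneg by (intro always_eventually allI) (meson diff_less_0_iff_less less_imp_le mult_nonpos_nonneg order_trans)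
    next
      case False
      have "0 < min (\<epsilon> / 2) ((\<beta> - \<alpha>) / 2)" using e ab by simp
      then obtain i where "1 / real (Suc i) < min (\<epsilon> / 2) ((\<beta> - \<alpha>) / 2)" using nat_approx_posE by blast
      then have i: "2 * \<eta> i < \<epsilon>" "2 * \<eta> i < \<beta> - \<alpha>" by (auto simp: \<eta>_def)
      define j where "j = \<lfloor>snd z / \<eta> i\<rfloor>"
      have "of_int j \<le> snd z / \<eta> i" "snd z / \<eta> i < of_int j + 1" unfolding j_def by linarith+
      then have j: "y0 i j \<le> snd z" "snd z < y0 i j + \<eta> i"
        using \<eta>[of i] by (auto simp: y0_def pos_le_divide_eq pos_divide_less_eq distrib_right)
      have int: "(\<integral>\<^sup>+l. indicator {0<..} l * ennreal (?\<phi> i l) \<partial>lborel) = ennreal (measure \<mu> A * (\<beta> - \<alpha> - 2 * \<eta> i) * EW g)"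
      proof -
        let ?\<psi> = "\<lambda>l. 1 / \<gamma> * l powr (- 1 / \<gamma>) * fZ (l powr (- 1 / \<gamma>)) * g l"
        note [measurable] = fZm
        have "(\<integral>\<^sup>+l. indicator {0<..} l * ennreal (?\<phi> i l) \<partial>lborel)
            = (\<integral>\<^sup>+l. ennreal (measure \<mu> A * (\<beta> - \<alpha> - 2 * \<eta> i)) * (indicator {0<..} l * ennreal (?\<psi> l)) \<partial>lborel)"
        proof (rule nn_integral_cong)
          fix l :: real
          have "?\<phi> i l = (measure \<mu> A * (\<beta> - \<alpha> - 2 * \<eta> i)) * ?\<psi> l" by (simp add: algebra_simps)
          then have "ennreal (?\<phi> i l) = ennreal (measure \<mu> A * (\<beta> - \<alpha> - 2 * \<eta> i)) * ennreal (?\<psi> l)"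
            using i by (simp only:) (rule ennreal_mult', simp)
          then show "indicator {0<..} l * ennreal (?\<phi> i l) = ennreal (measure \<mu> A * (\<beta> - \<alpha> - 2 * \<eta> i)) * (indicator {0<..} l * ennreal (?\<psi> l))"
            by (simp only: mult_ac)
        qed
        also have "\<dots> = ennreal (measure \<mu> A * (\<beta> - \<alpha> - 2 * \<eta> i)) * (\<integral>\<^sup>+l. indicator {0<..} l * ennreal (?\<psi> l) \<partial>lborel)"
          by (rule nn_integral_cmult) simp
        also have "(\<integral>\<^sup>+l. indicator {0<..} l * ennreal (?\<psi> l) \<partial>lborel) = ennreal (EW g)"
          unfolding EW_def by (rule stable_density_change_of_variables[OF rv.gamma Y fZ g_meas g(2,3)])
        finally show ?thesis using i EW_bounds(2)[OF g_meas g(2,3)] by (simp add: ennreal_mult)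
      qed
      have "?I - \<epsilon> < measure \<mu> A * (\<beta> - \<alpha> - 2 * \<eta> i) * EW g"
      proof -
        have "measure \<mu> A * EW g \<le> 1 * 1" by (intro mult_mono EW_bounds[OF g_meas g(2,3)]) auto
        then have "measure \<mu> A * EW g * (2 * \<eta> i) \<le> 1 * (2 * \<eta> i)" using \<eta>[of i] by (intro mult_right_mono) auto
        then show ?thesis using i by (simp add: algebra_simps)
      qed
      then have c: "ennreal (?I - \<epsilon>) < (\<integral>\<^sup>+l. indicator {0<..} l * ennreal (?\<phi> i l) \<partial>lborel)"
        unfolding int using False by (intro ennreal_lessI) auto
      have "\<eta> i < \<beta> - \<alpha>" using i \<eta>[of i] by linarith
      from 3[rule_format, OF this c, of j] eventually_ge_at_top[of 1]
      show ?thesis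
      proof eventually_elim
        fix n :: nat assume lt: "ennreal (?I - \<epsilon>) < (\<Sum>k. ennreal (?g n k * ?lp i j n k (fst z) / u n))" and n: "1 \<le> n"
        let ?Z = "F.Th n (\<lambda>z. ?F z * g (D n z)) z"
        have un: "0 < u n" by (rule u_pos[OF n])
        have "(\<Sum>k<K. ennreal (?g n k * ?lp i j n k (fst z) / u n)) \<le> ennreal (?Z / u n)" for K
        proof -
          have "(\<Sum>k<K. ennreal (?g n k * ?lp i j n k (fst z) / u n)) = ennreal ((\<Sum>k<K. ?g n k * ?lp i j n k (fst z)) / u n)"
            unfolding sum_divide_distrib using g 0 un by (intro sum_ennreal divide_nonneg_pos mult_nonneg_nonneg) auto
          also have "\<dots> \<le> ennreal ((\<Sum>k<K. ?g n k * F.Th n (\<lambda>z. ?F z * ?C n k z) z) / u n)"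
            using 1 j g un by (intro ennreal_leI divide_right_mono sum_mono mult_left_mono) auto
          also have "\<dots> \<le> ennreal (?Z / u n)"
            using 2 un by (intro ennreal_leI divide_right_mono) auto
          finally show ?thesis .
        qed
        then have "(\<Sum>k. ennreal (?g n k * ?lp i j n k (fst z) / u n)) \<le> ennreal (?Z / u n)"
          by (intro suminf_le_const) auto
        then have "ennreal (?I - \<epsilon>) < ennreal (?Z / u n)" using lt by (rule less_le_trans[rotated])
        then have "?I - \<epsilon> < ?Z / u n" by (rule contrapos_pp) (simp add: not_less ennreal_leI)
        then show "(?I - \<epsilon>) * u n \<le> ?Z" using un by (simp add: pos_less_divide_eq)
      qed
    qed
  qed
qed


end

section \<open>Averages of the weights; good densities from cylinders to integrable
  functions\<close>

context gll_system
begin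

lemma EW_one: "EW (\<lambda>_. 1) = 1"
  using mittag_leffler_law_mean[OF rv.gamma Y] by (simp add: EW_def)

text \<open>Otherwise the countable partition would cover the space by null sets.\<close>

lemma positive_cylinder: "\<exists>A\<in>cylinders \<mu> \<tau> \<aa>. 0 < measure \<mu> A"
proof (rule ccontr)
  assume "\<not> (\<exists>A\<in>cylinders \<mu> \<tau> \<aa>. 0 < measure \<mu> A)"
  then have z: "measure \<mu> A = 0" if "A \<in> \<aa>" for A
    using that partition_subset_cylinders[OF fib] by (metis less_eq_real_def measure_nonneg subsetD)
  have \<aa>: "countable \<aa>" "\<aa> \<subseteq> sets \<mu>" "\<Union>\<aa> = space \<mu>"
    using fib by (auto simp: fibered_system_def partition_on_def)
  have "(\<Union>A\<in>\<aa>. A) \<in> null_sets \<mu>"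
    using \<aa> z by (intro null_sets_UN') (auto simp: null_sets_def base.emeasure_eq_measure)
  then have "measure \<mu> (space \<mu>) = 0" using \<aa>(3) by (simp add: measure_def null_setsD1)
  then show False using base.prob_space by simp
qed

text \<open>Upper bound: by \<open>lower_bound\<close> with \<open>g = 1\<close>, the transfer
  images of a strip over a cylinder are at least about \<open>?I * u n\<close>, while their averages
  converge to \<open>?I\<close>. Lower bound: \<open>karamata_lower\<close> together with
  \<open>ab\<close>. As \<open>u\<close> does not depend on the point, one point \<open>z\<close> is
  enough.\<close>

lemma u_avg: "avg a u \<longlonglongrightarrow> 1"
proof (rule tendstoI)
  fix e :: real assume e: "e > 0"
  obtain A where A: "A \<in> cylinders \<mu> \<tau> \<aa>" "0 < measure \<mu> A" using positive_cylinder by auto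
  have As: "A \<in> sets \<mu>" by (rule base.cylinder_sets[OF _ A(1)]) (use fib in \<open>simp add: fibered_system_def\<close>)
  let ?F = "indicator (A \<times> {0..<s}) :: _ \<Rightarrow> real" and ?I = "s * measure \<mu> A"
  have F: "integrable m ?F" "(\<integral>z. ?F z \<partial>m) = ?I" using integral_low[OF As, of 0 s] s by auto
  have I: "0 < ?I" using A s by simp
  have "AE z in m. \<forall>\<epsilon>>0. \<forall>\<^sub>F n in sequentially. (?I - \<epsilon>) * u n \<le> F.Th n ?F z"
    using lower_bound[OF A(1), of 0 s "\<lambda>_. 1"] s EW_one by simp
  with F.avg_Th[OF rs F(1)]
  have "AE z in m. avg a (\<lambda>n. F.Th n ?F z) \<longlonglongrightarrow> ?I \<and> (\<forall>\<epsilon>>0. \<forall>\<^sub>F n in sequentially. (?I - \<epsilon>) * u n \<le> F.Th n ?F z)"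
    unfolding F(2) by eventually_elim simp
  from AE_base_positive[OF this] obtain z where z: "avg a (\<lambda>n. F.Th n ?F z) \<longlonglongrightarrow> ?I"
    "\<And>\<epsilon>. \<epsilon> > 0 \<Longrightarrow> \<forall>\<^sub>F n in sequentially. (?I - \<epsilon>) * u n \<le> F.Th n ?F z" by auto
  \<comment> \<open>Chosen so that \<open>(?I + \<epsilon>) / (?I - \<epsilon>) < 1 + e\<close>,
    which amounts to \<open>\<epsilon> * (2 + e) < e * ?I\<close>.\<close>
  define \<epsilon> where "\<epsilon> = e * ?I / (2 * (2 + e))"
  have "\<epsilon> * (2 + e) = e * ?I / 2" using e by (simp add: \<epsilon>_def field_simps)
  moreover have "0 < e * ?I" using e I by simp
  ultimately have \<epsilon>0: "\<epsilon> * (2 + e) < e * ?I" "0 < \<epsilon>"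
    by linarith (use e I in \<open>simp add: \<epsilon>_def\<close>)
  have "e * ?I \<le> (2 + e) * ?I" by (rule mult_right_mono) (use I in auto)
  then have "(2 + e) * \<epsilon> < (2 + e) * ?I" using \<epsilon>0(1) by (simp only: mult.commute[of \<epsilon>])
  then have "\<epsilon> < ?I" using e by simp
  moreover have "(?I + \<epsilon>) < (1 + e) * (?I - \<epsilon>)" using \<epsilon>0(1) by (simp add: algebra_simps)
  ultimately have \<epsilon>: "(?I + \<epsilon>) / (?I - \<epsilon>) < 1 + e" "0 < \<epsilon>" "\<epsilon> < ?I"
    using \<epsilon>0(2) by (auto simp: pos_divide_less_eq)
  have up: "\<forall>\<^sub>F N in sequentially. (?I - \<epsilon>) * avg a u N < ?I + \<epsilon>"
    using avg_limsup[OF a_inf z(2)[OF \<epsilon>(2)] z(1) \<epsilon>(2)] by (simp add: avg_cmult)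
  have "(\<lambda>n. inverse (a n * s / b (real n * s))) \<longlonglongrightarrow> inverse 1" by (intro tendsto_intros ab) simp
  then have "(\<lambda>N. (1 - e / 2) * inverse (a N * s / b (real N * s))) \<longlonglongrightarrow> (1 - e / 2) * inverse 1"
    by (intro tendsto_mult tendsto_const)
  then have low1: "\<forall>\<^sub>F N in sequentially. 1 - e < (1 - e / 2) * inverse (a N * s / b (real N * s))"
    by (rule order_tendstoD(1)) (use e in simp)
  have "\<forall>\<^sub>F N in sequentially. 0 < a N" using a_inf by (rule filterlim_at_top_dense[THEN iffD1, rule_format])
  with up low1 rv.karamata_lower[OF s(1) half_gt_zero[OF e]]
  show "\<forall>\<^sub>F N in sequentially. dist (avg a u N) 1 < e"
  proof eventually_elim
    case (elim N)
    have "avg a u N < (?I + \<epsilon>) / (?I - \<epsilon>)" using elim(1) \<epsilon> by (simp add: pos_less_divide_eq mult.commute)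
    then have "avg a u N < 1 + e" using \<epsilon>(1) by linarith
    moreover have "1 - e < avg a u N"
    proof -
      have "(1 - e / 2) * (b (real N * s) / s) / a N \<le> (\<Sum>n=1..N. u n) / a N"
        using elim(3,4) e unfolding u_def by (intro divide_right_mono) auto
      moreover have "(1 - e / 2) * (b (real N * s) / s) / a N = (1 - e / 2) * inverse (a N * s / b (real N * s))"
      proof -
        have "X * (Z / s) / V = X * inverse (V * s / Z)" for X Z V :: real by simp
        then show ?thesis .
      qed
      ultimately have "(1 - e / 2) * inverse (a N * s / b (real N * s)) \<le> avg a u N"
        unfolding avg_def by (simp only: mult_1_left times_divide_eq_left)
      then show ?thesis using elim(2) by linarith
    qed
    ultimately show ?case by (auto simp: dist_real_def abs_less_iff)
  qed
qed

sublocale cesaro_system m "\<Psi> s" a u D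
proof unfold_locales
  show "return_sequence m (\<Psi> s) a" by (rule rs)
  show "filterlim a at_top sequentially" by (rule a_inf)
  show "avg a u \<longlonglongrightarrow> 1" by (rule u_avg)
  show "(\<lambda>n. u (Suc n) / u n) \<longlonglongrightarrow> 1" by (rule u_shift)
qed (auto intro: u_pos D_meas D_nonneg D_shift)

context
  fixes g :: "real \<Rightarrow> real"
  assumes g_cont: "continuous_on UNIV g" and g_bd: "\<And>x. 0 \<le> g x" "\<And>x. g x \<le> 1"
    and g_osc: "\<And>\<epsilon>. \<epsilon> > 0 \<Longrightarrow> \<exists>d>0. \<forall>x y. 0 \<le> x \<longrightarrow> 0 \<le> y \<longrightarrow> \<bar>x - y\<bar> \<le> d * (1 + y) \<longrightarrow> \<bar>g x - g y\<bar> \<le> \<epsilon>"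
begin

lemma g_meas: "g \<in> borel_measurable borel"
  using g_cont by (rule borel_measurable_continuous_onI)

lemmas EWg = EW_bounds[OF g_meas g_bd]

lemmas good_lincomb' = good_lincomb[OF g_meas g_bd EWg(2)]
lemmas good_limit' = good_limit[OF g_meas g_bd EWg(2)]
lemmas good_cong' = good_cong_AE[OF g_meas g_bd EWg(2)]

lemma good_zero: "good g (EW g) (\<lambda>_. 0)"
proof -
  have "AE z in m. \<forall>n. F.Th n (\<lambda>_. 0) z = 0" unfolding AE_all_countable by (intro allI F.Th_zero)
  then show ?thesis unfolding good_def by (auto simp: avg_def[abs_def] elim!: eventually_mono)
qed

lemma good_sum:
  assumes "finite I" "\<And>i. i \<in> I \<Longrightarrow> good g (EW g) (H i)"
  shows "good g (EW g) (\<lambda>z. \<Sum>i\<in>I. H i z)"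
  using assms
proof (induction I rule: finite_induct)
  case empty then show ?case using good_zero by simp
next
  case (insert i I)
  then show ?case using good_lincomb'[of "H i" "\<lambda>z. \<Sum>i\<in>I. H i z" 1 1] by simp
qed

text \<open>Pointwise approximation with an integrable majorant of the errors is approximation in
  L1, to which \<open>good_limit\<close> applies.\<close>

lemma good_limit_dominated:
  assumes H: "\<And>k. good g (EW g) (H k)" and F: "integrable m F" and w: "integrable m w"
    and lim: "AE z in m. (\<lambda>k. H k z) \<longlonglongrightarrow> F z" and dom: "\<And>k. AE z in m. \<bar>F z - H k z\<bar> \<le> w z"
  shows "good g (EW g) F"
proof (rule good_limit'[OF F])
  fix d :: real assume d: "d > 0"
  have Hi: "integrable m (H k)" for k using H by (simp add: good_def)
  have "(\<lambda>k. \<integral>z. \<bar>F z - H k z\<bar> \<partial>m) \<longlonglongrightarrow> (\<integral>z. 0 \<partial>m)"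
  proof (rule integral_dominated_convergence[OF _ _ w])
    show "AE z in m. (\<lambda>k. \<bar>F z - H k z\<bar>) \<longlonglongrightarrow> 0"
      using lim
    proof eventually_elim
      fix z assume "(\<lambda>k. H k z) \<longlonglongrightarrow> F z"
      then have "(\<lambda>k. \<bar>F z - H k z\<bar>) \<longlonglongrightarrow> \<bar>F z - F z\<bar>" by (intro tendsto_intros)
      then show "(\<lambda>k. \<bar>F z - H k z\<bar>) \<longlonglongrightarrow> 0" by simp
    qed
    show "AE z in m. norm \<bar>F z - H k z\<bar> \<le> w z" for k using dom[of k] by simp
  qed (use F Hi in auto)
  then have "\<forall>\<^sub>F k in sequentially. (\<integral>z. \<bar>F z - H k z\<bar> \<partial>m) < d" using d by (intro order_tendstoD(2)) auto
  then obtain k where "(\<integral>z. \<bar>F z - H k z\<bar> \<partial>m) < d" by (auto simp: eventually_sequentially)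
  then show "\<exists>H. good g (EW g) H \<and> (\<integral>z. \<bar>F z - H z\<bar> \<partial>m) \<le> d" using H[of k] by (intro exI[of _ "H k"]) auto
qed

lemma strip_integrable:
  assumes E: "E \<in> sets (\<mu> \<Otimes>\<^sub>M lborel)"
  shows "integrable m (\<lambda>z. indicator E z * indicator (space \<mu> \<times> {0..<s}) z :: real)"
proof -
  have "integrable m (\<lambda>z. indicator (space \<mu> \<times> {0..<s}) z * indicator E z :: real)"
  proof (rule F.integrable_bounded_mult[OF _ indicator_prod_meas[OF E]])
    show "integrable m (indicator (space \<mu> \<times> {0..<s}) :: _ \<Rightarrow> real)"
      using integral_low(1)[of "space \<mu>" 0 s] s by simp
    show "AE z in m. \<bar>indicator E z :: real\<bar> \<le> 1" by (auto simp: indicator_def)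
  qed
  then show ?thesis by (simp add: mult.commute)
qed

text \<open>Intersecting with the strip lets \<open>E\<close> range over the whole product
  \<sigma>-algebra, where the Dynkin system arguments take place.\<close>

definition strip_good :: "('w \<times> real) set \<Rightarrow> bool" where
  "strip_good E \<longleftrightarrow> good g (EW g) (\<lambda>z. indicator E z * indicator (space \<mu> \<times> {0..<s}) z)"

lemma strip_good_empty: "strip_good {}"
  using good_zero by (simp add: strip_good_def)

lemma strip_good_Diff:
  assumes "strip_good E" "strip_good E'" "E' \<subseteq> E" shows "strip_good (E - E')"
proof -
  have "(\<lambda>z. indicator (E - E') z * indicator (space \<mu> \<times> {0..<s}) z :: real) =
    (\<lambda>z. 1 * (indicator E z * indicator (space \<mu> \<times> {0..<s}) z) + (-1) * (indicator E' z * indicator (space \<mu> \<times> {0..<s}) z))"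
    using assms(3) by (auto simp: fun_eq_iff indicator_def)
  moreover have "good g (EW g) (\<lambda>z. 1 * (indicator E z * indicator (space \<mu> \<times> {0..<s}) z) + (-1) * (indicator E' z * indicator (space \<mu> \<times> {0..<s}) z))"
    by (rule good_lincomb') (use assms in \<open>simp_all add: strip_good_def\<close>)
  ultimately show ?thesis unfolding strip_good_def by (simp only:)
qed

lemma strip_good_UN:
  assumes E: "disjoint_family E" "range E \<subseteq> sets (\<mu> \<Otimes>\<^sub>M lborel)" "\<And>i::nat. strip_good (E i)"
  shows "strip_good (\<Union>i. E i)"
  unfolding strip_good_def
proof (rule good_limit_dominated)
  let ?s = "indicator (space \<mu> \<times> {0..<s}) :: _ \<Rightarrow> real"
  let ?H = "\<lambda>k z. \<Sum>i<k. indicator (E i) z * ?s z"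
  show "good g (EW g) (?H k)" for k
    by (rule good_sum) (use E(3) in \<open>auto simp: strip_good_def\<close>)
  show "integrable m (\<lambda>z. indicator (\<Union>i. E i) z * ?s z)" by (rule strip_integrable) (use E(2) in auto)
  show "integrable m ?s" using integral_low(1)[of "space \<mu>" 0 s] s by simp
  have eq: "?H k z = indicator (\<Union>i<k. E i) z * ?s z" for k z
  proof -
    have "indicator (\<Union>i<k. E i) z = (\<Sum>i<k. indicator (E i) z :: real)"
      by (rule indicator_UN_disjoint) (use E(1) in \<open>auto simp: disjoint_family_on_def\<close>)
    then show ?thesis by (simp add: sum_distrib_right)
  qed
  show "AE z in m. \<bar>indicator (\<Union>i. E i) z * ?s z - ?H k z\<bar> \<le> ?s z" for k
    unfolding eq by (auto simp: indicator_def)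
  show "AE z in m. (\<lambda>k. ?H k z) \<longlonglongrightarrow> indicator (\<Union>i. E i) z * ?s z"
  proof (rule AE_I2)
    fix z
    show "(\<lambda>k. ?H k z) \<longlonglongrightarrow> indicator (\<Union>i. E i) z * ?s z"
      unfolding eq by (intro tendsto_intros LIMSEQ_indicator_UN)
  qed
qed

text \<open>\<open>lower_bound\<close> applies to \<open>1 - g\<close> as well as to
  \<open>g\<close>, and its constants are complementary because
  \<open>EW (\<lambda>x. 1 - g x) = 1 - EW g\<close>.\<close>

lemma strip_good_cylinder:
  assumes A: "A \<in> cylinders \<mu> \<tau> \<aa>" and ab: "0 \<le> \<alpha>" "\<alpha> < \<beta>" "\<beta> \<le> s"
  shows "strip_good (A \<times> {\<alpha>..<\<beta>})"
proof -
  have As: "A \<in> sets \<mu>" by (rule base.cylinder_sets[OF _ A]) (use fib in \<open>simp add: fibered_system_def\<close>)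
  let ?F = "indicator (A \<times> {\<alpha>..<\<beta>}) :: _ \<Rightarrow> real"
  have F: "integrable m ?F" "(\<integral>z. ?F z \<partial>m) = (\<beta> - \<alpha>) * measure \<mu> A" using integral_low[OF As ab(1), of \<beta>] ab s by auto
  have "good g (EW g) ?F"
  proof (rule good_if_lower_bounds[OF g_meas g_bd EWg(2) F(1)])
    show "AE z in m. \<forall>\<epsilon>>0. \<forall>\<^sub>F n in sequentially. ((\<integral>x. ?F x \<partial>m) * EW g - \<epsilon>) * u n \<le> F.Th n (\<lambda>x. ?F x * g (D n x)) z"
      unfolding F(2) by (rule lower_bound[OF A ab g_cont g_bd])
    show "AE z in m. \<forall>\<epsilon>>0. \<forall>\<^sub>F n in sequentially. ((\<integral>x. ?F x \<partial>m) * (1 - EW g) - \<epsilon>) * u n \<le> F.Th n (\<lambda>x. ?F x * (1 - g (D n x))) z"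
      unfolding F(2) EWg(4)[symmetric]
      by (rule lower_bound[OF A ab]) (use g_bd in \<open>auto intro!: continuous_intros g_cont\<close>)
  qed
  moreover have "?F z = ?F z * indicator (space \<mu> \<times> {0..<s}) z" for z
    using ab sets.sets_into_space[OF As] by (auto simp: indicator_def)
  ultimately show ?thesis unfolding strip_good_def by presburger
qed

text \<open>Induction over the Dynkin system generated by the cylinders. The whole space enters
  separately as the countable disjoint union of the partition, and the generated \<sigma>-algebra
  exhausts the measurable sets modulo null sets, so \<open>B\<close> is replaced by some
  \<open>B'\<close>.\<close>

lemma strip_good_rect:
  assumes B: "B \<in> sets \<mu>" and ab: "0 \<le> \<alpha>" "\<alpha> < \<beta>" "\<beta> \<le> s"
  shows "strip_good (B \<times> {\<alpha>..<\<beta>})"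
proof -
  let ?G = "insert {} (cylinders \<mu> \<tau> \<aa>)"
  have cyl: "cylinders \<mu> \<tau> \<aa> \<subseteq> sets \<mu>" using base.cylinder_sets fib by (auto simp: fibered_system_def)
  have \<aa>: "countable \<aa>" "\<Union>\<aa> = space \<mu>" "disjoint \<aa>" using fib by (auto simp: fibered_system_def partition_on_def)
  have space: "strip_good (space \<mu> \<times> {\<alpha>..<\<beta>})"
  proof -
    have ne: "\<aa> \<noteq> {}" using \<aa>(2) base.not_empty by auto
    define f where "f = from_nat_into \<aa>"
    have f: "range f = \<aa>" unfolding f_def using ne \<aa>(1) by (rule range_from_nat_into)
    define E where "E i = disjointed f i \<times> {\<alpha>..<\<beta>}" for i
    \<comment> \<open>An enumeration of the partition may repeat elements; repetitions become
      empty.\<close>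
    have dis: "disjointed f i = {} \<or> disjointed f i = f i" for i
    proof (cases "\<exists>j<i. f j = f i")
      case True
      then show ?thesis by (auto simp: disjointed_def)
    next
      case False
      have "f i \<inter> f j = {}" if "j < i" for j
        using disjointD[OF \<aa>(3), of "f i" "f j"] f False that by (metis rangeI)
      then have "\<forall>j\<in>{0..<i}. f i \<inter> f j = {}" by simp
      then have "f i \<inter> (\<Union>j\<in>{0..<i}. f j) = {}" by blast
      then show ?thesis by (simp add: disjointed_def Diff_triv)
    qed
    have "strip_good (\<Union>i. E i)"
    proof (rule strip_good_UN)
      show "disjoint_family E"
        using disjoint_family_disjointed[of f] by (auto simp: disjoint_family_on_def E_def)
      have fi: "f i \<in> cylinders \<mu> \<tau> \<aa>" for i using f partition_subset_cylinders[OF fib] by auto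
      show "range E \<subseteq> sets (\<mu> \<Otimes>\<^sub>M lborel)"
      proof
        fix X assume "X \<in> range E"
        then obtain i where X: "X = disjointed f i \<times> {\<alpha>..<\<beta>}" by (auto simp: E_def)
        have "disjointed f i \<in> sets \<mu>" using dis[of i] fi[of i] cyl by auto
        then show "X \<in> sets (\<mu> \<Otimes>\<^sub>M lborel)" unfolding X by (intro pair_measureI) auto
      qed
      show "strip_good (E i)" for i
        using dis[of i] strip_good_empty strip_good_cylinder[OF fi[of i] ab] by (auto simp: E_def)
    qed
    moreover have "(\<Union>i. E i) = space \<mu> \<times> {\<alpha>..<\<beta>}"
      using UN_disjointed_eq[of f] f \<aa>(2) by (auto simp: E_def)
    ultimately show ?thesis by simp
  qed
  have "Int_stable ?G" using cylinder_Int[OF fib] by (auto simp: Int_stable_def)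
  moreover have "?G \<subseteq> Pow (space \<mu>)" using cyl sets.sets_into_space by blast
  ultimately have gen: "B \<in> sets \<mu> \<and> strip_good (B \<times> {\<alpha>..<\<beta>})" if "B \<in> sigma_sets (space \<mu>) ?G" for B
    using that
  proof (induction rule: sigma_sets_induct_disjoint)
    fix A assume "A \<in> ?G"
    then show "A \<in> sets \<mu> \<and> strip_good (A \<times> {\<alpha>..<\<beta>})"
      using cyl strip_good_cylinder[OF _ ab, of A] strip_good_empty by auto
  next
    show "{} \<in> sets \<mu> \<and> strip_good ({} \<times> {\<alpha>..<\<beta>})" using strip_good_empty by simp
  next
    fix A assume A: "A \<in> sets \<mu> \<and> strip_good (A \<times> {\<alpha>..<\<beta>})"
    have "(space \<mu> - A) \<times> {\<alpha>..<\<beta>} = space \<mu> \<times> {\<alpha>..<\<beta>} - A \<times> {\<alpha>..<\<beta>}" by auto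
    moreover have "A \<times> {\<alpha>..<\<beta>} \<subseteq> space \<mu> \<times> {\<alpha>..<\<beta>}" using A sets.sets_into_space by blast
    ultimately show "space \<mu> - A \<in> sets \<mu> \<and> strip_good ((space \<mu> - A) \<times> {\<alpha>..<\<beta>})"
      using A strip_good_Diff[OF space] by auto
  next
    fix A :: "nat \<Rightarrow> 'w set"
    assume A: "disjoint_family A" "\<And>i. A i \<in> sets \<mu> \<and> strip_good (A i \<times> {\<alpha>..<\<beta>})"
    have "strip_good (\<Union>i. A i \<times> {\<alpha>..<\<beta>})"
    proof (rule strip_good_UN)
      show "disjoint_family (\<lambda>i. A i \<times> {\<alpha>..<\<beta>})" using A(1) by (auto simp: disjoint_family_on_def)
    qed (use A in auto)
    moreover have "(\<Union>i. A i \<times> {\<alpha>..<\<beta>}) = (\<Union>i. A i) \<times> {\<alpha>..<\<beta>}" by auto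
    ultimately show "(\<Union>i. A i) \<in> sets \<mu> \<and> strip_good ((\<Union>i. A i) \<times> {\<alpha>..<\<beta>})" using A by auto
  qed
  obtain B' where B': "B' \<in> sigma_sets (space \<mu>) (cylinders \<mu> \<tau> \<aa>)" "emeasure \<mu> ((B - B') \<union> (B' - B)) = 0"
    using fib B unfolding fibered_system_def by blast
  have "B' \<in> sigma_sets (space \<mu>) ?G" using B'(1) sigma_sets_mono'[of "cylinders \<mu> \<tau> \<aa>" ?G] by blast
  from gen[OF this] have B's: "B' \<in> sets \<mu>" "strip_good (B' \<times> {\<alpha>..<\<beta>})" by auto
  have "(B - B') \<union> (B' - B) \<in> null_sets \<mu>" using B' B B's by (auto intro!: null_setsI)
  from AE_m_fst[OF AE_not_in[OF this]]
  have "AE z in m. indicator (B \<times> {\<alpha>..<\<beta>}) z * indicator (space \<mu> \<times> {0..<s}) z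
    = (indicator (B' \<times> {\<alpha>..<\<beta>}) z * indicator (space \<mu> \<times> {0..<s}) z :: real)"
    by eventually_elim (auto simp: indicator_def)
  from good_cong'[OF B's(2)[unfolded strip_good_def] strip_integrable this]
  show ?thesis using B by (simp add: strip_good_def)
qed

text \<open>Dynkin system argument in the product: a rectangle meets the strip in a rectangle with
  clipped height, to which \<open>strip_good_rect\<close> applies, or not at all.\<close>

lemma strip_good_sets:
  assumes E: "E \<in> sets (\<mu> \<Otimes>\<^sub>M lborel)"
  shows "strip_good E"
proof -
  let ?I = "range (\<lambda>(a, b). {a..<b::real})"
  let ?G = "{a \<times> b | a b. a \<in> sets \<mu> \<and> b \<in> ?I}"
  let ?\<Omega> = "space \<mu> \<times> (UNIV :: real set)"
  have sub: "?G \<subseteq> Pow ?\<Omega>"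
  proof
    fix X assume "X \<in> ?G"
    then obtain A b where "X = A \<times> b" "A \<in> sets \<mu>" by auto
    then show "X \<in> Pow ?\<Omega>" using sets.sets_into_space[of A \<mu>] by auto
  qed
  have sets_eq: "sets (\<mu> \<Otimes>\<^sub>M lborel) = sigma_sets ?\<Omega> ?G"
  proof -
    have 1: "sets (\<mu> \<Otimes>\<^sub>M (borel :: real measure)) = sets (sigma (space \<mu> \<times> space (borel :: real measure)) ?G)"
    proof (rule sets_pair_eq)
      show "sets \<mu> \<subseteq> Pow (space \<mu>)" by (rule sets.space_closed)
      show "sets \<mu> = sigma_sets (space \<mu>) (sets \<mu>)" by (simp add: sets.sigma_sets_eq)
      show "countable {space \<mu>}" "{space \<mu>} \<subseteq> sets \<mu>" "\<Union> {space \<mu>} = space \<mu>" by auto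
      show "?I \<subseteq> Pow (space borel)" by auto
      show "sets (borel :: real measure) = sigma_sets (space borel) ?I"
        unfolding borel_eq_atLeastLessThan by (subst sets_measure_of) (auto)
      show "countable (range (\<lambda>n::nat. {- real n..<real n}))" by simp
      show "range (\<lambda>n::nat. {- real n..<real n}) \<subseteq> ?I" by auto
      show "\<Union> (range (\<lambda>n::nat. {- real n..<real n})) = space borel"
      proof -
        have "\<exists>n::nat. - real n \<le> x \<and> x < real n" for x :: real
        proof -
          obtain n :: nat where "\<bar>x\<bar> < real n" using reals_Archimedean2 by blast
          then show ?thesis by (intro exI[of _ n]) auto
        qed
        then show ?thesis by auto
      qed
    qed
    have "sets (\<mu> \<Otimes>\<^sub>M lborel) = sets (\<mu> \<Otimes>\<^sub>M (borel :: real measure))" by (rule sets_pair_measure_cong) auto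
    also have "\<dots> = sigma_sets ?\<Omega> ?G"
      unfolding 1 space_borel by (rule sets_measure_of[OF sub])
    finally show ?thesis .
  qed
  have stable: "Int_stable ?G"
  proof (rule Int_stableI)
    fix X X' assume "X \<in> ?G" "X' \<in> ?G"
    then obtain A a b A' a' b' where X: "X = A \<times> {a..<b}" "A \<in> sets \<mu>" "X' = A' \<times> {a'..<b'}" "A' \<in> sets \<mu>" by auto
    have "X \<inter> X' = (A \<inter> A') \<times> {max a a'..<min b b'}" unfolding X by auto
    moreover have "{max a a'..<min b b'} \<in> ?I" by (rule image_eqI[of _ _ "(max a a', min b b')"]) auto
    ultimately show "X \<inter> X' \<in> ?G" using X by blast
  qed
  have "E \<in> sigma_sets ?\<Omega> ?G" using E sets_eq by simp
  with stable sub have "E \<in> sets (\<mu> \<Otimes>\<^sub>M lborel) \<and> strip_good E"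
  proof (induction rule: sigma_sets_induct_disjoint)
    fix X assume "X \<in> ?G"
    then obtain A a b where X: "X = A \<times> {a..<b}" "A \<in> sets \<mu>" by auto
    have "strip_good X"
    proof (cases "max a 0 < min b s")
      case True
      have "strip_good (A \<times> {max a 0..<min b s})" by (rule strip_good_rect[OF X(2) _ True]) auto
      moreover have "(\<lambda>z. indicator X z * indicator (space \<mu> \<times> {0..<s}) z)
         = (\<lambda>z. indicator (A \<times> {max a 0..<min b s}) z * indicator (space \<mu> \<times> {0..<s}) z :: real)"
        unfolding X by (auto simp: fun_eq_iff indicator_def)
      ultimately show ?thesis by (simp only: strip_good_def)
    next
      case False
      then have "(\<lambda>z. indicator X z * indicator (space \<mu> \<times> {0..<s}) z) = (\<lambda>z. 0 :: real)"
        unfolding X by (auto simp: fun_eq_iff indicator_def)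
      then show ?thesis using good_zero by (simp only: strip_good_def)
    qed
    then show "X \<in> sets (\<mu> \<Otimes>\<^sub>M lborel) \<and> strip_good X" using X by auto
  next
    show "{} \<in> sets (\<mu> \<Otimes>\<^sub>M lborel) \<and> strip_good {}" using strip_good_empty by simp
  next
    fix X assume X: "X \<in> sets (\<mu> \<Otimes>\<^sub>M lborel) \<and> strip_good X"
    have sp: "?\<Omega> \<in> sets (\<mu> \<Otimes>\<^sub>M lborel)" by auto
    have "strip_good ?\<Omega>"
    proof -
      have "(\<lambda>z. indicator ?\<Omega> z * indicator (space \<mu> \<times> {0..<s}) z)
         = (\<lambda>z. indicator (space \<mu> \<times> {0..<s}) z * indicator (space \<mu> \<times> {0..<s}) z :: real)"
        by (auto simp: fun_eq_iff indicator_def)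
      then show ?thesis using strip_good_rect[of "space \<mu>" 0 s] s unfolding strip_good_def by simp
    qed
    moreover have "X \<subseteq> ?\<Omega>" using X sets.sets_into_space[of X "\<mu> \<Otimes>\<^sub>M lborel"] by (auto simp: space_pair_measure)
    ultimately show "?\<Omega> - X \<in> sets (\<mu> \<Otimes>\<^sub>M lborel) \<and> strip_good (?\<Omega> - X)"
      using X sp strip_good_Diff by blast
  next
    fix A :: "nat \<Rightarrow> ('w \<times> real) set"
    assume "disjoint_family A" "\<And>i. A i \<in> sets (\<mu> \<Otimes>\<^sub>M lborel) \<and> strip_good (A i)"
    then show "(\<Union>i. A i) \<in> sets (\<mu> \<Otimes>\<^sub>M lborel) \<and> strip_good (\<Union>i. A i)"
      using strip_good_UN[of A] by auto
  qed
  then show ?thesis by simp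
qed

lemma good_strip:
  assumes H: "integrable m H"
  shows "good g (EW g) (\<lambda>z. indicator (space \<mu> \<times> {0..<s}) z * H z)"
  using H
proof (induction rule: integrable_induct)
  fix A :: "('w \<times> real) set" and c :: real
  assume "A \<in> sets m"
  then have "A \<in> sets (\<mu> \<Otimes>\<^sub>M lborel)" using sets_m_prod by simp
  from good_lincomb'[OF strip_good_sets[OF this, unfolded strip_good_def] good_zero, of c 0]
  show "good g (EW g) (\<lambda>z. indicator (space \<mu> \<times> {0..<s}) z * (indicator A z *\<^sub>R c))"
    by (simp add: mult_ac)
next
  fix f h
  assume "good g (EW g) (\<lambda>z. indicator (space \<mu> \<times> {0..<s}) z * f z)"
    and "good g (EW g) (\<lambda>z. indicator (space \<mu> \<times> {0..<s}) z * h z)"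
  from good_lincomb'[OF this, of 1 1]
  show "good g (EW g) (\<lambda>z. indicator (space \<mu> \<times> {0..<s}) z * (f z + h z))" by (simp add: distrib_left)
next
  let ?s = "indicator (space \<mu> \<times> {0..<s}) :: _ \<Rightarrow> real"
  fix f S
  assume S: "\<And>i::nat. good g (EW g) (\<lambda>z. ?s z * S i z)" and lim: "\<And>z. z \<in> space m \<Longrightarrow> (\<lambda>i. S i z) \<longlonglongrightarrow> f z"
    and le: "\<And>i z. z \<in> space m \<Longrightarrow> norm (S i z) \<le> 2 * norm (f z)" and f: "integrable m f"
  have [measurable]: "?s \<in> borel_measurable m" by (rule indicator_prod_meas) simp
  have s1: "0 \<le> ?s z" "?s z \<le> 1" for z by (auto simp: indicator_def)
  have "integrable m (\<lambda>z. f z * ?s z)"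
    by (rule F.integrable_bounded_mult[OF f, where B = 1]) (use s1 in auto)
  then have sf: "integrable m (\<lambda>z. ?s z * f z)" by (simp add: mult.commute)
  show "good g (EW g) (\<lambda>z. ?s z * f z)"
  proof (rule good_limit_dominated[OF S sf])
    show "integrable m (\<lambda>z. 3 * \<bar>f z\<bar>)" using f by simp
    show "AE z in m. (\<lambda>k. ?s z * S k z) \<longlonglongrightarrow> ?s z * f z"
      using lim by (intro AE_I2 tendsto_intros) auto
    fix k
    show "AE z in m. \<bar>?s z * f z - ?s z * S k z\<bar> \<le> 3 * \<bar>f z\<bar>"
    proof (rule AE_I2)
      fix z assume "z \<in> space m"
      then have "norm (S k z) \<le> 2 * norm (f z)" by (rule le)
      moreover have "\<bar>?s z * f z - ?s z * S k z\<bar> = ?s z * \<bar>f z - S k z\<bar>"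
        using s1[of z] by (simp add: right_diff_distrib[symmetric] abs_mult)
      moreover have "?s z * \<bar>f z - S k z\<bar> \<le> 1 * \<bar>f z - S k z\<bar>" using s1 by (intro mult_right_mono) auto
      ultimately show "\<bar>?s z * f z - ?s z * S k z\<bar> \<le> 3 * \<bar>f z\<bar>" by auto
    qed
  qed
qed

text \<open>
  Almost every point is in the strip over the section right after its first crossing, and
  \<open>good\<close> can be pulled back along the transfer operator.
\<close>

theorem good_integrable:
  assumes F: "integrable m F"
  shows "good g (EW g) F"
proof -
  let ?s = "indicator (space \<mu> \<times> {0..<s}) :: _ \<Rightarrow> real"
  let ?N = "\<lambda>k z. crossings \<tau> r (real k * s) z"
  have [measurable]: "?s \<in> borel_measurable m" by (rule indicator_prod_meas) simp
  have ind: "integrable m (\<lambda>z. F z * indicator {z. P z} z)" if "Measurable.pred m P" for P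
    by (rule F.integrable_bounded_mult[OF F, where B = 1]) (use that in \<open>auto simp: indicator_def\<close>)
  have T0: "0 \<le> real k * s" for k :: nat using s by simp
  \<comment> \<open>Points whose first crossing falls between the times \<open>k * s\<close> and
    \<open>Suc k * s\<close> are in the strip at the later time, so \<open>Suc k\<close> transfer
    steps carry this part of \<open>F\<close> to a density on the strip, which is good by
    \<open>good_strip\<close>.\<close>
  have step: "good g (EW g) (\<lambda>z. F z * indicator {z. ?N k z = 0 \<and> 1 \<le> ?N (Suc k) z} z)" for k
  proof -
    let ?F = "\<lambda>z. F z * indicator {z. ?N k z = 0 \<and> 1 \<le> ?N (Suc k) z} z"
    have Fi: "integrable m ?F" by (rule ind) measurable
    have supp: "AE z in m. ?F z * ?s ((\<Psi> s ^^ Suc k) z) = ?F z"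
      using crossings_cocycle[OF T0 less_imp_le[OF s(1)], of k] flow_iter[OF less_imp_le[OF s(1)], of k]
        F.AE_iter[OF crossings_small_AE[OF s], of k]
    proof eventually_elim
      fix z assume 1: "crossings \<tau> r (real k * s + s) z = ?N k z + crossings \<tau> r s (\<Psi> (real k * s) z)"
        and 2: "(\<Psi> s ^^ k) z = \<Psi> (real k * s) z"
        and 3: "real (crossings \<tau> r s ((\<Psi> s ^^ k) z)) = ?s (\<Psi> s ((\<Psi> s ^^ k) z))"
      have ss: "real (Suc k) * s = real k * s + s" by (simp add: distrib_right)
      have "?s ((\<Psi> s ^^ Suc k) z) = 1" if "?N k z = 0" "1 \<le> ?N (Suc k) z"
      proof -
        have "1 \<le> crossings \<tau> r s ((\<Psi> s ^^ k) z)" using that 1 unfolding 2 ss by simp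
        then have "1 \<le> ?s (\<Psi> s ((\<Psi> s ^^ k) z))" unfolding 3[symmetric] by simp
        then show ?thesis by (cases "(\<Psi> s ^^ Suc k) z \<in> space \<mu> \<times> {0..<s}") auto
      qed
      then show "?F z * ?s ((\<Psi> s ^^ Suc k) z) = ?F z"
        by (cases "?N k z = 0 \<and> 1 \<le> ?N (Suc k) z") auto
    qed
    have Fsi: "integrable m (\<lambda>z. ?F z * ?s ((\<Psi> s ^^ Suc k) z))"
    proof (rule F.integrable_bounded_mult[OF Fi])
      show "(\<lambda>z. ?s ((\<Psi> s ^^ Suc k) z)) \<in> borel_measurable m"
        by (rule measurable_compose[OF F.iter_measurable]) simp
      show "AE z in m. \<bar>?s ((\<Psi> s ^^ Suc k) z)\<bar> \<le> 1" by (auto simp: indicator_def)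
    qed
    have "AE z in m. F.Th (Suc k) ?F z = F.Th (Suc k) (\<lambda>z. ?F z * ?s ((\<Psi> s ^^ Suc k) z)) z"
      by (rule F.Th_cong_AE[OF Fi Fsi]) (use supp in \<open>auto elim: eventually_mono\<close>)
    moreover have "AE z in m. F.Th (Suc k) (\<lambda>z. ?F z * ?s ((\<Psi> s ^^ Suc k) z)) z = F.Th (Suc k) ?F z * ?s z"
      by (rule F.Th_mult_iter[OF Fi, where B = 1]) (simp, simp add: indicator_def)
    ultimately have "AE z in m. F.Th (Suc k) ?F z = ?s z * F.Th (Suc k) ?F z"
    proof eventually_elim
      fix z assume "F.Th (Suc k) ?F z = F.Th (Suc k) (\<lambda>z. ?F z * ?s ((\<Psi> s ^^ Suc k) z)) z"
        and "F.Th (Suc k) (\<lambda>z. ?F z * ?s ((\<Psi> s ^^ Suc k) z)) z = F.Th (Suc k) ?F z * ?s z"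
      then have "F.Th (Suc k) ?F z = F.Th (Suc k) ?F z * ?s z" by (rule trans)
      then show "F.Th (Suc k) ?F z = ?s z * F.Th (Suc k) ?F z" by (subst (asm) mult.commute)
    qed
    then have gT: "good g (EW g) (F.Th (Suc k) ?F)"
      by (intro good_cong'[OF good_strip[OF F.Th_integrable[OF Fi]] F.Th_integrable[OF Fi]])
    show ?thesis by (rule good_transfer_iter[OF g_meas g_bd EWg(2) _ Fi gT]) (rule g_osc)
  qed
  \<comment> \<open>The parts according to the step of the first crossing are disjoint and add
    up.\<close>
  have part: "good g (EW g) (\<lambda>z. F z * indicator {z. 1 \<le> ?N k z} z)" for k
  proof (induction k)
    case 0
    have "AE z in m. F z * indicator {z. 1 \<le> ?N 0 z} z = 0"
      using birkhoff_crossings[OF less_imp_le[OF s(1)], of 0] by eventually_elim (simp add: birkhoff_sum_def)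
    then show ?case by (intro good_cong'[OF good_zero] ind) measurable
  next
    case (Suc k)
    have "AE z in m. F z * indicator {z. 1 \<le> ?N (Suc k) z} z
      = 1 * (F z * indicator {z. 1 \<le> ?N k z} z) + 1 * (F z * indicator {z. ?N k z = 0 \<and> 1 \<le> ?N (Suc k) z} z)"
      using crossings_cocycle[OF T0 less_imp_le[OF s(1)], of k]
    proof eventually_elim
      fix z assume 1: "crossings \<tau> r (real k * s + s) z = ?N k z + crossings \<tau> r s (\<Psi> (real k * s) z)"
      have ss: "real (Suc k) * s = real k * s + s" by (simp add: distrib_right)
      show "F z * indicator {z. 1 \<le> ?N (Suc k) z} z
        = 1 * (F z * indicator {z. 1 \<le> ?N k z} z) + 1 * (F z * indicator {z. ?N k z = 0 \<and> 1 \<le> ?N (Suc k) z} z)"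
        unfolding ss using 1 by (auto simp: indicator_def)
    qed
    then show ?case by (intro good_cong'[OF good_lincomb'[OF Suc step]] ind) measurable
  qed
  show ?thesis
  proof (rule good_limit_dominated[OF part F])
    show "integrable m (\<lambda>z. \<bar>F z\<bar>)" using F by simp
    show "AE z in m. \<bar>F z - F z * indicator {z. 1 \<le> ?N k z} z\<bar> \<le> \<bar>F z\<bar>" for k by (auto simp: indicator_def)
    show "AE z in m. (\<lambda>k. F z * indicator {z. 1 \<le> ?N k z} z) \<longlonglongrightarrow> F z"
      using crossings_at_top[OF s(1)]
    proof eventually_elim
      fix z assume "filterlim (\<lambda>n. real (?N n z)) at_top sequentially"
      then have "\<forall>\<^sub>F n in sequentially. 1 \<le> real (?N n z)" unfolding filterlim_at_top by blast
      then have "\<forall>\<^sub>F n in sequentially. F z * indicator {z. 1 \<le> ?N n z} z = F z" by eventually_elim simp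
      then show "(\<lambda>k. F z * indicator {z. 1 \<le> ?N k z} z) \<longlonglongrightarrow> F z" by (rule tendsto_eventually)
    qed
  qed
qed

end

end

section \<open>From occupation numbers to Birkhoff sums\<close>

context suspension
begin

lemma flow_mult:
  assumes s: "0 \<le> s"
  shows "AE z in m. (\<Psi> (real q * s) ^^ k) z = (\<Psi> s ^^ (q * k)) z"
proof -
  have "0 \<le> real q * s" using s by simp
  from flow_iter[OF this, of k] flow_iter[OF s, of "q * k"] show ?thesis
    by eventually_elim (simp add: mult_ac)
qed

text \<open>The semigroup law of the flow holds only almost everywhere and
  \<open>transfer_op\<close> is only a version, so the identity is verified through duality.\<close>

lemma transfer_mult:
  assumes s: "0 \<le> s" and f: "integrable m f"
  shows "AE z in m. (transfer_op m (\<Psi> (real q * s)) ^^ k) f z = (transfer_op m (\<Psi> s) ^^ (q * k)) f z"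
proof -
  interpret R: mp_system m "\<Psi> s" by (rule mps_flow[OF s])
  interpret T: mp_system m "\<Psi> (real q * s)" by (rule mps_flow) (use s in simp)
  show ?thesis
  proof (rule T.Th_unique[OF f R.Th_integrable[OF f]])
    fix A assume A: "A \<in> sets m"
    have "(\<integral>x. R.Th (q * k) f x * indicator A x \<partial>m) = (\<integral>x. f x * indicator A ((\<Psi> s ^^ (q * k)) x) \<partial>m)"
      by (rule R.Th_dual_set[OF f A])
    also have "\<dots> = (\<integral>x. f x * indicator A ((\<Psi> (real q * s) ^^ k) x) \<partial>m)"
    proof (rule integral_cong_AE)
      have [measurable]: "f \<in> borel_measurable m" using f by auto
      note [measurable] = A
      show "(\<lambda>x. f x * indicator A ((\<Psi> s ^^ (q * k)) x)) \<in> borel_measurable m"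
        "(\<lambda>x. f x * indicator A ((\<Psi> (real q * s) ^^ k) x)) \<in> borel_measurable m" by measurable
    
      show "AE x in m. f x * indicator A ((\<Psi> s ^^ (q * k)) x) = f x * indicator A ((\<Psi> (real q * s) ^^ k) x)"
        using flow_mult[OF s, where q = q and k = k] by eventually_elim (simp only:)
    qed
    finally show "(\<integral>x. R.Th (q * k) f x * indicator A x \<partial>m) = (\<integral>x. f x * indicator A ((\<Psi> (real q * s) ^^ k) x) \<partial>m)" .
  qed
qed

text \<open>Collecting the first \<open>q\<close> transfer images of \<open>?J\<close> into one
  function \<open>G\<close> turns the sum over \<open>n\<close> steps of length \<open>q * s\<close>
  for \<open>G\<close> into the sum over \<open>q * n\<close> steps of length \<open>s\<close> for
  \<open>?J\<close>; the integral of \<open>G\<close> is \<open>q\<close> times that of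
  \<open>?J\<close>. The ratio is read off at one point.\<close>

lemma return_sequence_mult:
  assumes s: "0 \<le> s" and q: "1 \<le> q" and a: "return_sequence m (\<Psi> s) a"
    and a': "return_sequence m (\<Psi> (real q * s)) a'"
  shows "(\<lambda>n. a (q * n) / a' n) \<longlonglongrightarrow> real q"
proof -
  interpret R: mp_system m "\<Psi> s" by (rule mps_flow[OF s])
  interpret T: mp_system m "\<Psi> (real q * s)" by (rule mps_flow) (use s in simp)
  let ?J = "indicator (space \<mu> \<times> {0..<c}) :: _ \<Rightarrow> real"
  have J: "integrable m ?J" "(\<integral>z. ?J z \<partial>m) = c"
    using integral_low[of "space \<mu>" 0 c] c_pos base.prob_space by auto
  define G where "G z = (\<Sum>j<q. R.Th j ?J z)" for z
  have G: "integrable m G" unfolding G_def[abs_def] using J by auto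
  have Gint: "(\<integral>z. G z \<partial>m) = real q * c"
    unfolding G_def using J R.integral_Th[OF J(1)] by (subst Bochner_Integration.integral_sum) auto
  have eq: "AE z in m. \<forall>k. T.Th k G z = (\<Sum>j<q. R.Th (q * k + j) ?J z)"
    unfolding AE_all_countable
  proof
    fix k
    have "AE z in m. R.Th (q * k) (\<lambda>z. \<Sum>j<q. R.Th j ?J z) z = (\<Sum>j<q. R.Th (q * k) (R.Th j ?J) z)"
      by (rule R.Th_sum) (use J in auto)
    with transfer_mult[OF s G, where q = q and k = k] show "AE z in m. T.Th k G z = (\<Sum>j<q. R.Th (q * k + j) ?J z)"
      by eventually_elim (simp add: G_def[abs_def] funpow_add)
  qed
  have blocks: "(\<Sum>k<n. \<Sum>j<q. x (q * k + j)) = (\<Sum>i<q * n. x i)" for x :: "nat \<Rightarrow> real" and n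
  proof -
    have "(\<Sum>j<q. x (q * k + j)) = sum x {k * q..<k * q + q}" for k
      using sum.shift_bounds_nat_ivl[of x 0 "k * q" q] by (simp add: atLeast0LessThan ac_simps)
    then show ?thesis using sum.nat_group[of x q n] by (simp add: mult.commute)
  qed
  have "AE z in m. (\<lambda>n. (1 / a n) * (\<Sum>k<n. R.Th k ?J z)) \<longlonglongrightarrow> (\<integral>z. ?J z \<partial>m)"
    "AE z in m. (\<lambda>n. (1 / a' n) * (\<Sum>k<n. T.Th k G z)) \<longlonglongrightarrow> (\<integral>z. G z \<partial>m)"
    using a a' J(1) G unfolding return_sequence_def by blast+
  with eq have "AE z in m. (\<lambda>n. (1 / a n) * (\<Sum>k<n. R.Th k ?J z)) \<longlonglongrightarrow> c \<and>
      (\<lambda>n. (1 / a' n) * (\<Sum>i<q * n. R.Th i ?J z)) \<longlonglongrightarrow> real q * c"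
    unfolding J(2) Gint
  proof eventually_elim
    fix z assume "\<forall>k. T.Th k G z = (\<Sum>j<q. R.Th (q * k + j) ?J z)"
      "(\<lambda>n. (1 / a n) * (\<Sum>k<n. R.Th k ?J z)) \<longlonglongrightarrow> c" "(\<lambda>n. (1 / a' n) * (\<Sum>k<n. T.Th k G z)) \<longlonglongrightarrow> real q * c"
    then show "(\<lambda>n. (1 / a n) * (\<Sum>k<n. R.Th k ?J z)) \<longlonglongrightarrow> c \<and>
        (\<lambda>n. (1 / a' n) * (\<Sum>i<q * n. R.Th i ?J z)) \<longlonglongrightarrow> real q * c"
      by (simp add: blocks[of "\<lambda>i. R.Th i ?J z"])
  qed
  from AE_base_positive[OF this] obtain z where z: "(\<lambda>n. (1 / a n) * (\<Sum>k<n. R.Th k ?J z)) \<longlonglongrightarrow> c"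
      "(\<lambda>n. (1 / a' n) * (\<Sum>i<q * n. R.Th i ?J z)) \<longlonglongrightarrow> real q * c" by auto
  have "filterlim (\<lambda>n. q * n) at_top sequentially" using q by (intro filterlim_subseq) (auto simp: strict_mono_def)
  from filterlim_compose[OF z(1) this]
  have z1: "(\<lambda>n. (1 / a (q * n)) * (\<Sum>i<q * n. R.Th i ?J z)) \<longlonglongrightarrow> c" .
  have "(\<lambda>n. ((1 / a' n) * (\<Sum>i<q * n. R.Th i ?J z)) / ((1 / a (q * n)) * (\<Sum>i<q * n. R.Th i ?J z))) \<longlonglongrightarrow> real q * c / c"
    by (rule tendsto_divide[OF z(2) z1]) (use c_pos in simp)
  moreover have "\<forall>\<^sub>F n in sequentially. ((1 / a' n) * (\<Sum>i<q * n. R.Th i ?J z)) / ((1 / a (q * n)) * (\<Sum>i<q * n. R.Th i ?J z))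
      = a (q * n) / a' n"
    using order_tendstoD(1)[OF z1 c_pos]
  proof eventually_elim
    fix n assume "0 < (1 / a (q * n)) * (\<Sum>i<q * n. R.Th i ?J z)"
    then have "(\<Sum>i<q * n. R.Th i ?J z) \<noteq> 0" by auto
    then show "((1 / a' n) * (\<Sum>i<q * n. R.Th i ?J z)) / ((1 / a (q * n)) * (\<Sum>i<q * n. R.Th i ?J z)) = a (q * n) / a' n" by simp
  qed
  ultimately have "(\<lambda>n. a (q * n) / a' n) \<longlonglongrightarrow> real q * c / c" by (rule Lim_transform_eventually)
  then show ?thesis using c_pos by simp
qed

end

text \<open>Uniform continuity with respect to the relative distance
  \<open>\<bar>x - y\<bar> / (1 + y)\<close>, the form in which the normalized counts are
  perturbed.\<close>

definition slowly_oscillating :: "(real \<Rightarrow> real) \<Rightarrow> bool" where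
  "slowly_oscillating g \<longleftrightarrow>
     (\<forall>\<epsilon>>0. \<exists>d>0. \<forall>x y. 0 \<le> x \<longrightarrow> 0 \<le> y \<longrightarrow> \<bar>x - y\<bar> \<le> d * (1 + y) \<longrightarrow> \<bar>g x - g y\<bar> \<le> \<epsilon>)"

lemma slowly_oscillating_const: "slowly_oscillating (\<lambda>_. k)"
  unfolding slowly_oscillating_def by (auto intro!: exI[of _ 1])

lemma slowly_oscillating_diff: "slowly_oscillating g \<Longrightarrow> slowly_oscillating (\<lambda>x. k - g x)"
  unfolding slowly_oscillating_def by (simp add: abs_minus_commute)

lemma slowly_oscillating_scale:
  assumes g: "slowly_oscillating g" and I: "0 \<le> I"
  shows "slowly_oscillating (\<lambda>x. g (I * x))"
  unfolding slowly_oscillating_def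
proof (intro allI impI)
  fix \<epsilon> :: real assume "\<epsilon> > 0"
  then obtain d where d: "d > 0" "\<And>x y. 0 \<le> x \<Longrightarrow> 0 \<le> y \<Longrightarrow> \<bar>x - y\<bar> \<le> d * (1 + y) \<Longrightarrow> \<bar>g x - g y\<bar> \<le> \<epsilon>"
    using g unfolding slowly_oscillating_def by metis
  show "\<exists>d>0. \<forall>x y. 0 \<le> x \<longrightarrow> 0 \<le> y \<longrightarrow> \<bar>x - y\<bar> \<le> d * (1 + y) \<longrightarrow> \<bar>g (I * x) - g (I * y)\<bar> \<le> \<epsilon>"
  proof (intro exI[of _ "d / (1 + I)"] conjI allI impI)
    show "0 < d / (1 + I)" using d I by simp
    fix x y :: real assume xy: "0 \<le> x" "0 \<le> y" "\<bar>x - y\<bar> \<le> d / (1 + I) * (1 + y)"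
    show "\<bar>g (I * x) - g (I * y)\<bar> \<le> \<epsilon>"
    proof (rule d(2))
      have "\<bar>I * x - I * y\<bar> = I * \<bar>x - y\<bar>" using I by (simp add: abs_mult flip: right_diff_distrib)
      also have "\<dots> \<le> I * (d / (1 + I) * (1 + y))" using xy I by (intro mult_left_mono) auto
      also have "\<dots> = d * (I / (1 + I)) + d * (I * y / (1 + I))" by (simp add: distrib_left add_divide_distrib mult_ac)
      also have "\<dots> \<le> d * 1 + d * (I * y)"
      proof (intro add_mono mult_left_mono)
        show "I / (1 + I) \<le> 1" using I by simp
        have "I * y * 1 \<le> I * y * (1 + I)" using I xy by (intro mult_left_mono) auto
        then show "I * y / (1 + I) \<le> I * y" using I by (simp add: pos_divide_le_eq)
      qed (use d in auto)
      finally show "\<bar>I * x - I * y\<bar> \<le> d * (1 + I * y)" by (simp add: distrib_left)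
    qed (use xy I in auto)
  qed
qed

text \<open>On the compact interval \<open>{0..2 * K + 2}\<close> relative closeness implies
  closeness and uniform continuity applies. Once an argument is beyond this range, a relative
  distance of at most one half keeps both arguments above \<open>K\<close>, where \<open>g\<close>
  vanishes.\<close>

lemma slowly_oscillating_compact_support:
  assumes g: "continuous_on UNIV g" and K: "0 \<le> K" and zero: "\<And>x. K \<le> x \<Longrightarrow> g x = (0::real)"
  shows "slowly_oscillating g"
  unfolding slowly_oscillating_def
proof (intro allI impI)
  fix \<epsilon> :: real assume "\<epsilon> > 0"
  have "uniformly_continuous_on {0..2 * K + 2} g"
    by (rule compact_uniformly_continuous) (use g in \<open>auto intro: continuous_on_subset\<close>)
  then obtain \<delta> where \<delta>: "\<delta> > 0" "\<And>x y. x \<in> {0..2 * K + 2} \<Longrightarrow> y \<in> {0..2 * K + 2} \<Longrightarrow> dist y x < \<delta> \<Longrightarrow> dist (g y) (g x) < \<epsilon>"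
    using \<open>\<epsilon> > 0\<close> unfolding uniformly_continuous_on_def by metis
  define d where "d = min (1 / 2) (\<delta> / (2 * (2 * K + 3)))"
  have d: "d > 0" using \<delta>(1) K by (simp add: d_def)
  have d': "d \<le> 1 / 2" unfolding d_def by (rule min.cobounded1)
  show "\<exists>d>0. \<forall>x y. 0 \<le> x \<longrightarrow> 0 \<le> y \<longrightarrow> \<bar>x - y\<bar> \<le> d * (1 + y) \<longrightarrow> \<bar>g x - g y\<bar> \<le> \<epsilon>"
  proof (intro exI[of _ d] conjI allI impI d)
    fix x y :: real assume x: "0 \<le> x" and y: "0 \<le> y" and xy: "\<bar>x - y\<bar> \<le> d * (1 + y)"
    have half: "d * (1 + y) \<le> 1 / 2 * (1 + y)" using d' y by (intro mult_right_mono) auto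
    show "\<bar>g x - g y\<bar> \<le> \<epsilon>"
    proof (cases "y \<le> 2 * K + 1")
      case False
      then have "K \<le> y" using K by linarith
      moreover have "y - x \<le> (1 + y) / 2" using order_trans[OF order_trans[OF abs_ge_minus_self xy] half] by simp
      then have "K \<le> x" using False by argo
      ultimately have "K \<le> x" "K \<le> y" by simp_all
      then show ?thesis using zero \<open>\<epsilon> > 0\<close> by simp
    next
      case True
      show ?thesis
      proof (cases "x \<le> 2 * K + 2")
        case True': True
        have "d * (1 + y) \<le> \<delta> / (2 * (2 * K + 3)) * (2 * K + 3)"
          using True y K \<delta>(1) by (intro mult_mono) (auto simp: d_def)
        also have "\<dots> = \<delta> / 2" using K by (simp add: field_simps)
        finally have "dist x y < \<delta>" using xy \<delta>(1) by (simp add: dist_real_def)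
        then have "dist (g x) (g y) < \<epsilon>" using True True' x y K by (intro \<delta>(2)) auto
        then show ?thesis by (simp add: dist_real_def)
      next
        case False
        have "x - y \<le> (1 + y) / 2" using order_trans[OF order_trans[OF abs_ge_self xy] half] by simp
        with False have "K \<le> x" "K \<le> y" using K by (simp, argo)
        then show ?thesis using zero \<open>\<epsilon> > 0\<close> by simp
      qed
    qed
  qed
qed

definition cutoff :: "nat \<Rightarrow> real \<Rightarrow> real" where
  "cutoff j x = max 0 (min 1 (real j + 1 - x))"

lemma cutoff: "continuous_on UNIV (cutoff j)" "0 \<le> cutoff j x" "cutoff j x \<le> 1"
  "x \<le> real j \<Longrightarrow> cutoff j x = 1" "real j + 1 \<le> x \<Longrightarrow> cutoff j x = 0"
  unfolding cutoff_def by (auto intro!: continuous_intros)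

section \<open>Birkhoff sums at the time \<open>t = q * s\<close>\<close>

context gll_system
begin

context
  fixes q :: nat and t :: real and a' :: "nat \<Rightarrow> real" and f :: "'w \<times> real \<Rightarrow> real" and C :: "('w \<times> real) set"
  assumes q: "1 \<le> q" and t: "t = real q * s" and a': "return_sequence m (\<Psi> t) a'"
    and f: "integrable m f" and f_nonneg: "\<And>z. z \<in> space m \<Longrightarrow> 0 \<le> f z" and C: "C \<in> finite_pos_sets m"
begin

lemma t_pos: "0 < t" using q t s by simp

interpretation T: mp_system m "\<Psi> t" using t_pos by (intro mps_flow) simp

lemma qt: "real (q * n) * s = real n * t" by (simp add: t)

lemma a_ratio: "(\<lambda>n. a (q * n) / a' n) \<longlonglongrightarrow> real q"
  using return_sequence_mult[OF less_imp_le[OF s(1)] q rs] a' by (simp add: t)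

lemma qn_inf: "filterlim (\<lambda>n. q * n) at_top sequentially"
  using q by (intro filterlim_subseq) (auto simp: strict_mono_def)

lemma a'_growth: "(\<lambda>n. a' n * t / b (real n * t)) \<longlonglongrightarrow> 1"
proof -
  have 1: "(\<lambda>n. a (q * n) * s / b (real n * t)) \<longlonglongrightarrow> 1"
    using filterlim_compose[OF ab qn_inf] by (simp only: qt)
  have "(\<lambda>n. inverse (a (q * n) / a' n) * (a (q * n) * s / b (real n * t)) * real q) \<longlonglongrightarrow> inverse (real q) * 1 * real q"
    by (intro tendsto_mult tendsto_inverse a_ratio 1 tendsto_const) (use q in simp)
  moreover have "\<forall>\<^sub>F n in sequentially. inverse (a (q * n) / a' n) * (a (q * n) * s / b (real n * t)) * real q = a' n * t / b (real n * t)"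
  proof -
    have "\<forall>\<^sub>F n in sequentially. 0 < a (q * n)"
      using filterlim_at_top_dense[THEN iffD1, rule_format, OF filterlim_compose[OF a_inf qn_inf]] .
    then show ?thesis by eventually_elim (simp add: t)
  qed
  ultimately show ?thesis using q Lim_transform_eventually by fastforce
qed

lemma a'_inf: "filterlim a' at_top sequentially"
proof -
  have nt: "filterlim (\<lambda>n. real n * t) at_top sequentially"
    using filterlim_tendsto_pos_mult_at_top[OF tendsto_const t_pos filterlim_real_sequentially] by (simp add: mult.commute)
  have "filterlim (\<lambda>n. (a' n * t / b (real n * t)) * b (real n * t)) at_top sequentially"
    by (rule filterlim_tendsto_pos_mult_at_top[OF a'_growth _ filterlim_compose[OF rv.b_inf nt]]) simp
  then have "filterlim (\<lambda>n. t * a' n) at_top sequentially" using rv.b_pos by (simp add: order_less_imp_not_eq2 mult.commute)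
  from filterlim_tendsto_pos_mult_at_top[OF tendsto_const _ this, of "1 / t"] show ?thesis using t_pos by simp
qed

lemma C_props: "C \<in> sets m" "integrable m (indicator C :: _ \<Rightarrow> real)" "(\<integral>z. indicator C z \<partial>m) = measure m C" "0 < measure m C"
proof -
  show C1: "C \<in> sets m" using C by (simp add: finite_pos_sets_def)
  show "integrable m (indicator C :: _ \<Rightarrow> real)" using C by (simp add: finite_pos_sets_def)
  show "(\<integral>z. indicator C z \<partial>m) = measure m C" using sets.sets_into_space[OF C1] by (simp add: Int_absorb2)
  show "0 < measure m C" using C by (auto simp: finite_pos_sets_def measure_def enn2real_positive_iff)
qed

definition D' :: "nat \<Rightarrow> 'w \<times> real \<Rightarrow> real" where "D' n = D (q * n)"
definition u' :: "nat \<Rightarrow> real" where "u' n = u (q * n)"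

lemma D'_eq: "D' n z = real (crossings \<tau> r (real n * t) z) / b (real n * t)"
  by (simp only: D'_def D_def qt)

lemma u'_eq: "u' n = \<gamma> * b (real n * t) / (real n * t)"
  by (simp only: u'_def u_def qt)

lemma u'_nonneg: "0 \<le> u' n" unfolding u'_def by (rule u_nonneg)

text \<open>The sum over multiples of \<open>q\<close> is part of the whole sum up to
  \<open>q * N\<close>, and the change of normalization has the finite limit
  \<open>q\<close>.\<close>

lemma avg_thin:
  assumes x: "\<And>n. 0 \<le> x n" and lim: "avg a x \<longlonglongrightarrow> 0"
  shows "avg a' (\<lambda>n. x (q * n)) \<longlonglongrightarrow> 0"
proof (rule tendsto_sandwich[of "\<lambda>_. 0" _ _ "\<lambda>N. (a (q * N) / a' N) * avg a x (q * N)"])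
  have pos: "\<forall>\<^sub>F N in sequentially. 0 < a' N" "\<forall>\<^sub>F N in sequentially. 0 < a (q * N)"
    using filterlim_at_top_dense[THEN iffD1, rule_format, OF a'_inf]
      filterlim_at_top_dense[THEN iffD1, rule_format, OF filterlim_compose[OF a_inf qn_inf]] by auto
  show "\<forall>\<^sub>F N in sequentially. 0 \<le> avg a' (\<lambda>n. x (q * n)) N"
    using pos(1) by eventually_elim (auto intro!: avg_nonneg x)
  show "\<forall>\<^sub>F N in sequentially. avg a' (\<lambda>n. x (q * n)) N \<le> (a (q * N) / a' N) * avg a x (q * N)"
    using pos
  proof eventually_elim
    fix N assume p: "0 < a' N" "0 < a (q * N)"
    have "(\<Sum>n=1..N. x (q * n)) = (\<Sum>k\<in>(\<lambda>n. q * n) ` {1..N}. x k)"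
      by (subst sum.reindex) (use q in \<open>auto simp: inj_on_def\<close>)
    also have "\<dots> \<le> (\<Sum>k=1..q * N. x k)"
    proof (rule sum_mono2)
      show "(\<lambda>n. q * n) ` {1..N} \<subseteq> {1..q * N}" using q by (auto simp: Suc_le_eq)
    qed (use x in auto)
    finally have "(1 / a' N) * (\<Sum>n=1..N. x (q * n)) \<le> (1 / a' N) * (\<Sum>k=1..q * N. x k)"
      using p by (intro mult_left_mono) auto
    then show "avg a' (\<lambda>n. x (q * n)) N \<le> (a (q * N) / a' N) * avg a x (q * N)" using p by (simp add: avg_def)
  qed
  have "(\<lambda>N. (a (q * N) / a' N) * avg a x (q * N)) \<longlonglongrightarrow> real q * 0"
    by (intro tendsto_mult a_ratio filterlim_compose[OF lim qn_inf])
  then show "(\<lambda>N. (a (q * N) / a' N) * avg a x (q * N)) \<longlonglongrightarrow> 0" by simp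
qed simp

text \<open>This is \<open>good_integrable\<close> for the density of \<open>C\<close>, read along
  the multiples of \<open>q\<close>.\<close>

lemma occupation_limit:
  assumes g: "continuous_on UNIV g" "\<And>x. 0 \<le> g x" "\<And>x. g x \<le> 1" "slowly_oscillating g"
  shows "AE z in m. avg a' (\<lambda>n. \<bar>T.Th n (\<lambda>x. indicator C x * g (D' n x)) z - measure m C * EW g * u' n\<bar>) \<longlonglongrightarrow> 0"
proof -
  have gm[measurable]: "g \<in> borel_measurable borel" using g(1) by (rule borel_measurable_continuous_onI)
  have i: "integrable m (\<lambda>x. indicator C x * g (D n x))" for n
    by (rule F.integrable_bounded_mult[OF C_props(2), where B = 1]) (use g in auto)
  have "good g (EW g) (indicator C)"
    by (rule good_integrable[OF g(1-3) _ C_props(2)]) (use g(4) in \<open>auto simp: slowly_oscillating_def\<close>)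
  then have "AE z in m. avg a (\<lambda>n. \<bar>F.Th n (\<lambda>x. indicator C x * g (D n x)) z - measure m C * EW g * u n\<bar>) \<longlonglongrightarrow> 0"
    unfolding good_def C_props(3) by simp
  moreover have "AE z in m. \<forall>n. T.Th n (\<lambda>x. indicator C x * g (D (q * n) x)) z = F.Th (q * n) (\<lambda>x. indicator C x * g (D (q * n) x)) z"
    unfolding AE_all_countable t by (intro allI transfer_mult i) (use s in simp)
  ultimately show ?thesis
  proof eventually_elim
    fix z
    assume l: "avg a (\<lambda>n. \<bar>F.Th n (\<lambda>x. indicator C x * g (D n x)) z - measure m C * EW g * u n\<bar>) \<longlonglongrightarrow> 0"
      and eq: "\<forall>n. T.Th n (\<lambda>x. indicator C x * g (D (q * n) x)) z = F.Th (q * n) (\<lambda>x. indicator C x * g (D (q * n) x)) z"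
    from avg_thin[OF abs_ge_zero l]
    show "avg a' (\<lambda>n. \<bar>T.Th n (\<lambda>x. indicator C x * g (D' n x)) z - measure m C * EW g * u' n\<bar>) \<longlonglongrightarrow> 0"
      by (simp add: D'_def u'_def eq)
  qed
qed

definition V :: "nat \<Rightarrow> 'w \<times> real \<Rightarrow> real" where "V n z = birkhoff_sum (\<Psi> t) n f z / a' n"
definition I where "I = (\<integral>z. f z \<partial>m)"

lemma f_meas [measurable]: "f \<in> borel_measurable m" using f by auto

lemma V_meas [measurable]: "V n \<in> borel_measurable m" unfolding V_def by measurable

lemma D'_meas [measurable]: "D' n \<in> borel_measurable m" unfolding D'_def by measurable

lemma D'_nonneg: "0 \<le> D' n z" unfolding D'_def by (rule D_nonneg)

lemma I_nonneg: "0 \<le> I" unfolding I_def by (rule integral_nonneg_AE) (use f_nonneg in auto)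

lemma V_nonneg: assumes "z \<in> space m" "n \<ge> 1" shows "0 \<le> V n z"
proof -
  have "0 < a' n" using a' assms(2) by (simp add: return_sequence_def)
  moreover have "0 \<le> birkhoff_sum (\<Psi> t) n f z"
    unfolding birkhoff_sum_def by (intro sum_nonneg f_nonneg T.iter_space assms(1))
  ultimately show ?thesis by (simp add: V_def)
qed

text \<open>By the ratio ergodic theorem the Birkhoff sum of \<open>f\<close> is about
  \<open>I / t\<close> times the crossings, whose one-step mean is \<open>t\<close>; with
  \<open>a' n * t\<close> asymptotic to \<open>b (n * t)\<close> this gives
  \<open>V n = \<kappa> n * D' n\<close> with \<open>\<kappa> n\<close> tending to \<open>I\<close>.
  For \<open>I = 0\<close> the allowed error no longer grows with \<open>D' n\<close>, but then
  \<open>f\<close> vanishes along almost every orbit.\<close>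

lemma V_close:
  "AE z in m. \<forall>d>0. \<forall>\<^sub>F n in sequentially. \<bar>V n z - I * D' n z\<bar> \<le> d * (1 + I * D' n z)"
proof (cases "I = 0")
  case True
  have "AE z in m. 0 \<le> f z" using f_nonneg by (rule AE_I2)
  then have "AE z in m. f z = 0" using integral_nonneg_eq_0_iff_AE[OF f] True by (simp add: I_def)
  then have "AE z in m. \<forall>k. f ((\<Psi> t ^^ k) z) = 0" unfolding AE_all_countable by (intro allI T.AE_iter)
  then show ?thesis by eventually_elim (simp add: V_def birkhoff_sum_def True)
next
  case False
  then have I: "0 < I" using I_nonneg by simp
  let ?p = "\<lambda>z. real (crossings \<tau> r t z)"
  have "AE z in m. \<forall>n. birkhoff_sum (\<Psi> t) n ?p z = real (crossings \<tau> r (real n * t) z)"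
    unfolding AE_all_countable by (intro allI birkhoff_crossings) (use t_pos in simp)
  then have inf: "AE z in m. (\<forall>n. birkhoff_sum (\<Psi> t) n ?p z = real (crossings \<tau> r (real n * t) z)) \<and>
      filterlim (\<lambda>n. birkhoff_sum (\<Psi> t) n ?p z) at_top sequentially"
    using crossings_at_top[OF t_pos] by eventually_elim simp
  have "AE z in m. (\<lambda>n. birkhoff_sum (\<Psi> t) n f z / birkhoff_sum (\<Psi> t) n ?p z) \<longlonglongrightarrow> (\<integral>x. f x \<partial>m) / (\<integral>x. ?p x \<partial>m)"
  proof (rule T.ratio_ergodic[OF T.ergodic_if_return_sequence[OF a'] f])
    show "integrable m ?p" "0 < (\<integral>x. ?p x \<partial>m)" using crossings_integral[OF t_pos] t_pos by auto
    show "AE z in m. filterlim (\<lambda>n. birkhoff_sum (\<Psi> t) n ?p z) at_top sequentially" using inf by eventually_elim (rule conjunct2)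
  qed
  with inf show ?thesis
  proof (eventually_elim, intro allI impI)
    fix z and d :: real
    assume z: "(\<forall>n. birkhoff_sum (\<Psi> t) n ?p z = real (crossings \<tau> r (real n * t) z)) \<and>
      filterlim (\<lambda>n. birkhoff_sum (\<Psi> t) n ?p z) at_top sequentially"
      and l: "(\<lambda>n. birkhoff_sum (\<Psi> t) n f z / birkhoff_sum (\<Psi> t) n ?p z) \<longlonglongrightarrow> (\<integral>x. f x \<partial>m) / (\<integral>x. ?p x \<partial>m)"
      and d: "0 < d"
    let ?N = "\<lambda>n. real (crossings \<tau> r (real n * t) z)"
    have l': "(\<lambda>n. birkhoff_sum (\<Psi> t) n f z / ?N n) \<longlonglongrightarrow> I / t"
      using l z crossings_integral(2)[OF t_pos] by (simp add: I_def)
    have N: "\<forall>\<^sub>F n in sequentially. 0 < ?N n"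
      using filterlim_at_top_dense[THEN iffD1, rule_format, OF conjunct2[OF z], of 0] conjunct1[OF z] by simp
    define \<kappa> where "\<kappa> n = (birkhoff_sum (\<Psi> t) n f z / ?N n) * (inverse (a' n * t / b (real n * t)) * t)" for n
    have "\<kappa> \<longlonglongrightarrow> I / t * (inverse 1 * t)"
      unfolding \<kappa>_def[abs_def] by (intro tendsto_mult tendsto_inverse l' a'_growth tendsto_const) simp
    then have \<kappa>: "\<kappa> \<longlonglongrightarrow> I" using t_pos by simp
    have "0 < d * I" using d I by simp
    from tendstoD[OF \<kappa> this] N eventually_ge_at_top[of 1]
    show "\<forall>\<^sub>F n in sequentially. \<bar>V n z - I * D' n z\<bar> \<le> d * (1 + I * D' n z)"
    proof eventually_elim
      fix n :: nat assume k: "dist (\<kappa> n) I < d * I" and n: "0 < ?N n" "1 \<le> n"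
      have "0 < a' n" using a' n(2) by (simp add: return_sequence_def)
      then have "V n z = \<kappa> n * D' n z"
        using n t_pos rv.b_pos[of "real n * t"] unfolding V_def \<kappa>_def D'_eq by (simp add: field_simps)
      then have "\<bar>V n z - I * D' n z\<bar> = \<bar>\<kappa> n - I\<bar> * D' n z"
        using D'_nonneg[of n z] by (simp add: abs_mult flip: left_diff_distrib)
      also have "\<dots> \<le> d * I * D' n z" using k D'_nonneg[of n z] by (intro mult_right_mono) (auto simp: dist_real_def)
      also have "\<dots> \<le> d * (1 + I * D' n z)" using d by (simp add: distrib_left mult.assoc)
      finally show "\<bar>V n z - I * D' n z\<bar> \<le> d * (1 + I * D' n z)" .
    qed
  qed
qed

text \<open>
  Off a set of small measure the Birkhoff sums and the occupation numbers are uniformly close from some time on;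
  the exceptional part of \<open>C\<close> contributes its measure to the averages.
\<close>

lemma birkhoff_limit:
  assumes g: "continuous_on UNIV g" "\<And>x. 0 \<le> g x" "\<And>x. g x \<le> 1" "slowly_oscillating g"
  shows "AE z in m. avg a' (\<lambda>n. \<bar>T.Th n (\<lambda>x. indicator C x * g (V n x)) z - measure m C * EW (\<lambda>w. g (I * w)) * u' n\<bar>) \<longlonglongrightarrow> 0"
proof -
  have gm[measurable]: "g \<in> borel_measurable borel" using g(1) by (rule borel_measurable_continuous_onI)
  note [measurable] = C_props(1)
  have g_abs: "\<bar>g x\<bar> \<le> 1" for x using g(2,3)[of x] by simp
  have iV: "integrable m (\<lambda>x. indicator C x * g (V n x))" and iD: "integrable m (\<lambda>x. indicator C x * g (I * D' n x))" for n
    by (rule F.integrable_bounded_mult[OF C_props(2), where B = 1]; use g_abs in auto)+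
  have "\<forall>i. \<exists>d>0. \<forall>x y. 0 \<le> x \<longrightarrow> 0 \<le> y \<longrightarrow> \<bar>x - y\<bar> \<le> d * (1 + y) \<longrightarrow> \<bar>g x - g y\<bar> \<le> 1 / real (Suc i)"
    using g(4) unfolding slowly_oscillating_def by simp
  then obtain d where d: "\<And>i. 0 < d i"
    "\<And>i x y. 0 \<le> x \<Longrightarrow> 0 \<le> y \<Longrightarrow> \<bar>x - y\<bar> \<le> d i * (1 + y) \<Longrightarrow> \<bar>g x - g y\<bar> \<le> 1 / real (Suc i)"
    by metis
  \<comment> \<open>The points of \<open>C\<close> at which the comparison with tolerance
    \<open>d i\<close> fails at some time from \<open>k\<close> on; for fixed \<open>i\<close> these
    sets shrink to a null set.\<close>
  define E where "E i k = {z \<in> space m. \<exists>n\<ge>k. d i * (1 + I * D' n z) < \<bar>V n z - I * D' n z\<bar>} \<inter> C" for i k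
  have E_sets[measurable]: "E i k \<in> sets m" for i k unfolding E_def by measurable
  have Ei: "integrable m (indicator (E i k) :: _ \<Rightarrow> real)" for i k
    by (rule Bochner_Integration.integrable_bound[OF C_props(2)]) (auto simp: E_def indicator_def)
  have E0: "(\<lambda>k. \<integral>z. indicator (E i k) z \<partial>m) \<longlonglongrightarrow> (0::real)" for i
  proof -
    have "(\<lambda>k. \<integral>z. indicator (E i k) z \<partial>m) \<longlonglongrightarrow> (\<integral>z. (0::real) \<partial>m)"
    proof (rule integral_dominated_convergence[where w = "indicator C"])
      show "AE z in m. (\<lambda>k. indicator (E i k) z :: real) \<longlonglongrightarrow> 0"
        using V_close
      proof eventually_elim
        fix z assume "\<forall>d>0. \<forall>\<^sub>F n in sequentially. \<bar>V n z - I * D' n z\<bar> \<le> d * (1 + I * D' n z)"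
        then obtain N where N: "\<And>n. n \<ge> N \<Longrightarrow> \<bar>V n z - I * D' n z\<bar> \<le> d i * (1 + I * D' n z)"
          using d(1)[of i] by (auto simp: eventually_sequentially)
        then have "indicator (E i k) z = (0::real)" if "k \<ge> N" for k
        proof -
          have "\<bar>V n z - I * D' n z\<bar> \<le> d i * (1 + I * D' n z)" if "n \<ge> k" for n
            using N[OF order_trans[OF \<open>N \<le> k\<close> that]] .
          then have "z \<notin> E i k" unfolding E_def by (auto simp: not_less)
          then show ?thesis by simp
        qed
        then show "(\<lambda>k. indicator (E i k) z :: real) \<longlonglongrightarrow> 0"
          by (intro tendsto_eventually) (auto simp: eventually_sequentially)
      qed
      show "AE z in m. norm (indicator (E i k) z :: real) \<le> indicator C z" for k by (auto simp: E_def indicator_def)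
    qed (use C_props(2) in auto)
    then show ?thesis by (simp only: Bochner_Integration.integral_zero)
  qed
  have "AE z in m. \<forall>n i k. k \<le> n \<longrightarrow> 1 \<le> n \<longrightarrow> \<bar>T.Th n (\<lambda>x. indicator C x * g (V n x) - indicator C x * g (I * D' n x)) z\<bar>
      \<le> T.Th n (\<lambda>x. 1 / real (Suc i) * indicator C x + 1 * indicator (E i k) x) z"
    unfolding AE_all_countable
  proof (intro allI)
    fix n i k
    show "AE z in m. k \<le> n \<longrightarrow> 1 \<le> n \<longrightarrow> \<bar>T.Th n (\<lambda>x. indicator C x * g (V n x) - indicator C x * g (I * D' n x)) z\<bar>
      \<le> T.Th n (\<lambda>x. 1 / real (Suc i) * indicator C x + 1 * indicator (E i k) x) z"
    proof (cases "k \<le> n \<and> 1 \<le> n")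
      case True
      have "AE z in m. \<bar>T.Th n (\<lambda>x. indicator C x * g (V n x) - indicator C x * g (I * D' n x)) z\<bar>
        \<le> T.Th n (\<lambda>x. 1 / real (Suc i) * indicator C x + 1 * indicator (E i k) x) z"
      proof (rule T.Th_abs_le)
        show "AE x in m. \<bar>indicator C x * g (V n x) - indicator C x * g (I * D' n x)\<bar> \<le> 1 / real (Suc i) * indicator C x + 1 * indicator (E i k) x"
        proof (rule AE_I2)
          fix x assume x: "x \<in> space m"
          show "\<bar>indicator C x * g (V n x) - indicator C x * g (I * D' n x)\<bar> \<le> 1 / real (Suc i) * indicator C x + 1 * indicator (E i k) x"
          proof (cases "x \<in> C")
            case xC: True
            show ?thesis
            proof (cases "x \<in> E i k")
              case True
              have "\<bar>g (V n x) - g (I * D' n x)\<bar> \<le> 1" using g(2,3)[of "V n x"] g(2,3)[of "I * D' n x"] by (simp add: abs_le_iff)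
              moreover have "0 \<le> 1 / real (Suc i)" by simp
              ultimately have "\<bar>g (V n x) - g (I * D' n x)\<bar> \<le> 1 / real (Suc i) + 1" by linarith
              then show ?thesis using True xC by (simp del: of_nat_Suc)
            next
              case False
              then have "\<bar>V n x - I * D' n x\<bar> \<le> d i * (1 + I * D' n x)"
                using x xC \<open>k \<le> n \<and> 1 \<le> n\<close> by (auto simp: E_def not_less)
              then have "\<bar>g (V n x) - g (I * D' n x)\<bar> \<le> 1 / real (Suc i)"
                by (intro d(2) V_nonneg x mult_nonneg_nonneg I_nonneg D'_nonneg) (use True in auto)
              then show ?thesis using False xC by (simp del: of_nat_Suc)
            qed
          next
            case False then show ?thesis by (simp add: E_def)
          qed
        qed
      qed (use iV iD C_props(2) Ei in auto)
      then show ?thesis by eventually_elim blast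
    qed auto
  qed
  moreover have "AE z in m. \<forall>n i k. T.Th n (\<lambda>x. 1 / real (Suc i) * indicator C x + 1 * indicator (E i k) x) z
      = 1 / real (Suc i) * T.Th n (indicator C) z + 1 * T.Th n (indicator (E i k)) z"
    unfolding AE_all_countable by (intro allI T.Th_lincomb C_props(2) Ei)
  moreover have "AE z in m. \<forall>n. T.Th n (\<lambda>x. indicator C x * g (V n x) - indicator C x * g (I * D' n x)) z
      = T.Th n (\<lambda>x. indicator C x * g (V n x)) z - T.Th n (\<lambda>x. indicator C x * g (I * D' n x)) z"
    unfolding AE_all_countable by (intro allI T.Th_diff iV iD)
  moreover have "AE z in m. avg a' (\<lambda>n. \<bar>T.Th n (\<lambda>x. indicator C x * g (I * D' n x)) z - measure m C * EW (\<lambda>w. g (I * w)) * u' n\<bar>) \<longlonglongrightarrow> 0"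
  proof (rule occupation_limit[of "\<lambda>w. g (I * w)"])
    show "continuous_on UNIV (\<lambda>w. g (I * w))"
      by (rule continuous_on_compose2[OF g(1)]) (auto intro!: continuous_intros)
  qed (use g I_nonneg in \<open>auto intro!: slowly_oscillating_scale\<close>)
  moreover have "AE z in m. avg a' (\<lambda>n. T.Th n (indicator C) z) \<longlonglongrightarrow> measure m C"
    using T.avg_Th[OF a' C_props(2)] C_props(3) by simp
  moreover have "AE z in m. \<forall>i k. avg a' (\<lambda>n. T.Th n (indicator (E i k)) z) \<longlonglongrightarrow> (\<integral>z. indicator (E i k) z \<partial>m)"
    unfolding AE_all_countable by (intro allI T.avg_Th[OF a' Ei])
  ultimately show ?thesis
  proof eventually_elim
    fix z
    let ?X = "\<lambda>n. T.Th n (\<lambda>x. indicator C x * g (V n x)) z" and ?Y = "\<lambda>n. T.Th n (\<lambda>x. indicator C x * g (I * D' n x)) z"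
    let ?c = "measure m C * EW (\<lambda>w. g (I * w))"
    assume 1: "\<forall>n i k. k \<le> n \<longrightarrow> 1 \<le> n \<longrightarrow> \<bar>T.Th n (\<lambda>x. indicator C x * g (V n x) - indicator C x * g (I * D' n x)) z\<bar>
      \<le> T.Th n (\<lambda>x. 1 / real (Suc i) * indicator C x + 1 * indicator (E i k) x) z"
      and 2: "\<forall>n i k. T.Th n (\<lambda>x. 1 / real (Suc i) * indicator C x + 1 * indicator (E i k) x) z
      = 1 / real (Suc i) * T.Th n (indicator C) z + 1 * T.Th n (indicator (E i k)) z"
      and 3: "\<forall>n. T.Th n (\<lambda>x. indicator C x * g (V n x) - indicator C x * g (I * D' n x)) z = ?X n - ?Y n"
      and 4: "avg a' (\<lambda>n. \<bar>?Y n - ?c * u' n\<bar>) \<longlonglongrightarrow> 0"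
      and 5: "avg a' (\<lambda>n. T.Th n (indicator C) z) \<longlonglongrightarrow> measure m C"
      and 6: "\<forall>i k. avg a' (\<lambda>n. T.Th n (indicator (E i k)) z) \<longlonglongrightarrow> (\<integral>z. indicator (E i k) z \<partial>m)"
    show "avg a' (\<lambda>n. \<bar>?X n - ?c * u' n\<bar>) \<longlonglongrightarrow> 0"
    proof (rule avg_null[OF a'_inf])
      fix \<epsilon> :: real assume e: "\<epsilon> > 0"
      then have "0 < \<epsilon> / (2 * measure m C)" using C_props(4) by simp
      then obtain i where i: "1 / real (Suc i) < \<epsilon> / (2 * measure m C)" by (rule nat_approx_posE)
      have "\<forall>\<^sub>F k in sequentially. (\<integral>z. indicator (E i k) z \<partial>m) < \<epsilon> / 2"
        using order_tendstoD(2)[OF E0[of i], of "\<epsilon> / 2"] e by simp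
      then obtain k where k: "(\<integral>z. indicator (E i k) z \<partial>m) < \<epsilon> / 2" by (auto simp: eventually_sequentially)
      \<comment> \<open>The averages of the three terms tend to less than half of \<epsilon>, less
        than half of \<epsilon>, and 0.\<close>
      let ?y = "\<lambda>n. (1 / real (Suc i) * T.Th n (indicator C) z + 1 * T.Th n (indicator (E i k)) z) + \<bar>?Y n - ?c * u' n\<bar>"
      have "\<bar>?X n - ?c * u' n\<bar> \<le> ?y n" if "n \<ge> max 1 k" for n
      proof -
        have "\<bar>?X n - ?Y n\<bar> \<le> 1 / real (Suc i) * T.Th n (indicator C) z + 1 * T.Th n (indicator (E i k)) z"
          using 1[rule_format, of k n i] that unfolding 3[rule_format, of n] 2[rule_format, of n i k] by simp
        moreover have "\<bar>?X n - ?c * u' n\<bar> \<le> \<bar>?X n - ?Y n\<bar> + \<bar>?Y n - ?c * u' n\<bar>" by linarith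
        ultimately show ?thesis by (rule order_trans[rotated, OF add_right_mono])
      qed
      then have "\<forall>\<^sub>F n in sequentially. \<bar>?X n - ?c * u' n\<bar> \<le> ?y n" unfolding eventually_sequentially by blast
      moreover have "avg a' ?y \<longlonglongrightarrow> (1 / real (Suc i) * measure m C + 1 * (\<integral>z. indicator (E i k) z \<partial>m)) + 0"
        unfolding avg_add avg_cmult by (intro tendsto_add tendsto_mult tendsto_const 4 5 6[rule_format])
      moreover have "(1 / real (Suc i) * measure m C + 1 * (\<integral>z. indicator (E i k) z \<partial>m)) + 0 \<le> \<epsilon>"
      proof -
        have "1 / real (Suc i) * measure m C \<le> \<epsilon> / (2 * measure m C) * measure m C"
          using i C_props(4) by (intro mult_right_mono) auto
        also have "\<dots> = \<epsilon> / 2" using C_props(4) by simp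
        finally show ?thesis using k by linarith
      qed
      ultimately show "\<exists>y l. (\<forall>\<^sub>F n in sequentially. \<bar>?X n - ?c * u' n\<bar> \<le> y n) \<and> avg a' y \<longlonglongrightarrow> l \<and> l \<le> \<epsilon>"
        by - (rule exI, rule exI, rule conjI, assumption, rule conjI, assumption+)
    qed simp
  qed
qed

text \<open>The transfer images of the indicator of \<open>C\<close> have averages tending to
  \<open>measure m C\<close> by dual ergodicity, and by \<open>birkhoff_limit\<close> with
  \<open>g = 1\<close> they are \<open>measure m C * u' n\<close> in the average.\<close>

lemma u'_avg: "avg a' u' \<longlonglongrightarrow> 1"
proof -
  have "AE z in m. avg a' (\<lambda>n. \<bar>T.Th n (\<lambda>x. indicator C x * 1) z - measure m C * EW (\<lambda>w. 1) * u' n\<bar>) \<longlonglongrightarrow> 0"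
    by (rule birkhoff_limit) (auto intro: slowly_oscillating_const)
  moreover have "AE z in m. avg a' (\<lambda>n. T.Th n (indicator C) z) \<longlonglongrightarrow> measure m C"
    using T.avg_Th[OF a' C_props(2)] C_props(3) by simp
  ultimately have "AE z in m. avg a' (\<lambda>n. \<bar>T.Th n (indicator C) z - measure m C * u' n\<bar>) \<longlonglongrightarrow> 0 \<and>
      avg a' (\<lambda>n. T.Th n (indicator C) z) \<longlonglongrightarrow> measure m C"
    by eventually_elim (simp add: EW_one)
  from AE_base_positive[OF this] obtain z where z: "avg a' (\<lambda>n. \<bar>T.Th n (indicator C) z - measure m C * u' n\<bar>) \<longlonglongrightarrow> 0"
      "avg a' (\<lambda>n. T.Th n (indicator C) z) \<longlonglongrightarrow> measure m C" by auto
  have "avg a' (\<lambda>n. T.Th n (indicator C) z - measure m C * u' n) \<longlonglongrightarrow> 0"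
  proof (rule Lim_null_comparison[OF _ z(1)])
    have "\<forall>\<^sub>F N in sequentially. 0 < a' N"
      using a'_inf by (rule filterlim_at_top_dense[THEN iffD1, rule_format])
    then show "\<forall>\<^sub>F N in sequentially. norm (avg a' (\<lambda>n. T.Th n (indicator C) z - measure m C * u' n) N)
      \<le> avg a' (\<lambda>n. \<bar>T.Th n (indicator C) z - measure m C * u' n\<bar>) N"
    proof eventually_elim
      fix N assume "0 < a' N"
      then show "norm (avg a' (\<lambda>n. T.Th n (indicator C) z - measure m C * u' n) N)
        \<le> avg a' (\<lambda>n. \<bar>T.Th n (indicator C) z - measure m C * u' n\<bar>) N"
        using sum_abs[of "\<lambda>n. T.Th n (indicator C) z - measure m C * u' n" "{1..N}"]
        by (simp add: avg_def abs_mult divide_right_mono)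
    qed
  qed
  from tendsto_diff[OF z(2) this] have "(\<lambda>N. measure m C * avg a' u' N) \<longlonglongrightarrow> measure m C"
    by (simp add: avg_diff avg_cmult)
  from tendsto_mult[OF tendsto_const[of "1 / measure m C"] this] show ?thesis using C_props(4) by simp
qed

text \<open>A continuous function may oscillate too fast at infinity, so \<open>g\<close> is
  multiplied by a cutoff. The discarded mass is controlled by the same limit for
  \<open>1 - cutoff j\<close>, which is slowly oscillating; its expectation tends to 0 with
  \<open>j\<close> because \<open>Y\<close> has a finite mean.\<close>

lemma birkhoff_limit_unit:
  assumes g: "continuous_on UNIV g" "\<And>x. 0 \<le> g x" "\<And>x. g x \<le> 1"
  shows "AE z in m. avg a' (\<lambda>n. \<bar>T.Th n (\<lambda>x. indicator C x * g (V n x)) z - measure m C * EW (\<lambda>w. g (I * w)) * u' n\<bar>) \<longlonglongrightarrow> 0"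
proof -
  interpret Y: real_distribution Y using Y by (simp add: mittag_leffler_law_def)
  have gm[measurable]: "g \<in> borel_measurable borel" using g(1) by (rule borel_measurable_continuous_onI)
  note [measurable] = C_props(1)
  let ?h = "\<lambda>j x. g x * cutoff j x" and ?k = "\<lambda>j x. 1 - cutoff j x"
  have cm[measurable]: "cutoff j \<in> borel_measurable borel" for j using cutoff(1) by (rule borel_measurable_continuous_onI)
  have h: "continuous_on UNIV (?h j)" "\<And>x. 0 \<le> ?h j x" "\<And>x. ?h j x \<le> 1" "slowly_oscillating (?h j)" for j
  proof -
    show 1: "continuous_on UNIV (?h j)" by (intro continuous_intros g(1) cutoff(1))
    show "0 \<le> ?h j x" for x by (intro mult_nonneg_nonneg g(2) cutoff(2))
    show "?h j x \<le> 1" for x using mult_mono[OF g(3)[of x] cutoff(3)[of j x]] cutoff(2)[of j x] by simp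
    show "slowly_oscillating (?h j)"
      by (rule slowly_oscillating_compact_support[OF 1, of "real j + 1"]) (use cutoff(5) in auto)
  qed
  have k: "continuous_on UNIV (?k j)" "\<And>x. 0 \<le> ?k j x" "\<And>x. ?k j x \<le> 1" "slowly_oscillating (?k j)" for j
  proof -
    show "continuous_on UNIV (?k j)" by (intro continuous_intros cutoff(1))
    show "0 \<le> ?k j x" "?k j x \<le> 1" for x using cutoff(2,3)[of j x] by auto
    show "slowly_oscillating (?k j)"
      by (rule slowly_oscillating_diff, rule slowly_oscillating_compact_support[OF cutoff(1), of "real j + 1"])
        (use cutoff(5) in auto)
  qed
  let ?m = "measure m C"
  let ?eh = "\<lambda>j. EW (\<lambda>w. ?h j (I * w))" and ?ek = "\<lambda>j. EW (\<lambda>w. ?k j (I * w))" and ?eg = "EW (\<lambda>w. g (I * w))"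
  have int: "integrable Y (\<lambda>y. y * w (I * y))" "0 \<le> EW (\<lambda>y. w (I * y))"
    if "w \<in> borel_measurable borel" "\<And>x. 0 \<le> w x" "\<And>x. w x \<le> 1" for w
    using EW_bounds(1,2)[of "\<lambda>y. w (I * y)"] that by auto
  have pos: "AE y in Y. 0 < y" using Y by (simp add: mittag_leffler_law_def)
  have gk: "\<bar>?eh j - ?eg\<bar> \<le> ?ek j" for j
  proof -
    have "?eg - ?eh j = (\<integral>y. y * g (I * y) - y * ?h j (I * y) \<partial>Y)"
      unfolding EW_def by (rule Bochner_Integration.integral_diff[symmetric]; rule int; use g h in auto)
    then have "\<bar>?eh j - ?eg\<bar> = \<bar>\<integral>y. y * g (I * y) - y * ?h j (I * y) \<partial>Y\<bar>" by linarith
    also have "\<dots> \<le> (\<integral>y. \<bar>y * g (I * y) - y * ?h j (I * y)\<bar> \<partial>Y)" by (rule integral_abs_bound)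
    also have "\<dots> \<le> ?ek j"
      unfolding EW_def
    proof (rule integral_mono_AE)
      show "integrable Y (\<lambda>y. \<bar>y * g (I * y) - y * ?h j (I * y)\<bar>)"
        by (intro Bochner_Integration.integrable_abs Bochner_Integration.integrable_diff; rule int; use g h in auto)
      show "integrable Y (\<lambda>y. y * ?k j (I * y))" by (rule int) (use k in auto)
      show "AE y in Y. \<bar>y * g (I * y) - y * ?h j (I * y)\<bar> \<le> y * ?k j (I * y)"
        using pos
      proof eventually_elim
        fix y :: real assume y: "0 < y"
        have "y * g (I * y) - y * ?h j (I * y) = y * (g (I * y) * ?k j (I * y))" by (simp add: algebra_simps)
        then have "\<bar>y * g (I * y) - y * ?h j (I * y)\<bar> = y * (g (I * y) * ?k j (I * y))"
          using y g(2)[of "I * y"] k(2)[of j "I * y"] by simp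
        also have "\<dots> \<le> y * (1 * ?k j (I * y))" using y g(3) k(2) by (intro mult_left_mono mult_right_mono) auto
        finally show "\<bar>y * g (I * y) - y * ?h j (I * y)\<bar> \<le> y * ?k j (I * y)" by simp
      qed
    qed
    finally show ?thesis .
  qed
  have ek0: "?ek \<longlonglongrightarrow> 0"
  proof -
    have "(\<lambda>j. \<integral>y. y * ?k j (I * y) \<partial>Y) \<longlonglongrightarrow> (\<integral>y. 0 \<partial>Y)"
    proof (rule integral_dominated_convergence[where w = "\<lambda>y. \<bar>y\<bar>"])
      show "integrable Y (\<lambda>y. \<bar>y\<bar>)" using mittag_leffler_law_mean(1)[OF rv.gamma Y] by simp
      show "AE y in Y. (\<lambda>j. y * ?k j (I * y)) \<longlonglongrightarrow> 0"
      proof (rule AE_I2, rule tendsto_eventually)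
        fix y :: real
        obtain j0 :: nat where "I * y \<le> real j0" using real_arch_simple by blast
        then have "y * ?k j (I * y) = 0" if "j \<ge> j0" for j using that cutoff(4)[of "I * y" j] by simp
        then show "\<forall>\<^sub>F j in sequentially. y * ?k j (I * y) = 0" unfolding eventually_sequentially by blast
      qed
      show "AE y in Y. norm (y * ?k j (I * y)) \<le> \<bar>y\<bar>" for j
      proof (rule AE_I2)
        fix y
        have "\<bar>y\<bar> * \<bar>?k j (I * y)\<bar> \<le> \<bar>y\<bar> * 1" using k(2,3)[of j "I * y"] by (intro mult_left_mono) auto
        then show "norm (y * ?k j (I * y)) \<le> \<bar>y\<bar>" by (simp add: abs_mult)
      qed
    qed simp_all
    then show ?thesis by (simp add: EW_def)
  qed
  have iw: "integrable m (\<lambda>x. indicator C x * w (V n x))"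
    if "w \<in> borel_measurable borel" "\<And>x. 0 \<le> w x" "\<And>x. w x \<le> 1" for w :: "real \<Rightarrow> real" and n
    by (rule F.integrable_bounded_mult[OF C_props(2), where B = 1]) (use that in \<open>auto simp: abs_le_iff intro: order_trans[of _ 0]\<close>)
  have ig: "integrable m (\<lambda>x. indicator C x * g (V n x))" and ih: "integrable m (\<lambda>x. indicator C x * ?h j (V n x))"
    and ik: "integrable m (\<lambda>x. indicator C x * ?k j (V n x))" for n j
    by (rule iw; use g h k in auto)+
  have "AE z in m. \<forall>n j. \<bar>T.Th n (\<lambda>x. indicator C x * g (V n x) - indicator C x * ?h j (V n x)) z\<bar> \<le> T.Th n (\<lambda>x. indicator C x * ?k j (V n x)) z"
    unfolding AE_all_countable
  proof (intro allI T.Th_abs_le AE_I2)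
    fix n j x
    have "indicator C x * g (V n x) - indicator C x * ?h j (V n x) = indicator C x * (g (V n x) * ?k j (V n x))"
      by (simp add: algebra_simps)
    then have "\<bar>indicator C x * g (V n x) - indicator C x * ?h j (V n x)\<bar> = indicator C x * (g (V n x) * ?k j (V n x))"
      using g(2)[of "V n x"] k(2)[of j "V n x"] by simp
    moreover have "indicator C x * (g (V n x) * ?k j (V n x)) \<le> indicator C x * (1 * ?k j (V n x))"
      using g(3) k(2) by (intro mult_left_mono mult_right_mono) auto
    ultimately show "\<bar>indicator C x * g (V n x) - indicator C x * ?h j (V n x)\<bar> \<le> indicator C x * ?k j (V n x)" by simp
  qed (use ig ih ik in auto)
  moreover have "AE z in m. \<forall>n j. T.Th n (\<lambda>x. indicator C x * g (V n x) - indicator C x * ?h j (V n x)) z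
      = T.Th n (\<lambda>x. indicator C x * g (V n x)) z - T.Th n (\<lambda>x. indicator C x * ?h j (V n x)) z"
    unfolding AE_all_countable by (intro allI T.Th_diff ig ih)
  moreover have "AE z in m. \<forall>j. avg a' (\<lambda>n. \<bar>T.Th n (\<lambda>x. indicator C x * ?h j (V n x)) z - ?m * ?eh j * u' n\<bar>) \<longlonglongrightarrow> 0"
    unfolding AE_all_countable by (intro allI birkhoff_limit h)
  moreover have "AE z in m. \<forall>j. avg a' (\<lambda>n. \<bar>T.Th n (\<lambda>x. indicator C x * ?k j (V n x)) z - ?m * ?ek j * u' n\<bar>) \<longlonglongrightarrow> 0"
    unfolding AE_all_countable by (intro allI birkhoff_limit k)
  ultimately show ?thesis
  proof eventually_elim
    fix z
    let ?G = "\<lambda>n. T.Th n (\<lambda>x. indicator C x * g (V n x)) z"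
    let ?H = "\<lambda>j n. T.Th n (\<lambda>x. indicator C x * ?h j (V n x)) z"
    let ?K = "\<lambda>j n. T.Th n (\<lambda>x. indicator C x * ?k j (V n x)) z"
    assume 1: "\<forall>n j. \<bar>T.Th n (\<lambda>x. indicator C x * g (V n x) - indicator C x * ?h j (V n x)) z\<bar> \<le> ?K j n"
      and 2: "\<forall>n j. T.Th n (\<lambda>x. indicator C x * g (V n x) - indicator C x * ?h j (V n x)) z = ?G n - ?H j n"
      and 3: "\<forall>j. avg a' (\<lambda>n. \<bar>?H j n - ?m * ?eh j * u' n\<bar>) \<longlonglongrightarrow> 0"
      and 4: "\<forall>j. avg a' (\<lambda>n. \<bar>?K j n - ?m * ?ek j * u' n\<bar>) \<longlonglongrightarrow> 0"
    show "avg a' (\<lambda>n. \<bar>?G n - ?m * ?eg * u' n\<bar>) \<longlonglongrightarrow> 0"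
    proof (rule avg_null[OF a'_inf])
      fix \<epsilon> :: real assume e: "\<epsilon> > 0"
      then have "0 < \<epsilon> / (2 * ?m)" using C_props(4) by simp
      from order_tendstoD(2)[OF ek0 this] obtain j where j: "?ek j < \<epsilon> / (2 * ?m)"
        by (auto simp: eventually_sequentially)
      \<comment> \<open>The last term collects \<open>?m * ?ek j\<close> twice: as the weight of
        \<open>?K j\<close> in the average and as the change of the expectation of
        \<open>g\<close>.\<close>
      let ?y = "\<lambda>n. \<bar>?H j n - ?m * ?eh j * u' n\<bar> + \<bar>?K j n - ?m * ?ek j * u' n\<bar> + (2 * ?m * ?ek j) * u' n"
      have "\<bar>?G n - ?m * ?eg * u' n\<bar> \<le> ?y n" for n
      proof -
        have "\<bar>?G n - ?H j n\<bar> \<le> ?K j n" using 1[rule_format, of n j] unfolding 2[rule_format, of n j] .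
        moreover have "\<bar>?m * ?eh j * u' n - ?m * ?eg * u' n\<bar> \<le> ?m * ?ek j * u' n"
        proof -
          have 5: "?m * ?eh j * u' n - ?m * ?eg * u' n = ?m * ((?eh j - ?eg) * u' n)" by (simp add: algebra_simps)
          have "\<bar>?m * ((?eh j - ?eg) * u' n)\<bar> = ?m * (\<bar>?eh j - ?eg\<bar> * u' n)" using u'_nonneg[of n] by (simp add: abs_mult)
          moreover have "?m * (\<bar>?eh j - ?eg\<bar> * u' n) \<le> ?m * (?ek j * u' n)"
            by (intro mult_left_mono mult_right_mono gk u'_nonneg measure_nonneg)
          ultimately show ?thesis unfolding 5 by (simp only: mult.assoc)
        qed
        moreover have "(2 * ?m * ?ek j) * u' n = ?m * ?ek j * u' n + ?m * ?ek j * u' n" by simp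
        ultimately show ?thesis by linarith
      qed
      moreover have "avg a' ?y \<longlonglongrightarrow> 0 + 0 + (2 * ?m * ?ek j) * 1"
        unfolding avg_add avg_cmult by (intro tendsto_add tendsto_mult tendsto_const 3[rule_format] 4[rule_format] u'_avg)
      moreover have "0 + 0 + (2 * ?m * ?ek j) * 1 \<le> \<epsilon>" using j C_props(4) by (simp add: field_simps)
      ultimately show "\<exists>y l. (\<forall>\<^sub>F n in sequentially. \<bar>?G n - ?m * ?eg * u' n\<bar> \<le> y n) \<and> avg a' y \<longlonglongrightarrow> l \<and> l \<le> \<epsilon>"
        by (intro exI[of _ ?y] exI[of _ "0 + 0 + (2 * ?m * ?ek j) * 1"] conjI always_eventually allI)
    qed simp
  qed
qed

text \<open>An affine change brings \<open>g\<close> into the unit interval, the constant part being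
  treated by the limit for the function 1. Values of \<open>g\<close> at negative arguments are
  arbitrary, hence the composition with \<open>max 0\<close>. Finally \<open>u'\<close> is replaced
  by the asymptotically equal \<open>v\<close>.\<close>

theorem birkhoff_limit_bounded:
  assumes g: "continuous_on {0..} g" "bounded (g ` {0..})"
    and v: "v \<sim>[sequentially] (\<lambda>n. \<gamma> * a' n / real n)"
  shows "AE z in m. avg a' (\<lambda>n. \<bar>T.Th n (\<lambda>x. indicator C x * g (birkhoff_sum (\<Psi> t) n f x / a' n)) z
      - measure m C * (LINT w:{0..}|size_biased_law Y. g (I * w)) * v n\<bar>) \<longlonglongrightarrow> 0"
proof -
  interpret Y: real_distribution Y using Y by (simp add: mittag_leffler_law_def)
  obtain K where K: "0 < K" "\<And>x. 0 \<le> x \<Longrightarrow> \<bar>g x\<bar> \<le> K"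
    using g(2) unfolding bounded_pos by auto
  define G where "G x = g (max 0 x)" for x
  have Gc: "continuous_on UNIV G" unfolding G_def
    by (rule continuous_on_compose2[OF g(1)]) (auto intro!: continuous_intros)
  have Gb: "\<bar>G x\<bar> \<le> K" for x unfolding G_def by (rule K(2)) simp
  have Gm[measurable]: "G \<in> borel_measurable borel" using Gc by (rule borel_measurable_continuous_onI)
  note [measurable] = C_props(1)
  define h where "h x = (G x + K) / (2 * K)" for x
  have h: "continuous_on UNIV h" "0 \<le> h x" "h x \<le> 1" for x
    unfolding h_def using K(1) Gb[of x] by (auto intro!: continuous_intros Gc simp: abs_le_iff field_simps)
  have Gh: "G x = 2 * K * h x + (- K) * 1" for x using K(1) by (simp add: h_def)
  have hm[measurable]: "h \<in> borel_measurable borel" using h(1) by (rule borel_measurable_continuous_onI)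
  let ?m = "measure m C" and ?e = "EW (\<lambda>w. h (I * w))"
  define E where "E = (LINT w:{0..}|size_biased_law Y. g (I * w))"
  have E: "E = 2 * K * ?e - K"
  proof -
    have "E = (LINT w:{0..}|size_biased_law Y. G (I * w))"
      unfolding E_def by (rule set_lebesgue_integral_cong) (auto simp: size_biased_law_def G_def max_absorb2 I_nonneg)
    also have "\<dots> = (\<integral>y. y * G (I * y) \<partial>Y)" by (rule size_biased_expectation[OF rv.gamma Y]) measurable
    also have "\<dots> = (\<integral>y. 2 * K * (y * h (I * y)) - K * y \<partial>Y)"
      by (rule Bochner_Integration.integral_cong) (auto simp: Gh algebra_simps)
    also have "\<dots> = 2 * K * ?e - K * (\<integral>y. y \<partial>Y)"
    proof -
      have "integrable Y (\<lambda>y. y * h (I * y))" by (rule EW_bounds(1)) (use h in auto)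
      then have 1: "integrable Y (\<lambda>y. 2 * K * (y * h (I * y)))" by (rule integrable_mult_right)
      have 2: "integrable Y (\<lambda>y. K * y)" by (intro integrable_mult_right mittag_leffler_law_mean(1)[OF rv.gamma Y])
      show ?thesis by (simp only: Bochner_Integration.integral_diff[OF 1 2] integral_mult_right_zero EW_def)
    qed
    finally show ?thesis using mittag_leffler_law_mean(2)[OF rv.gamma Y] by simp
  qed
  have iG: "integrable m (\<lambda>x. indicator C x * G (V n x))" for n
    by (rule F.integrable_bounded_mult[OF C_props(2), where B = K]) (use Gb in auto)
  have ih: "integrable m (\<lambda>x. indicator C x * h (V n x))" for n
    by (rule F.integrable_bounded_mult[OF C_props(2), where B = 1]) (use h in auto)
  have eqg: "indicator C x * g (birkhoff_sum (\<Psi> t) n f x / a' n) = indicator C x * G (V n x)"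
    if "x \<in> space m" "1 \<le> n" for x n
    using V_nonneg[OF that] by (simp add: G_def V_def max_absorb2)
  have "AE z in m. \<forall>n. 1 \<le> n \<longrightarrow> T.Th n (\<lambda>x. indicator C x * g (birkhoff_sum (\<Psi> t) n f x / a' n)) z = T.Th n (\<lambda>x. indicator C x * G (V n x)) z"
    unfolding AE_all_countable
  proof
    fix n
    show "AE z in m. 1 \<le> n \<longrightarrow> T.Th n (\<lambda>x. indicator C x * g (birkhoff_sum (\<Psi> t) n f x / a' n)) z = T.Th n (\<lambda>x. indicator C x * G (V n x)) z"
    proof (cases "1 \<le> n")
      case True
      have "integrable m (\<lambda>x. indicator C x * g (birkhoff_sum (\<Psi> t) n f x / a' n))"
        by (rule iffD2[OF Bochner_Integration.integrable_cong[OF refl] iG[of n]]) (use eqg True in blast)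
      then have "AE z in m. T.Th n (\<lambda>x. indicator C x * g (birkhoff_sum (\<Psi> t) n f x / a' n)) z = T.Th n (\<lambda>x. indicator C x * G (V n x)) z"
        by (intro T.Th_cong_AE iG AE_I2 eqg[OF _ True])
      then show ?thesis by eventually_elim simp
    qed simp
  qed
  moreover have "AE z in m. \<forall>n. T.Th n (\<lambda>x. 2 * K * (indicator C x * h (V n x)) + (- K) * indicator C x) z
      = 2 * K * T.Th n (\<lambda>x. indicator C x * h (V n x)) z + (- K) * T.Th n (indicator C) z"
    unfolding AE_all_countable by (intro allI T.Th_lincomb ih C_props(2))
  moreover have "AE z in m. avg a' (\<lambda>n. \<bar>T.Th n (\<lambda>x. indicator C x * h (V n x)) z - ?m * ?e * u' n\<bar>) \<longlonglongrightarrow> 0"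
    by (rule birkhoff_limit_unit) (rule h)+
  moreover have "AE z in m. avg a' (\<lambda>n. \<bar>T.Th n (\<lambda>x. indicator C x * 1) z - ?m * EW (\<lambda>w. 1) * u' n\<bar>) \<longlonglongrightarrow> 0"
    by (rule birkhoff_limit_unit) auto
  ultimately show ?thesis unfolding E_def[symmetric]
  proof eventually_elim
    fix z
    let ?g = "\<lambda>n. T.Th n (\<lambda>x. indicator C x * g (birkhoff_sum (\<Psi> t) n f x / a' n)) z"
    let ?h = "\<lambda>n. T.Th n (\<lambda>x. indicator C x * h (V n x)) z" and ?c = "\<lambda>n. T.Th n (indicator C) z"
    assume 1: "\<forall>n. 1 \<le> n \<longrightarrow> ?g n = T.Th n (\<lambda>x. indicator C x * G (V n x)) z"
      and 2: "\<forall>n. T.Th n (\<lambda>x. 2 * K * (indicator C x * h (V n x)) + (- K) * indicator C x) z = 2 * K * ?h n + (- K) * ?c n"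
      and 3: "avg a' (\<lambda>n. \<bar>?h n - ?m * ?e * u' n\<bar>) \<longlonglongrightarrow> 0"
      and "avg a' (\<lambda>n. \<bar>T.Th n (\<lambda>x. indicator C x * 1) z - ?m * EW (\<lambda>w. 1) * u' n\<bar>) \<longlonglongrightarrow> 0"
    then have 4: "avg a' (\<lambda>n. \<bar>?c n - ?m * u' n\<bar>) \<longlonglongrightarrow> 0" by (simp add: EW_one)
    have g_eq: "?g n = 2 * K * ?h n - K * ?c n" if "1 \<le> n" for n
    proof -
      have "(\<lambda>x. indicator C x * G (V n x)) = (\<lambda>x. 2 * K * (indicator C x * h (V n x)) + (- K) * indicator C x)"
        by (auto simp: Gh fun_eq_iff algebra_simps)
      then show ?thesis using 1[rule_format, OF that] 2[rule_format, of n] by simp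
    qed
    have vu: "(\<lambda>n. v n / u' n) \<longlonglongrightarrow> 1"
    proof -
      have p: "\<forall>\<^sub>F n in sequentially. 0 < a' n \<and> 1 \<le> n"
        using filterlim_at_top_dense[THEN iffD1, rule_format, OF a'_inf, of 0] eventually_ge_at_top[of 1] by eventually_elim simp
      have "(\<lambda>n. if v n = 0 \<and> \<gamma> * a' n / real n = 0 then 1 else v n / (\<gamma> * a' n / real n)) \<longlonglongrightarrow> 1"
        using v by (simp add: asymp_equiv_def)
      then have "(\<lambda>n. v n / (\<gamma> * a' n / real n)) \<longlonglongrightarrow> 1"
        by (rule Lim_transform_eventually) (use p rv.gamma in \<open>auto elim!: eventually_mono\<close>)
      then have "(\<lambda>n. v n / (\<gamma> * a' n / real n) * (a' n * t / b (real n * t))) \<longlonglongrightarrow> 1 * 1"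
        by (intro tendsto_mult a'_growth)
      moreover have "\<forall>\<^sub>F n in sequentially. v n / (\<gamma> * a' n / real n) * (a' n * t / b (real n * t)) = v n / u' n"
        using p
      proof eventually_elim
        fix n :: nat assume "0 < a' n \<and> 1 \<le> n"
        then show "v n / (\<gamma> * a' n / real n) * (a' n * t / b (real n * t)) = v n / u' n"
          using rv.gamma t_pos rv.b_pos[of "real n * t"] unfolding u'_eq by (simp add: field_simps)
      qed
      ultimately show ?thesis using Lim_transform_eventually by fastforce
    qed
    show "avg a' (\<lambda>n. \<bar>?g n - ?m * E * v n\<bar>) \<longlonglongrightarrow> 0"
    proof (rule avg_null[OF a'_inf])
      fix \<epsilon> :: real assume e: "\<epsilon> > 0"
      \<comment> \<open>The denominator is increased by 1 because \<open>E\<close> may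
        vanish.\<close>
      define \<delta> where "\<delta> = \<epsilon> / (?m * \<bar>E\<bar> + 1)"
      have mE: "0 < ?m * \<bar>E\<bar> + 1" by (intro add_nonneg_pos) auto
      then have "\<delta> > 0" using e by (simp add: \<delta>_def)
      let ?y = "\<lambda>n. 2 * K * \<bar>?h n - ?m * ?e * u' n\<bar> + K * \<bar>?c n - ?m * u' n\<bar> + (?m * \<bar>E\<bar> * \<delta>) * u' n"
      from tendstoD[OF vu \<open>\<delta> > 0\<close>] eventually_ge_at_top[of 1]
      have "\<forall>\<^sub>F n in sequentially. \<bar>?g n - ?m * E * v n\<bar> \<le> ?y n"
      proof eventually_elim
        fix n :: nat assume vd: "dist (v n / u' n) 1 < \<delta>" and n: "1 \<le> n"
        have un: "0 < u' n" unfolding u'_def by (rule u_pos) (use n q in auto)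
        have "v n / u' n - 1 = (v n - u' n) / u' n" using un by (simp add: diff_divide_distrib)
        then have "\<bar>v n - u' n\<bar> < \<delta> * u' n" using vd un by (simp add: dist_real_def abs_divide pos_divide_less_eq)
        then have "?m * \<bar>E\<bar> * \<bar>v n - u' n\<bar> \<le> ?m * \<bar>E\<bar> * (\<delta> * u' n)" by (intro mult_left_mono) auto
        then have a: "\<bar>?m * E * (u' n - v n)\<bar> \<le> ?m * \<bar>E\<bar> * \<delta> * u' n"
          by (simp add: abs_mult abs_minus_commute mult.assoc)
        have "?g n - ?m * E * v n = 2 * K * (?h n - ?m * ?e * u' n) - K * (?c n - ?m * u' n) + ?m * E * (u' n - v n)"
          unfolding g_eq[OF n] by (simp add: E algebra_simps)
        moreover have "\<bar>2 * K * (?h n - ?m * ?e * u' n)\<bar> = 2 * K * \<bar>?h n - ?m * ?e * u' n\<bar>"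
          "\<bar>K * (?c n - ?m * u' n)\<bar> = K * \<bar>?c n - ?m * u' n\<bar>" using K(1) by (auto simp: abs_mult)
        ultimately show "\<bar>?g n - ?m * E * v n\<bar> \<le> ?y n" using a by linarith
      qed
      moreover have "avg a' ?y \<longlonglongrightarrow> 2 * K * 0 + K * 0 + (?m * \<bar>E\<bar> * \<delta>) * 1"
        unfolding avg_add avg_cmult by (intro tendsto_add tendsto_mult tendsto_const 3 4 u'_avg)
      moreover have "2 * K * 0 + K * 0 + (?m * \<bar>E\<bar> * \<delta>) * 1 \<le> \<epsilon>"
      proof -
        have "?m * \<bar>E\<bar> * \<delta> \<le> (?m * \<bar>E\<bar> + 1) * \<delta>" using \<open>\<delta> > 0\<close> by (intro mult_right_mono) auto
        also have "\<dots> = \<epsilon>" using mE by (simp add: \<delta>_def)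
        finally show ?thesis by simp
      qed
      ultimately show "\<exists>y l. (\<forall>\<^sub>F n in sequentially. \<bar>?g n - ?m * E * v n\<bar> \<le> y n) \<and> avg a' y \<longlonglongrightarrow> l \<and> l \<le> \<epsilon>"
        by - (rule exI, rule exI, rule conjI, assumption, rule conjI, assumption+)
    qed simp
  qed
qed

end

end

text \<open>The tail of \<open>r\<close> tends to 0, so the almost sure lower bounds form a bounded
  set and their supremum is at least \<open>c\<close>.\<close>

lemma less_ess_lower_bound:
  assumes P: "prob_space \<mu>" and r: "r \<in> borel_measurable \<mu>" and c: "AE x in \<mu>. c \<le> r x" and s: "s < c"
  shows "s < ess_lower_bound \<mu> r"
proof -
  interpret prob_space \<mu> by (rule P)
  note [measurable] = r
  from order_tendstoD(2)[OF tail_null[OF P r], of 1] obtain K where K: "prob {x \<in> space \<mu>. r x > K} < 1"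
    by (auto simp: eventually_at_top_linorder)
  have "c' \<le> K" if "AE x in \<mu>. c' \<le> r x" for c'
  proof (rule ccontr)
    assume "\<not> c' \<le> K"
    then have "AE x in \<mu>. K < r x" using that by (auto elim!: eventually_mono)
    then show False using K prob_Collect_eq_1[of "\<lambda>x. K < r x"] by simp
  qed
  then have "c \<le> ess_lower_bound \<mu> r"
    unfolding ess_lower_bound_def using c by (intro cSup_upper bdd_aboveI[of _ K]) auto
  then show ?thesis using s by simp
qed

theorem theorem5p2:
  fixes \<gamma> :: real
    and Y :: "real measure"
    and m :: "('w::polish_space \<times> real) measure"
    and \<Psi> :: "real \<Rightarrow> 'w \<times> real \<Rightarrow> 'w \<times> real"
    and a :: "real \<Rightarrow> nat \<Rightarrow> real"
    and \<mu> :: "'w measure"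
    and \<tau> :: "'w \<Rightarrow> 'w"
    and \<alpha> :: "'w set set"
    and r :: "'w \<Rightarrow> real"
    and t :: real
    and u :: "nat \<Rightarrow> real"
    and C :: "('w \<times> real) set"
    and g :: "real \<Rightarrow> real"
    and f :: "'w \<times> real \<Rightarrow> real"
  assumes "0 < \<gamma>" and "\<gamma> < 1"
    and "mittag_leffler_law \<gamma> Y"
    and "mp_semiflow m \<Psi>"
    and "\<And>s. s > 0 \<Longrightarrow> return_sequence m (\<Psi> s) (a s)"
    and "regularly_varying \<gamma> (\<lambda>x. a 1 (nat \<lfloor>x\<rfloor>))"
    and "darling_kac_section m \<Psi> \<mu> \<tau> r"
    and "gll_section \<gamma> Y m \<Psi> \<mu> \<tau> \<alpha> r"
    and "t > 0"
    and "u \<sim>[sequentially] (\<lambda>n. \<gamma> * a t n / real n)"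
    and "C \<in> finite_pos_sets m"
    and "continuous_on {0..} g" and "bounded (g ` {0..})"
    and "integrable m f" and "\<And>z. z \<in> space m \<Longrightarrow> 0 \<le> f z"
  shows "AE z in m.
    (\<lambda>N. (1 / a 1 N) * (\<Sum>n=1..N.
       \<bar>(transfer_op m (\<Psi> t) ^^ n)
           (\<lambda>x. indicator C x * g (birkhoff_sum (\<Psi> t) n f x / a t n)) z
         - measure m C * (LINT w:{0..}|size_biased_law Y. g ((\<integral>x. f x \<partial>m) * w)) * u n\<bar>))
    \<longlonglongrightarrow> 0"
proof -
  note Y = assms(3) and rs = assms(5)
  obtain c where sec: "is_section m \<Psi> \<mu> \<tau> r" and c: "0 < c" "AE x in \<mu>. c \<le> r x"
    using assms(7) by (auto simp: darling_kac_section_def standard_section_def)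
  interpret suspension m \<Psi> \<mu> \<tau> r c by standard (rule assms(4) sec c)+
  obtain b binv fZ where fib: "fibered_system \<mu> \<tau> \<alpha>" and fZ: "stable_density \<gamma> Y fZ"
    and st: "asymptotically_stable \<gamma> Y \<mu> \<tau> r b binv"
    and glt: "aperiodic_llt \<mu> \<tau> \<alpha> r binv fZ \<or> periodic_llt \<mu> \<tau> \<alpha> r binv fZ"
    using assms(8) by (auto simp: gll_section_def)
  obtain \<beta> where rv: "monotone_rv \<gamma> \<beta> binv"
    using monotone_rv_if_stable[OF assms(1,2) prob_base r_meas st] by blast
  interpret rv: monotone_rv \<gamma> \<beta> binv by (rule rv)
  obtain s0 where s0: "0 < s0" and ll: "\<And>A x y. A \<in> cylinders \<mu> \<tau> \<alpha> \<Longrightarrow> 0 \<le> x \<Longrightarrow> x < y \<Longrightarrow> y \<le> s0 \<Longrightarrow>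
      local_limits \<mu> \<tau> r binv fZ A x y"
    using local_limits_if_glt[OF glt] by blast
  \<comment> \<open>The step is taken strictly below \<open>c\<close> and \<open>s0\<close>: the
    Darling-Kac property is available strictly below the essential lower bound of the roof, and
    \<open>s0\<close> limits the intervals in the local limits.\<close>
  have sys: "\<exists>q\<ge>1. gll_system m \<Psi> \<mu> \<tau> r c \<gamma> \<beta> binv Y fZ \<alpha> (T / real q) (a (T / real q))" if "0 < T" for T
  proof -
    obtain q :: nat where q: "T / min c s0 < real q" using reals_Archimedean2 by blast
    have pos: "0 < min c s0" using c s0 by simp
    then have "0 < T / min c s0" using that by simp
    with q have q0: "0 < real q" by linarith
    have "T < real q * min c s0" using q pos by (simp only: pos_divide_less_eq)
    then have "T / real q < min c s0" using q0 by (simp only: pos_divide_less_eq mult.commute)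
    then have s: "0 < T / real q" "T / real q < min c s0" using that q0 by simp_all
    have "(\<lambda>n. a (T / real q) n * (T / real q) / \<beta> (real n * (T / real q))) \<longlonglongrightarrow> 1"
    proof (rule darling_kac_return_sequence[OF rv s(1)])
      show "weak_conv_m (\<lambda>n. distr \<mu> borel (\<lambda>x. birkhoff_sum \<tau> n r x / binv (real n))) (stable_law \<gamma> Y)"
        using st by (simp add: asymptotically_stable_def)
      have "T / real q < ess_lower_bound \<mu> r" by (rule less_ess_lower_bound[OF prob_base r_meas c(2)]) (use s in simp)
      then show "darling_kac_set m (\<Psi> (T / real q)) ((space \<mu> \<times> {0..T / real q}) \<inter> space m)"
        using assms(7) s(1) by (simp add: darling_kac_section_def)
    qed (use s Y mittag_leffler_law_mean[OF assms(1) Y] tail_null[OF prob_base r_meas] rs[OF s(1)]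
          in \<open>simp_all add: mittag_leffler_law_def\<close>)
    then have "gll_system m \<Psi> \<mu> \<tau> r c \<gamma> \<beta> binv Y fZ \<alpha> (T / real q) (a (T / real q))"
      by unfold_locales (use s Y fZ fib ll rs[OF s(1)] in auto)
    then show ?thesis using q0 by (intro exI[of _ q]) simp
  qed
  \<comment> \<open>Comparison of \<open>a T\<close> with the tail function for every
    \<open>T\<close>; it is used for \<open>t\<close> and for 1, to exchange the
    normalizations.\<close>
  have growth: "(\<lambda>n. a T n * T / \<beta> (real n * T)) \<longlonglongrightarrow> 1" if T: "0 < T" for T
  proof -
    obtain q where q: "1 \<le> q" and "gll_system m \<Psi> \<mu> \<tau> r c \<gamma> \<beta> binv Y fZ \<alpha> (T / real q) (a (T / real q))"
      using sys[OF T] by blast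
    then interpret S: gll_system m \<Psi> \<mu> \<tau> r c \<gamma> \<beta> binv Y fZ \<alpha> "T / real q" "a (T / real q)" by simp
    show ?thesis by (rule S.a'_growth[OF q _ rs[OF T] assms(14,15,11)]) (use q in simp_all)
  qed
  let ?x = "\<lambda>z n. \<bar>(transfer_op m (\<Psi> t) ^^ n) (\<lambda>x. indicator C x * g (birkhoff_sum (\<Psi> t) n f x / a t n)) z
         - measure m C * (LINT w:{0..}|size_biased_law Y. g ((\<integral>x. f x \<partial>m) * w)) * u n\<bar>"
  have "AE z in m. avg (a t) (?x z) \<longlonglongrightarrow> 0"
  proof -
    obtain q where q: "1 \<le> q" and "gll_system m \<Psi> \<mu> \<tau> r c \<gamma> \<beta> binv Y fZ \<alpha> (t / real q) (a (t / real q))"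
      using sys[OF assms(9)] by blast
    then interpret S: gll_system m \<Psi> \<mu> \<tau> r c \<gamma> \<beta> binv Y fZ \<alpha> "t / real q" "a (t / real q)" by simp
    have t: "t = real q * (t / real q)" using q by simp
    note I = S.I_def[OF q t rs[OF assms(9)] assms(14,15,11)]
    show ?thesis
      using S.birkhoff_limit_bounded[OF q t rs[OF assms(9)] assms(14,15,11,12,13,10)] by (simp only: I)
  qed
  \<comment> \<open>The averages so far are normalized by \<open>a t\<close>; its ratio to
    \<open>a 1\<close> converges to the finite number \<open>t powr \<gamma> / t\<close>.\<close>
  moreover have "(\<lambda>N. a t N / a 1 N) \<longlonglongrightarrow> (1 * inverse 1 * t powr \<gamma>) * (1 / t)"
  proof (rule Lim_transform_eventually)
    have "(\<lambda>N. \<beta> (real N * t) / \<beta> (real N * 1)) \<longlonglongrightarrow> t powr \<gamma>"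
    proof (rule rv.b_ratio[OF _ _ assms(9)])
      show "filterlim (\<lambda>N. real N * 1) at_top sequentially" using filterlim_real_sequentially by simp
      show "(\<lambda>N. real N * t / (real N * 1)) \<longlonglongrightarrow> t"
        by (rule tendsto_eventually, rule eventually_mono[OF eventually_gt_at_top[of 0]]) simp
    qed
    then show "(\<lambda>N. (a t N * t / \<beta> (real N * t)) * inverse (a 1 N * 1 / \<beta> (real N * 1)) * (\<beta> (real N * t) / \<beta> (real N * 1)) * (1 / t))
      \<longlonglongrightarrow> (1 * inverse 1 * t powr \<gamma>) * (1 / t)"
      by (intro tendsto_mult tendsto_inverse growth tendsto_const assms(9)) simp_all
    show "\<forall>\<^sub>F N in sequentially. (a t N * t / \<beta> (real N * t)) * inverse (a 1 N * 1 / \<beta> (real N * 1)) *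
        (\<beta> (real N * t) / \<beta> (real N * 1)) * (1 / t) = a t N / a 1 N"
      using eventually_ge_at_top[of 1]
    proof eventually_elim
      fix N :: nat assume "1 \<le> N"
      then have "0 < a 1 N" using rs[of 1] by (simp add: return_sequence_def)
      then show "(a t N * t / \<beta> (real N * t)) * inverse (a 1 N * 1 / \<beta> (real N * 1)) *
        (\<beta> (real N * t) / \<beta> (real N * 1)) * (1 / t) = a t N / a 1 N"
        using rv.b_pos[of "real N * t"] rv.b_pos[of "real N * 1"] assms(9) by (simp add: field_simps)
    qed
  qed
  ultimately show ?thesis
  proof (elim eventually_mono)
    fix z
    assume ratio: "(\<lambda>N. a t N / a 1 N) \<longlonglongrightarrow> (1 * inverse 1 * t powr \<gamma>) * (1 / t)" and lim: "avg (a t) (?x z) \<longlonglongrightarrow> 0"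
    have "(\<lambda>N. (a t N / a 1 N) * avg (a t) (?x z) N) \<longlonglongrightarrow> 0"
      using tendsto_mult[OF ratio lim] by simp
    moreover have "\<forall>\<^sub>F N in sequentially. (a t N / a 1 N) * avg (a t) (?x z) N = (1 / a 1 N) * (\<Sum>n=1..N. ?x z n)"
      using eventually_ge_at_top[of 1]
    proof eventually_elim
      fix N :: nat assume "1 \<le> N"
      then have "a t N \<noteq> 0" using rs[OF assms(9)] by (auto simp: return_sequence_def)
      then show "(a t N / a 1 N) * avg (a t) (?x z) N = (1 / a 1 N) * (\<Sum>n=1..N. ?x z n)" unfolding avg_def by simp
    qed
    ultimately show "(\<lambda>N. (1 / a 1 N) * (\<Sum>n=1..N. ?x z n)) \<longlonglongrightarrow> 0" by (rule Lim_transform_eventually)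
  qed
qed

end
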